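(* Let $\mathbb{D}$ be a monoidal derivator. The structure morphism $i_!\colon\mathbb{D}\to\mathbb{A}^1_{\mathbb{D}}$ is strong monoidal, i.e. $i_!(X\boxtimes_{\mathbb{D}}Y)\cong i_!X\boxtimes_{\mathbb{A}^1_{\mathbb{D}}}i_!Y$.
   Context: Derivators. A prederivator is a strict 2-functor $\mathbb{D}\colon\mathrm{Cat}^{op}\to\mathrm{CAT}$ from small categories to categories (reversing functors, preserving the direction of natural transformations); for a functor $u$ write $u^*=\mathbb{D}(u)$. Let $e$ be the terminal category. A derivator is a prederivator with: (Der1) $\mathbb{D}$ takes finite coproducts to products; (Der2) a morphism $f$ of $\mathbb{D}(A)$ is an isomorphism iff $a^*f$ is an isomorphism in $\mathbb{D}(e)$ for all objects $a\colon e\to A$; (Der3) every $u^*$ has a left adjoint $u_!$ and a right adjoint $u_*$; (Der4) for $u\colon A\to B$ and $b\in B$ the canonical maps $\pi_!\,\mathrm{pr}^*\to b^*u_!$ (over the slice category $(u/b)$) and $b^*u_*\to\pi_*\,\mathrm{pr}^*$ (over $(b/u)$) are isomorphisms, where $\mathrm{pr}$ is the forgetful functor to $A$ and $\pi$ the projection to $e$. A morphism of derivators $F\colon\mathbb{D}\to\mathbb{E}$ is a pseudonatural transformation: functors $F_I\colon\mathbb{D}(I)\to\mathbb{E}(I)$ with coherent natural isomorphisms $u^*F_B\cong F_Au^*$ for $u\colon A\to B$. For a small category $L$, $\mathbb{D}^L(I)=\mathbb{D}(L\times I)$ is a derivator. A functor $u\colon A\to B$ gives a morphism $u_!\colon\mathbb{D}^A\to\mathbb{D}^B$,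 given at $I$ by $(u\times 1_I)_!$. Monoidal derivators. A monoidal prederivator is a pseudomonoid in prederivators: each $\mathbb{D}(A)$ is monoidal with product $\otimes_A$, compatibly with the $u^*$, which are strong monoidal. The external product of $X\in\mathbb{D}(A)$, $Y\in\mathbb{D}(B)$ is $X\boxtimes_{\mathbb{D}}Y=\pi_B^*X\otimes_{A\times B}\pi_A^*Y\in\mathbb{D}(A\times B)$, with $\pi_B\colon A\times B\to A$, $\pi_A\colon A\times B\to B$ the projections. A monoidal derivator is a derivator that is a monoidal prederivator whose product is cocontinuous in each variable: $(u\times1)_!(X\boxtimes Y)\cong u_!X\boxtimes Y$ and $(1\times v)_!(X\boxtimes Y)\cong X\boxtimes v_!Y$ canonically. $\mathbf{1}_{\mathbb{D}}\in\mathbb{D}(e)$ is the unit. $\underline{\mathbb{N}}$ is the category with one object and endomorphism monoid $(\mathbb{N},+)$, $\mathbb N=\{0,1,2,\dots\}$; $i\colon e\to\underline{\mathbb{N}}$ is the unique functor; $+\colon\underline{\mathbb{N}}\times\underline{\mathbb{N}}\to\underline{\mathbb{N}}$ sends $(a,b)$ to $a+b$. $\mathbb{A}^1_{\mathbb{D}}:=\mathbb{D}^{\underline{\mathbb{N}}}$ carries the monoidal structure with external product $X\boxtimes_{\mathbb{A}^1_{\mathbb{D}}}Y:=+_!(X\boxtimes_{\mathbb{D}}Y)$ and unit $i_!\mathbf{1}_{\mathbb{D}}$. The structure morphism is the left Kan extension morphism $i_!\colon\mathbb{D}\to\mathbb{D}^{\underline{\mathbb{N}}}$. *)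

theory Defs
  imports Main "HOL-Library.FuncSet"
begin

section \<open>Categories, functors and natural transformations\<close>

text \<open>
  \<open>Cmp C g f\<close> is ``\<open>g\<close> after \<open>f\<close>''. All operations are required to be undefined outside
  their carriers, so that equality of the records below is equality of categories, functors and
  transformations. Strict 2-functoriality of a prederivator is stated with these equalities.
\<close>

record ('o, 'm) cat =
  Ob :: "'o set"
  Arr :: "'m set"
  Dom :: "'m \<Rightarrow> 'o"
  Cod :: "'m \<Rightarrow> 'o"
  Idn :: "'o \<Rightarrow> 'm"
  Cmp :: "'m \<Rightarrow> 'm \<Rightarrow> 'm"

abbreviation comp_in :: "'m \<Rightarrow> ('o, 'm) cat \<Rightarrow> 'm \<Rightarrow> 'm"
    ("(_ \<cdot>\<^bsub>_\<^esub> _)" [71, 0, 70] 70) where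
  "g \<cdot>\<^bsub>C\<^esub> f \<equiv> Cmp C g f"

definition hom :: "('o, 'm) cat \<Rightarrow> 'o \<Rightarrow> 'o \<Rightarrow> 'm set" where
  "hom C a b = {f \<in> Arr C. Dom C f = a \<and> Cod C f = b}"

locale category =
  fixes C :: "('o, 'm) cat"
  assumes dom_in: "f \<in> Arr C \<Longrightarrow> Dom C f \<in> Ob C"
    and cod_in: "f \<in> Arr C \<Longrightarrow> Cod C f \<in> Ob C"
    and id_in: "a \<in> Ob C \<Longrightarrow> Idn C a \<in> hom C a a"
    and comp_closed: "\<lbrakk>f \<in> hom C a b; g \<in> hom C b c\<rbrakk> \<Longrightarrow> g \<cdot>\<^bsub>C\<^esub> f \<in> hom C a c"
    and id_left: "f \<in> hom C a b \<Longrightarrow> Idn C b \<cdot>\<^bsub>C\<^esub> f = f"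
    and id_right: "f \<in> hom C a b \<Longrightarrow> f \<cdot>\<^bsub>C\<^esub> Idn C a = f"
    and assoc: "\<lbrakk>f \<in> hom C a b; g \<in> hom C b c; h \<in> hom C c d\<rbrakk>
      \<Longrightarrow> (h \<cdot>\<^bsub>C\<^esub> g) \<cdot>\<^bsub>C\<^esub> f = h \<cdot>\<^bsub>C\<^esub> (g \<cdot>\<^bsub>C\<^esub> f)"
    and dom_ext: "Dom C \<in> extensional (Arr C)"
    and cod_ext: "Cod C \<in> extensional (Arr C)"
    and id_ext: "Idn C \<in> extensional (Ob C)"
    and comp_ext: "\<not> (f \<in> Arr C \<and> g \<in> Arr C \<and> Cod C f = Dom C g)
      \<Longrightarrow> g \<cdot>\<^bsub>C\<^esub> f = undefined"

definition mk_cat :: "'o set \<Rightarrow> 'm set \<Rightarrow> ('m \<Rightarrow> 'o) \<Rightarrow> ('m \<Rightarrow> 'o) \<Rightarrow> ('o \<Rightarrow> 'm)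
    \<Rightarrow> ('m \<Rightarrow> 'm \<Rightarrow> 'm) \<Rightarrow> ('o, 'm) cat" where
  "mk_cat Obs Arrs d c i m =
    \<lparr> Ob = Obs, Arr = Arrs, Dom = restrict d Arrs, Cod = restrict c Arrs, Idn = restrict i Obs,
      Cmp = (\<lambda>g f. if f \<in> Arrs \<and> g \<in> Arrs \<and> c f = d g then m g f else undefined) \<rparr>"

definition isos :: "('o, 'm) cat \<Rightarrow> 'o \<Rightarrow> 'o \<Rightarrow> 'm set" where
  "isos C a b = {f \<in> hom C a b. \<exists>g \<in> hom C b a. g \<cdot>\<^bsub>C\<^esub> f = Idn C a \<and> f \<cdot>\<^bsub>C\<^esub> g = Idn C b}"

definition is_iso :: "('o, 'm) cat \<Rightarrow> 'm \<Rightarrow> bool" where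
  "is_iso C f \<longleftrightarrow> f \<in> isos C (Dom C f) (Cod C f)"

definition inverse_in :: "('o, 'm) cat \<Rightarrow> 'm \<Rightarrow> 'm" where
  "inverse_in C f = (THE g. g \<in> hom C (Cod C f) (Dom C f)
     \<and> g \<cdot>\<^bsub>C\<^esub> f = Idn C (Dom C f) \<and> f \<cdot>\<^bsub>C\<^esub> g = Idn C (Cod C f))"

record ('o, 'm, 'p, 'n) fctr =
  Src :: "('o, 'm) cat"
  Tgt :: "('p, 'n) cat"
  FO :: "'o \<Rightarrow> 'p"
  FA :: "'m \<Rightarrow> 'n"

locale is_functor =
  fixes F :: "('o, 'm, 'p, 'n) fctr"
  assumes src_cat: "category (Src F)"
    and tgt_cat: "category (Tgt F)"
    and obj_in: "a \<in> Ob (Src F) \<Longrightarrow> FO F a \<in> Ob (Tgt F)"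
    and arr_in: "f \<in> hom (Src F) a b \<Longrightarrow> FA F f \<in> hom (Tgt F) (FO F a) (FO F b)"
    and pres_id: "a \<in> Ob (Src F) \<Longrightarrow> FA F (Idn (Src F) a) = Idn (Tgt F) (FO F a)"
    and pres_comp: "\<lbrakk>f \<in> hom (Src F) a b; g \<in> hom (Src F) b c\<rbrakk>
      \<Longrightarrow> FA F (g \<cdot>\<^bsub>Src F\<^esub> f) = FA F g \<cdot>\<^bsub>Tgt F\<^esub> FA F f"
    and obj_ext: "FO F \<in> extensional (Ob (Src F))"
    and arr_ext: "FA F \<in> extensional (Arr (Src F))"

definition mk_fun :: "('o, 'm) cat \<Rightarrow> ('p, 'n) cat \<Rightarrow> ('o \<Rightarrow> 'p) \<Rightarrow> ('m \<Rightarrow> 'n)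
    \<Rightarrow> ('o, 'm, 'p, 'n) fctr" where
  "mk_fun A B fo fa =
    \<lparr> Src = A, Tgt = B, FO = restrict fo (Ob A), FA = restrict fa (Arr A) \<rparr>"

definition id_fun :: "('o, 'm) cat \<Rightarrow> ('o, 'm, 'o, 'm) fctr" where
  "id_fun A = mk_fun A A (\<lambda>x. x) (\<lambda>f. f)"

definition comp_fun :: "('p, 'n, 'q, 'k) fctr \<Rightarrow> ('o, 'm, 'p, 'n) fctr \<Rightarrow> ('o, 'm, 'q, 'k) fctr"
    (infixr "\<odot>" 70) where
  "G \<odot> F = mk_fun (Src F) (Tgt G) (FO G \<circ> FO F) (FA G \<circ> FA F)"

record ('o, 'm, 'p, 'n) ntrans =
  NSrc :: "('o, 'm, 'p, 'n) fctr"
  NTgt :: "('o, 'm, 'p, 'n) fctr"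
  At :: "'o \<Rightarrow> 'n"

locale is_nat =
  fixes \<alpha> :: "('o, 'm, 'p, 'n) ntrans"
  assumes nsrc_fun: "is_functor (NSrc \<alpha>)"
    and ntgt_fun: "is_functor (NTgt \<alpha>)"
    and same_src: "Src (NSrc \<alpha>) = Src (NTgt \<alpha>)"
    and same_tgt: "Tgt (NSrc \<alpha>) = Tgt (NTgt \<alpha>)"
    and at_in: "a \<in> Ob (Src (NSrc \<alpha>)) \<Longrightarrow>
      At \<alpha> a \<in> hom (Tgt (NSrc \<alpha>)) (FO (NSrc \<alpha>) a) (FO (NTgt \<alpha>) a)"
    and natural: "f \<in> hom (Src (NSrc \<alpha>)) a b \<Longrightarrow>
      At \<alpha> b \<cdot>\<^bsub>Tgt (NSrc \<alpha>)\<^esub> FA (NSrc \<alpha>) f = FA (NTgt \<alpha>) f \<cdot>\<^bsub>Tgt (NSrc \<alpha>)\<^esub> At \<alpha> a"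
    and at_ext: "At \<alpha> \<in> extensional (Ob (Src (NSrc \<alpha>)))"

definition mk_nat :: "('o, 'm, 'p, 'n) fctr \<Rightarrow> ('o, 'm, 'p, 'n) fctr \<Rightarrow> ('o \<Rightarrow> 'n)
    \<Rightarrow> ('o, 'm, 'p, 'n) ntrans" where
  "mk_nat F G t = \<lparr> NSrc = F, NTgt = G, At = restrict t (Ob (Src F)) \<rparr>"

definition id_nat :: "('o, 'm, 'p, 'n) fctr \<Rightarrow> ('o, 'm, 'p, 'n) ntrans" where
  "id_nat F = mk_nat F F (\<lambda>a. Idn (Tgt F) (FO F a))"

definition vcomp :: "('o, 'm, 'p, 'n) ntrans \<Rightarrow> ('o, 'm, 'p, 'n) ntrans \<Rightarrow> ('o, 'm, 'p, 'n) ntrans"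
  where "vcomp \<beta> \<alpha> = mk_nat (NSrc \<alpha>) (NTgt \<beta>) (\<lambda>a. At \<beta> a \<cdot>\<^bsub>Tgt (NSrc \<alpha>)\<^esub> At \<alpha> a)"

definition hcomp :: "('p, 'n, 'q, 'k) ntrans \<Rightarrow> ('o, 'm, 'p, 'n) ntrans \<Rightarrow> ('o, 'm, 'q, 'k) ntrans"
  where "hcomp \<beta> \<alpha> = mk_nat (NSrc \<beta> \<odot> NSrc \<alpha>) (NTgt \<beta> \<odot> NTgt \<alpha>)
    (\<lambda>a. At \<beta> (FO (NTgt \<alpha>) a) \<cdot>\<^bsub>Tgt (NSrc \<beta>)\<^esub> FA (NSrc \<beta>) (At \<alpha> a))"

definition nat_iso :: "('o, 'm, 'p, 'n) ntrans \<Rightarrow> bool" where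
  "nat_iso \<alpha> \<longleftrightarrow> is_nat \<alpha> \<and> (\<forall>a \<in> Ob (Src (NSrc \<alpha>)). is_iso (Tgt (NSrc \<alpha>)) (At \<alpha> a))"

definition is_equivalence :: "('o, 'm, 'p, 'n) fctr \<Rightarrow> bool" where
  "is_equivalence F \<longleftrightarrow> is_functor F \<and>
    (\<exists>G \<eta> \<epsilon>. is_functor G \<and> Src G = Tgt F \<and> Tgt G = Src F
      \<and> nat_iso \<eta> \<and> NSrc \<eta> = id_fun (Src F) \<and> NTgt \<eta> = G \<odot> F
      \<and> nat_iso \<epsilon> \<and> NSrc \<epsilon> = F \<odot> G \<and> NTgt \<epsilon> = id_fun (Tgt F))"

text \<open>\<open>F\<close> is left adjoint to \<open>G\<close> with unit \<open>\<eta>\<close> and counit \<open>\<epsilon>\<close>.\<close>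

definition adjunction :: "('o, 'm, 'p, 'n) fctr \<Rightarrow> ('p, 'n, 'o, 'm) fctr \<Rightarrow> ('o, 'm, 'o, 'm) ntrans
    \<Rightarrow> ('p, 'n, 'p, 'n) ntrans \<Rightarrow> bool" where
  "adjunction F G \<eta> \<epsilon> \<longleftrightarrow> is_functor F \<and> is_functor G \<and> Src G = Tgt F \<and> Tgt G = Src F
    \<and> is_nat \<eta> \<and> NSrc \<eta> = id_fun (Src F) \<and> NTgt \<eta> = G \<odot> F
    \<and> is_nat \<epsilon> \<and> NSrc \<epsilon> = F \<odot> G \<and> NTgt \<epsilon> = id_fun (Tgt F)
    \<and> (\<forall>c \<in> Ob (Src F). At \<epsilon> (FO F c) \<cdot>\<^bsub>Tgt F\<^esub> FA F (At \<eta> c) = Idn (Tgt F) (FO F c))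
    \<and> (\<forall>d \<in> Ob (Tgt F). FA G (At \<epsilon> d) \<cdot>\<^bsub>Src F\<^esub> At \<eta> (FO G d) = Idn (Src F) (FO G d))"

definition prod_family :: "nat \<Rightarrow> (nat \<Rightarrow> ('o, 'm) cat) \<Rightarrow> (nat \<Rightarrow> 'o, nat \<Rightarrow> 'm) cat" where
  "prod_family n C = mk_cat (\<Pi>\<^sub>E k\<in>{..<n}. Ob (C k)) (\<Pi>\<^sub>E k\<in>{..<n}. Arr (C k))
    (\<lambda>f. \<lambda>k\<in>{..<n}. Dom (C k) (f k)) (\<lambda>f. \<lambda>k\<in>{..<n}. Cod (C k) (f k))
    (\<lambda>a. \<lambda>k\<in>{..<n}. Idn (C k) (a k)) (\<lambda>g f. \<lambda>k\<in>{..<n}. g k \<cdot>\<^bsub>C k\<^esub> f k)"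


section \<open>Small categories\<close>

text \<open>
  The small categories have their objects and arrows in the type \<open>'a elem\<close>, where \<open>'a\<close> is an
  arbitrary type; this type contains the natural numbers and has a pairing. Smallness is
  relative to a collection \<open>S\<close> of sets of such elements (``the small sets''), of which only closure
  conditions are required that make the small categories closed under the constructions occurring
  in the theory of derivators. The small sets may be all sets over \<open>'a elem\<close>, the countable ones,
  or, if the cardinality of \<open>'a\<close> is strongly inaccessible, those of smaller cardinality, which is
  smallness with respect to a Grothendieck universe.
\<close>

datatype 'a elem = Atom 'a | Nat_el (nat_of: nat) | Pair_el (pfst: "'a elem") (psnd: "'a elem")

type_synonym 'a scat = "('a elem, 'a elem) cat"
type_synonym 'a sfun = "('a elem, 'a elem, 'a elem, 'a elem) fctr"
type_synonym 'a snat = "('a elem, 'a elem, 'a elem, 'a elem) ntrans"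

definition size_class :: "'a elem set set \<Rightarrow> bool" where
  "size_class S \<longleftrightarrow> range Nat_el \<in> S
    \<and> (\<forall>X \<in> S. \<forall>f Y. Y \<subseteq> f ` X \<longrightarrow> Y \<in> S)
    \<and> (\<forall>X \<in> S. \<forall>Y \<in> S. {Pair_el x y |x y. x \<in> X \<and> y \<in> Y} \<in> S)"

definition small_cat :: "'a elem set set \<Rightarrow> 'a scat \<Rightarrow> bool" where
  "small_cat S A \<longleftrightarrow> category A \<and> Ob A \<in> S \<and> Arr A \<in> S"

definition small_fun :: "'a elem set set \<Rightarrow> 'a sfun \<Rightarrow> bool" where
  "small_fun S u \<longleftrightarrow> is_functor u \<and> small_cat S (Src u) \<and> small_cat S (Tgt u)"

definition small_nat :: "'a elem set set \<Rightarrow> 'a snat \<Rightarrow> bool" where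
  "small_nat S \<alpha> \<longleftrightarrow> is_nat \<alpha> \<and> small_fun S (NSrc \<alpha>) \<and> small_fun S (NTgt \<alpha>)"

definition pt_cat :: "'a scat" ("\<^bold>e") where
  "\<^bold>e = mk_cat {Nat_el 0} {Nat_el 0} (\<lambda>_. Nat_el 0) (\<lambda>_. Nat_el 0) (\<lambda>_. Nat_el 0) (\<lambda>_ _. Nat_el 0)"

definition pt_fun :: "'a scat \<Rightarrow> 'a elem \<Rightarrow> 'a sfun" where
  "pt_fun A a = mk_fun \<^bold>e A (\<lambda>_. a) (\<lambda>_. Idn A a)"

definition bang :: "'a scat \<Rightarrow> 'a sfun" where
  "bang A = mk_fun A \<^bold>e (\<lambda>_. Nat_el 0) (\<lambda>_. Nat_el 0)"

definition prod_cat :: "'a scat \<Rightarrow> 'a scat \<Rightarrow> 'a scat" (infixr "\<otimes>\<^sub>c" 75) where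
  "A \<otimes>\<^sub>c B = mk_cat {Pair_el a b |a b. a \<in> Ob A \<and> b \<in> Ob B} {Pair_el f g |f g. f \<in> Arr A \<and> g \<in> Arr B}
    (\<lambda>p. Pair_el (Dom A (pfst p)) (Dom B (psnd p))) (\<lambda>p. Pair_el (Cod A (pfst p)) (Cod B (psnd p)))
    (\<lambda>p. Pair_el (Idn A (pfst p)) (Idn B (psnd p)))
    (\<lambda>q p. Pair_el (pfst q \<cdot>\<^bsub>A\<^esub> pfst p) (psnd q \<cdot>\<^bsub>B\<^esub> psnd p))"

definition prod_fun :: "'a sfun \<Rightarrow> 'a sfun \<Rightarrow> 'a sfun" (infixr "\<otimes>\<^sub>f" 75) where
  "u \<otimes>\<^sub>f v = mk_fun (Src u \<otimes>\<^sub>c Src v) (Tgt u \<otimes>\<^sub>c Tgt v)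
    (\<lambda>p. Pair_el (FO u (pfst p)) (FO v (psnd p))) (\<lambda>p. Pair_el (FA u (pfst p)) (FA v (psnd p)))"

definition lprod_nat :: "'a scat \<Rightarrow> 'a snat \<Rightarrow> 'a snat" where
  "lprod_nat L \<alpha> = mk_nat (id_fun L \<otimes>\<^sub>f NSrc \<alpha>) (id_fun L \<otimes>\<^sub>f NTgt \<alpha>)
    (\<lambda>p. Pair_el (Idn L (pfst p)) (At \<alpha> (psnd p)))"

definition pr1 :: "'a scat \<Rightarrow> 'a scat \<Rightarrow> 'a sfun" where
  "pr1 A B = mk_fun (A \<otimes>\<^sub>c B) A pfst pfst"

definition pr2 :: "'a scat \<Rightarrow> 'a scat \<Rightarrow> 'a sfun" where
  "pr2 A B = mk_fun (A \<otimes>\<^sub>c B) B psnd psnd"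

definition assoc_fun :: "'a scat \<Rightarrow> 'a scat \<Rightarrow> 'a scat \<Rightarrow> 'a sfun" where
  "assoc_fun A B C =
    (let r = (\<lambda>p. Pair_el (pfst (pfst p)) (Pair_el (psnd (pfst p)) (psnd p)))
     in mk_fun ((A \<otimes>\<^sub>c B) \<otimes>\<^sub>c C) (A \<otimes>\<^sub>c (B \<otimes>\<^sub>c C)) r r)"

text \<open>\<open>mid_swap\<close> is its own inverse, up to exchanging the roles of \<open>B\<close> and \<open>C\<close>.\<close>

definition mid_swap :: "'a scat \<Rightarrow> 'a scat \<Rightarrow> 'a scat \<Rightarrow> 'a scat \<Rightarrow> 'a sfun" where
  "mid_swap A B C D =
    (let r = (\<lambda>p. Pair_el (Pair_el (pfst (pfst p)) (pfst (psnd p)))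
                          (Pair_el (psnd (pfst p)) (psnd (psnd p))))
     in mk_fun ((A \<otimes>\<^sub>c B) \<otimes>\<^sub>c (C \<otimes>\<^sub>c D)) ((A \<otimes>\<^sub>c C) \<otimes>\<^sub>c (B \<otimes>\<^sub>c D)) r r)"

definition coprod_family :: "nat \<Rightarrow> (nat \<Rightarrow> 'a scat) \<Rightarrow> 'a scat" where
  "coprod_family n A = mk_cat {Pair_el (Nat_el k) a |k a. k < n \<and> a \<in> Ob (A k)}
    {Pair_el (Nat_el k) f |k f. k < n \<and> f \<in> Arr (A k)}
    (\<lambda>p. Pair_el (pfst p) (Dom (A (nat_of (pfst p))) (psnd p)))
    (\<lambda>p. Pair_el (pfst p) (Cod (A (nat_of (pfst p))) (psnd p)))
    (\<lambda>p. Pair_el (pfst p) (Idn (A (nat_of (pfst p))) (psnd p)))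
    (\<lambda>q p. Pair_el (pfst p) (psnd q \<cdot>\<^bsub>A (nat_of (pfst p))\<^esub> psnd p))"

definition coprod_in :: "nat \<Rightarrow> (nat \<Rightarrow> 'a scat) \<Rightarrow> nat \<Rightarrow> 'a sfun" where
  "coprod_in n A k = mk_fun (A k) (coprod_family n A) (Pair_el (Nat_el k)) (Pair_el (Nat_el k))"

text \<open>
  In the slice categories \<open>(u/b)\<close> and \<open>(b/u)\<close> an object is a pair \<open>(a, h)\<close> with \<open>h: u a \<rightarrow> b\<close>,
  respectively \<open>h: b \<rightarrow> u a\<close>. An arrow is stored as \<open>(g, (x, y))\<close> with \<open>x\<close> and \<open>y\<close> its source and
  target objects.
\<close>

definition slice_arrows :: "'a sfun \<Rightarrow> 'a elem set \<Rightarrow> ('a elem \<Rightarrow> 'a elem \<Rightarrow> 'a elem \<Rightarrow> bool)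
    \<Rightarrow> 'a elem set" where
  "slice_arrows u Obs commutes = {Pair_el g (Pair_el x y) |g x y. x \<in> Obs \<and> y \<in> Obs
     \<and> g \<in> hom (Src u) (pfst x) (pfst y) \<and> commutes g (psnd x) (psnd y)}"

definition slice_of :: "'a sfun \<Rightarrow> 'a elem set \<Rightarrow> ('a elem \<Rightarrow> 'a elem \<Rightarrow> 'a elem \<Rightarrow> bool) \<Rightarrow> 'a scat"
  where
  "slice_of u Obs commutes = mk_cat Obs (slice_arrows u Obs commutes)
     (\<lambda>p. pfst (psnd p)) (\<lambda>p. psnd (psnd p))
     (\<lambda>x. Pair_el (Idn (Src u) (pfst x)) (Pair_el x x))
     (\<lambda>q p. Pair_el (pfst q \<cdot>\<^bsub>Src u\<^esub> pfst p) (Pair_el (pfst (psnd p)) (psnd (psnd q))))"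

definition slice :: "'a sfun \<Rightarrow> 'a elem \<Rightarrow> 'a scat" where
  "slice u b = slice_of u {Pair_el a h |a h. a \<in> Ob (Src u) \<and> h \<in> hom (Tgt u) (FO u a) b}
     (\<lambda>g h h'. h' \<cdot>\<^bsub>Tgt u\<^esub> FA u g = h)"

definition coslice :: "'a sfun \<Rightarrow> 'a elem \<Rightarrow> 'a scat" where
  "coslice u b = slice_of u {Pair_el a h |a h. a \<in> Ob (Src u) \<and> h \<in> hom (Tgt u) b (FO u a)}
     (\<lambda>g h h'. FA u g \<cdot>\<^bsub>Tgt u\<^esub> h = h')"

definition slice_pr :: "'a sfun \<Rightarrow> 'a elem \<Rightarrow> 'a sfun" where
  "slice_pr u b = mk_fun (slice u b) (Src u) pfst pfst"

definition coslice_pr :: "'a sfun \<Rightarrow> 'a elem \<Rightarrow> 'a sfun" where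
  "coslice_pr u b = mk_fun (coslice u b) (Src u) pfst pfst"

definition slice_nat :: "'a sfun \<Rightarrow> 'a elem \<Rightarrow> 'a snat" where
  "slice_nat u b = mk_nat (u \<odot> slice_pr u b) (pt_fun (Tgt u) b \<odot> bang (slice u b)) psnd"

definition coslice_nat :: "'a sfun \<Rightarrow> 'a elem \<Rightarrow> 'a snat" where
  "coslice_nat u b = mk_nat (pt_fun (Tgt u) b \<odot> bang (coslice u b)) (u \<odot> coslice_pr u b) psnd"

definition N_cat :: "'a scat" ("\<^bold>N") where
  "\<^bold>N = mk_cat {Nat_el 0} (range Nat_el) (\<lambda>_. Nat_el 0) (\<lambda>_. Nat_el 0) (\<lambda>_. Nat_el 0)
     (\<lambda>n m. Nat_el (nat_of m + nat_of n))"

definition N_pt :: "'a sfun" where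
  "N_pt = mk_fun \<^bold>e \<^bold>N (\<lambda>_. Nat_el 0) (\<lambda>_. Nat_el 0)"

definition N_plus :: "'a sfun" where
  "N_plus = mk_fun (\<^bold>N \<otimes>\<^sub>c \<^bold>N) \<^bold>N (\<lambda>_. Nat_el 0) (\<lambda>p. Nat_el (nat_of (pfst p) + nat_of (psnd p)))"


section \<open>Derivators\<close>

text \<open>
  The categories \<open>D(A)\<close> may have arbitrary carriers in the types \<open>'o\<close> and \<open>'m\<close>, independently of the
  size class \<open>S\<close>. The values of \<open>DCat\<close>, \<open>DFun\<close> and \<open>DNat\<close> outside the small categories, functors
  and transformations are irrelevant.
\<close>

record ('a, 'o, 'm) drv_data =
  DCat :: "'a scat \<Rightarrow> ('o, 'm) cat"
  DFun :: "'a sfun \<Rightarrow> ('o, 'm, 'o, 'm) fctr"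
  DNat :: "'a snat \<Rightarrow> ('o, 'm, 'o, 'm) ntrans"

locale prederivator =
  fixes S :: "'a elem set set" and D :: "('a, 'o, 'm, 'z) drv_data_scheme"
  assumes cat: "small_cat S A \<Longrightarrow> category (DCat D A)"
    and "fun": "small_fun S u \<Longrightarrow> is_functor (DFun D u)
      \<and> Src (DFun D u) = DCat D (Tgt u) \<and> Tgt (DFun D u) = DCat D (Src u)"
    and nat: "small_nat S \<alpha> \<Longrightarrow> is_nat (DNat D \<alpha>)
      \<and> NSrc (DNat D \<alpha>) = DFun D (NSrc \<alpha>) \<and> NTgt (DNat D \<alpha>) = DFun D (NTgt \<alpha>)"
    and fun_id: "small_cat S A \<Longrightarrow> DFun D (id_fun A) = id_fun (DCat D A)"
    and fun_comp: "\<lbrakk>small_fun S u; small_fun S v; Tgt u = Src v\<rbrakk>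
      \<Longrightarrow> DFun D (v \<odot> u) = DFun D u \<odot> DFun D v"
    and nat_id: "small_fun S u \<Longrightarrow> DNat D (id_nat u) = id_nat (DFun D u)"
    and nat_vcomp: "\<lbrakk>small_nat S \<alpha>; small_nat S \<beta>; NTgt \<alpha> = NSrc \<beta>\<rbrakk>
      \<Longrightarrow> DNat D (vcomp \<beta> \<alpha>) = vcomp (DNat D \<beta>) (DNat D \<alpha>)"
    and nat_hcomp: "\<lbrakk>small_nat S \<alpha>; small_nat S \<beta>; Tgt (NSrc \<alpha>) = Src (NSrc \<beta>)\<rbrakk>
      \<Longrightarrow> DNat D (hcomp \<beta> \<alpha>) = hcomp (DNat D \<alpha>) (DNat D \<beta>)"

abbreviation reO :: "('a, 'o, 'm, 'z) drv_data_scheme \<Rightarrow> 'a sfun \<Rightarrow> 'o \<Rightarrow> 'o" where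
  "reO D u X \<equiv> FO (DFun D u) X"

abbreviation reA :: "('a, 'o, 'm, 'z) drv_data_scheme \<Rightarrow> 'a sfun \<Rightarrow> 'm \<Rightarrow> 'm" where
  "reA D u f \<equiv> FA (DFun D u) f"

text \<open>Chosen left and right adjoints \<open>u\<^sub>!\<close> and \<open>u\<^sub>*\<close>, with chosen units and counits.\<close>

definition lan_adj :: "('a, 'o, 'm, 'z) drv_data_scheme \<Rightarrow> 'a sfun
    \<Rightarrow> ('o, 'm, 'o, 'm) fctr \<times> ('o, 'm, 'o, 'm) ntrans \<times> ('o, 'm, 'o, 'm) ntrans" where
  "lan_adj D u = (SOME (F, \<eta>, \<epsilon>). adjunction F (DFun D u) \<eta> \<epsilon>)"

definition ran_adj :: "('a, 'o, 'm, 'z) drv_data_scheme \<Rightarrow> 'a sfun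
    \<Rightarrow> ('o, 'm, 'o, 'm) fctr \<times> ('o, 'm, 'o, 'm) ntrans \<times> ('o, 'm, 'o, 'm) ntrans" where
  "ran_adj D u = (SOME (G, \<eta>, \<epsilon>). adjunction (DFun D u) G \<eta> \<epsilon>)"

definition "lkan D u = fst (lan_adj D u)"
definition "lan_unit D u X = At (fst (snd (lan_adj D u))) X"
definition "lan_counit D u X = At (snd (snd (lan_adj D u))) X"
definition "rkan D u = fst (ran_adj D u)"
definition "ran_unit D u X = At (fst (snd (ran_adj D u))) X"
definition "ran_counit D u X = At (snd (snd (ran_adj D u))) X"

text \<open>
  The mates of \<open>\<alpha>: u p \<Rightarrow> v q\<close> and \<open>\<alpha>: v q \<Rightarrow> u p\<close>, where \<open>u\<close> and \<open>v\<close> have the same target and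
  \<open>p\<close> and \<open>q\<close> the same source: the canonical maps \<open>q\<^sub>! p\<^sup>* X \<rightarrow> v\<^sup>* u\<^sub>! X\<close> and
  \<open>v\<^sup>* u\<^sub>* X \<rightarrow> q\<^sub>* p\<^sup>* X\<close>.
\<close>

definition lan_mate :: "('a, 'o, 'm, 'z) drv_data_scheme \<Rightarrow> 'a sfun \<Rightarrow> 'a sfun \<Rightarrow> 'a sfun \<Rightarrow> 'a sfun
    \<Rightarrow> 'a snat \<Rightarrow> 'o \<Rightarrow> 'm" where
  "lan_mate D p q u v \<alpha> X =
    lan_counit D q (reO D v (FO (lkan D u) X)) \<cdot>\<^bsub>DCat D (Tgt q)\<^esub>
    FA (lkan D q) (At (DNat D \<alpha>) (FO (lkan D u) X) \<cdot>\<^bsub>DCat D (Src p)\<^esub> reA D p (lan_unit D u X))"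

definition ran_mate :: "('a, 'o, 'm, 'z) drv_data_scheme \<Rightarrow> 'a sfun \<Rightarrow> 'a sfun \<Rightarrow> 'a sfun \<Rightarrow> 'a sfun
    \<Rightarrow> 'a snat \<Rightarrow> 'o \<Rightarrow> 'm" where
  "ran_mate D p q u v \<alpha> X =
    FA (rkan D q) (reA D p (ran_counit D u X) \<cdot>\<^bsub>DCat D (Src p)\<^esub> At (DNat D \<alpha>) (FO (rkan D u) X))
    \<cdot>\<^bsub>DCat D (Tgt q)\<^esub> ran_unit D q (reO D v (FO (rkan D u) X))"

definition coprod_restriction :: "('a, 'o, 'm, 'z) drv_data_scheme \<Rightarrow> nat \<Rightarrow> (nat \<Rightarrow> 'a scat)
    \<Rightarrow> ('o, 'm, nat \<Rightarrow> 'o, nat \<Rightarrow> 'm) fctr" where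
  "coprod_restriction D n A =
    mk_fun (DCat D (coprod_family n A)) (prod_family n (\<lambda>k. DCat D (A k)))
      (\<lambda>X. \<lambda>k\<in>{..<n}. reO D (coprod_in n A k) X) (\<lambda>f. \<lambda>k\<in>{..<n}. reA D (coprod_in n A k) f)"

locale derivator = prederivator S D
  for S :: "'a elem set set" and D :: "('a, 'o, 'm, 'z) drv_data_scheme" +
  assumes Der1: "(\<And>k. k < n \<Longrightarrow> small_cat S (A k)) \<Longrightarrow> is_equivalence (coprod_restriction D n A)"
    and Der2: "\<lbrakk>small_cat S B; f \<in> Arr (DCat D B)\<rbrakk> \<Longrightarrow>
      is_iso (DCat D B) f \<longleftrightarrow> (\<forall>b \<in> Ob B. is_iso (DCat D \<^bold>e) (reA D (pt_fun B b) f))"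
    and Der3_left: "small_fun S u \<Longrightarrow> \<exists>F \<eta> \<epsilon>. adjunction F (DFun D u) \<eta> \<epsilon>"
    and Der3_right: "small_fun S u \<Longrightarrow> \<exists>G \<eta> \<epsilon>. adjunction (DFun D u) G \<eta> \<epsilon>"
    and Der4_left: "\<lbrakk>small_fun S u; b \<in> Ob (Tgt u); X \<in> Ob (DCat D (Src u))\<rbrakk> \<Longrightarrow>
      is_iso (DCat D \<^bold>e)
        (lan_mate D (slice_pr u b) (bang (slice u b)) u (pt_fun (Tgt u) b) (slice_nat u b) X)"
    and Der4_right: "\<lbrakk>small_fun S u; b \<in> Ob (Tgt u); X \<in> Ob (DCat D (Src u))\<rbrakk> \<Longrightarrow>
      is_iso (DCat D \<^bold>e)
        (ran_mate D (coslice_pr u b) (bang (coslice u b)) u (pt_fun (Tgt u) b) (coslice_nat u b) X)"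


section \<open>Morphisms of prederivators\<close>

text \<open>\<open>MC F u X\<close> is the component \<open>F\<^sub>A (u\<^sup>* X) \<rightarrow> u\<^sup>* (F\<^sub>B X)\<close> of the pseudonaturality
  isomorphism at \<open>u: A \<rightarrow> B\<close>.\<close>

record ('a, 'o, 'm, 'p, 'n) drv_mor =
  MF :: "'a scat \<Rightarrow> ('o, 'm, 'p, 'n) fctr"
  MC :: "'a sfun \<Rightarrow> 'o \<Rightarrow> 'n"

locale derivator_morphism =
  fixes S :: "'a elem set set" and D :: "('a, 'o, 'm, 'z) drv_data_scheme"
    and E :: "('a, 'p, 'n, 'y) drv_data_scheme" and F :: "('a, 'o, 'm, 'p, 'n) drv_mor"
  assumes component: "small_cat S A \<Longrightarrow>
      is_functor (MF F A) \<and> Src (MF F A) = DCat D A \<and> Tgt (MF F A) = DCat E A"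
    and constraint: "\<lbrakk>small_fun S u; X \<in> Ob (DCat D (Tgt u))\<rbrakk> \<Longrightarrow> MC F u X \<in> isos (DCat E (Src u))
      (FO (MF F (Src u)) (reO D u X)) (reO E u (FO (MF F (Tgt u)) X))"
    and constraint_natural: "\<lbrakk>small_fun S u; f \<in> hom (DCat D (Tgt u)) X Y\<rbrakk> \<Longrightarrow>
      MC F u Y \<cdot>\<^bsub>DCat E (Src u)\<^esub> FA (MF F (Src u)) (reA D u f)
      = reA E u (FA (MF F (Tgt u)) f) \<cdot>\<^bsub>DCat E (Src u)\<^esub> MC F u X"
    and constraint_id: "\<lbrakk>small_cat S A; X \<in> Ob (DCat D A)\<rbrakk> \<Longrightarrow>
      MC F (id_fun A) X = Idn (DCat E A) (FO (MF F A) X)"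
    and constraint_comp: "\<lbrakk>small_fun S u; small_fun S v; Tgt u = Src v; X \<in> Ob (DCat D (Tgt v))\<rbrakk> \<Longrightarrow>
      MC F (v \<odot> u) X = reA E u (MC F v X) \<cdot>\<^bsub>DCat E (Src u)\<^esub> MC F u (reO D v X)"
    and constraint_nat: "\<lbrakk>small_nat S \<alpha>; NSrc \<alpha> = u; NTgt \<alpha> = v; X \<in> Ob (DCat D (Tgt u))\<rbrakk> \<Longrightarrow>
      At (DNat E \<alpha>) (FO (MF F (Tgt u)) X) \<cdot>\<^bsub>DCat E (Src u)\<^esub> MC F u X
      = MC F v X \<cdot>\<^bsub>DCat E (Src u)\<^esub> FA (MF F (Src u)) (At (DNat D \<alpha>) X)"

text \<open>The shifted derivator \<open>D\<^sup>L\<close>.\<close>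

definition shift :: "('a, 'o, 'm, 'z) drv_data_scheme \<Rightarrow> 'a scat \<Rightarrow> ('a, 'o, 'm) drv_data" where
  "shift D L = \<lparr> DCat = (\<lambda>I. DCat D (L \<otimes>\<^sub>c I)), DFun = (\<lambda>u. DFun D (id_fun L \<otimes>\<^sub>f u)),
     DNat = (\<lambda>\<alpha>. DNat D (lprod_nat L \<alpha>)) \<rparr>"

text \<open>The morphism \<open>u\<^sub>!: D\<^sup>A \<rightarrow> D\<^sup>B\<close>; its constraint at \<open>w\<close> is the mate of the identity
  \<open>(u \<times> 1) (1 \<times> w) = (1 \<times> w) (u \<times> 1)\<close>.\<close>

definition lan_mor :: "('a, 'o, 'm, 'z) drv_data_scheme \<Rightarrow> 'a sfun \<Rightarrow> ('a, 'o, 'm, 'o, 'm) drv_mor"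
  where
  "lan_mor D u = \<lparr> MF = (\<lambda>I. lkan D (u \<otimes>\<^sub>f id_fun I)),
     MC = (\<lambda>w. lan_mate D (id_fun (Src u) \<otimes>\<^sub>f w) (u \<otimes>\<^sub>f id_fun (Src w))
                 (u \<otimes>\<^sub>f id_fun (Tgt w)) (id_fun (Tgt u) \<otimes>\<^sub>f w) (id_nat (u \<otimes>\<^sub>f w))) \<rparr>"


section \<open>Monoidal derivators\<close>

record ('o, 'm) mon =
  TO :: "'o \<Rightarrow> 'o \<Rightarrow> 'o"
  TA :: "'m \<Rightarrow> 'm \<Rightarrow> 'm"
  TU :: "'o"
  TAs :: "'o \<Rightarrow> 'o \<Rightarrow> 'o \<Rightarrow> 'm"
  TL :: "'o \<Rightarrow> 'm"
  TR :: "'o \<Rightarrow> 'm"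

locale monoidal_category = category C
  for C :: "('o, 'm) cat" +
  fixes M :: "('o, 'm) mon"
  assumes tensor_obj: "\<lbrakk>X \<in> Ob C; Y \<in> Ob C\<rbrakk> \<Longrightarrow> TO M X Y \<in> Ob C"
    and tensor_arr: "\<lbrakk>f \<in> hom C X X'; g \<in> hom C Y Y'\<rbrakk> \<Longrightarrow> TA M f g \<in> hom C (TO M X Y) (TO M X' Y')"
    and tensor_id: "\<lbrakk>X \<in> Ob C; Y \<in> Ob C\<rbrakk> \<Longrightarrow> TA M (Idn C X) (Idn C Y) = Idn C (TO M X Y)"
    and tensor_comp: "\<lbrakk>f \<in> hom C X X'; f' \<in> hom C X' X''; g \<in> hom C Y Y'; g' \<in> hom C Y' Y''\<rbrakk> \<Longrightarrow>
      TA M (f' \<cdot>\<^bsub>C\<^esub> f) (g' \<cdot>\<^bsub>C\<^esub> g) = TA M f' g' \<cdot>\<^bsub>C\<^esub> TA M f g"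
    and unit_obj: "TU M \<in> Ob C"
    and assoc_iso: "\<lbrakk>X \<in> Ob C; Y \<in> Ob C; Z \<in> Ob C\<rbrakk> \<Longrightarrow>
      TAs M X Y Z \<in> isos C (TO M (TO M X Y) Z) (TO M X (TO M Y Z))"
    and assoc_natural: "\<lbrakk>f \<in> hom C X X'; g \<in> hom C Y Y'; h \<in> hom C Z Z'\<rbrakk> \<Longrightarrow>
      TAs M X' Y' Z' \<cdot>\<^bsub>C\<^esub> TA M (TA M f g) h = TA M f (TA M g h) \<cdot>\<^bsub>C\<^esub> TAs M X Y Z"
    and lunit_iso: "X \<in> Ob C \<Longrightarrow> TL M X \<in> isos C (TO M (TU M) X) X"
    and lunit_natural: "f \<in> hom C X X' \<Longrightarrow>
      TL M X' \<cdot>\<^bsub>C\<^esub> TA M (Idn C (TU M)) f = f \<cdot>\<^bsub>C\<^esub> TL M X"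
    and runit_iso: "X \<in> Ob C \<Longrightarrow> TR M X \<in> isos C (TO M X (TU M)) X"
    and runit_natural: "f \<in> hom C X X' \<Longrightarrow>
      TR M X' \<cdot>\<^bsub>C\<^esub> TA M f (Idn C (TU M)) = f \<cdot>\<^bsub>C\<^esub> TR M X"
    and pentagon: "\<lbrakk>W \<in> Ob C; X \<in> Ob C; Y \<in> Ob C; Z \<in> Ob C\<rbrakk> \<Longrightarrow>
      TAs M W X (TO M Y Z) \<cdot>\<^bsub>C\<^esub> TAs M (TO M W X) Y Z
      = TA M (Idn C W) (TAs M X Y Z) \<cdot>\<^bsub>C\<^esub> TAs M W (TO M X Y) Z \<cdot>\<^bsub>C\<^esub> TA M (TAs M W X Y) (Idn C Z)"
    and triangle: "\<lbrakk>X \<in> Ob C; Y \<in> Ob C\<rbrakk> \<Longrightarrow>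
      TA M (Idn C X) (TL M Y) \<cdot>\<^bsub>C\<^esub> TAs M X (TU M) Y = TA M (TR M X) (Idn C Y)"

locale strong_monoidal_functor =
  fixes F :: "('o, 'm, 'p, 'n) fctr" and M :: "('o, 'm) mon" and N :: "('p, 'n) mon"
    and \<phi> :: "'o \<Rightarrow> 'o \<Rightarrow> 'n" and \<phi>0 :: "'n"
  assumes functor_ax: "is_functor F"
    and source_mon: "monoidal_category (Src F) M"
    and target_mon: "monoidal_category (Tgt F) N"
    and mult_iso: "\<lbrakk>X \<in> Ob (Src F); Y \<in> Ob (Src F)\<rbrakk> \<Longrightarrow>
      \<phi> X Y \<in> isos (Tgt F) (TO N (FO F X) (FO F Y)) (FO F (TO M X Y))"
    and unit_iso: "\<phi>0 \<in> isos (Tgt F) (TU N) (FO F (TU M))"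
    and mult_natural: "\<lbrakk>f \<in> hom (Src F) X X'; g \<in> hom (Src F) Y Y'\<rbrakk> \<Longrightarrow>
      \<phi> X' Y' \<cdot>\<^bsub>Tgt F\<^esub> TA N (FA F f) (FA F g) = FA F (TA M f g) \<cdot>\<^bsub>Tgt F\<^esub> \<phi> X Y"
    and mult_assoc: "\<lbrakk>X \<in> Ob (Src F); Y \<in> Ob (Src F); Z \<in> Ob (Src F)\<rbrakk> \<Longrightarrow>
      FA F (TAs M X Y Z) \<cdot>\<^bsub>Tgt F\<^esub> \<phi> (TO M X Y) Z \<cdot>\<^bsub>Tgt F\<^esub> TA N (\<phi> X Y) (Idn (Tgt F) (FO F Z))
      = \<phi> X (TO M Y Z) \<cdot>\<^bsub>Tgt F\<^esub> TA N (Idn (Tgt F) (FO F X)) (\<phi> Y Z)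
          \<cdot>\<^bsub>Tgt F\<^esub> TAs N (FO F X) (FO F Y) (FO F Z)"
    and mult_lunit: "X \<in> Ob (Src F) \<Longrightarrow> TL N (FO F X)
      = FA F (TL M X) \<cdot>\<^bsub>Tgt F\<^esub> \<phi> (TU M) X \<cdot>\<^bsub>Tgt F\<^esub> TA N \<phi>0 (Idn (Tgt F) (FO F X))"
    and mult_runit: "X \<in> Ob (Src F) \<Longrightarrow> TR N (FO F X)
      = FA F (TR M X) \<cdot>\<^bsub>Tgt F\<^esub> \<phi> X (TU M) \<cdot>\<^bsub>Tgt F\<^esub> TA N (Idn (Tgt F) (FO F X)) \<phi>0"

text \<open>
  A pseudomonoid in prederivators, spelled out: \<open>Mon D A\<close> is the monoidal structure of \<open>D(A)\<close>, and
  \<open>ResT D u X Y: u\<^sup>*X \<otimes> u\<^sup>*Y \<rightarrow> u\<^sup>*(X \<otimes> Y)\<close> and \<open>ResU D u: 1 \<rightarrow> u\<^sup>*1\<close> are the pseudonaturality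
  isomorphisms of the product and the unit.
\<close>

record ('a, 'o, 'm) mon_drv_data = "('a, 'o, 'm) drv_data" +
  Mon :: "'a scat \<Rightarrow> ('o, 'm) mon"
  ResT :: "'a sfun \<Rightarrow> 'o \<Rightarrow> 'o \<Rightarrow> 'm"
  ResU :: "'a sfun \<Rightarrow> 'm"

locale monoidal_prederivator = prederivator S D
  for S :: "'a elem set set" and D :: "('a, 'o, 'm) mon_drv_data" +
  assumes mon_cat: "small_cat S A \<Longrightarrow> monoidal_category (DCat D A) (Mon D A)"
    and mon_fun: "small_fun S u \<Longrightarrow>
      strong_monoidal_functor (DFun D u) (Mon D (Tgt u)) (Mon D (Src u)) (ResT D u) (ResU D u)"
    and mult_id: "\<lbrakk>small_cat S A; X \<in> Ob (DCat D A); Y \<in> Ob (DCat D A)\<rbrakk> \<Longrightarrow>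
      ResT D (id_fun A) X Y = Idn (DCat D A) (TO (Mon D A) X Y)"
    and unit_id: "small_cat S A \<Longrightarrow> ResU D (id_fun A) = Idn (DCat D A) (TU (Mon D A))"
    and mult_comp: "\<lbrakk>small_fun S u; small_fun S v; Tgt u = Src v;
        X \<in> Ob (DCat D (Tgt v)); Y \<in> Ob (DCat D (Tgt v))\<rbrakk> \<Longrightarrow>
      ResT D (v \<odot> u) X Y
      = reA D u (ResT D v X Y) \<cdot>\<^bsub>DCat D (Src u)\<^esub> ResT D u (reO D v X) (reO D v Y)"
    and unit_comp: "\<lbrakk>small_fun S u; small_fun S v; Tgt u = Src v\<rbrakk> \<Longrightarrow>
      ResU D (v \<odot> u) = reA D u (ResU D v) \<cdot>\<^bsub>DCat D (Src u)\<^esub> ResU D u"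
    and mult_nat: "\<lbrakk>small_nat S \<alpha>; NSrc \<alpha> = u; NTgt \<alpha> = v;
        X \<in> Ob (DCat D (Tgt u)); Y \<in> Ob (DCat D (Tgt u))\<rbrakk> \<Longrightarrow>
      At (DNat D \<alpha>) (TO (Mon D (Tgt u)) X Y) \<cdot>\<^bsub>DCat D (Src u)\<^esub> ResT D u X Y
      = ResT D v X Y \<cdot>\<^bsub>DCat D (Src u)\<^esub> TA (Mon D (Src u)) (At (DNat D \<alpha>) X) (At (DNat D \<alpha>) Y)"
    and unit_nat: "\<lbrakk>small_nat S \<alpha>; NSrc \<alpha> = u; NTgt \<alpha> = v\<rbrakk> \<Longrightarrow>
      At (DNat D \<alpha>) (TU (Mon D (Tgt u))) \<cdot>\<^bsub>DCat D (Src u)\<^esub> ResU D u = ResU D v"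

text \<open>
  External product. \<open>extRes\<close> is the canonical isomorphism \<open>u\<^sup>*X \<boxtimes> v\<^sup>*Y \<rightarrow> (u \<times> v)\<^sup>*(X \<boxtimes> Y)\<close>; its
  source has this form because \<open>(u \<times> v)\<^sup>* pr1\<^sup>* = pr1\<^sup>* u\<^sup>*\<close> and \<open>(u \<times> v)\<^sup>* pr2\<^sup>* = pr2\<^sup>* v\<^sup>*\<close>.
\<close>

definition extO :: "('a, 'o, 'm) mon_drv_data \<Rightarrow> 'a scat \<Rightarrow> 'a scat \<Rightarrow> 'o \<Rightarrow> 'o \<Rightarrow> 'o" where
  "extO D A B X Y = TO (Mon D (A \<otimes>\<^sub>c B)) (reO D (pr1 A B) X) (reO D (pr2 A B) Y)"

definition extA :: "('a, 'o, 'm) mon_drv_data \<Rightarrow> 'a scat \<Rightarrow> 'a scat \<Rightarrow> 'm \<Rightarrow> 'm \<Rightarrow> 'm" where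
  "extA D A B f g = TA (Mon D (A \<otimes>\<^sub>c B)) (reA D (pr1 A B) f) (reA D (pr2 A B) g)"

definition extRes :: "('a, 'o, 'm) mon_drv_data \<Rightarrow> 'a sfun \<Rightarrow> 'a sfun \<Rightarrow> 'o \<Rightarrow> 'o \<Rightarrow> 'm" where
  "extRes D u v X Y =
    ResT D (u \<otimes>\<^sub>f v) (reO D (pr1 (Tgt u) (Tgt v)) X) (reO D (pr2 (Tgt u) (Tgt v)) Y)"

text \<open>\<open>(X \<boxtimes> Y) \<boxtimes> Z \<rightarrow> assoc\<^sup>* (X \<boxtimes> (Y \<boxtimes> Z))\<close>, \<open>1 \<boxtimes> X \<rightarrow> pr2\<^sup>* X\<close> and \<open>X \<boxtimes> 1 \<rightarrow> pr1\<^sup>* X\<close>.\<close>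

definition extAs :: "('a, 'o, 'm) mon_drv_data \<Rightarrow> 'a scat \<Rightarrow> 'a scat \<Rightarrow> 'a scat \<Rightarrow> 'o \<Rightarrow> 'o \<Rightarrow> 'o \<Rightarrow> 'm"
  where
  "extAs D A B C X Y Z =
    (let P = (A \<otimes>\<^sub>c B) \<otimes>\<^sub>c C; K = DCat D P; M = Mon D P;
         a = assoc_fun A B C; p = pr1 (A \<otimes>\<^sub>c B) C; r = pr2 A (B \<otimes>\<^sub>c C) \<odot> a;
         X1 = reO D (pr1 A B) X; Y1 = reO D (pr2 A B) Y;
         Y2 = reO D (pr1 B C) Y; Z2 = reO D (pr2 B C) Z;
         X' = reO D p X1; Y' = reO D p Y1; Z' = reO D (pr2 (A \<otimes>\<^sub>c B) C) Z
     in ResT D a (reO D (pr1 A (B \<otimes>\<^sub>c C)) X) (reO D (pr2 A (B \<otimes>\<^sub>c C)) (extO D B C Y Z))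
        \<cdot>\<^bsub>K\<^esub> TA M (Idn K X') (ResT D r Y2 Z2)
        \<cdot>\<^bsub>K\<^esub> TAs M X' Y' Z'
        \<cdot>\<^bsub>K\<^esub> TA M (inverse_in K (ResT D p X1 Y1)) (Idn K Z'))"

definition extL :: "('a, 'o, 'm) mon_drv_data \<Rightarrow> 'a scat \<Rightarrow> 'o \<Rightarrow> 'm" where
  "extL D A X = (let K = DCat D (\<^bold>e \<otimes>\<^sub>c A); M = Mon D (\<^bold>e \<otimes>\<^sub>c A); X' = reO D (pr2 \<^bold>e A) X
     in TL M X' \<cdot>\<^bsub>K\<^esub> TA M (inverse_in K (ResU D (pr1 \<^bold>e A))) (Idn K X'))"

definition extR :: "('a, 'o, 'm) mon_drv_data \<Rightarrow> 'a scat \<Rightarrow> 'o \<Rightarrow> 'm" where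
  "extR D A X = (let K = DCat D (A \<otimes>\<^sub>c \<^bold>e); M = Mon D (A \<otimes>\<^sub>c \<^bold>e); X' = reO D (pr1 A \<^bold>e) X
     in TR M X' \<cdot>\<^bsub>K\<^esub> TA M (Idn K X') (inverse_in K (ResU D (pr2 A \<^bold>e))))"

text \<open>The canonical maps \<open>(u \<times> 1)\<^sub>! (X \<boxtimes> Y) \<rightarrow> u\<^sub>! X \<boxtimes> Y\<close> and \<open>(1 \<times> v)\<^sub>! (X \<boxtimes> Y) \<rightarrow> X \<boxtimes> v\<^sub>! Y\<close>.\<close>

definition cocont1 :: "('a, 'o, 'm) mon_drv_data \<Rightarrow> 'a sfun \<Rightarrow> 'a scat \<Rightarrow> 'o \<Rightarrow> 'o \<Rightarrow> 'm" where
  "cocont1 D u B X Y =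
    (let w = u \<otimes>\<^sub>f id_fun B; X' = FO (lkan D u) X
     in lan_counit D w (extO D (Tgt u) B X' Y) \<cdot>\<^bsub>DCat D (Tgt w)\<^esub>
        FA (lkan D w) (extRes D u (id_fun B) X' Y \<cdot>\<^bsub>DCat D (Src w)\<^esub>
          extA D (Src u) B (lan_unit D u X) (Idn (DCat D B) Y)))"

definition cocont2 :: "('a, 'o, 'm) mon_drv_data \<Rightarrow> 'a scat \<Rightarrow> 'a sfun \<Rightarrow> 'o \<Rightarrow> 'o \<Rightarrow> 'm" where
  "cocont2 D A v X Y =
    (let w = id_fun A \<otimes>\<^sub>f v; Y' = FO (lkan D v) Y
     in lan_counit D w (extO D A (Tgt v) X Y') \<cdot>\<^bsub>DCat D (Tgt w)\<^esub>
        FA (lkan D w) (extRes D (id_fun A) v X Y' \<cdot>\<^bsub>DCat D (Src w)\<^esub>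
          extA D A (Src v) (Idn (DCat D A) X) (lan_unit D v Y)))"

locale monoidal_derivator = derivator S D + monoidal_prederivator S D
  for S :: "'a elem set set" and D :: "('a, 'o, 'm) mon_drv_data" +
  assumes cocontinuous1: "\<lbrakk>small_fun S u; small_cat S B; X \<in> Ob (DCat D (Src u)); Y \<in> Ob (DCat D B)\<rbrakk>
      \<Longrightarrow> is_iso (DCat D (Tgt u \<otimes>\<^sub>c B)) (cocont1 D u B X Y)"
    and cocontinuous2: "\<lbrakk>small_cat S A; small_fun S v; X \<in> Ob (DCat D A); Y \<in> Ob (DCat D (Src v))\<rbrakk>
      \<Longrightarrow> is_iso (DCat D (A \<otimes>\<^sub>c Tgt v)) (cocont2 D A v X Y)"


section \<open>External monoidal structures and strong monoidal morphisms\<close>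

text \<open>
  A prederivator with a monoidal structure presented by its external product
  \<open>\<boxtimes>: E(A) \<times> E(B) \<rightarrow> E(A \<times> B)\<close> (\<open>XO\<close> on objects, \<open>XA\<close> on arrows), the unit in \<open>E(e)\<close> and the
  structure isomorphisms
    \<open>XRes: u\<^sup>*X \<boxtimes> v\<^sup>*Y \<rightarrow> (u \<times> v)\<^sup>*(X \<boxtimes> Y)\<close>,
    \<open>XAs: (X \<boxtimes> Y) \<boxtimes> Z \<rightarrow> assoc\<^sup>*(X \<boxtimes> (Y \<boxtimes> Z))\<close>,
    \<open>XL: 1 \<boxtimes> X \<rightarrow> pr2\<^sup>*X\<close>,
    \<open>XR: X \<boxtimes> 1 \<rightarrow> pr1\<^sup>*X\<close>.
\<close>

record ('a, 'o, 'm) ext_drv_data = "('a, 'o, 'm) drv_data" +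
  XO :: "'a scat \<Rightarrow> 'a scat \<Rightarrow> 'o \<Rightarrow> 'o \<Rightarrow> 'o"
  XA :: "'a scat \<Rightarrow> 'a scat \<Rightarrow> 'm \<Rightarrow> 'm \<Rightarrow> 'm"
  XU :: "'o"
  XRes :: "'a sfun \<Rightarrow> 'a sfun \<Rightarrow> 'o \<Rightarrow> 'o \<Rightarrow> 'm"
  XAs :: "'a scat \<Rightarrow> 'a scat \<Rightarrow> 'a scat \<Rightarrow> 'o \<Rightarrow> 'o \<Rightarrow> 'o \<Rightarrow> 'm"
  XL :: "'a scat \<Rightarrow> 'o \<Rightarrow> 'm"
  XR :: "'a scat \<Rightarrow> 'o \<Rightarrow> 'm"

definition external :: "('a, 'o, 'm) mon_drv_data \<Rightarrow> ('a, 'o, 'm) ext_drv_data" where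
  "external D = \<lparr> DCat = DCat D, DFun = DFun D, DNat = DNat D, XO = extO D, XA = extA D,
     XU = TU (Mon D \<^bold>e), XRes = extRes D, XAs = extAs D, XL = extL D, XR = extR D \<rparr>"

text \<open>\<open>\<mu> A B X Y: F X \<boxtimes> F Y \<rightarrow> F (X \<boxtimes> Y)\<close> and \<open>\<epsilon>: 1 \<rightarrow> F 1\<close> make \<open>F\<close> strong monoidal.\<close>

locale strong_monoidal_structure = derivator_morphism S D E F
  for S :: "'a elem set set" and D :: "('a, 'o, 'm) ext_drv_data"
    and E :: "('a, 'p, 'n) ext_drv_data" and F :: "('a, 'o, 'm, 'p, 'n) drv_mor" +
  fixes \<mu> :: "'a scat \<Rightarrow> 'a scat \<Rightarrow> 'o \<Rightarrow> 'o \<Rightarrow> 'n" and \<epsilon> :: "'n"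
  assumes mult_iso: "\<lbrakk>small_cat S A; small_cat S B; X \<in> Ob (DCat D A); Y \<in> Ob (DCat D B)\<rbrakk> \<Longrightarrow>
      \<mu> A B X Y \<in> isos (DCat E (A \<otimes>\<^sub>c B))
        (XO E A B (FO (MF F A) X) (FO (MF F B) Y)) (FO (MF F (A \<otimes>\<^sub>c B)) (XO D A B X Y))"
    and unit_iso: "\<epsilon> \<in> isos (DCat E \<^bold>e) (XU E) (FO (MF F \<^bold>e) (XU D))"
    and mult_natural: "\<lbrakk>small_cat S A; small_cat S B;
        f \<in> hom (DCat D A) X X'; g \<in> hom (DCat D B) Y Y'\<rbrakk> \<Longrightarrow>
      \<mu> A B X' Y' \<cdot>\<^bsub>DCat E (A \<otimes>\<^sub>c B)\<^esub> XA E A B (FA (MF F A) f) (FA (MF F B) g)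
      = FA (MF F (A \<otimes>\<^sub>c B)) (XA D A B f g) \<cdot>\<^bsub>DCat E (A \<otimes>\<^sub>c B)\<^esub> \<mu> A B X Y"
    and mult_res: "\<lbrakk>small_fun S u; small_fun S v;
        X \<in> Ob (DCat D (Tgt u)); Y \<in> Ob (DCat D (Tgt v)); K = DCat E (Src u \<otimes>\<^sub>c Src v)\<rbrakk> \<Longrightarrow>
      reA E (u \<otimes>\<^sub>f v) (\<mu> (Tgt u) (Tgt v) X Y)
        \<cdot>\<^bsub>K\<^esub> XRes E u v (FO (MF F (Tgt u)) X) (FO (MF F (Tgt v)) Y)
        \<cdot>\<^bsub>K\<^esub> XA E (Src u) (Src v) (MC F u X) (MC F v Y)
      = MC F (u \<otimes>\<^sub>f v) (XO D (Tgt u) (Tgt v) X Y)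
        \<cdot>\<^bsub>K\<^esub> FA (MF F (Src u \<otimes>\<^sub>c Src v)) (XRes D u v X Y)
        \<cdot>\<^bsub>K\<^esub> \<mu> (Src u) (Src v) (reO D u X) (reO D v Y)"
    and mult_assoc: "\<lbrakk>small_cat S A; small_cat S B; small_cat S C;
        X \<in> Ob (DCat D A); Y \<in> Ob (DCat D B); Z \<in> Ob (DCat D C);
        P = (A \<otimes>\<^sub>c B) \<otimes>\<^sub>c C; K = DCat E P; a = assoc_fun A B C\<rbrakk> \<Longrightarrow>
      MC F a (XO D A (B \<otimes>\<^sub>c C) X (XO D B C Y Z))
        \<cdot>\<^bsub>K\<^esub> FA (MF F P) (XAs D A B C X Y Z)
        \<cdot>\<^bsub>K\<^esub> \<mu> (A \<otimes>\<^sub>c B) C (XO D A B X Y) Z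
        \<cdot>\<^bsub>K\<^esub> XA E (A \<otimes>\<^sub>c B) C (\<mu> A B X Y) (Idn (DCat E C) (FO (MF F C) Z))
      = reA E a (\<mu> A (B \<otimes>\<^sub>c C) X (XO D B C Y Z))
        \<cdot>\<^bsub>K\<^esub> reA E a (XA E A (B \<otimes>\<^sub>c C) (Idn (DCat E A) (FO (MF F A) X)) (\<mu> B C Y Z))
        \<cdot>\<^bsub>K\<^esub> XAs E A B C (FO (MF F A) X) (FO (MF F B) Y) (FO (MF F C) Z)"
    and mult_lunit: "\<lbrakk>small_cat S A; X \<in> Ob (DCat D A); K = DCat E (\<^bold>e \<otimes>\<^sub>c A)\<rbrakk> \<Longrightarrow>
      XL E A (FO (MF F A) X)
      = MC F (pr2 \<^bold>e A) X
        \<cdot>\<^bsub>K\<^esub> FA (MF F (\<^bold>e \<otimes>\<^sub>c A)) (XL D A X)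
        \<cdot>\<^bsub>K\<^esub> \<mu> \<^bold>e A (XU D) X
        \<cdot>\<^bsub>K\<^esub> XA E \<^bold>e A \<epsilon> (Idn (DCat E A) (FO (MF F A) X))"
    and mult_runit: "\<lbrakk>small_cat S A; X \<in> Ob (DCat D A); K = DCat E (A \<otimes>\<^sub>c \<^bold>e)\<rbrakk> \<Longrightarrow>
      XR E A (FO (MF F A) X)
      = MC F (pr1 A \<^bold>e) X
        \<cdot>\<^bsub>K\<^esub> FA (MF F (A \<otimes>\<^sub>c \<^bold>e)) (XR D A X)
        \<cdot>\<^bsub>K\<^esub> \<mu> A \<^bold>e X (XU D)
        \<cdot>\<^bsub>K\<^esub> XA E A \<^bold>e (Idn (DCat E A) (FO (MF F A) X)) \<epsilon>"

definition strong_monoidal :: "'a elem set set \<Rightarrow> ('a, 'o, 'm) ext_drv_data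
    \<Rightarrow> ('a, 'p, 'n) ext_drv_data \<Rightarrow> ('a, 'o, 'm, 'p, 'n) drv_mor \<Rightarrow> bool" where
  "strong_monoidal S D E F \<longleftrightarrow> (\<exists>\<mu> \<epsilon>. strong_monoidal_structure S D E F \<mu> \<epsilon>)"


section \<open>The affine line\<close>

text \<open>
  The structure morphism is \<open>i\<^sub>!: D\<^sup>e \<rightarrow> D\<^sup>N\<close>, precomposed with the identification \<open>D \<cong> D\<^sup>e\<close> given by
  restriction along the isomorphisms \<open>pr2: e \<times> I \<rightarrow> I\<close>; it needs no constraint of its own because
  \<open>pr2\<^sup>* w\<^sup>* = (1 \<times> w)\<^sup>* pr2\<^sup>*\<close>.
\<close>

definition structure_morphism :: "('a, 'o, 'm, 'z) drv_data_scheme \<Rightarrow> ('a, 'o, 'm, 'o, 'm) drv_mor"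
  where
  "structure_morphism D =
    \<lparr> MF = (\<lambda>I. MF (lan_mor D N_pt) I \<odot> DFun D (pr2 \<^bold>e I)),
      MC = (\<lambda>w X. MC (lan_mor D N_pt) w (reO D (pr2 \<^bold>e (Tgt w)) X)) \<rparr>"

text \<open>
  \<open>X \<boxtimes> Y\<close> for \<open>X \<in> D\<^sup>N(I)\<close> and \<open>Y \<in> D\<^sup>N(J)\<close> is formed in \<open>D((N \<times> I) \<times> (N \<times> J))\<close> and regarded as an
  object of \<open>D\<^sup>N\<^sup>\<times>\<^sup>N(I \<times> J)\<close> by means of \<open>mid_swap\<close>, before \<open>+\<^sub>!\<close> is applied. Over
  \<open>(N \<times> I) \<times> (N \<times> J)\<close>, the unit of \<open>+\<^sub>!\<close> becomes the universal arrow
  \<open>line_univ: X \<boxtimes> Y \<rightarrow> q\<^sup>*(X \<boxtimes>' Y)\<close>, where \<open>\<boxtimes>'\<close> is the product of the affine line and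
  \<open>q = line_plus I J: (N \<times> I) \<times> (N \<times> J) \<rightarrow> N \<times> (I \<times> J)\<close> adds the \<open>N\<close>-components.
\<close>

definition line_swap :: "'a scat \<Rightarrow> 'a scat \<Rightarrow> 'a sfun" where
  "line_swap I J = mid_swap \<^bold>N \<^bold>N I J"

definition lineO :: "('a, 'o, 'm) mon_drv_data \<Rightarrow> 'a scat \<Rightarrow> 'a scat \<Rightarrow> 'o \<Rightarrow> 'o \<Rightarrow> 'o" where
  "lineO D I J X Y = FO (MF (lan_mor D N_plus) (I \<otimes>\<^sub>c J))
     (reO D (line_swap I J) (extO D (\<^bold>N \<otimes>\<^sub>c I) (\<^bold>N \<otimes>\<^sub>c J) X Y))"

definition lineA :: "('a, 'o, 'm) mon_drv_data \<Rightarrow> 'a scat \<Rightarrow> 'a scat \<Rightarrow> 'm \<Rightarrow> 'm \<Rightarrow> 'm" where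
  "lineA D I J f g = FA (MF (lan_mor D N_plus) (I \<otimes>\<^sub>c J))
     (reA D (line_swap I J) (extA D (\<^bold>N \<otimes>\<^sub>c I) (\<^bold>N \<otimes>\<^sub>c J) f g))"

definition lineU :: "('a, 'o, 'm) mon_drv_data \<Rightarrow> 'o" where
  "lineU D = FO (MF (structure_morphism D) \<^bold>e) (TU (Mon D \<^bold>e))"

definition line_plus :: "'a scat \<Rightarrow> 'a scat \<Rightarrow> 'a sfun" where
  "line_plus I J = (N_plus \<otimes>\<^sub>f id_fun (I \<otimes>\<^sub>c J)) \<odot> mid_swap \<^bold>N I \<^bold>N J"

definition line_univ :: "('a, 'o, 'm) mon_drv_data \<Rightarrow> 'a scat \<Rightarrow> 'a scat \<Rightarrow> 'o \<Rightarrow> 'o \<Rightarrow> 'm" where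
  "line_univ D I J X Y = reA D (mid_swap \<^bold>N I \<^bold>N J)
     (lan_unit D (N_plus \<otimes>\<^sub>f id_fun (I \<otimes>\<^sub>c J))
       (reO D (line_swap I J) (extO D (\<^bold>N \<otimes>\<^sub>c I) (\<^bold>N \<otimes>\<^sub>c J) X Y)))"

text \<open>
  The universal arrow of \<open>i\<^sub>!\<close>, from \<open>pr2\<^sup>*X\<close> to \<open>(i \<times> 1)\<^sup>* (i\<^sub>! X)\<close> in \<open>D(e \<times> I)\<close>.
\<close>

definition pt_univ :: "('a, 'o, 'm) mon_drv_data \<Rightarrow> 'a scat \<Rightarrow> 'o \<Rightarrow> 'm" where
  "pt_univ D I X = lan_unit D (N_pt \<otimes>\<^sub>f id_fun I) (reO D (pr2 \<^bold>e I) X)"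

text \<open>
  The structure isomorphisms of the affine line are those induced by the ones of \<open>D\<close> on left Kan
  extensions: each of them is the unique arrow that restricts along the universal arrows to the
  corresponding structure isomorphism of \<open>D\<close>. For a monoidal derivator such unique arrows exist
  because \<open>\<boxtimes>\<close> is cocontinuous in each variable.
\<close>

definition lineRes :: "('a, 'o, 'm) mon_drv_data \<Rightarrow> 'a sfun \<Rightarrow> 'a sfun \<Rightarrow> 'o \<Rightarrow> 'o \<Rightarrow> 'm" where
  "lineRes D u v X Y =
    (let I = Src u; I' = Tgt u; J = Src v; J' = Tgt v;
         u' = id_fun \<^bold>N \<otimes>\<^sub>f u; v' = id_fun \<^bold>N \<otimes>\<^sub>f v;
         K = DCat D ((\<^bold>N \<otimes>\<^sub>c I) \<otimes>\<^sub>c (\<^bold>N \<otimes>\<^sub>c J))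
     in THE r. r \<in> hom (DCat D (\<^bold>N \<otimes>\<^sub>c (I \<otimes>\<^sub>c J)))
               (lineO D I J (reO D u' X) (reO D v' Y))
               (reO D (id_fun \<^bold>N \<otimes>\<^sub>f (u \<otimes>\<^sub>f v)) (lineO D I' J' X Y))
          \<and> reA D (line_plus I J) r \<cdot>\<^bsub>K\<^esub> line_univ D I J (reO D u' X) (reO D v' Y)
            = reA D (u' \<otimes>\<^sub>f v') (line_univ D I' J' X Y) \<cdot>\<^bsub>K\<^esub> extRes D u' v' X Y)"

definition lineAs :: "('a, 'o, 'm) mon_drv_data \<Rightarrow> 'a scat \<Rightarrow> 'a scat \<Rightarrow> 'a scat \<Rightarrow> 'o \<Rightarrow> 'o \<Rightarrow> 'o \<Rightarrow> 'm"
  where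
  "lineAs D A B C X Y Z =
    (let NA = \<^bold>N \<otimes>\<^sub>c A; NB = \<^bold>N \<otimes>\<^sub>c B; NC = \<^bold>N \<otimes>\<^sub>c C;
         XY = lineO D A B X Y; YZ = lineO D B C Y Z;
         K = DCat D ((NA \<otimes>\<^sub>c NB) \<otimes>\<^sub>c NC); L = DCat D (NA \<otimes>\<^sub>c (NB \<otimes>\<^sub>c NC));
         w = line_plus A B \<otimes>\<^sub>f id_fun NC; w' = id_fun NA \<otimes>\<^sub>f line_plus B C
     in THE r. r \<in> hom (DCat D (\<^bold>N \<otimes>\<^sub>c ((A \<otimes>\<^sub>c B) \<otimes>\<^sub>c C)))
               (lineO D (A \<otimes>\<^sub>c B) C XY Z)
               (reO D (id_fun \<^bold>N \<otimes>\<^sub>f assoc_fun A B C) (lineO D A (B \<otimes>\<^sub>c C) X YZ))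
          \<and> reA D (line_plus (A \<otimes>\<^sub>c B) C \<odot> w) r
              \<cdot>\<^bsub>K\<^esub> reA D w (line_univ D (A \<otimes>\<^sub>c B) C XY Z)
              \<cdot>\<^bsub>K\<^esub> extRes D (line_plus A B) (id_fun NC) XY Z
              \<cdot>\<^bsub>K\<^esub> extA D (NA \<otimes>\<^sub>c NB) NC (line_univ D A B X Y) (Idn (DCat D NC) Z)
            = reA D (assoc_fun NA NB NC)
                (reA D w' (line_univ D A (B \<otimes>\<^sub>c C) X YZ)
                 \<cdot>\<^bsub>L\<^esub> extRes D (id_fun NA) (line_plus B C) X YZ
                 \<cdot>\<^bsub>L\<^esub> extA D NA (NB \<otimes>\<^sub>c NC) (Idn (DCat D NA) X) (line_univ D B C Y Z))
              \<cdot>\<^bsub>K\<^esub> extAs D NA NB NC X Y Z)"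

definition lineL :: "('a, 'o, 'm) mon_drv_data \<Rightarrow> 'a scat \<Rightarrow> 'o \<Rightarrow> 'm" where
  "lineL D A X =
    (let NA = \<^bold>N \<otimes>\<^sub>c A; U = TU (Mon D \<^bold>e); i = N_pt \<otimes>\<^sub>f id_fun \<^bold>e; w = i \<otimes>\<^sub>f id_fun NA;
         l = pr2 \<^bold>e \<^bold>e; K = DCat D ((\<^bold>e \<otimes>\<^sub>c \<^bold>e) \<otimes>\<^sub>c NA)
     in THE r. r \<in> hom (DCat D (\<^bold>N \<otimes>\<^sub>c (\<^bold>e \<otimes>\<^sub>c A)))
               (lineO D \<^bold>e A (lineU D) X) (reO D (id_fun \<^bold>N \<otimes>\<^sub>f pr2 \<^bold>e A) X)
          \<and> reA D (line_plus \<^bold>e A \<odot> w) r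
              \<cdot>\<^bsub>K\<^esub> reA D w (line_univ D \<^bold>e A (lineU D) X)
              \<cdot>\<^bsub>K\<^esub> extRes D i (id_fun NA) (lineU D) X
              \<cdot>\<^bsub>K\<^esub> extA D (\<^bold>e \<otimes>\<^sub>c \<^bold>e) NA (pt_univ D \<^bold>e U) (Idn (DCat D NA) X)
            = reA D (l \<otimes>\<^sub>f id_fun NA) (extL D NA X) \<cdot>\<^bsub>K\<^esub> extRes D l (id_fun NA) U X)"

definition lineR :: "('a, 'o, 'm) mon_drv_data \<Rightarrow> 'a scat \<Rightarrow> 'o \<Rightarrow> 'm" where
  "lineR D A X =
    (let NA = \<^bold>N \<otimes>\<^sub>c A; U = TU (Mon D \<^bold>e); i = N_pt \<otimes>\<^sub>f id_fun \<^bold>e; w = id_fun NA \<otimes>\<^sub>f i;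
         l = pr2 \<^bold>e \<^bold>e; K = DCat D (NA \<otimes>\<^sub>c (\<^bold>e \<otimes>\<^sub>c \<^bold>e))
     in THE r. r \<in> hom (DCat D (\<^bold>N \<otimes>\<^sub>c (A \<otimes>\<^sub>c \<^bold>e)))
               (lineO D A \<^bold>e X (lineU D)) (reO D (id_fun \<^bold>N \<otimes>\<^sub>f pr1 A \<^bold>e) X)
          \<and> reA D (line_plus A \<^bold>e \<odot> w) r
              \<cdot>\<^bsub>K\<^esub> reA D w (line_univ D A \<^bold>e X (lineU D))
              \<cdot>\<^bsub>K\<^esub> extRes D (id_fun NA) i X (lineU D)
              \<cdot>\<^bsub>K\<^esub> extA D NA (\<^bold>e \<otimes>\<^sub>c \<^bold>e) (Idn (DCat D NA) X) (pt_univ D \<^bold>e U)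
            = reA D (id_fun NA \<otimes>\<^sub>f l) (extR D NA X) \<cdot>\<^bsub>K\<^esub> extRes D (id_fun NA) l X U)"

definition affine_line :: "('a, 'o, 'm) mon_drv_data \<Rightarrow> ('a, 'o, 'm) ext_drv_data" where
  "affine_line D = \<lparr> DCat = DCat (shift D \<^bold>N), DFun = DFun (shift D \<^bold>N), DNat = DNat (shift D \<^bold>N),
     XO = lineO D, XA = lineA D, XU = lineU D, XRes = lineRes D, XAs = lineAs D,
     XL = lineL D, XR = lineR D \<rparr>"

end

theory Submission
  imports Defs
begin

text \<open>
  The categories \<open>D(A)\<close> are glued to one category: its objects are pairs \<open>(A, X)\<close> with \<open>X\<close> in \<open>D(A)\<close>, and an arrow
  \<open>(A, X) \<rightarrow> (B, Y)\<close> consists of a functor \<open>u: A \<rightarrow> B\<close> and a morphism \<open>X \<rightarrow> u\<^sup>* Y\<close>. Restriction along \<open>u\<close> is then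
  given by cartesian arrows, and left Kan extension by cocartesian ones: the unit \<open>X \<rightarrow> u\<^sup>* u\<^sub>! X\<close>, read as an arrow
  \<open>X \<rightarrow> u\<^sub>! X\<close> over \<open>u\<close>, is universal among arrows out of \<open>X\<close> over functors that factor through \<open>u\<close>
  (\<open>cocart_lan_arr\<close>). Three facts make the theorem work.

  \<^item> The external product is a functor \<open>\<boxtimes>\<close> on this category (\<open>box_comp\<close>), and its associativity and unit constraints are
    natural with respect to all arrows, not only those of the fibres (\<open>asc_natural\<close>, \<open>lun_natural\<close>, \<open>run_natural\<close>).

  \<^item> Cocontinuity of the product means that \<open>\<boxtimes>\<close> preserves cocartesian arrows (\<open>cocart_box\<close>).

  \<^item> The product of the affine line and the functor \<open>i\<^sub>!\<close> are Kan extensions, and so come with cocartesian arrows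
    \<open>lam: F \<boxtimes> G \<rightarrow> F \<boxtimes>\<^sub>A\<^sub>1 G\<close> over addition and \<open>kap: X \<rightarrow> i\<^sub>! X\<close> over the inclusion of the base point.

  Hence \<open>lam \<star> (kap \<boxtimes> kap): X \<boxtimes> Y \<rightarrow> i\<^sub>! X \<boxtimes>\<^sub>A\<^sub>1 i\<^sub>! Y\<close> is cocartesian. It lies over the inclusion
  \<open>I \<times> J \<rightarrow> \<^bold>N \<times> (I \<times> J)\<close> of the base point because \<open>0 + 0 = 0\<close>, as does the cocartesian arrow
  \<open>kap: X \<boxtimes> Y \<rightarrow> i\<^sub>! (X \<boxtimes> Y)\<close>. Two cocartesian arrows with the same source over the same functor differ by a unique
  isomorphism, and this is the comparison \<open>i\<^sub>! X \<boxtimes>\<^sub>A\<^sub>1 i\<^sub>! Y \<cong> i\<^sub>! (X \<boxtimes> Y)\<close> (\<open>mu_iso_kap2\<close>). The unit of the affine line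
  is \<open>i\<^sub>! 1\<close>, so the unit comparison is the identity. The constraints of the affine line are themselves defined by the universal
  property of \<open>lam\<close> (\<open>res_arr_lam\<close>, \<open>as_arr_lam\<close>, \<open>lunit_arr_lam\<close>, \<open>runit_arr_lam\<close>). Every coherence condition is therefore an equation
  between arrows out of the target of a cocartesian arrow; after precomposition with it, the condition becomes
  naturality of a constraint of \<open>\<boxtimes>\<close> with respect to the arrows \<open>kap\<close>.

  That \<open>i\<^sub>!\<close> is a morphism of derivators requires its constraints \<open>i\<^sub>! w\<^sup>* X \<rightarrow> (1 \<times> w)\<^sup>* i\<^sub>! X\<close> to be invertible (\<open>con_iso\<close>). By
  cocontinuity \<open>i\<^sub>! X \<cong> i\<^sub>! 1 \<boxtimes> X\<close>, and for the latter the constraint is the isomorphism that expresses the compatibility of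
  \<open>\<boxtimes>\<close> with restriction.
\<close>

section \<open>Categories and functors\<close>

lemma mk_cat_simps [simp]:
  "Ob (mk_cat Obs Arrs d c i m) = Obs"
  "Arr (mk_cat Obs Arrs d c i m) = Arrs"
  "f \<in> Arrs \<Longrightarrow> Dom (mk_cat Obs Arrs d c i m) f = d f"
  "f \<in> Arrs \<Longrightarrow> Cod (mk_cat Obs Arrs d c i m) f = c f"
  "a \<in> Obs \<Longrightarrow> Idn (mk_cat Obs Arrs d c i m) a = i a"
  "f \<in> Arrs \<Longrightarrow> g \<in> Arrs \<Longrightarrow> c f = d g \<Longrightarrow> Cmp (mk_cat Obs Arrs d c i m) g f = m g f"
  by (simp_all add: mk_cat_def)

lemma category_mk_cat:
  assumes "\<And>f. f \<in> Arrs \<Longrightarrow> d f \<in> Obs" "\<And>f. f \<in> Arrs \<Longrightarrow> c f \<in> Obs"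
    and "\<And>a. a \<in> Obs \<Longrightarrow> i a \<in> Arrs \<and> d (i a) = a \<and> c (i a) = a"
    and "\<And>f g. f \<in> Arrs \<Longrightarrow> g \<in> Arrs \<Longrightarrow> c f = d g \<Longrightarrow>
           m g f \<in> Arrs \<and> d (m g f) = d f \<and> c (m g f) = c g"
    and "\<And>f. f \<in> Arrs \<Longrightarrow> m (i (c f)) f = f" "\<And>f. f \<in> Arrs \<Longrightarrow> m f (i (d f)) = f"
    and "\<And>f g h. f \<in> Arrs \<Longrightarrow> g \<in> Arrs \<Longrightarrow> h \<in> Arrs \<Longrightarrow> c f = d g \<Longrightarrow> c g = d h \<Longrightarrow>
           m (m h g) f = m h (m g f)"
  shows "category (mk_cat Obs Arrs d c i m)"
  using assms
  by unfold_locales (auto simp: hom_def mk_cat_def)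

context category
begin

lemma homI: "f \<in> Arr C \<Longrightarrow> f \<in> hom C (Dom C f) (Cod C f)"
  by (simp add: hom_def)

lemma Idn_simps [simp]: "a \<in> Ob C \<Longrightarrow> Idn C a \<in> Arr C" "a \<in> Ob C \<Longrightarrow> Dom C (Idn C a) = a"
  "a \<in> Ob C \<Longrightarrow> Cod C (Idn C a) = a"
  using id_in by (auto simp: hom_def)

lemma Cmp_simps [simp]:
  assumes "f \<in> Arr C" "g \<in> Arr C" "Cod C f = Dom C g"
  shows "g \<cdot>\<^bsub>C\<^esub> f \<in> Arr C" "Dom C (g \<cdot>\<^bsub>C\<^esub> f) = Dom C f" "Cod C (g \<cdot>\<^bsub>C\<^esub> f) = Cod C g"
  using comp_closed[of f "Dom C f" "Cod C f" g "Cod C g"] assms by (auto simp: hom_def)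

lemma Idn_left [simp]: "f \<in> Arr C \<Longrightarrow> Cod C f = b \<Longrightarrow> Idn C b \<cdot>\<^bsub>C\<^esub> f = f"
  using id_left homI by blast

lemma Idn_right [simp]: "f \<in> Arr C \<Longrightarrow> Dom C f = b \<Longrightarrow> f \<cdot>\<^bsub>C\<^esub> Idn C b = f"
  using id_right homI by blast

lemma Cmp_assoc:
  assumes "f \<in> Arr C" "g \<in> Arr C" "h \<in> Arr C" "Cod C f = Dom C g" "Cod C g = Dom C h"
  shows "(h \<cdot>\<^bsub>C\<^esub> g) \<cdot>\<^bsub>C\<^esub> f = h \<cdot>\<^bsub>C\<^esub> (g \<cdot>\<^bsub>C\<^esub> f)"
  using assoc[of f "Dom C f" "Cod C f" g "Cod C g" h "Cod C h"] assms by (auto simp: hom_def)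

end

lemma mk_fun_simps [simp]:
  "Src (mk_fun A B fo fa) = A" "Tgt (mk_fun A B fo fa) = B"
  "a \<in> Ob A \<Longrightarrow> FO (mk_fun A B fo fa) a = fo a"
  "f \<in> Arr A \<Longrightarrow> FA (mk_fun A B fo fa) f = fa f"
  by (simp_all add: mk_fun_def)

lemma is_functor_mk_fun:
  assumes A: "category A" and B: "category B"
    and "\<And>a. a \<in> Ob A \<Longrightarrow> fo a \<in> Ob B"
    and "\<And>f. f \<in> Arr A \<Longrightarrow> fa f \<in> Arr B \<and> Dom B (fa f) = fo (Dom A f) \<and> Cod B (fa f) = fo (Cod A f)"
    and "\<And>a. a \<in> Ob A \<Longrightarrow> fa (Idn A a) = Idn B (fo a)"
    and "\<And>f g. f \<in> Arr A \<Longrightarrow> g \<in> Arr A \<Longrightarrow> Cod A f = Dom A g \<Longrightarrow>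
           fa (g \<cdot>\<^bsub>A\<^esub> f) = fa g \<cdot>\<^bsub>B\<^esub> fa f"
  shows "is_functor (mk_fun A B fo fa)"
proof -
  interpret A: category A by fact
  interpret B: category B by fact
  show ?thesis
    using assms by (intro is_functor.intro) (auto simp: hom_def mk_fun_def A.dom_in A.cod_in)
qed

context is_functor
begin

lemma FA_simps [simp]:
  assumes "f \<in> Arr (Src F)"
  shows "FA F f \<in> Arr (Tgt F)" "Dom (Tgt F) (FA F f) = FO F (Dom (Src F) f)"
    "Cod (Tgt F) (FA F f) = FO F (Cod (Src F) f)"
  using arr_in[of f "Dom (Src F) f" "Cod (Src F) f"] assms by (auto simp: hom_def)

lemma FA_comp:
  assumes "f \<in> Arr (Src F)" "g \<in> Arr (Src F)" "Cod (Src F) f = Dom (Src F) g"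
  shows "FA F (g \<cdot>\<^bsub>Src F\<^esub> f) = FA F g \<cdot>\<^bsub>Tgt F\<^esub> FA F f"
  using pres_comp[of f "Dom (Src F) f" "Cod (Src F) f" g "Cod (Src F) g"] assms
  by (auto simp: hom_def)

end

text \<open>
  Object and arrow parts are undefined outside their carriers, so functors are determined by their
  values on the carriers.
\<close>

lemma functor_eqI:
  assumes "is_functor F" "is_functor G" "Src F = Src G" "Tgt F = Tgt G"
    and "\<And>a. a \<in> Ob (Src G) \<Longrightarrow> FO F a = FO G a" "\<And>f. f \<in> Arr (Src G) \<Longrightarrow> FA F f = FA G f"
  shows "F = G"
proof -
  interpret F: is_functor F by fact
  interpret G: is_functor G by fact
  have "FO F = FO G"
    using F.obj_ext G.obj_ext assms by (intro extensionalityI[of _ "Ob (Src G)"]) auto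
  moreover have "FA F = FA G"
    using F.arr_ext G.arr_ext assms by (intro extensionalityI[of _ "Arr (Src G)"]) auto
  ultimately show ?thesis using assms by simp
qed

lemma comp_fun_simps [simp]:
  "Src (G \<odot> F) = Src F" "Tgt (G \<odot> F) = Tgt G"
  "a \<in> Ob (Src F) \<Longrightarrow> FO (G \<odot> F) a = FO G (FO F a)"
  "f \<in> Arr (Src F) \<Longrightarrow> FA (G \<odot> F) f = FA G (FA F f)"
  by (simp_all add: comp_fun_def)

lemma id_fun_simps [simp]:
  "Src (id_fun A) = A" "Tgt (id_fun A) = A"
  "a \<in> Ob A \<Longrightarrow> FO (id_fun A) a = a" "f \<in> Arr A \<Longrightarrow> FA (id_fun A) f = f"
  by (simp_all add: id_fun_def)

lemma is_functor_id_fun: "category A \<Longrightarrow> is_functor (id_fun A)"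
  unfolding id_fun_def by (rule is_functor_mk_fun) auto

lemma is_functor_comp_fun:
  assumes "is_functor F" "is_functor G" "Tgt F = Src G"
  shows "is_functor (G \<odot> F)"
proof -
  interpret F: is_functor F by fact
  interpret G: is_functor G by fact
  show ?thesis
    unfolding comp_fun_def using assms(3)
    by (intro is_functor_mk_fun)
      (auto simp: F.src_cat G.tgt_cat F.obj_in[unfolded assms(3)] G.obj_in
        F.FA_simps[unfolded assms(3)] F.pres_id[unfolded assms(3)] G.pres_id
        F.FA_comp[unfolded assms(3)] G.FA_comp)
qed

lemma comp_fun_assoc:
  assumes "is_functor F" "Tgt F = Src G"
  shows "(H \<odot> G) \<odot> F = H \<odot> (G \<odot> F)"
proof -
  interpret F: is_functor F by fact
  have "FO F a \<in> Ob (Src G)" if "a \<in> Ob (Src F)" for a using F.obj_in that assms by simp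
  moreover have "FA F f \<in> Arr (Src G)" if "f \<in> Arr (Src F)" for f
    using F.FA_simps(1) that assms by simp
  ultimately show ?thesis by (auto simp: comp_fun_def mk_fun_def restrict_def)
qed

lemma comp_id_fun [simp]:
  assumes "is_functor F"
  shows "Tgt F = B \<Longrightarrow> id_fun B \<odot> F = F" "Src F = A \<Longrightarrow> F \<odot> id_fun A = F"
proof -
  interpret F: is_functor F by fact
  show "Tgt F = B \<Longrightarrow> id_fun B \<odot> F = F"
    using assms F.tgt_cat F.obj_in
    by (intro functor_eqI) (auto intro: is_functor_comp_fun is_functor_id_fun)
  show "Src F = A \<Longrightarrow> F \<odot> id_fun A = F"
    using assms F.src_cat
    by (intro functor_eqI) (auto intro: is_functor_comp_fun is_functor_id_fun)
qed

subsection \<open>Products and the monoid of natural numbers\<close>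

lemma prod_cat_simps:
  "Ob (A \<otimes>\<^sub>c B) = {Pair_el a b |a b. a \<in> Ob A \<and> b \<in> Ob B}"
  "Arr (A \<otimes>\<^sub>c B) = {Pair_el f g |f g. f \<in> Arr A \<and> g \<in> Arr B}"
  by (simp_all add: prod_cat_def)

lemma prod_cat_mem [simp]:
  "Pair_el a b \<in> Ob (A \<otimes>\<^sub>c B) \<longleftrightarrow> a \<in> Ob A \<and> b \<in> Ob B"
  "Pair_el f g \<in> Arr (A \<otimes>\<^sub>c B) \<longleftrightarrow> f \<in> Arr A \<and> g \<in> Arr B"
  by (simp_all add: prod_cat_simps)

lemma prod_cat_ops [simp]:
  "f \<in> Arr A \<Longrightarrow> g \<in> Arr B \<Longrightarrow> Dom (A \<otimes>\<^sub>c B) (Pair_el f g) = Pair_el (Dom A f) (Dom B g)"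
  "f \<in> Arr A \<Longrightarrow> g \<in> Arr B \<Longrightarrow> Cod (A \<otimes>\<^sub>c B) (Pair_el f g) = Pair_el (Cod A f) (Cod B g)"
  "a \<in> Ob A \<Longrightarrow> b \<in> Ob B \<Longrightarrow> Idn (A \<otimes>\<^sub>c B) (Pair_el a b) = Pair_el (Idn A a) (Idn B b)"
  by (simp_all add: prod_cat_def)

lemma prod_cat_comp [simp]:
  assumes "f \<in> Arr A" "g \<in> Arr B" "f' \<in> Arr A" "g' \<in> Arr B" "Cod A f = Dom A f'" "Cod B g = Dom B g'"
  shows "Pair_el f' g' \<cdot>\<^bsub>A \<otimes>\<^sub>c B\<^esub> Pair_el f g = Pair_el (f' \<cdot>\<^bsub>A\<^esub> f) (g' \<cdot>\<^bsub>B\<^esub> g)"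
  using assms by (simp add: prod_cat_def)

lemma category_prod_cat:
  assumes "category A" "category B"
  shows "category (A \<otimes>\<^sub>c B)"
proof -
  interpret A: category A by fact
  interpret B: category B by fact
  show ?thesis
    unfolding prod_cat_def
    by (rule category_mk_cat) (auto simp: A.dom_in A.cod_in B.dom_in B.cod_in A.Cmp_assoc B.Cmp_assoc)
qed

lemma category_pt_cat: "category \<^bold>e"
  unfolding pt_cat_def by (rule category_mk_cat) auto

lemma pt_cat_simps [simp]: "Ob \<^bold>e = {Nat_el 0}" "Arr \<^bold>e = {Nat_el 0}"
  "Dom \<^bold>e (Nat_el 0) = Nat_el 0" "Cod \<^bold>e (Nat_el 0) = Nat_el 0" "Idn \<^bold>e (Nat_el 0) = Nat_el 0"
  "Nat_el 0 \<cdot>\<^bsub>\<^bold>e\<^esub> Nat_el 0 = Nat_el 0"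
  by (simp_all add: pt_cat_def)

lemma category_N_cat: "category \<^bold>N"
  unfolding N_cat_def by (rule category_mk_cat) auto

lemma N_cat_simps [simp]: "Ob \<^bold>N = {Nat_el 0}" "Arr \<^bold>N = range Nat_el"
  "Dom \<^bold>N (Nat_el n) = Nat_el 0" "Cod \<^bold>N (Nat_el n) = Nat_el 0" "Idn \<^bold>N (Nat_el 0) = Nat_el 0"
  "Nat_el n \<cdot>\<^bsub>\<^bold>N\<^esub> Nat_el m = Nat_el (m + n)"
  by (simp_all add: N_cat_def)

lemma prod_fun_simps [simp]:
  "Src (u \<otimes>\<^sub>f v) = Src u \<otimes>\<^sub>c Src v" "Tgt (u \<otimes>\<^sub>f v) = Tgt u \<otimes>\<^sub>c Tgt v"
  "a \<in> Ob (Src u) \<Longrightarrow> b \<in> Ob (Src v) \<Longrightarrow> FO (u \<otimes>\<^sub>f v) (Pair_el a b) = Pair_el (FO u a) (FO v b)"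
  "f \<in> Arr (Src u) \<Longrightarrow> g \<in> Arr (Src v) \<Longrightarrow> FA (u \<otimes>\<^sub>f v) (Pair_el f g) = Pair_el (FA u f) (FA v g)"
  by (simp_all add: prod_fun_def)

lemma is_functor_prod_fun:
  assumes "is_functor u" "is_functor v"
  shows "is_functor (u \<otimes>\<^sub>f v)"
proof -
  interpret u: is_functor u by fact
  interpret v: is_functor v by fact
  interpret A: category "Src u" by (rule u.src_cat)
  interpret B: category "Src v" by (rule v.src_cat)
  show ?thesis
    unfolding prod_fun_def
    by (rule is_functor_mk_fun)
      (auto simp: prod_cat_simps(1)[of "Src u"] prod_cat_simps(2)[of "Src u"] u.obj_in v.obj_in
        u.pres_id v.pres_id u.FA_comp v.FA_comp
        intro!: category_prod_cat u.src_cat v.src_cat u.tgt_cat v.tgt_cat)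
qed

lemma pr_simps [simp]:
  "Src (pr1 A B) = A \<otimes>\<^sub>c B" "Tgt (pr1 A B) = A" "Src (pr2 A B) = A \<otimes>\<^sub>c B" "Tgt (pr2 A B) = B"
  "a \<in> Ob A \<Longrightarrow> b \<in> Ob B \<Longrightarrow> FO (pr1 A B) (Pair_el a b) = a"
  "a \<in> Ob A \<Longrightarrow> b \<in> Ob B \<Longrightarrow> FO (pr2 A B) (Pair_el a b) = b"
  "f \<in> Arr A \<Longrightarrow> g \<in> Arr B \<Longrightarrow> FA (pr1 A B) (Pair_el f g) = f"
  "f \<in> Arr A \<Longrightarrow> g \<in> Arr B \<Longrightarrow> FA (pr2 A B) (Pair_el f g) = g"
  by (simp_all add: pr1_def pr2_def)

lemma is_functor_pr:
  assumes "category A" "category B"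
  shows "is_functor (pr1 A B)" "is_functor (pr2 A B)"
proof -
  interpret A: category A by fact
  interpret B: category B by fact
  show "is_functor (pr1 A B)" "is_functor (pr2 A B)"
    unfolding pr1_def pr2_def
    by (rule is_functor_mk_fun;
        use assms in \<open>auto simp: prod_cat_simps(1)[of A B] prod_cat_simps(2)[of A B]
          intro: category_prod_cat\<close>)+
qed

lemma assoc_fun_simps [simp]:
  "Src (assoc_fun A B C) = (A \<otimes>\<^sub>c B) \<otimes>\<^sub>c C" "Tgt (assoc_fun A B C) = A \<otimes>\<^sub>c (B \<otimes>\<^sub>c C)"
  "a \<in> Ob A \<Longrightarrow> b \<in> Ob B \<Longrightarrow> c \<in> Ob C \<Longrightarrow>
    FO (assoc_fun A B C) (Pair_el (Pair_el a b) c) = Pair_el a (Pair_el b c)"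
  "f \<in> Arr A \<Longrightarrow> g \<in> Arr B \<Longrightarrow> h \<in> Arr C \<Longrightarrow>
    FA (assoc_fun A B C) (Pair_el (Pair_el f g) h) = Pair_el f (Pair_el g h)"
  by (simp_all add: assoc_fun_def Let_def)

lemma mid_swap_simps [simp]:
  "Src (mid_swap A B C D) = (A \<otimes>\<^sub>c B) \<otimes>\<^sub>c (C \<otimes>\<^sub>c D)"
  "Tgt (mid_swap A B C D) = (A \<otimes>\<^sub>c C) \<otimes>\<^sub>c (B \<otimes>\<^sub>c D)"
  "a \<in> Ob A \<Longrightarrow> b \<in> Ob B \<Longrightarrow> c \<in> Ob C \<Longrightarrow> d \<in> Ob D \<Longrightarrow>
    FO (mid_swap A B C D) (Pair_el (Pair_el a b) (Pair_el c d)) = Pair_el (Pair_el a c) (Pair_el b d)"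
  "f \<in> Arr A \<Longrightarrow> g \<in> Arr B \<Longrightarrow> h \<in> Arr C \<Longrightarrow> k \<in> Arr D \<Longrightarrow>
    FA (mid_swap A B C D) (Pair_el (Pair_el f g) (Pair_el h k)) = Pair_el (Pair_el f h) (Pair_el g k)"
  by (simp_all add: mid_swap_def Let_def)

lemma is_functor_assoc_fun:
  assumes "category A" "category B" "category C"
  shows "is_functor (assoc_fun A B C)"
proof -
  interpret A: category A by fact
  interpret B: category B by fact
  interpret C: category C by fact
  show ?thesis
    unfolding assoc_fun_def Let_def
    by (rule is_functor_mk_fun)
      (use assms in \<open>auto simp: prod_cat_simps(1)[of "A \<otimes>\<^sub>c B" C] prod_cat_simps(2)[of "A \<otimes>\<^sub>c B" C]
         prod_cat_simps(1)[of A B] prod_cat_simps(2)[of A B] intro: category_prod_cat\<close>)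
qed

lemma is_functor_mid_swap:
  assumes "category A" "category B" "category C" "category D"
  shows "is_functor (mid_swap A B C D)"
proof -
  interpret A: category A by fact
  interpret B: category B by fact
  interpret C: category C by fact
  interpret D: category D by fact
  show ?thesis
    unfolding mid_swap_def Let_def
    by (rule is_functor_mk_fun)
      (use assms in \<open>auto simp: prod_cat_simps(1)[of "A \<otimes>\<^sub>c B" "C \<otimes>\<^sub>c D"]
         prod_cat_simps(2)[of "A \<otimes>\<^sub>c B" "C \<otimes>\<^sub>c D"] prod_cat_simps(1)[of A B] prod_cat_simps(2)[of A B]
         prod_cat_simps(1)[of C D] prod_cat_simps(2)[of C D] intro: category_prod_cat\<close>)
qed

lemma N_pt_simps [simp]: "Src N_pt = \<^bold>e" "Tgt N_pt = \<^bold>N" "FO N_pt (Nat_el 0) = Nat_el 0"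
  "FA N_pt (Nat_el 0) = Nat_el 0"
  by (simp_all add: N_pt_def)

lemma N_plus_simps [simp]: "Src N_plus = \<^bold>N \<otimes>\<^sub>c \<^bold>N" "Tgt N_plus = \<^bold>N"
  "FO N_plus (Pair_el (Nat_el 0) (Nat_el 0)) = Nat_el 0"
  "FA N_plus (Pair_el (Nat_el m) (Nat_el n)) = Nat_el (m + n)"
  by (simp_all add: N_plus_def)

lemma is_functor_N_pt: "is_functor N_pt"
  unfolding N_pt_def by (rule is_functor_mk_fun) (auto intro: category_pt_cat category_N_cat)

lemma is_functor_N_plus: "is_functor N_plus"
  unfolding N_plus_def
  by (rule is_functor_mk_fun)
    (auto intro: category_prod_cat category_N_cat simp: prod_cat_simps)

section \<open>Small categories and the functors of the affine line\<close>

locale size_universe =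
  fixes S :: "'a elem set set"
  assumes size: "size_class S"
begin

lemma small_image: "X \<in> S \<Longrightarrow> Y \<subseteq> f ` X \<Longrightarrow> Y \<in> S"
  using size unfolding size_class_def by blast

lemma small_pairs: "X \<in> S \<Longrightarrow> Y \<in> S \<Longrightarrow> {Pair_el x y |x y. x \<in> X \<and> y \<in> Y} \<in> S"
  using size unfolding size_class_def by blast

lemma small_range_Nat: "range Nat_el \<in> S"
  using size unfolding size_class_def by blast

lemma small_funI:
  "is_functor u \<Longrightarrow> small_cat S (Src u) \<Longrightarrow> small_cat S (Tgt u) \<Longrightarrow> small_fun S u"
  by (simp add: small_fun_def)

lemma small_fun_functor: "small_fun S u \<Longrightarrow> is_functor u"
  by (simp add: small_fun_def)

lemma small_fun_cat [simp]: "small_fun S u \<Longrightarrow> small_cat S (Src u)"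
  "small_fun S u \<Longrightarrow> small_cat S (Tgt u)"
  by (simp_all add: small_fun_def)

lemma small_cat_category: "small_cat S A \<Longrightarrow> category A"
  by (simp add: small_cat_def)

lemma small_fun_simps [simp]:
  assumes "small_fun S u"
  shows "a \<in> Ob (Src u) \<Longrightarrow> FO u a \<in> Ob (Tgt u)"
    "f \<in> Arr (Src u) \<Longrightarrow> FA u f \<in> Arr (Tgt u)"
    "f \<in> Arr (Src u) \<Longrightarrow> Dom (Tgt u) (FA u f) = FO u (Dom (Src u) f)"
    "f \<in> Arr (Src u) \<Longrightarrow> Cod (Tgt u) (FA u f) = FO u (Cod (Src u) f)"
    "a \<in> Ob (Src u) \<Longrightarrow> FA u (Idn (Src u) a) = Idn (Tgt u) (FO u a)"
  using small_fun_functor[OF assms]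
  by (simp_all add: is_functor.obj_in is_functor.FA_simps is_functor.pres_id)

lemma small_cat_dom_cod [simp]:
  "small_cat S A \<Longrightarrow> f \<in> Arr A \<Longrightarrow> Dom A f \<in> Ob A"
  "small_cat S A \<Longrightarrow> f \<in> Arr A \<Longrightarrow> Cod A f \<in> Ob A"
  "small_cat S A \<Longrightarrow> a \<in> Ob A \<Longrightarrow> Idn A a \<in> Arr A"
  "small_cat S A \<Longrightarrow> a \<in> Ob A \<Longrightarrow> Dom A (Idn A a) = a"
  "small_cat S A \<Longrightarrow> a \<in> Ob A \<Longrightarrow> Cod A (Idn A a) = a"
  "small_cat S A \<Longrightarrow> f \<in> Arr A \<Longrightarrow> Cod A f = b \<Longrightarrow> Idn A b \<cdot>\<^bsub>A\<^esub> f = f"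
  "small_cat S A \<Longrightarrow> f \<in> Arr A \<Longrightarrow> Dom A f = b \<Longrightarrow> f \<cdot>\<^bsub>A\<^esub> Idn A b = f"
  by (simp_all add: small_cat_category category.dom_in category.cod_in category.Idn_simps
    category.Idn_left category.Idn_right)

lemma small_pt_cat [simp]: "small_cat S \<^bold>e"
  using small_image[OF small_range_Nat, of "{Nat_el 0}" id]
  by (simp add: small_cat_def category_pt_cat)

lemma small_N_cat [simp]: "small_cat S \<^bold>N"
  using small_image[OF small_range_Nat, of "{Nat_el 0}" id] small_range_Nat
  by (simp add: small_cat_def category_N_cat)

lemma small_prod_cat [simp]: "small_cat S A \<Longrightarrow> small_cat S B \<Longrightarrow> small_cat S (A \<otimes>\<^sub>c B)"
  unfolding small_cat_def prod_cat_simps by (simp add: category_prod_cat small_pairs)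

lemma small_id_fun [simp]: "small_cat S A \<Longrightarrow> small_fun S (id_fun A)"
  by (rule small_funI) (simp_all add: small_cat_category is_functor_id_fun)

lemma small_comp_fun [simp]: "small_fun S u \<Longrightarrow> small_fun S v \<Longrightarrow> Tgt u = Src v \<Longrightarrow> small_fun S (v \<odot> u)"
  by (rule small_funI) (simp_all add: small_fun_functor is_functor_comp_fun)

lemma small_prod_fun [simp]: "small_fun S u \<Longrightarrow> small_fun S v \<Longrightarrow> small_fun S (u \<otimes>\<^sub>f v)"
  by (rule small_funI) (simp_all add: small_fun_functor is_functor_prod_fun)

lemma small_pr [simp]:
  "small_cat S A \<Longrightarrow> small_cat S B \<Longrightarrow> small_fun S (pr1 A B)"
  "small_cat S A \<Longrightarrow> small_cat S B \<Longrightarrow> small_fun S (pr2 A B)"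
  by (rule small_funI; simp add: small_cat_category is_functor_pr)+

lemma small_assoc_fun [simp]:
  "small_cat S A \<Longrightarrow> small_cat S B \<Longrightarrow> small_cat S C \<Longrightarrow> small_fun S (assoc_fun A B C)"
  by (rule small_funI) (simp_all add: small_cat_category is_functor_assoc_fun)

lemma small_mid_swap [simp]:
  "small_cat S A \<Longrightarrow> small_cat S B \<Longrightarrow> small_cat S C \<Longrightarrow> small_cat S D \<Longrightarrow>
   small_fun S (mid_swap A B C D)"
  by (rule small_funI) (simp_all add: small_cat_category is_functor_mid_swap)

lemma small_N_pt [simp]: "small_fun S N_pt"
  by (rule small_funI) (simp_all add: is_functor_N_pt)

lemma small_N_plus [simp]: "small_fun S N_plus"
  by (rule small_funI) (simp_all add: is_functor_N_plus)

text \<open>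
  The equations between functors built from products, projections and \<open>+\<close> that are used below
  are all verified elementwise through this lemma.
\<close>

lemma small_fun_eqI:
  assumes "small_fun S F" "small_fun S G" "Src F = Src G" "Tgt F = Tgt G"
    and "\<And>a. a \<in> Ob (Src G) \<Longrightarrow> FO F a = FO G a" "\<And>f. f \<in> Arr (Src G) \<Longrightarrow> FA F f = FA G f"
  shows "F = G"
  by (rule functor_eqI) (use assms in \<open>simp_all add: small_fun_functor\<close>)

lemma small_comp_assoc:
  "small_fun S F \<Longrightarrow> Tgt F = Src G \<Longrightarrow> (H \<odot> G) \<odot> F = H \<odot> (G \<odot> F)"
  by (simp add: comp_fun_assoc small_fun_functor)

lemma small_comp_id [simp]:
  "small_fun S F \<Longrightarrow> Tgt F = B \<Longrightarrow> id_fun B \<odot> F = F"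
  "small_fun S F \<Longrightarrow> Src F = A \<Longrightarrow> F \<odot> id_fun A = F"
  by (simp_all add: small_fun_functor)

lemma prod_fun_comp [simp]:
  assumes "small_fun S u" "small_fun S v" "small_fun S u'" "small_fun S v'"
    and "Tgt u = Src u'" "Tgt v = Src v'"
  shows "(u' \<otimes>\<^sub>f v') \<odot> (u \<otimes>\<^sub>f v) = (u' \<odot> u) \<otimes>\<^sub>f (v' \<odot> v)"
  using assms small_fun_simps[of u] small_fun_simps[of v]
  by (intro small_fun_eqI) (auto simp: prod_cat_simps)

lemma prod_fun_id [simp]:
  "small_cat S A \<Longrightarrow> small_cat S B \<Longrightarrow> id_fun A \<otimes>\<^sub>f id_fun B = id_fun (A \<otimes>\<^sub>c B)"
  by (intro small_fun_eqI) (auto simp: prod_cat_simps)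

lemma pr_prod_fun:
  assumes "small_fun S u" "small_fun S v" "A = Tgt u" "B = Tgt v"
  shows "pr1 A B \<odot> (u \<otimes>\<^sub>f v) = u \<odot> pr1 (Src u) (Src v)"
    and "pr2 A B \<odot> (u \<otimes>\<^sub>f v) = v \<odot> pr2 (Src u) (Src v)"
  by (rule small_fun_eqI; use assms in \<open>auto simp: prod_cat_simps\<close>)+

lemma pr_assoc_fun:
  assumes "small_cat S A" "small_cat S B" "small_cat S C"
  shows "pr1 A (B \<otimes>\<^sub>c C) \<odot> assoc_fun A B C = pr1 A B \<odot> pr1 (A \<otimes>\<^sub>c B) C"
    "pr1 B C \<odot> pr2 A (B \<otimes>\<^sub>c C) \<odot> assoc_fun A B C = pr2 A B \<odot> pr1 (A \<otimes>\<^sub>c B) C"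
    "pr2 B C \<odot> pr2 A (B \<otimes>\<^sub>c C) \<odot> assoc_fun A B C = pr2 (A \<otimes>\<^sub>c B) C"
  by (rule small_fun_eqI; use assms in \<open>auto simp: prod_cat_simps\<close>)+

lemma assoc_fun_natural:
  assumes "small_fun S u" "small_fun S v" "small_fun S w"
  shows "assoc_fun (Tgt u) (Tgt v) (Tgt w) \<odot> ((u \<otimes>\<^sub>f v) \<otimes>\<^sub>f w)
    = (u \<otimes>\<^sub>f (v \<otimes>\<^sub>f w)) \<odot> assoc_fun (Src u) (Src v) (Src w)"
  using assms by (intro small_fun_eqI) (auto simp: prod_cat_simps)

lemma mid_swap_mid_swap:
  assumes "small_cat S A" "small_cat S B" "small_cat S C" "small_cat S D"
  shows "mid_swap A C B D \<odot> mid_swap A B C D = id_fun ((A \<otimes>\<^sub>c B) \<otimes>\<^sub>c (C \<otimes>\<^sub>c D))"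
  using assms by (intro small_fun_eqI) (auto simp: prod_cat_simps)

lemma line_plus_simps [simp]:
  "Src (line_plus I J) = (\<^bold>N \<otimes>\<^sub>c I) \<otimes>\<^sub>c (\<^bold>N \<otimes>\<^sub>c J)" "Tgt (line_plus I J) = \<^bold>N \<otimes>\<^sub>c (I \<otimes>\<^sub>c J)"
  "a \<in> Ob I \<Longrightarrow> b \<in> Ob J \<Longrightarrow>
    FO (line_plus I J) (Pair_el (Pair_el (Nat_el 0) a) (Pair_el (Nat_el 0) b))
    = Pair_el (Nat_el 0) (Pair_el a b)"
  "f \<in> Arr I \<Longrightarrow> g \<in> Arr J \<Longrightarrow>
    FA (line_plus I J) (Pair_el (Pair_el (Nat_el m) f) (Pair_el (Nat_el n) g))
    = Pair_el (Nat_el (m + n)) (Pair_el f g)"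
  by (simp_all add: line_plus_def)

lemma small_line_plus [simp]:
  "small_cat S I \<Longrightarrow> small_cat S J \<Longrightarrow> small_fun S (line_plus I J)"
  by (simp add: line_plus_def)

lemma line_plus_natural:
  assumes "small_fun S u" "small_fun S v"
  shows "line_plus (Tgt u) (Tgt v) \<odot> ((id_fun \<^bold>N \<otimes>\<^sub>f u) \<otimes>\<^sub>f (id_fun \<^bold>N \<otimes>\<^sub>f v))
    = (id_fun \<^bold>N \<otimes>\<^sub>f (u \<otimes>\<^sub>f v)) \<odot> line_plus (Src u) (Src v)"
  using assms by (intro small_fun_eqI) (auto simp: prod_cat_simps)

text \<open>
  This is associativity of addition on \<open>\<^bold>N\<close>, in the form in which two successive products of the
  affine line meet it.
\<close>

lemma line_plus_assoc:
  assumes "small_cat S A" "small_cat S B" "small_cat S C"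
  shows "(id_fun \<^bold>N \<otimes>\<^sub>f assoc_fun A B C)
      \<odot> line_plus (A \<otimes>\<^sub>c B) C \<odot> (line_plus A B \<otimes>\<^sub>f id_fun (\<^bold>N \<otimes>\<^sub>c C))
    = line_plus A (B \<otimes>\<^sub>c C) \<odot> (id_fun (\<^bold>N \<otimes>\<^sub>c A) \<otimes>\<^sub>f line_plus B C)
      \<odot> assoc_fun (\<^bold>N \<otimes>\<^sub>c A) (\<^bold>N \<otimes>\<^sub>c B) (\<^bold>N \<otimes>\<^sub>c C)"
  using assms by (intro small_fun_eqI) (auto simp: prod_cat_simps)

text \<open>
  The inverse of the isomorphism \<open>pr2 \<^bold>e I\<close>. It removes the factor \<open>\<^bold>e\<close> from the universal arrow of
  \<open>i\<^sub>!\<close>, which lives over \<open>i \<times> 1: \<^bold>e \<times> I \<rightarrow> \<^bold>N \<times> I\<close>; what remains lies over \<open>line_pt I: I \<rightarrow> \<^bold>N \<times> I\<close>.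
\<close>

definition pt_sec :: "'a scat \<Rightarrow> 'a sfun" where
  "pt_sec I = mk_fun I (\<^bold>e \<otimes>\<^sub>c I) (Pair_el (Nat_el 0)) (Pair_el (Nat_el 0))"

definition line_pt :: "'a scat \<Rightarrow> 'a sfun" where
  "line_pt I = (N_pt \<otimes>\<^sub>f id_fun I) \<odot> pt_sec I"

lemma pt_sec_simps [simp]: "Src (pt_sec I) = I" "Tgt (pt_sec I) = \<^bold>e \<otimes>\<^sub>c I"
  "a \<in> Ob I \<Longrightarrow> FO (pt_sec I) a = Pair_el (Nat_el 0) a"
  "f \<in> Arr I \<Longrightarrow> FA (pt_sec I) f = Pair_el (Nat_el 0) f"
  by (simp_all add: pt_sec_def)

lemma small_pt_sec [simp]: "small_cat S I \<Longrightarrow> small_fun S (pt_sec I)"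
  by (rule small_funI)
    (auto simp: pt_sec_def intro!: is_functor_mk_fun category_prod_cat category_pt_cat
      small_cat_category)

lemma line_pt_simps [simp]: "Src (line_pt I) = I" "Tgt (line_pt I) = \<^bold>N \<otimes>\<^sub>c I"
  "a \<in> Ob I \<Longrightarrow> FO (line_pt I) a = Pair_el (Nat_el 0) a"
  "f \<in> Arr I \<Longrightarrow> FA (line_pt I) f = Pair_el (Nat_el 0) f"
  by (simp_all add: line_pt_def)

lemma small_line_pt [simp]: "small_cat S I \<Longrightarrow> small_fun S (line_pt I)"
  by (simp add: line_pt_def)

lemma pt_sec_inverse:
  assumes "small_cat S I"
  shows "pt_sec I \<odot> pr2 \<^bold>e I = id_fun (\<^bold>e \<otimes>\<^sub>c I)" "pr2 \<^bold>e I \<odot> pt_sec I = id_fun I"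
  by (rule small_fun_eqI; use assms in \<open>auto simp: prod_cat_simps\<close>)+

lemma line_pt_pr2: "small_cat S I \<Longrightarrow> line_pt I \<odot> pr2 \<^bold>e I = N_pt \<otimes>\<^sub>f id_fun I"
  by (intro small_fun_eqI) (auto simp: prod_cat_simps)

lemma line_pt_natural: "small_fun S u \<Longrightarrow> (id_fun \<^bold>N \<otimes>\<^sub>f u) \<odot> line_pt (Src u) = line_pt (Tgt u) \<odot> u"
  by (intro small_fun_eqI) (auto simp: prod_cat_simps)

text \<open>
  The equation \<open>0 + 0 = 0\<close>: this is why \<open>i\<^sub>! X \<boxtimes>\<^sub>A\<^sub>1 i\<^sub>! Y\<close> and \<open>i\<^sub>! (X \<boxtimes> Y)\<close> are Kan extensions along the
  same functor.
\<close>

lemma line_plus_line_pt: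
  assumes "small_cat S I" "small_cat S J"
  shows "line_plus I J \<odot> (line_pt I \<otimes>\<^sub>f line_pt J) = line_pt (I \<otimes>\<^sub>c J)"
  using assms by (intro small_fun_eqI) (auto simp: prod_cat_simps)

text \<open>
  Neutrality of \<open>0\<close> for addition. The factors \<open>pr2 \<^bold>e \<^bold>e\<close> come from the unit of the affine line, whose
  universal arrow starts over \<open>\<^bold>e \<times> \<^bold>e\<close> rather than over \<open>\<^bold>e\<close>.
\<close>

lemma line_plus_unit:
  assumes "small_cat S A"
  shows "(id_fun \<^bold>N \<otimes>\<^sub>f pr2 \<^bold>e A) \<odot> line_plus \<^bold>e A \<odot> ((N_pt \<otimes>\<^sub>f id_fun \<^bold>e) \<otimes>\<^sub>f id_fun (\<^bold>N \<otimes>\<^sub>c A))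
      = pr2 \<^bold>e (\<^bold>N \<otimes>\<^sub>c A) \<odot> (pr2 \<^bold>e \<^bold>e \<otimes>\<^sub>f id_fun (\<^bold>N \<otimes>\<^sub>c A))"
    "(id_fun \<^bold>N \<otimes>\<^sub>f pr1 A \<^bold>e) \<odot> line_plus A \<^bold>e \<odot> (id_fun (\<^bold>N \<otimes>\<^sub>c A) \<otimes>\<^sub>f (N_pt \<otimes>\<^sub>f id_fun \<^bold>e))
      = pr1 (\<^bold>N \<otimes>\<^sub>c A) \<^bold>e \<odot> (id_fun (\<^bold>N \<otimes>\<^sub>c A) \<otimes>\<^sub>f pr2 \<^bold>e \<^bold>e)"
  by (rule small_fun_eqI; use assms in \<open>auto simp: prod_cat_simps\<close>)+

end

section \<open>The total category of a prederivator\<close>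

text \<open>
  An arrow \<open>(A, X) \<rightarrow> (B, Y)\<close> of the total category is a functor \<open>u: A \<rightarrow> B\<close> together with
  \<open>f: X \<rightarrow> u\<^sup>* Y\<close> in \<open>D(A)\<close>. The target object \<open>Y\<close> cannot be recovered from \<open>u\<^sup>* Y\<close> and is recorded; the source
  object is the domain of \<open>f\<close>. \<open>No_arr\<close> absorbs composites that do not match, which makes composition
  associative without any side condition, so that long composites can be rearranged by rewriting.
\<close>

datatype ('a, 'o, 'm) over_arr = No_arr | Over (base: "'a sfun") (fib: 'm) (tgt: 'o)

locale small_prederivator = size_universe S + prederivator S D
  for S :: "'a elem set set" and D :: "('a, 'o, 'm, 'z) drv_data_scheme"
begin

lemma D_cat [simp]:
  assumes "small_cat S A"
  shows "f \<in> Arr (DCat D A) \<Longrightarrow> Dom (DCat D A) f \<in> Ob (DCat D A)"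
    "f \<in> Arr (DCat D A) \<Longrightarrow> Cod (DCat D A) f \<in> Ob (DCat D A)"
    "X \<in> Ob (DCat D A) \<Longrightarrow> Idn (DCat D A) X \<in> Arr (DCat D A)"
    "X \<in> Ob (DCat D A) \<Longrightarrow> Dom (DCat D A) (Idn (DCat D A) X) = X"
    "X \<in> Ob (DCat D A) \<Longrightarrow> Cod (DCat D A) (Idn (DCat D A) X) = X"
    "f \<in> Arr (DCat D A) \<Longrightarrow> Cod (DCat D A) f = X \<Longrightarrow> Idn (DCat D A) X \<cdot>\<^bsub>DCat D A\<^esub> f = f"
    "f \<in> Arr (DCat D A) \<Longrightarrow> Dom (DCat D A) f = X \<Longrightarrow> f \<cdot>\<^bsub>DCat D A\<^esub> Idn (DCat D A) X = f"
  using cat[OF assms]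
  by (simp_all add: category.dom_in category.cod_in category.Idn_simps category.Idn_left
      category.Idn_right)

lemma D_comp [simp]:
  assumes "small_cat S A" "f \<in> Arr (DCat D A)" "g \<in> Arr (DCat D A)"
    "Cod (DCat D A) f = Dom (DCat D A) g"
  shows "g \<cdot>\<^bsub>DCat D A\<^esub> f \<in> Arr (DCat D A)"
    "Dom (DCat D A) (g \<cdot>\<^bsub>DCat D A\<^esub> f) = Dom (DCat D A) f"
    "Cod (DCat D A) (g \<cdot>\<^bsub>DCat D A\<^esub> f) = Cod (DCat D A) g"
  using assms cat[OF assms(1)] by (simp_all add: category.Cmp_simps)

lemma D_assoc:
  assumes "small_cat S A" "f \<in> Arr (DCat D A)" "g \<in> Arr (DCat D A)" "h \<in> Arr (DCat D A)"
    "Cod (DCat D A) f = Dom (DCat D A) g" "Cod (DCat D A) g = Dom (DCat D A) h"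
  shows "(h \<cdot>\<^bsub>DCat D A\<^esub> g) \<cdot>\<^bsub>DCat D A\<^esub> f = h \<cdot>\<^bsub>DCat D A\<^esub> (g \<cdot>\<^bsub>DCat D A\<^esub> f)"
  using assms cat[OF assms(1)] by (simp add: category.Cmp_assoc)

lemma D_res [simp]:
  assumes "small_fun S u"
  shows "X \<in> Ob (DCat D (Tgt u)) \<Longrightarrow> reO D u X \<in> Ob (DCat D (Src u))"
    "f \<in> Arr (DCat D (Tgt u)) \<Longrightarrow> reA D u f \<in> Arr (DCat D (Src u))"
    "f \<in> Arr (DCat D (Tgt u)) \<Longrightarrow> Dom (DCat D (Src u)) (reA D u f) = reO D u (Dom (DCat D (Tgt u)) f)"
    "f \<in> Arr (DCat D (Tgt u)) \<Longrightarrow> Cod (DCat D (Src u)) (reA D u f) = reO D u (Cod (DCat D (Tgt u)) f)"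
    "X \<in> Ob (DCat D (Tgt u)) \<Longrightarrow> reA D u (Idn (DCat D (Tgt u)) X) = Idn (DCat D (Src u)) (reO D u X)"
    "\<lbrakk>f \<in> Arr (DCat D (Tgt u)); g \<in> Arr (DCat D (Tgt u)); Cod (DCat D (Tgt u)) f = Dom (DCat D (Tgt u)) g\<rbrakk>
      \<Longrightarrow> reA D u (g \<cdot>\<^bsub>DCat D (Tgt u)\<^esub> f) = reA D u g \<cdot>\<^bsub>DCat D (Src u)\<^esub> reA D u f"
proof -
  have u: "Src (DFun D u) = DCat D (Tgt u)" "Tgt (DFun D u) = DCat D (Src u)"
    using "fun"[OF assms] by auto
  interpret u: is_functor "DFun D u" using "fun"[OF assms] by auto
  note r = u.obj_in u.FA_simps u.pres_id u.FA_comp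
  show "X \<in> Ob (DCat D (Tgt u)) \<Longrightarrow> reO D u X \<in> Ob (DCat D (Src u))"
    "f \<in> Arr (DCat D (Tgt u)) \<Longrightarrow> reA D u f \<in> Arr (DCat D (Src u))"
    "f \<in> Arr (DCat D (Tgt u)) \<Longrightarrow> Dom (DCat D (Src u)) (reA D u f) = reO D u (Dom (DCat D (Tgt u)) f)"
    "f \<in> Arr (DCat D (Tgt u)) \<Longrightarrow> Cod (DCat D (Src u)) (reA D u f) = reO D u (Cod (DCat D (Tgt u)) f)"
    "X \<in> Ob (DCat D (Tgt u)) \<Longrightarrow> reA D u (Idn (DCat D (Tgt u)) X) = Idn (DCat D (Src u)) (reO D u X)"
    "\<lbrakk>f \<in> Arr (DCat D (Tgt u)); g \<in> Arr (DCat D (Tgt u)); Cod (DCat D (Tgt u)) f = Dom (DCat D (Tgt u)) g\<rbrakk>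
      \<Longrightarrow> reA D u (g \<cdot>\<^bsub>DCat D (Tgt u)\<^esub> f) = reA D u g \<cdot>\<^bsub>DCat D (Src u)\<^esub> reA D u f"
    using r by (simp_all add: u)
qed

lemma D_res_id [simp]:
  "small_cat S A \<Longrightarrow> X \<in> Ob (DCat D A) \<Longrightarrow> reO D (id_fun A) X = X"
  "small_cat S A \<Longrightarrow> f \<in> Arr (DCat D A) \<Longrightarrow> reA D (id_fun A) f = f"
  by (simp_all add: fun_id)

lemma D_res_comp [simp]:
  assumes "small_fun S u" "small_fun S v" "Tgt u = Src v"
  shows "X \<in> Ob (DCat D (Tgt v)) \<Longrightarrow> reO D (v \<odot> u) X = reO D u (reO D v X)"
    "f \<in> Arr (DCat D (Tgt v)) \<Longrightarrow> reA D (v \<odot> u) f = reA D u (reA D v f)"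
  using "fun"[OF assms(2)] by (simp_all add: fun_comp[OF assms])

definition arr :: "('a, 'o, 'm) over_arr \<Rightarrow> bool" where
  "arr t \<longleftrightarrow> (case t of No_arr \<Rightarrow> False | Over u f Y \<Rightarrow> small_fun S u \<and> Y \<in> Ob (DCat D (Tgt u))
     \<and> f \<in> Arr (DCat D (Src u)) \<and> Cod (DCat D (Src u)) f = reO D u Y)"

definition dm :: "('a, 'o, 'm) over_arr \<Rightarrow> 'a scat \<times> 'o" where
  "dm t = (Src (base t), Dom (DCat D (Src (base t))) (fib t))"

definition cd :: "('a, 'o, 'm) over_arr \<Rightarrow> 'a scat \<times> 'o" where
  "cd t = (Tgt (base t), tgt t)"

definition cmp :: "('a, 'o, 'm) over_arr \<Rightarrow> ('a, 'o, 'm) over_arr \<Rightarrow> ('a, 'o, 'm) over_arr"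
    (infixr "\<star>" 70) where
  "t \<star> s = (if arr s \<and> arr t \<and> cd s = dm t then
     Over (base t \<odot> base s) (reA D (base s) (fib t) \<cdot>\<^bsub>DCat D (Src (base s))\<^esub> fib s) (tgt t)
     else No_arr)"

definition ide :: "'a scat \<times> 'o \<Rightarrow> ('a, 'o, 'm) over_arr" where
  "ide P = Over (id_fun (fst P)) (Idn (DCat D (fst P)) (snd P)) (snd P)"

definition ob :: "'a scat \<times> 'o \<Rightarrow> bool" where
  "ob P \<longleftrightarrow> small_cat S (fst P) \<and> snd P \<in> Ob (DCat D (fst P))"

text \<open>
  The arrows over identity functors are those of the fibres \<open>D(A)\<close>, and \<open>cart u Y: (A, u\<^sup>* Y) \<rightarrow> (B, Y)\<close>
  is the cartesian lift of \<open>u\<close>. Every arrow is a vertical one followed by a cartesian one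
  (\<open>Over_eq_cart_vert\<close>).
\<close>

definition vert :: "'a scat \<Rightarrow> 'm \<Rightarrow> ('a, 'o, 'm) over_arr" where
  "vert A f = Over (id_fun A) f (Cod (DCat D A) f)"

definition cart :: "'a sfun \<Rightarrow> 'o \<Rightarrow> ('a, 'o, 'm) over_arr" where
  "cart u Y = Over u (Idn (DCat D (Src u)) (reO D u Y)) Y"

lemma ob_Pair [simp]: "ob (A, X) \<longleftrightarrow> small_cat S A \<and> X \<in> Ob (DCat D A)"
  by (simp add: ob_def)

lemma arr_No [simp]: "\<not> arr No_arr"
  by (simp add: arr_def)

lemma arr_Over [simp]: "arr (Over u f Y) \<longleftrightarrow> small_fun S u \<and> Y \<in> Ob (DCat D (Tgt u))
     \<and> f \<in> Arr (DCat D (Src u)) \<and> Cod (DCat D (Src u)) f = reO D u Y"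
  by (simp add: arr_def)

lemma dm_Over [simp]: "dm (Over u f Y) = (Src u, Dom (DCat D (Src u)) f)"
  by (simp add: dm_def)

lemma cd_Over [simp]: "cd (Over u f Y) = (Tgt u, Y)"
  by (simp add: cd_def)

lemma arrE:
  assumes "arr t"
  obtains u f Y where "t = Over u f Y" "small_fun S u" "Y \<in> Ob (DCat D (Tgt u))"
    "f \<in> Arr (DCat D (Src u))" "Cod (DCat D (Src u)) f = reO D u Y"
  using assms by (cases t) auto

lemma arr_base [simp]: "arr t \<Longrightarrow> small_fun S (base t)"
  by (auto elim: arrE)

lemma arr_ob [simp]: "arr t \<Longrightarrow> ob (dm t)" "arr t \<Longrightarrow> ob (cd t)"
  by (auto elim: arrE)

lemma fst_dm_cd [simp]: "fst (dm t) = Src (base t)" "fst (cd t) = Tgt (base t)"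
  by (simp_all add: dm_def cd_def)

lemma arr_cmp [simp]:
  assumes "arr s" "arr t" "cd s = dm t"
  shows "arr (t \<star> s)" "dm (t \<star> s) = dm s" "cd (t \<star> s) = cd t" "base (t \<star> s) = base t \<odot> base s"
proof -
  obtain u f Y where s: "s = Over u f Y" "small_fun S u" "Y \<in> Ob (DCat D (Tgt u))"
    "f \<in> Arr (DCat D (Src u))" "Cod (DCat D (Src u)) f = reO D u Y" using assms by (blast elim: arrE)
  obtain v g Z where t: "t = Over v g Z" "small_fun S v" "Z \<in> Ob (DCat D (Tgt v))"
    "g \<in> Arr (DCat D (Src v))" "Cod (DCat D (Src v)) g = reO D v Z" using assms by (blast elim: arrE)
  have "Tgt u = Src v" "Y = Dom (DCat D (Src v)) g" using assms s t by auto
  moreover have "reA D u g \<in> Arr (DCat D (Src u))" "Dom (DCat D (Src u)) (reA D u g) = reO D u Y"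
     "Cod (DCat D (Src u)) (reA D u g) = reO D u (reO D v Z)"
    using D_res(2-4)[OF s(2), of g] calculation t by auto
  ultimately show "arr (t \<star> s)" "dm (t \<star> s) = dm s" "cd (t \<star> s) = cd t"
    "base (t \<star> s) = base t \<odot> base s"
    using s t by (simp_all add: cmp_def)
qed

lemma arr_cmpD: "arr (t \<star> s) \<Longrightarrow> arr s \<and> arr t \<and> cd s = dm t"
  by (auto simp: cmp_def split: if_splits)

lemma cmp_No [simp]: "No_arr \<star> s = No_arr" "t \<star> No_arr = No_arr"
  by (simp_all add: cmp_def)

lemma not_arr_cmp: "\<not> (arr s \<and> arr t \<and> cd s = dm t) \<Longrightarrow> t \<star> s = No_arr"
  by (auto simp: cmp_def)

lemma cmp_assoc: "(r \<star> t) \<star> s = r \<star> (t \<star> s)"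
proof (cases "arr s \<and> arr t \<and> arr r \<and> cd s = dm t \<and> cd t = dm r")
  case False
  then have "(r \<star> t) \<star> s = No_arr"
    using not_arr_cmp[of s "r \<star> t"] arr_cmpD[of r t] arr_cmp[of t r] by metis
  moreover from False have "r \<star> (t \<star> s) = No_arr"
    using not_arr_cmp[of "t \<star> s" r] arr_cmpD[of t s] arr_cmp[of s t] by metis
  ultimately show ?thesis by simp
next
  case True
  obtain u f Y where s: "s = Over u f Y" "small_fun S u" "Y \<in> Ob (DCat D (Tgt u))"
    "f \<in> Arr (DCat D (Src u))" "Cod (DCat D (Src u)) f = reO D u Y" using True by (blast elim: arrE)
  obtain v g Z where t: "t = Over v g Z" "small_fun S v" "Z \<in> Ob (DCat D (Tgt v))"
    "g \<in> Arr (DCat D (Src v))" "Cod (DCat D (Src v)) g = reO D v Z" using True by (blast elim: arrE)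
  obtain w h W where r: "r = Over w h W" "small_fun S w" "W \<in> Ob (DCat D (Tgt w))"
    "h \<in> Arr (DCat D (Src w))" "Cod (DCat D (Src w)) h = reO D w W" using True by (blast elim: arrE)
  have c: "Tgt u = Src v" "Dom (DCat D (Src v)) g = Y" "Tgt v = Src w" "Dom (DCat D (Src w)) h = Z"
    using True s t r by auto
  have 1: "(r \<star> t) \<star> s = Over ((w \<odot> v) \<odot> u)
     (reA D u (reA D v h \<cdot>\<^bsub>DCat D (Src v)\<^esub> g) \<cdot>\<^bsub>DCat D (Src u)\<^esub> f) W"
    using True arr_cmp[of t r] by (simp add: cmp_def[of "r \<star> t" s]) (simp add: cmp_def s t r)
  have 2: "r \<star> (t \<star> s) = Over (w \<odot> (v \<odot> u))
     (reA D (v \<odot> u) h \<cdot>\<^bsub>DCat D (Src u)\<^esub> (reA D u g \<cdot>\<^bsub>DCat D (Src u)\<^esub> f)) W"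
    using True arr_cmp[of s t] by (simp add: cmp_def[of r "t \<star> s"]) (simp add: cmp_def s t r)
  have vh: "reA D v h \<in> Arr (DCat D (Tgt u))" "Dom (DCat D (Tgt u)) (reA D v h) = reO D v Z"
    using D_res(2-4)[OF t(2), of h] c r by auto
  have g: "g \<in> Arr (DCat D (Tgt u))" "Cod (DCat D (Tgt u)) g = reO D v Z" "Dom (DCat D (Tgt u)) g = Y"
    using c t by auto
  have "reA D u (reA D v h \<cdot>\<^bsub>DCat D (Src v)\<^esub> g)
      = reA D u (reA D v h) \<cdot>\<^bsub>DCat D (Src u)\<^esub> reA D u g"
    using D_res(6)[OF s(2) g(1) vh(1)] g vh by (simp add: c)
  moreover have "reA D (v \<odot> u) h = reA D u (reA D v h)"
    using s t r c by simp
  ultimately show ?thesis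
    unfolding 1 2 using s t r c g vh by (simp add: small_comp_assoc D_assoc)
qed

text \<open>
  Applies a known two-factor equation inside a composite that is bracketed to the right.
\<close>

lemma cmp_reassoc: "t \<star> s = r \<Longrightarrow> t \<star> (s \<star> q) = r \<star> q"
  by (simp flip: cmp_assoc)

lemma arr_ide [simp]:
  "ob P \<Longrightarrow> arr (ide P)" "dm (ide P) = P" if "ob P"
  using that by (cases P; simp add: ide_def)+

lemma ide_simps [simp]: "cd (ide P) = P" "base (ide P) = id_fun (fst P)"
  by (simp_all add: ide_def)

lemma cmp_ide [simp]:
  assumes "arr t"
  shows "cd t = P \<Longrightarrow> ide P \<star> t = t" "dm t = P \<Longrightarrow> t \<star> ide P = t"
  using assms by (auto elim!: arrE simp: cmp_def ide_def)

lemma vert_simps [simp]: "base (vert A f) = id_fun A" "cd (vert A f) = (A, Cod (DCat D A) f)"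
  "dm (vert A f) = (A, Dom (DCat D A) f)"
  by (simp_all add: vert_def)

lemma arr_vert [simp]: "small_cat S A \<Longrightarrow> arr (vert A f) \<longleftrightarrow> f \<in> Arr (DCat D A)"
  by (auto simp: vert_def)

lemma vert_comp:
  "\<lbrakk>small_cat S A; f \<in> Arr (DCat D A); g \<in> Arr (DCat D A); Cod (DCat D A) f = Dom (DCat D A) g\<rbrakk>
    \<Longrightarrow> vert A (g \<cdot>\<^bsub>DCat D A\<^esub> f) = vert A g \<star> vert A f"
  by (simp add: cmp_def) (simp add: vert_def)

lemma vert_Idn [simp]: "small_cat S A \<Longrightarrow> X \<in> Ob (DCat D A) \<Longrightarrow> vert A (Idn (DCat D A) X) = ide (A, X)"
  by (simp add: vert_def ide_def)

lemma vert_inject: "vert A f = vert A g \<Longrightarrow> f = g"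
  by (simp add: vert_def)

lemma vertical_is_vert:
  assumes "arr t" "base t = id_fun A"
  shows "t = vert A (fib t)" "fib t \<in> hom (DCat D A) (snd (dm t)) (snd (cd t))"
proof -
  have "small_cat S A" using arr_base[OF assms(1)] small_fun_cat(1)[of "id_fun A"] assms(2) by simp
  then show "t = vert A (fib t)" "fib t \<in> hom (DCat D A) (snd (dm t)) (snd (cd t))"
    using assms by (auto elim!: arrE simp: vert_def hom_def)
qed

lemma cart_simps [simp]: "base (cart u Y) = u" "cd (cart u Y) = (Tgt u, Y)"
  by (simp_all add: cart_def)

lemma arr_cart [simp]: "small_fun S u \<Longrightarrow> Y \<in> Ob (DCat D (Tgt u)) \<Longrightarrow> arr (cart u Y)"
  "small_fun S u \<Longrightarrow> Y \<in> Ob (DCat D (Tgt u)) \<Longrightarrow> dm (cart u Y) = (Src u, reO D u Y)"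
  by (simp_all add: cart_def)

lemma Over_eq_cart_vert:
  assumes "small_fun S u" "Y \<in> Ob (DCat D (Tgt u))" "f \<in> Arr (DCat D (Src u))"
    "Cod (DCat D (Src u)) f = reO D u Y"
  shows "Over u f Y = cart u Y \<star> vert (Src u) f"
  using assms by (simp add: cmp_def) (simp add: cart_def vert_def)

lemma cart_comp:
  assumes "small_fun S u" "small_fun S v" "Tgt u = Src v" "Y \<in> Ob (DCat D (Tgt v))"
  shows "cart v Y \<star> cart u (reO D v Y) = cart (v \<odot> u) Y"
proof -
  have "reO D v Y \<in> Ob (DCat D (Tgt u))" using assms by simp
  moreover from this have "reA D u (Idn (DCat D (Src v)) (reO D v Y)) = Idn (DCat D (Src u)) (reO D u (reO D v Y))"
    using D_res(5)[OF assms(1), of "reO D v Y"] assms by simp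
  ultimately show ?thesis
    using assms by (simp add: cmp_def) (simp add: cart_def)
qed

lemma cart_id [simp]: "small_cat S A \<Longrightarrow> Y \<in> Ob (DCat D A) \<Longrightarrow> cart (id_fun A) Y = ide (A, Y)"
  by (simp add: cart_def ide_def)

lemma Over_comp_vert:
  assumes "small_fun S u" "Y \<in> Ob (DCat D (Tgt u))" "f \<in> Arr (DCat D (Src u))"
    "Cod (DCat D (Src u)) f = reO D u Y" "g \<in> Arr (DCat D (Src u))"
    "Cod (DCat D (Src u)) g = Dom (DCat D (Src u)) f"
  shows "Over u (f \<cdot>\<^bsub>DCat D (Src u)\<^esub> g) Y = Over u f Y \<star> vert (Src u) g"
  using assms by (simp add: cmp_def) (simp add: vert_def)

lemma vert_comp_Over:
  assumes "small_fun S u" "f \<in> Arr (DCat D (Src u))" "g \<in> Arr (DCat D (Tgt u))"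
    "Cod (DCat D (Src u)) f = reO D u (Dom (DCat D (Tgt u)) g)"
  shows "Over u (reA D u g \<cdot>\<^bsub>DCat D (Src u)\<^esub> f) (Cod (DCat D (Tgt u)) g)
    = vert (Tgt u) g \<star> Over u f (Dom (DCat D (Tgt u)) g)"
  using assms by (simp add: cmp_def) (simp add: vert_def)

text \<open>
  Functoriality of \<open>u\<^sup>*\<close> on arrows, expressed as naturality of the cartesian lifts.
\<close>

lemma cart_natural:
  assumes "small_fun S u" "g \<in> Arr (DCat D (Tgt u))"
  shows "cart u (Cod (DCat D (Tgt u)) g) \<star> vert (Src u) (reA D u g)
    = vert (Tgt u) g \<star> cart u (Dom (DCat D (Tgt u)) g)"
  using assms by (simp add: cmp_def) (simp add: vert_def cart_def)

text \<open>
  Together with \<open>cart_lift\<close>, this is the universal property of cartesian arrows, in the strong form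
  in which the arrows to be factored may lie over any functor.
\<close>

lemma cart_cancel:
  assumes "small_fun S u" "Y \<in> Ob (DCat D (Tgt u))" "arr s" "arr t" "base s = base t"
    "cd s = (Src u, reO D u Y)" "cd t = (Src u, reO D u Y)"
    and eq: "cart u Y \<star> s = cart u Y \<star> t"
  shows "s = t"
proof -
  obtain v f Z where s: "s = Over v f Z" "small_fun S v" "Z \<in> Ob (DCat D (Tgt v))"
    "f \<in> Arr (DCat D (Src v))" "Cod (DCat D (Src v)) f = reO D v Z" using assms by (blast elim: arrE)
  obtain v' g Z' where t: "t = Over v' g Z'" "small_fun S v'" "Z' \<in> Ob (DCat D (Tgt v'))"
    "g \<in> Arr (DCat D (Src v'))" "Cod (DCat D (Src v')) g = reO D v' Z'"
    using assms by (blast elim: arrE)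
  have c: "v = v'" "Tgt v' = Src u" "Z = reO D u Y" "Z' = reO D u Y"
    using assms(5-7) unfolding s(1) t(1) by auto
  have "reO D u Y \<in> Ob (DCat D (Tgt v'))" using assms c by simp
  then have i: "reA D v' (Idn (DCat D (Src u)) (reO D u Y)) = Idn (DCat D (Src v')) (reO D v' (reO D u Y))"
    using D_res(5)[OF t(2), of "reO D u Y"] c by simp
  have "fib (cart u Y \<star> s) = f" "fib (cart u Y \<star> t) = g"
    using assms(1-7) s t c i by (simp_all add: cmp_def) (simp_all add: cart_def)
  then have "f = g" using eq by simp
  then show ?thesis using s t c by simp
qed

lemma cart_lift:
  assumes "small_fun S u" "small_fun S v" "Tgt v = Src u" "arr t" "base t = u \<odot> v" "cd t = (Tgt u, Y)"
  obtains s where "arr s" "base s = v" "dm s = dm t" "cd s = (Src u, reO D u Y)" "cart u Y \<star> s = t"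
proof -
  obtain w f Z where t: "t = Over w f Z" "small_fun S w" "Z \<in> Ob (DCat D (Tgt w))"
    "f \<in> Arr (DCat D (Src w))" "Cod (DCat D (Src w)) f = reO D w Z" using assms by (blast elim: arrE)
  have c: "w = u \<odot> v" "Z = Y" "Y \<in> Ob (DCat D (Tgt u))" using assms t by auto
  have rY: "reO D u Y \<in> Ob (DCat D (Tgt v))" using assms c by simp
  then have i: "reA D v (Idn (DCat D (Src u)) (reO D u Y)) = Idn (DCat D (Src v)) (reO D v (reO D u Y))"
    using D_res(5)[OF assms(2), of "reO D u Y"] assms by simp
  let ?s = "Over v f (reO D u Y)"
  have "arr ?s" using t c assms rY by simp
  moreover have "cart u Y \<star> ?s = t"
    using calculation t c assms i by (simp add: cmp_def) (simp add: cart_def)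
  ultimately show ?thesis using that[of ?s] t c assms by simp
qed

section \<open>Cocartesian arrows and Kan extensions\<close>

lemma cd_dm_base:
  "cd s = dm t \<Longrightarrow> Tgt (base s) = Src (base t)"
  "dm s = dm t \<Longrightarrow> Src (base s) = Src (base t)"
  "cd s = cd t \<Longrightarrow> Tgt (base s) = Tgt (base t)"
  "dm t = cd s \<Longrightarrow> Src (base t) = Tgt (base s)"
  "dm t = (A, X) \<Longrightarrow> Src (base t) = A"
  "cd t = (A, X) \<Longrightarrow> Tgt (base t) = A"
  by (simp_all add: dm_def cd_def)

definition invertible :: "('a, 'o, 'm) over_arr \<Rightarrow> bool" where
  "invertible t \<longleftrightarrow> arr t \<and> (\<exists>s. arr s \<and> s \<star> t = ide (dm t) \<and> t \<star> s = ide (cd t))"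

text \<open>
  An arrow \<open>k: (A, X) \<rightarrow> (B, Y)\<close> over \<open>u\<close> is cocartesian when \<open>Y\<close>, with \<open>k\<close>, is a left Kan extension of \<open>X\<close>
  along \<open>u\<close>. The factorisation is required over every \<open>v\<close>, and only arrows of the total category occur in it;
  closure under composition is then immediate.
\<close>

definition cocart :: "('a, 'o, 'm) over_arr \<Rightarrow> bool" where
  "cocart k \<longleftrightarrow> arr k \<and> (\<forall>h v. arr h \<and> dm h = dm k \<and> small_fun S v \<and> Src v = Tgt (base k)
     \<and> base h = v \<odot> base k \<longrightarrow> (\<exists>!g. arr g \<and> base g = v \<and> dm g = cd k \<and> g \<star> k = h))"

lemma cocart_arr [simp]: "cocart k \<Longrightarrow> arr k"
  by (simp add: cocart_def)

lemma invertible_arr [simp]: "invertible k \<Longrightarrow> arr k"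
  by (simp add: invertible_def)

lemma invertibleE:
  assumes "invertible t"
  obtains s where "arr s" "dm s = cd t" "cd s = dm t" "s \<star> t = ide (dm t)" "t \<star> s = ide (cd t)"
    "base s \<odot> base t = id_fun (Src (base t))" "base t \<odot> base s = id_fun (Tgt (base t))"
    "invertible s"
proof -
  obtain s where s: "arr s" "s \<star> t = ide (dm t)" "t \<star> s = ide (cd t)" "arr t"
    using assms unfolding invertible_def by blast
  have "arr (s \<star> t)" "arr (t \<star> s)" unfolding s(2,3) using s(4) by simp_all
  then have c: "cd t = dm s" "cd s = dm t" by (blast dest: arr_cmpD)+
  have "base s \<odot> base t = base (s \<star> t)" "base t \<odot> base s = base (t \<star> s)"
    using s(1,4) c by simp_all
  then have b: "base s \<odot> base t = id_fun (Src (base t))" "base t \<odot> base s = id_fun (Tgt (base t))"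
    unfolding s(2,3) by simp_all
  have "\<exists>r. arr r \<and> r \<star> s = ide (dm s) \<and> s \<star> r = ide (cd s)"
    using s c by (intro exI[of _ t]) simp
  then have "invertible s" using s(1) unfolding invertible_def by simp
  then show ?thesis using that[OF s(1) c(1)[symmetric] c(2) s(2,3) b] by simp
qed

lemma cocartE:
  assumes "cocart k" "arr h" "dm h = dm k" "small_fun S v" "Src v = Tgt (base k)" "base h = v \<odot> base k"
  obtains g where "arr g" "base g = v" "dm g = cd k" "cd g = cd h" "g \<star> k = h"
proof -
  obtain g where g: "arr g" "base g = v" "dm g = cd k" "g \<star> k = h"
    using assms unfolding cocart_def by blast
  then have "cd g = cd h" using arr_cmp(3)[of k g] assms(1) by auto
  with g that show ?thesis by blast
qed

lemma cocart_cancel: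
  assumes "cocart k" "arr g" "arr h" "dm g = cd k" "dm h = cd k" "base g = base h"
    and "g \<star> k = h \<star> k"
  shows "g = h"
proof -
  have "Src (base g) = Tgt (base k)" using assms(4) by (rule cd_dm_base)
  moreover have "base (g \<star> k) = base g \<odot> base k" "arr (g \<star> k)" "dm (g \<star> k) = dm k"
    using assms by simp_all
  ultimately have "\<exists>!x. arr x \<and> base x = base g \<and> dm x = cd k \<and> x \<star> k = g \<star> k"
    using assms(1,2) unfolding cocart_def by simp
  then show ?thesis using assms by metis
qed

lemma cocart_comp:
  assumes k: "cocart k" and l: "cocart l" and c: "cd k = dm l"
  shows "cocart (l \<star> k)"
  unfolding cocart_def
proof (intro conjI allI impI)
  show "arr (l \<star> k)" using assms by simp
  fix h v assume h: "arr h \<and> dm h = dm (l \<star> k) \<and> small_fun S v \<and> Src v = Tgt (base (l \<star> k))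
     \<and> base h = v \<odot> base (l \<star> k)"
  have tk: "Tgt (base k) = Src (base l)" using c by (rule cd_dm_base)
  have hb: "base h = (v \<odot> base l) \<odot> base k" using h k l c tk by (simp add: small_comp_assoc)
  have h': "arr h" "dm h = dm k" "small_fun S v" "Src v = Tgt (base l)" using h k l c by simp_all
  have sv: "small_fun S (v \<odot> base l)" "Src (v \<odot> base l) = Tgt (base k)" using h' l tk by simp_all
  obtain g where g: "arr g" "base g = v \<odot> base l" "dm g = cd k" "cd g = cd h" "g \<star> k = h"
    by (rule cocartE[OF k h'(1,2) sv hb])
  obtain g' where g': "arr g'" "base g' = v" "dm g' = cd l" "cd g' = cd g" "g' \<star> l = g"
    by (rule cocartE[OF l g(1) g(3)[unfolded c] h'(3,4) g(2)])
  show "\<exists>!g. arr g \<and> base g = v \<and> dm g = cd (l \<star> k) \<and> g \<star> l \<star> k = h"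
  proof (intro ex1I[of _ g'] conjI)
    show "g' \<star> l \<star> k = h" using g g' by (simp flip: cmp_assoc)
    fix x assume x: "arr x \<and> base x = v \<and> dm x = cd (l \<star> k) \<and> x \<star> l \<star> k = h"
    have d: "dm x = cd l" using x k l c by simp
    have "x \<star> l = g' \<star> l"
      by (rule cocart_cancel[OF k]) (use x d g g' k l c in \<open>simp_all add: cmp_assoc\<close>)
    then show "x = g'" by (rule cocart_cancel[OF l, rotated -1]) (use x d g' l in simp_all)
  qed (use g' k l c in simp_all)
qed

lemma invertible_cocart:
  assumes "invertible t"
  shows "cocart t"
  unfolding cocart_def
proof (intro conjI allI impI)
  show t: "arr t" using assms by simp
  obtain s where s: "arr s" "dm s = cd t" "cd s = dm t" "s \<star> t = ide (dm t)" "t \<star> s = ide (cd t)"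
    "base s \<odot> base t = id_fun (Src (base t))" "base t \<odot> base s = id_fun (Tgt (base t))"
    by (rule invertibleE[OF assms])
  fix h v assume h: "arr h \<and> dm h = dm t \<and> small_fun S v \<and> Src v = Tgt (base t) \<and> base h = v \<odot> base t"
  have bs: "Tgt (base s) = Src (base t)" "Src (base s) = Tgt (base t)"
    using cd_dm_base(1)[OF s(3)] cd_dm_base(4)[OF s(2)] by simp_all
  have b: "base (h \<star> s) = v"
    using h s t bs by (simp add: small_comp_assoc)
  show "\<exists>!g. arr g \<and> base g = v \<and> dm g = cd t \<and> g \<star> t = h"
  proof (intro ex1I[of _ "h \<star> s"] conjI)
    show "arr (h \<star> s)" "base (h \<star> s) = v" "dm (h \<star> s) = cd t" using h s b by simp_all
    show "(h \<star> s) \<star> t = h" using h s by (simp add: cmp_assoc)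
    fix x assume x: "arr x \<and> base x = v \<and> dm x = cd t \<and> x \<star> t = h"
    then have "h \<star> s = x \<star> (t \<star> s)" by (simp add: cmp_assoc[symmetric])
    then show "x = h \<star> s" using x s by simp
  qed
qed

lemma invertible_comp:
  assumes "invertible s" "invertible t" "cd s = dm t"
  shows "invertible (t \<star> s)"
proof -
  obtain s' where s': "arr s'" "dm s' = cd s" "cd s' = dm s" "s' \<star> s = ide (dm s)" "s \<star> s' = ide (cd s)"
    by (rule invertibleE[OF assms(1)])
  obtain t' where t': "arr t'" "dm t' = cd t" "cd t' = dm t" "t' \<star> t = ide (dm t)" "t \<star> t' = ide (cd t)"
    by (rule invertibleE[OF assms(2)])
  have "(s' \<star> t') \<star> (t \<star> s) = ide (dm (t \<star> s))"
    using s' t' assms cmp_reassoc[OF t'(4)] by (simp add: cmp_assoc)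
  moreover have "(t \<star> s) \<star> (s' \<star> t') = ide (cd (t \<star> s))"
    using s' t' assms cmp_reassoc[OF s'(5)] by (simp add: cmp_assoc)
  ultimately show ?thesis
    unfolding invertible_def using assms s' t' by (intro conjI exI[of _ "s' \<star> t'"]) simp_all
qed

lemma isosE:
  assumes "f \<in> isos (DCat D A) X Y" "small_cat S A"
  obtains g where "f \<in> Arr (DCat D A)" "Dom (DCat D A) f = X" "Cod (DCat D A) f = Y"
    "g \<in> Arr (DCat D A)" "Dom (DCat D A) g = Y" "Cod (DCat D A) g = X"
    "g \<cdot>\<^bsub>DCat D A\<^esub> f = Idn (DCat D A) X" "f \<cdot>\<^bsub>DCat D A\<^esub> g = Idn (DCat D A) Y"
  using assms unfolding isos_def hom_def by blast

lemma invertible_vert: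
  assumes "f \<in> isos (DCat D A) X Y" "small_cat S A"
  shows "invertible (vert A f)"
proof -
  obtain g where g: "f \<in> Arr (DCat D A)" "Dom (DCat D A) f = X" "Cod (DCat D A) f = Y"
    "g \<in> Arr (DCat D A)" "Dom (DCat D A) g = Y" "Cod (DCat D A) g = X"
    "g \<cdot>\<^bsub>DCat D A\<^esub> f = Idn (DCat D A) X" "f \<cdot>\<^bsub>DCat D A\<^esub> g = Idn (DCat D A) Y"
    using isosE[OF assms] .
  have "X \<in> Ob (DCat D A)" "Y \<in> Ob (DCat D A)" using D_cat(1,2)[OF assms(2) g(1)] g by simp_all
  then have "vert A g \<star> vert A f = ide (A, X)" "vert A f \<star> vert A g = ide (A, Y)"
    using vert_comp[OF assms(2) g(1,4)] vert_comp[OF assms(2) g(4,1)] g assms(2) by simp_all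
  then show ?thesis
    unfolding invertible_def using g assms(2) by (intro conjI exI[of _ "vert A g"]) simp_all
qed

lemma vert_invertible_isos:
  assumes "invertible t" "base t = id_fun A" "dm t = (A, X)" "cd t = (A, Y)"
  shows "fib t \<in> isos (DCat D A) X Y" "t = vert A (fib t)"
proof -
  obtain s where s: "arr s" "dm s = cd t" "cd s = dm t" "s \<star> t = ide (dm t)" "t \<star> s = ide (cd t)"
    "base s \<odot> base t = id_fun (Src (base t))" "base t \<odot> base s = id_fun (Tgt (base t))"
    by (rule invertibleE[OF assms(1)])
  have t: "arr t" using assms by simp
  have A: "small_cat S A" using t arr_ob(1)[OF t] assms(3) by simp
  have "Src (base s) = A" "Tgt (base s) = A"
    using s assms cd_dm_base(5)[of s] cd_dm_base(6)[of s] by simp_all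
  then have "base s = id_fun A" using s assms by simp
  then have st: "s = vert A (fib s)" "fib s \<in> hom (DCat D A) Y X"
    using vertical_is_vert[of s A] s assms by simp_all
  have tt: "t = vert A (fib t)" "fib t \<in> hom (DCat D A) X Y"
    using vertical_is_vert[OF t assms(2)] assms by simp_all
  have XY: "X \<in> Ob (DCat D A)" "Y \<in> Ob (DCat D A)" using arr_ob[OF t] assms by simp_all
  have "vert A (fib s \<cdot>\<^bsub>DCat D A\<^esub> fib t) = vert A (Idn (DCat D A) X)"
    "vert A (fib t \<cdot>\<^bsub>DCat D A\<^esub> fib s) = vert A (Idn (DCat D A) Y)"
    using st(2) tt(2) A s(4,5) st(1) tt(1) assms XY by (simp_all add: vert_comp hom_def)
  then have "fib s \<cdot>\<^bsub>DCat D A\<^esub> fib t = Idn (DCat D A) X"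
    "fib t \<cdot>\<^bsub>DCat D A\<^esub> fib s = Idn (DCat D A) Y" by (blast dest: vert_inject)+
  then show "fib t \<in> isos (DCat D A) X Y" using st tt unfolding isos_def by blast
  show "t = vert A (fib t)" by (fact tt)
qed

lemma invertible_ide [simp]: "small_cat S A \<Longrightarrow> X \<in> Ob (DCat D A) \<Longrightarrow> invertible (ide (A, X))"
  unfolding invertible_def by (intro conjI exI[of _ "ide (A, X)"]) simp_all

lemma invertible_cart:
  assumes u: "small_fun S u" and v: "small_fun S v" and uv: "Tgt u = Src v" "Tgt v = Src u"
    and inv: "v \<odot> u = id_fun (Src u)" "u \<odot> v = id_fun (Src v)" and Y: "Y \<in> Ob (DCat D (Tgt u))"
  shows "invertible (cart u Y)"
proof -
  have 1: "reO D v (reO D u Y) = Y" using D_res_comp(1)[OF v u uv(2) Y] inv Y uv v by simp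
  have 2: "cart u Y \<star> cart v (reO D u Y) = ide (Tgt u, Y)"
    using cart_comp[OF v u uv(2) Y] inv uv v Y by simp
  have 3: "cart v (reO D u Y) \<star> cart u Y = ide (Src u, reO D u Y)"
    using cart_comp[OF u v uv(1), of "reO D u Y"] 1 inv uv u Y by simp
  show ?thesis
    unfolding invertible_def
    using u v uv Y 2 3 by (intro conjI exI[of _ "cart v (reO D u Y)"]) simp_all
qed

text \<open>
  Uniqueness of left Kan extensions. The comparison morphism of the theorem is obtained from it.
\<close>

lemma cocart_unique:
  assumes k: "cocart k" and l: "cocart l" and d: "dm k = dm l" and b: "base k = base l"
  obtains m where "invertible m" "base m = id_fun (Tgt (base k))" "dm m = cd k" "cd m = cd l" "m \<star> k = l"
proof -
  let ?i = "id_fun (Tgt (base k))"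
  have s: "small_fun S ?i" "Src ?i = Tgt (base k)" "Src ?i = Tgt (base l)" using k l b by simp_all
  have bi: "base l = ?i \<odot> base k" "base k = ?i \<odot> base l" using k l b by simp_all
  obtain m where m: "arr m" "base m = ?i" "dm m = cd k" "cd m = cd l" "m \<star> k = l"
    by (rule cocartE[OF k cocart_arr[OF l] d[symmetric] s(1,2) bi(1)])
  obtain n where n: "arr n" "base n = ?i" "dm n = cd l" "cd n = cd k" "n \<star> l = k"
    by (rule cocartE[OF l cocart_arr[OF k] d s(1,3) bi(2)])
  have i: "small_cat S (Tgt (base k))" using k by simp
  have "n \<star> m = ide (cd k)"
    by (rule cocart_cancel[OF k]) (use k m n i in \<open>simp_all add: cmp_assoc\<close>)
  moreover have "m \<star> n = ide (cd l)"
    by (rule cocart_cancel[OF l]) (use l m n i b in \<open>simp_all add: cmp_assoc\<close>)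
  ultimately have "invertible m"
    unfolding invertible_def using m n by (intro conjI exI[of _ n]) simp_all
  then show ?thesis using that[of m] m by simp
qed

end

text \<open>
  Left adjoints of the restriction functors supply the cocartesian arrows.
\<close>

locale left_kan_prederivator = small_prederivator S D
  for S :: "'a elem set set" and D :: "('a, 'o, 'm, 'z) drv_data_scheme" +
  assumes left_adjoint: "small_fun S u \<Longrightarrow> \<exists>F \<eta> \<epsilon>. adjunction F (DFun D u) \<eta> \<epsilon>"
begin

lemma lan_adjunction:
  assumes "small_fun S u"
  shows "adjunction (lkan D u) (DFun D u) (fst (snd (lan_adj D u))) (snd (snd (lan_adj D u)))"
proof -
  have "\<exists>p. case p of (F, \<eta>, \<epsilon>) \<Rightarrow> adjunction F (DFun D u) \<eta> \<epsilon>"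
    using left_adjoint[OF assms] by auto
  then have "case lan_adj D u of (F, \<eta>, \<epsilon>) \<Rightarrow> adjunction F (DFun D u) \<eta> \<epsilon>"
    unfolding lan_adj_def by (rule someI_ex)
  then show ?thesis by (simp add: lkan_def split: prod.splits)
qed

lemma lkan_functor:
  assumes "small_fun S u"
  shows "is_functor (lkan D u)" "Src (lkan D u) = DCat D (Src u)" "Tgt (lkan D u) = DCat D (Tgt u)"
  using lan_adjunction[OF assms] "fun"[OF assms] unfolding adjunction_def by auto

lemma lkan_simps [simp]:
  assumes "small_fun S u"
  shows "X \<in> Ob (DCat D (Src u)) \<Longrightarrow> FO (lkan D u) X \<in> Ob (DCat D (Tgt u))"
    "f \<in> Arr (DCat D (Src u)) \<Longrightarrow> FA (lkan D u) f \<in> Arr (DCat D (Tgt u))"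
    "f \<in> Arr (DCat D (Src u)) \<Longrightarrow> Dom (DCat D (Tgt u)) (FA (lkan D u) f) = FO (lkan D u) (Dom (DCat D (Src u)) f)"
    "f \<in> Arr (DCat D (Src u)) \<Longrightarrow> Cod (DCat D (Tgt u)) (FA (lkan D u) f) = FO (lkan D u) (Cod (DCat D (Src u)) f)"
  using lkan_functor[OF assms] is_functor.obj_in[of "lkan D u"] is_functor.FA_simps[of "lkan D u"]
  by simp_all

lemma lan_unit_simps [simp]:
  assumes "small_fun S u" "X \<in> Ob (DCat D (Src u))"
  shows "lan_unit D u X \<in> Arr (DCat D (Src u))" "Dom (DCat D (Src u)) (lan_unit D u X) = X"
    "Cod (DCat D (Src u)) (lan_unit D u X) = reO D u (FO (lkan D u) X)"
proof -
  have "is_nat (fst (snd (lan_adj D u)))" "NSrc (fst (snd (lan_adj D u))) = id_fun (DCat D (Src u))"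
    "NTgt (fst (snd (lan_adj D u))) = DFun D u \<odot> lkan D u"
    using lan_adjunction[OF assms(1)] lkan_functor[OF assms(1)] by (simp_all add: adjunction_def)
  then have "lan_unit D u X \<in> hom (DCat D (Src u)) X (reO D u (FO (lkan D u) X))"
    using is_nat.at_in[of "fst (snd (lan_adj D u))" X] assms lkan_functor[OF assms(1)]
    by (simp add: lan_unit_def)
  then show "lan_unit D u X \<in> Arr (DCat D (Src u))" "Dom (DCat D (Src u)) (lan_unit D u X) = X"
    "Cod (DCat D (Src u)) (lan_unit D u X) = reO D u (FO (lkan D u) X)"
    by (simp_all add: hom_def)
qed

lemma lan_unit_natural:
  assumes "small_fun S u" "f \<in> Arr (DCat D (Src u))"
  shows "lan_unit D u (Cod (DCat D (Src u)) f) \<cdot>\<^bsub>DCat D (Src u)\<^esub> f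
    = reA D u (FA (lkan D u) f) \<cdot>\<^bsub>DCat D (Src u)\<^esub> lan_unit D u (Dom (DCat D (Src u)) f)"
proof -
  have "is_nat (fst (snd (lan_adj D u)))" "NSrc (fst (snd (lan_adj D u))) = id_fun (DCat D (Src u))"
    "NTgt (fst (snd (lan_adj D u))) = DFun D u \<odot> lkan D u"
    using lan_adjunction[OF assms(1)] lkan_functor[OF assms(1)] by (simp_all add: adjunction_def)
  then show ?thesis
    using is_nat.natural[of "fst (snd (lan_adj D u))" f "Dom (DCat D (Src u)) f" "Cod (DCat D (Src u)) f"]
      assms lkan_functor[OF assms(1)]
    by (simp add: lan_unit_def hom_def)
qed

lemma lan_counit_simps [simp]:
  assumes "small_fun S u" "Y \<in> Ob (DCat D (Tgt u))"
  shows "lan_counit D u Y \<in> Arr (DCat D (Tgt u))"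
    "Dom (DCat D (Tgt u)) (lan_counit D u Y) = FO (lkan D u) (reO D u Y)"
    "Cod (DCat D (Tgt u)) (lan_counit D u Y) = Y"
proof -
  have "is_nat (snd (snd (lan_adj D u)))" "NTgt (snd (snd (lan_adj D u))) = id_fun (DCat D (Tgt u))"
    "NSrc (snd (snd (lan_adj D u))) = lkan D u \<odot> DFun D u"
    using lan_adjunction[OF assms(1)] lkan_functor[OF assms(1)] by (simp_all add: adjunction_def)
  then have "lan_counit D u Y \<in> hom (DCat D (Tgt u)) (FO (lkan D u) (reO D u Y)) Y"
    using is_nat.at_in[of "snd (snd (lan_adj D u))" Y] assms lkan_functor[OF assms(1)]
      "fun"[OF assms(1)]
    by (simp add: lan_counit_def)
  then show "lan_counit D u Y \<in> Arr (DCat D (Tgt u))"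
    "Dom (DCat D (Tgt u)) (lan_counit D u Y) = FO (lkan D u) (reO D u Y)"
    "Cod (DCat D (Tgt u)) (lan_counit D u Y) = Y"
    by (simp_all add: hom_def)
qed

lemma lan_counit_natural:
  assumes "small_fun S u" "f \<in> Arr (DCat D (Tgt u))"
  shows "lan_counit D u (Cod (DCat D (Tgt u)) f) \<cdot>\<^bsub>DCat D (Tgt u)\<^esub> FA (lkan D u) (reA D u f)
    = f \<cdot>\<^bsub>DCat D (Tgt u)\<^esub> lan_counit D u (Dom (DCat D (Tgt u)) f)"
proof -
  have "is_nat (snd (snd (lan_adj D u)))" "NTgt (snd (snd (lan_adj D u))) = id_fun (DCat D (Tgt u))"
    "NSrc (snd (snd (lan_adj D u))) = lkan D u \<odot> DFun D u"
    using lan_adjunction[OF assms(1)] lkan_functor[OF assms(1)] by (simp_all add: adjunction_def)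
  then show ?thesis
    using is_nat.natural[of "snd (snd (lan_adj D u))" f "Dom (DCat D (Tgt u)) f" "Cod (DCat D (Tgt u)) f"]
      assms lkan_functor[OF assms(1)] "fun"[OF assms(1)]
    by (simp add: lan_counit_def hom_def)
qed

lemma lan_triangles:
  assumes "small_fun S u"
  shows "X \<in> Ob (DCat D (Src u)) \<Longrightarrow>
      lan_counit D u (FO (lkan D u) X) \<cdot>\<^bsub>DCat D (Tgt u)\<^esub> FA (lkan D u) (lan_unit D u X)
      = Idn (DCat D (Tgt u)) (FO (lkan D u) X)"
    "Y \<in> Ob (DCat D (Tgt u)) \<Longrightarrow>
      reA D u (lan_counit D u Y) \<cdot>\<^bsub>DCat D (Src u)\<^esub> lan_unit D u (reO D u Y)
      = Idn (DCat D (Src u)) (reO D u Y)"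
  using lan_adjunction[OF assms] lkan_functor[OF assms]
  by (simp_all add: adjunction_def lan_counit_def lan_unit_def)

definition lan_arr :: "'a sfun \<Rightarrow> 'o \<Rightarrow> ('a, 'o, 'm) over_arr" where
  "lan_arr u X = Over u (lan_unit D u X) (FO (lkan D u) X)"

lemma lan_arr_simps [simp]:
  "base (lan_arr u X) = u" "cd (lan_arr u X) = (Tgt u, FO (lkan D u) X)"
  "small_fun S u \<Longrightarrow> X \<in> Ob (DCat D (Src u)) \<Longrightarrow> arr (lan_arr u X)"
  "small_fun S u \<Longrightarrow> X \<in> Ob (DCat D (Src u)) \<Longrightarrow> dm (lan_arr u X) = (Src u, X)"
  by (simp_all add: lan_arr_def)

text \<open>
  The adjunct \<open>u\<^sub>! X \<rightarrow> Y\<close> of \<open>f: X \<rightarrow> u\<^sup>* Y\<close>.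
\<close>

definition transpose :: "'a sfun \<Rightarrow> 'm \<Rightarrow> 'o \<Rightarrow> 'm" where
  "transpose u f Y = lan_counit D u Y \<cdot>\<^bsub>DCat D (Tgt u)\<^esub> FA (lkan D u) f"

lemma transpose_simps [simp]:
  assumes "small_fun S u" "f \<in> Arr (DCat D (Src u))" "Y \<in> Ob (DCat D (Tgt u))"
    "Cod (DCat D (Src u)) f = reO D u Y"
  shows "transpose u f Y \<in> Arr (DCat D (Tgt u))"
    "Dom (DCat D (Tgt u)) (transpose u f Y) = FO (lkan D u) (Dom (DCat D (Src u)) f)"
    "Cod (DCat D (Tgt u)) (transpose u f Y) = Y"
  using assms by (simp_all add: transpose_def)

lemma transpose_lan_arr:
  assumes u: "small_fun S u" and f: "f \<in> Arr (DCat D (Src u))" and Y: "Y \<in> Ob (DCat D (Tgt u))"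
    and fY: "Cod (DCat D (Src u)) f = reO D u Y"
  shows "vert (Tgt u) (transpose u f Y) \<star> lan_arr u (Dom (DCat D (Src u)) f) = Over u f Y"
proof -
  let ?A = "DCat D (Src u)" and ?B = "DCat D (Tgt u)" and ?X = "Dom (DCat D (Src u)) f"
  have X: "?X \<in> Ob ?A" using u f by simp
  have "reA D u (transpose u f Y) \<cdot>\<^bsub>?A\<^esub> lan_unit D u ?X
      = reA D u (lan_counit D u Y) \<cdot>\<^bsub>?A\<^esub> (reA D u (FA (lkan D u) f) \<cdot>\<^bsub>?A\<^esub> lan_unit D u ?X)"
    unfolding transpose_def using u f Y X fY by (simp add: D_assoc)
  also have "\<dots> = reA D u (lan_counit D u Y) \<cdot>\<^bsub>?A\<^esub> (lan_unit D u (reO D u Y) \<cdot>\<^bsub>?A\<^esub> f)"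
    using lan_unit_natural[OF u f] fY by simp
  also have "\<dots> = (reA D u (lan_counit D u Y) \<cdot>\<^bsub>?A\<^esub> lan_unit D u (reO D u Y)) \<cdot>\<^bsub>?A\<^esub> f"
    using u f Y X fY by (simp add: D_assoc)
  also have "\<dots> = f" using lan_triangles(2)[OF u Y] u f fY by simp
  finally show ?thesis
    using vert_comp_Over[of u "lan_unit D u ?X" "transpose u f Y"] u f Y fY X
    by (simp add: lan_arr_def)
qed

lemma lkan_lan_arr:
  assumes u: "small_fun S u" and f: "f \<in> Arr (DCat D (Src u))"
  shows "vert (Tgt u) (FA (lkan D u) f) \<star> lan_arr u (Dom (DCat D (Src u)) f)
    = lan_arr u (Cod (DCat D (Src u)) f) \<star> vert (Src u) f"
proof -
  let ?A = "DCat D (Src u)"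
  have "vert (Tgt u) (FA (lkan D u) f) \<star> lan_arr u (Dom ?A f)
      = Over u (reA D u (FA (lkan D u) f) \<cdot>\<^bsub>?A\<^esub> lan_unit D u (Dom ?A f)) (FO (lkan D u) (Cod ?A f))"
    using vert_comp_Over[of u "lan_unit D u (Dom ?A f)" "FA (lkan D u) f"] u f
    by (simp add: lan_arr_def)
  also have "\<dots> = Over u (lan_unit D u (Cod ?A f) \<cdot>\<^bsub>?A\<^esub> f) (FO (lkan D u) (Cod ?A f))"
    using lan_unit_natural[OF u f] by simp
  also have "\<dots> = lan_arr u (Cod ?A f) \<star> vert (Src u) f"
    unfolding lan_arr_def using u f by (intro Over_comp_vert) simp_all
  finally show ?thesis .
qed

text \<open>
  The unit of the adjunction between \<open>u\<^sub>!\<close> and \<open>u\<^sup>*\<close> has the universal property: an arrow over \<open>v \<odot> u\<close> is first lifted through the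
  cartesian arrow over \<open>v\<close>, which leaves an arrow over \<open>u\<close>, and this one has a unique adjunct.
\<close>

lemma cocart_lan_arr:
  assumes u: "small_fun S u" and X: "X \<in> Ob (DCat D (Src u))"
  shows "cocart (lan_arr u X)"
  unfolding cocart_def
proof (intro conjI allI impI)
  let ?A = "DCat D (Src u)" and ?B = "DCat D (Tgt u)"
  show "arr (lan_arr u X)" using assms by simp
  fix h v assume "arr h \<and> dm h = dm (lan_arr u X) \<and> small_fun S v \<and> Src v = Tgt (base (lan_arr u X))
     \<and> base h = v \<odot> base (lan_arr u X)"
  then have h: "arr h" "dm h = (Src u, X)" and v: "small_fun S v" "Tgt u = Src v"
    and bh: "base h = v \<odot> u" using assms by auto
  obtain Y where Y: "cd h = (Tgt v, Y)" using cd_dm_base(6)[of h] bh by (cases "cd h") auto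
  then have YO: "Y \<in> Ob (DCat D (Tgt v))" using arr_ob(2)[OF h(1)] by simp
  obtain s where s: "arr s" "base s = u" "dm s = (Src u, X)" "cd s = (Src v, reO D v Y)"
    "cart v Y \<star> s = h"
    by (rule cart_lift[OF v(1) u v(2) h(1) bh Y]) (use h in simp)
  obtain f where f: "s = Over u f (reO D v Y)" "f \<in> Arr ?A" "Cod ?A f = reO D u (reO D v Y)" "Dom ?A f = X"
    using s by (auto elim!: arrE)
  have vY: "reO D v Y \<in> Ob ?B" using v YO by simp
  let ?g = "cart v Y \<star> vert (Tgt u) (transpose u f (reO D v Y))"
  note t = transpose_simps[OF u f(2) vY f(3)]
  have g: "arr ?g" "base ?g = v" "dm ?g = (Tgt u, FO (lkan D u) X)"
    using t v YO u f by simp_all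
  have gh: "?g \<star> lan_arr u X = h"
    using transpose_lan_arr[OF u f(2) vY f(3)] s f by (simp add: cmp_assoc)
  show "\<exists>!g. arr g \<and> base g = v \<and> dm g = cd (lan_arr u X) \<and> g \<star> lan_arr u X = h"
  proof (intro ex1I[of _ ?g])
    show "arr ?g \<and> base ?g = v \<and> dm ?g = cd (lan_arr u X) \<and> ?g \<star> lan_arr u X = h"
      using g gh by simp
    fix x assume x: "arr x \<and> base x = v \<and> dm x = cd (lan_arr u X) \<and> x \<star> lan_arr u X = h"
    have "cd x = cd h" using x arr_cmp(3)[of "lan_arr u X" x] u X by auto
    then obtain m where m: "x = Over v m Y" "m \<in> Arr ?B" "Cod ?B m = reO D v Y"
      "Dom ?B m = FO (lkan D u) X"
      using x Y v by (auto elim!: arrE)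
    have xm: "x = cart v Y \<star> vert (Tgt u) m"
      using Over_eq_cart_vert[OF v(1) YO] m v by simp
    have "vert (Tgt u) m \<star> lan_arr u X = s"
    proof (rule cart_cancel[OF v(1) YO])
      show "cart v Y \<star> vert (Tgt u) m \<star> lan_arr u X = cart v Y \<star> s"
        using x xm s by (simp add: cmp_assoc)
    qed (use u X m s v in simp_all)
    moreover have "vert (Tgt u) m \<star> lan_arr u X = Over u (reA D u m \<cdot>\<^bsub>?A\<^esub> lan_unit D u X) (reO D v Y)"
      using vert_comp_Over[of u "lan_unit D u X" m] u X m by (simp add: lan_arr_def)
    ultimately have fm: "f = reA D u m \<cdot>\<^bsub>?A\<^esub> lan_unit D u X" using f by simp
    have "transpose u f (reO D v Y) = lan_counit D u (reO D v Y) \<cdot>\<^bsub>?B\<^esub>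
        (FA (lkan D u) (reA D u m) \<cdot>\<^bsub>?B\<^esub> FA (lkan D u) (lan_unit D u X))"
      unfolding transpose_def fm
      using is_functor.FA_comp[OF lkan_functor(1)[OF u], of "lan_unit D u X" "reA D u m"]
        lkan_functor[OF u] u X m by simp
    also have "\<dots> = (lan_counit D u (reO D v Y) \<cdot>\<^bsub>?B\<^esub> FA (lkan D u) (reA D u m))
        \<cdot>\<^bsub>?B\<^esub> FA (lkan D u) (lan_unit D u X)"
      using u X m vY by (simp add: D_assoc)
    also have "\<dots> = (m \<cdot>\<^bsub>?B\<^esub> lan_counit D u (FO (lkan D u) X)) \<cdot>\<^bsub>?B\<^esub> FA (lkan D u) (lan_unit D u X)"
      using lan_counit_natural[OF u m(2)] m by simp
    also have "\<dots> = m"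
      using lan_triangles(1)[OF u X] u X m by (simp add: D_assoc)
    finally show "x = ?g" using xm by simp
  qed
qed

text \<open>
  Composing the unit of \<open>u\<^sub>!\<close> with an invertible map out of \<open>u\<^sub>! X\<close> keeps it universal. Axioms that declare a canonical map
  out of a Kan extension invertible, such as cocontinuity, thus become statements about cocartesian arrows.
\<close>

lemma cocart_of_transpose:
  assumes u: "small_fun S u" and f: "f \<in> Arr (DCat D (Src u))" and Y: "Y \<in> Ob (DCat D (Tgt u))"
    and fY: "Cod (DCat D (Src u)) f = reO D u Y"
    and iso: "is_iso (DCat D (Tgt u)) (transpose u f Y)"
  shows "cocart (Over u f Y)"
proof -
  have "invertible (vert (Tgt u) (transpose u f Y))"
    using iso u unfolding is_iso_def by (intro invertible_vert) auto
  then have "cocart (vert (Tgt u) (transpose u f Y) \<star> lan_arr u (Dom (DCat D (Src u)) f))"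
    using assms by (intro cocart_comp cocart_lan_arr invertible_cocart) simp_all
  then show ?thesis using transpose_lan_arr[OF u f Y fY] by simp
qed

end

section \<open>The fibrewise tensor product on the total category\<close>

locale small_monoidal_derivator = size_universe S + monoidal_derivator S D
  for S :: "'a elem set set" and D :: "('a, 'o, 'm) mon_drv_data"

sublocale small_monoidal_derivator \<subseteq> left_kan_prederivator S D
  by unfold_locales (rule Der3_left)

context small_monoidal_derivator
begin

lemma tensor_simps [simp]:
  assumes "small_cat S A"
  shows "X \<in> Ob (DCat D A) \<Longrightarrow> Y \<in> Ob (DCat D A) \<Longrightarrow> TO (Mon D A) X Y \<in> Ob (DCat D A)"
    "f \<in> Arr (DCat D A) \<Longrightarrow> g \<in> Arr (DCat D A) \<Longrightarrow> TA (Mon D A) f g \<in> Arr (DCat D A)"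
    "f \<in> Arr (DCat D A) \<Longrightarrow> g \<in> Arr (DCat D A) \<Longrightarrow>
      Dom (DCat D A) (TA (Mon D A) f g) = TO (Mon D A) (Dom (DCat D A) f) (Dom (DCat D A) g)"
    "f \<in> Arr (DCat D A) \<Longrightarrow> g \<in> Arr (DCat D A) \<Longrightarrow>
      Cod (DCat D A) (TA (Mon D A) f g) = TO (Mon D A) (Cod (DCat D A) f) (Cod (DCat D A) g)"
    "X \<in> Ob (DCat D A) \<Longrightarrow> Y \<in> Ob (DCat D A) \<Longrightarrow>
      TA (Mon D A) (Idn (DCat D A) X) (Idn (DCat D A) Y) = Idn (DCat D A) (TO (Mon D A) X Y)"
    "TU (Mon D A) \<in> Ob (DCat D A)"
proof -
  interpret A: monoidal_category "DCat D A" "Mon D A" by (rule mon_cat[OF assms])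
  show "X \<in> Ob (DCat D A) \<Longrightarrow> Y \<in> Ob (DCat D A) \<Longrightarrow> TO (Mon D A) X Y \<in> Ob (DCat D A)"
    "X \<in> Ob (DCat D A) \<Longrightarrow> Y \<in> Ob (DCat D A) \<Longrightarrow>
      TA (Mon D A) (Idn (DCat D A) X) (Idn (DCat D A) Y) = Idn (DCat D A) (TO (Mon D A) X Y)"
    "TU (Mon D A) \<in> Ob (DCat D A)"
    using A.tensor_obj A.tensor_id A.unit_obj by auto
  assume "f \<in> Arr (DCat D A)" "g \<in> Arr (DCat D A)"
  then have "TA (Mon D A) f g \<in> hom (DCat D A) (TO (Mon D A) (Dom (DCat D A) f) (Dom (DCat D A) g))
      (TO (Mon D A) (Cod (DCat D A) f) (Cod (DCat D A) g))"
    by (intro A.tensor_arr A.homI)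
  then show "TA (Mon D A) f g \<in> Arr (DCat D A)"
    "Dom (DCat D A) (TA (Mon D A) f g) = TO (Mon D A) (Dom (DCat D A) f) (Dom (DCat D A) g)"
    "Cod (DCat D A) (TA (Mon D A) f g) = TO (Mon D A) (Cod (DCat D A) f) (Cod (DCat D A) g)"
    by (simp_all add: hom_def)
qed

lemma tensor_comp':
  assumes "small_cat S A" "f \<in> Arr (DCat D A)" "f' \<in> Arr (DCat D A)" "g \<in> Arr (DCat D A)"
    "g' \<in> Arr (DCat D A)" "Cod (DCat D A) f = Dom (DCat D A) f'" "Cod (DCat D A) g = Dom (DCat D A) g'"
  shows "TA (Mon D A) (f' \<cdot>\<^bsub>DCat D A\<^esub> f) (g' \<cdot>\<^bsub>DCat D A\<^esub> g)
    = TA (Mon D A) f' g' \<cdot>\<^bsub>DCat D A\<^esub> TA (Mon D A) f g"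
proof -
  interpret A: monoidal_category "DCat D A" "Mon D A" by (rule mon_cat[OF assms(1)])
  show ?thesis using assms by (intro A.tensor_comp) (auto simp: hom_def)
qed

lemma res_fun [simp]:
  assumes "small_fun S u"
  shows "Src (DFun D u) = DCat D (Tgt u)" "Tgt (DFun D u) = DCat D (Src u)"
  using "fun"[OF assms] by auto

lemma ResT_iso:
  assumes "small_fun S u" "X \<in> Ob (DCat D (Tgt u))" "Y \<in> Ob (DCat D (Tgt u))"
  shows "ResT D u X Y \<in> isos (DCat D (Src u)) (TO (Mon D (Src u)) (reO D u X) (reO D u Y))
    (reO D u (TO (Mon D (Tgt u)) X Y))"
proof -
  interpret u: strong_monoidal_functor "DFun D u" "Mon D (Tgt u)" "Mon D (Src u)" "ResT D u" "ResU D u"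
    by (rule mon_fun[OF assms(1)])
  show ?thesis using u.mult_iso[of X Y] assms by simp
qed

lemma ResT_simps [simp]:
  assumes "small_fun S u" "X \<in> Ob (DCat D (Tgt u))" "Y \<in> Ob (DCat D (Tgt u))"
  shows "ResT D u X Y \<in> Arr (DCat D (Src u))"
    "Dom (DCat D (Src u)) (ResT D u X Y) = TO (Mon D (Src u)) (reO D u X) (reO D u Y)"
    "Cod (DCat D (Src u)) (ResT D u X Y) = reO D u (TO (Mon D (Tgt u)) X Y)"
  using ResT_iso[OF assms] by (auto simp: isos_def hom_def)

lemma ResT_natural:
  assumes "small_fun S u" "f \<in> Arr (DCat D (Tgt u))" "g \<in> Arr (DCat D (Tgt u))"
  shows "ResT D u (Cod (DCat D (Tgt u)) f) (Cod (DCat D (Tgt u)) g)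
      \<cdot>\<^bsub>DCat D (Src u)\<^esub> TA (Mon D (Src u)) (reA D u f) (reA D u g)
    = reA D u (TA (Mon D (Tgt u)) f g)
      \<cdot>\<^bsub>DCat D (Src u)\<^esub> ResT D u (Dom (DCat D (Tgt u)) f) (Dom (DCat D (Tgt u)) g)"
proof -
  interpret u: strong_monoidal_functor "DFun D u" "Mon D (Tgt u)" "Mon D (Src u)" "ResT D u" "ResU D u"
    by (rule mon_fun[OF assms(1)])
  show ?thesis using u.mult_natural[of f _ _ g] assms by (simp add: hom_def)
qed

lemma ResU_simps [simp]:
  assumes "small_fun S u"
  shows "ResU D u \<in> Arr (DCat D (Src u))" "Dom (DCat D (Src u)) (ResU D u) = TU (Mon D (Src u))"
    "Cod (DCat D (Src u)) (ResU D u) = reO D u (TU (Mon D (Tgt u)))"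
    "ResU D u \<in> isos (DCat D (Src u)) (TU (Mon D (Src u))) (reO D u (TU (Mon D (Tgt u))))"
proof -
  interpret u: strong_monoidal_functor "DFun D u" "Mon D (Tgt u)" "Mon D (Src u)" "ResT D u" "ResU D u"
    by (rule mon_fun[OF assms(1)])
  show "ResU D u \<in> isos (DCat D (Src u)) (TU (Mon D (Src u))) (reO D u (TU (Mon D (Tgt u))))"
    using u.unit_iso assms by simp
  then show "ResU D u \<in> Arr (DCat D (Src u))" "Dom (DCat D (Src u)) (ResU D u) = TU (Mon D (Src u))"
    "Cod (DCat D (Src u)) (ResU D u) = reO D u (TU (Mon D (Tgt u)))"
    by (simp_all add: isos_def hom_def)
qed

text \<open>
  The product of the fibres, made into an operation on arrows over a common functor \<open>u\<close> by means of the strong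
  monoidal structure \<open>u\<^sup>* X \<otimes> u\<^sup>* Y \<cong> u\<^sup>* (X \<otimes> Y)\<close>.
\<close>

definition tens :: "('a, 'o, 'm) over_arr \<Rightarrow> ('a, 'o, 'm) over_arr \<Rightarrow> ('a, 'o, 'm) over_arr"
    (infixr "\<otimes>\<^sub>t" 75) where
  "s \<otimes>\<^sub>t t = (if arr s \<and> arr t \<and> base s = base t then
     Over (base s) (ResT D (base s) (tgt s) (tgt t) \<cdot>\<^bsub>DCat D (Src (base s))\<^esub>
       TA (Mon D (Src (base s))) (fib s) (fib t)) (TO (Mon D (Tgt (base s))) (tgt s) (tgt t))
     else No_arr)"

definition tens_ob :: "'a scat \<times> 'o \<Rightarrow> 'a scat \<times> 'o \<Rightarrow> 'a scat \<times> 'o" where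
  "tens_ob P Q = (fst P, TO (Mon D (fst P)) (snd P) (snd Q))"

lemma tens_ob_Pair [simp]: "tens_ob (A, X) (A', Y) = (A, TO (Mon D A) X Y)"
  by (simp add: tens_ob_def)

lemma arr_props:
  assumes "arr s"
  shows "small_fun S (base s)" "tgt s \<in> Ob (DCat D (Tgt (base s)))" "fib s \<in> Arr (DCat D (Src (base s)))"
    "Cod (DCat D (Src (base s))) (fib s) = reO D (base s) (tgt s)"
  using assms by (auto elim!: arrE)

lemma tens_simps [simp]:
  assumes "arr s" "arr t" "base s = base t"
  shows "arr (s \<otimes>\<^sub>t t)" "base (s \<otimes>\<^sub>t t) = base t" "dm (s \<otimes>\<^sub>t t) = tens_ob (dm s) (dm t)"
    "cd (s \<otimes>\<^sub>t t) = tens_ob (cd s) (cd t)"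
  using arr_props[OF assms(1)] arr_props[OF assms(2)] assms
  by (simp_all add: tens_def tens_ob_def dm_def cd_def)

text \<open>
  Functoriality over composable functors combines three things: functoriality of the product, naturality
  of \<open>ResT\<close>, and its compatibility with \<open>(v u)\<^sup>* = u\<^sup>* v\<^sup>*\<close>.
\<close>

lemma tens_comp:
  assumes "arr s" "arr t" "arr s'" "arr t'" "base s = base t" "base s' = base t'"
    "cd s = dm s'" "cd t = dm t'"
  shows "(s' \<star> s) \<otimes>\<^sub>t (t' \<star> t) = (s' \<otimes>\<^sub>t t') \<star> (s \<otimes>\<^sub>t t)"
proof -
  define u v A f g f' g' X Y Z W where d: "u = base t" "v = base t'" "A = DCat D (Src u)"
    "f = fib s" "g = fib t" "f' = fib s'" "g' = fib t'" "X = tgt s" "Y = tgt t" "Z = tgt s'" "W = tgt t'"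
  have uv: "small_fun S u" "small_fun S v" "Tgt u = Src v"
    using assms cd_dm_base(1)[OF assms(8)] by (simp_all add: d)
  note ps = arr_props[OF assms(1)] arr_props[OF assms(2)] arr_props[OF assms(3)] arr_props[OF assms(4)]
  have f: "f \<in> Arr A" "Cod A f = reO D u X" "X \<in> Ob (DCat D (Src v))"
    "g \<in> Arr A" "Cod A g = reO D u Y" "Y \<in> Ob (DCat D (Src v))"
    and f': "f' \<in> Arr (DCat D (Src v))" "Cod (DCat D (Src v)) f' = reO D v Z" "Z \<in> Ob (DCat D (Tgt v))"
      "Dom (DCat D (Src v)) f' = X"
      "g' \<in> Arr (DCat D (Src v))" "Cod (DCat D (Src v)) g' = reO D v W" "W \<in> Ob (DCat D (Tgt v))"
      "Dom (DCat D (Src v)) g' = Y"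
    using ps assms(5-8) uv by (simp_all add: d cd_def dm_def)
  note res = D_res[OF uv(1), unfolded uv(3), folded d(3)]
  have sA: "small_cat S (Src u)" using uv by simp
  note tA = tensor_simps[OF sA, folded d(3)] and tu = ResT_simps[OF uv(1), unfolded uv(3), folded d(3)]
    and Dc = D_comp[OF sA, folded d(3)]
  have eq: "(s' \<star> s) = Over (v \<odot> u) (reA D u f' \<cdot>\<^bsub>A\<^esub> f) Z"
    "(t' \<star> t) = Over (v \<odot> u) (reA D u g' \<cdot>\<^bsub>A\<^esub> g) W"
    using assms by (simp_all add: cmp_def d)
  have "(s' \<star> s) \<otimes>\<^sub>t (t' \<star> t) = Over (v \<odot> u) (ResT D (v \<odot> u) Z W \<cdot>\<^bsub>A\<^esub>
      TA (Mon D (Src u)) (reA D u f' \<cdot>\<^bsub>A\<^esub> f) (reA D u g' \<cdot>\<^bsub>A\<^esub> g)) (TO (Mon D (Tgt v)) Z W)"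
    using assms by (simp add: tens_def) (simp add: eq d)
  moreover have "(s' \<otimes>\<^sub>t t') \<star> (s \<otimes>\<^sub>t t) = Over (v \<odot> u)
      (reA D u (ResT D v Z W \<cdot>\<^bsub>DCat D (Src v)\<^esub> TA (Mon D (Src v)) f' g')
        \<cdot>\<^bsub>A\<^esub> (ResT D u X Y \<cdot>\<^bsub>A\<^esub> TA (Mon D (Src u)) f g)) (TO (Mon D (Tgt v)) Z W)"
  proof -
    have "arr (s \<otimes>\<^sub>t t) \<and> arr (s' \<otimes>\<^sub>t t') \<and> cd (s \<otimes>\<^sub>t t) = dm (s' \<otimes>\<^sub>t t')" using assms by simp
    moreover have "s \<otimes>\<^sub>t t = Over u (ResT D u X Y \<cdot>\<^bsub>A\<^esub> TA (Mon D (Src u)) f g)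
        (TO (Mon D (Tgt u)) X Y)"
      "s' \<otimes>\<^sub>t t' = Over v (ResT D v Z W \<cdot>\<^bsub>DCat D (Src v)\<^esub> TA (Mon D (Src v)) f' g')
        (TO (Mon D (Tgt v)) Z W)"
      using assms by (simp_all add: tens_def d)
    ultimately show ?thesis by (simp only: cmp_def if_True simp_thms over_arr.sel d(3))
  qed
  moreover have "ResT D (v \<odot> u) Z W \<cdot>\<^bsub>A\<^esub>
      TA (Mon D (Src u)) (reA D u f' \<cdot>\<^bsub>A\<^esub> f) (reA D u g' \<cdot>\<^bsub>A\<^esub> g)
    = reA D u (ResT D v Z W \<cdot>\<^bsub>DCat D (Src v)\<^esub> TA (Mon D (Src v)) f' g')
        \<cdot>\<^bsub>A\<^esub> (ResT D u X Y \<cdot>\<^bsub>A\<^esub> TA (Mon D (Src u)) f g)"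
  proof -
    have "ResT D (v \<odot> u) Z W \<cdot>\<^bsub>A\<^esub>
        TA (Mon D (Src u)) (reA D u f' \<cdot>\<^bsub>A\<^esub> f) (reA D u g' \<cdot>\<^bsub>A\<^esub> g)
      = (reA D u (ResT D v Z W) \<cdot>\<^bsub>A\<^esub> ResT D u (reO D v Z) (reO D v W))
        \<cdot>\<^bsub>A\<^esub> (TA (Mon D (Src u)) (reA D u f') (reA D u g') \<cdot>\<^bsub>A\<^esub> TA (Mon D (Src u)) f g)"
      using mult_comp[OF uv f'(3) f'(7)] tensor_comp'[of "Src u" f "reA D u f'" g "reA D u g'"]
        f f' res uv by (simp add: d(3))
    also have "\<dots> = reA D u (ResT D v Z W) \<cdot>\<^bsub>A\<^esub> ((ResT D u (reO D v Z) (reO D v W)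
        \<cdot>\<^bsub>A\<^esub> TA (Mon D (Src u)) (reA D u f') (reA D u g')) \<cdot>\<^bsub>A\<^esub> TA (Mon D (Src u)) f g)"
      using f f' res uv tA tu Dc by (simp add: D_assoc[OF sA, folded d(3)])
    also have "ResT D u (reO D v Z) (reO D v W) \<cdot>\<^bsub>A\<^esub> TA (Mon D (Src u)) (reA D u f') (reA D u g')
      = reA D u (TA (Mon D (Src v)) f' g') \<cdot>\<^bsub>A\<^esub> ResT D u X Y"
      using ResT_natural[OF uv(1), of f' g'] f' uv by (simp add: d(3))
    also have "reA D u (ResT D v Z W) \<cdot>\<^bsub>A\<^esub> ((reA D u (TA (Mon D (Src v)) f' g') \<cdot>\<^bsub>A\<^esub> ResT D u X Y)
        \<cdot>\<^bsub>A\<^esub> TA (Mon D (Src u)) f g)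
      = reA D u (ResT D v Z W \<cdot>\<^bsub>DCat D (Src v)\<^esub> TA (Mon D (Src v)) f' g')
        \<cdot>\<^bsub>A\<^esub> (ResT D u X Y \<cdot>\<^bsub>A\<^esub> TA (Mon D (Src u)) f g)"
      using f f' res uv tA tu Dc by (simp add: D_assoc[OF sA, folded d(3)])
    finally show ?thesis .
  qed
  ultimately show ?thesis by simp
qed

lemma tens_vert:
  assumes "small_cat S A" "f \<in> Arr (DCat D A)" "g \<in> Arr (DCat D A)"
  shows "vert A f \<otimes>\<^sub>t vert A g = vert A (TA (Mon D A) f g)"
  using assms by (simp add: tens_def) (simp add: vert_def mult_id)

lemma tens_cart:
  assumes "small_fun S u" "X \<in> Ob (DCat D (Tgt u))" "Y \<in> Ob (DCat D (Tgt u))"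
  shows "cart u X \<otimes>\<^sub>t cart u Y = cart u (TO (Mon D (Tgt u)) X Y) \<star> vert (Src u) (ResT D u X Y)"
proof -
  have "cart u X \<otimes>\<^sub>t cart u Y = Over u (ResT D u X Y) (TO (Mon D (Tgt u)) X Y)"
    using assms by (simp add: tens_def) (simp add: cart_def)
  then show ?thesis using assms by (simp add: Over_eq_cart_vert)
qed

lemma tens_ide [simp]:
  assumes "small_cat S A" "X \<in> Ob (DCat D A)" "Y \<in> Ob (DCat D A)"
  shows "ide (A, X) \<otimes>\<^sub>t ide (A, Y) = ide (A, TO (Mon D A) X Y)"
  using tens_vert[of A "Idn (DCat D A) X" "Idn (DCat D A) Y"] assms by simp

lemma TAs_iso:
  "\<lbrakk>small_cat S A; X \<in> Ob (DCat D A); Y \<in> Ob (DCat D A); Z \<in> Ob (DCat D A)\<rbrakk> \<Longrightarrow>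
    TAs (Mon D A) X Y Z \<in> isos (DCat D A) (TO (Mon D A) (TO (Mon D A) X Y) Z)
      (TO (Mon D A) X (TO (Mon D A) Y Z))"
  by (rule monoidal_category.assoc_iso[OF mon_cat])

lemma TAs_simps [simp]:
  assumes "small_cat S A" "X \<in> Ob (DCat D A)" "Y \<in> Ob (DCat D A)" "Z \<in> Ob (DCat D A)"
  shows "TAs (Mon D A) X Y Z \<in> Arr (DCat D A)"
    "Dom (DCat D A) (TAs (Mon D A) X Y Z) = TO (Mon D A) (TO (Mon D A) X Y) Z"
    "Cod (DCat D A) (TAs (Mon D A) X Y Z) = TO (Mon D A) X (TO (Mon D A) Y Z)"
  using TAs_iso[OF assms] by (auto simp: isos_def hom_def)

lemma TL_simps [simp]:
  assumes "small_cat S A" "X \<in> Ob (DCat D A)"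
  shows "TL (Mon D A) X \<in> Arr (DCat D A)" "Dom (DCat D A) (TL (Mon D A) X) = TO (Mon D A) (TU (Mon D A)) X"
    "Cod (DCat D A) (TL (Mon D A) X) = X"
  using monoidal_category.lunit_iso[OF mon_cat, OF assms] by (auto simp: isos_def hom_def)

lemma TR_simps [simp]:
  assumes "small_cat S A" "X \<in> Ob (DCat D A)"
  shows "TR (Mon D A) X \<in> Arr (DCat D A)" "Dom (DCat D A) (TR (Mon D A) X) = TO (Mon D A) X (TU (Mon D A))"
    "Cod (DCat D A) (TR (Mon D A) X) = X"
  using monoidal_category.runit_iso[OF mon_cat, OF assms] by (auto simp: isos_def hom_def)

lemma arr_cart_vert:
  assumes "arr s" "base s = u" "dm s = (A, X)" "cd s = (B, Y)"
  obtains f where "f \<in> Arr (DCat D A)" "Dom (DCat D A) f = X" "Cod (DCat D A) f = reO D u Y"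
    "s = cart u Y \<star> vert A f" "Y \<in> Ob (DCat D B)"
proof -
  note p = arr_props[OF assms(1)]
  have c: "Src u = A" "Tgt u = B" "tgt s = Y" "Dom (DCat D A) (fib s) = X"
    using assms by (auto simp: dm_def cd_def)
  have "s = Over (base s) (fib s) (tgt s)" using assms by (cases s) auto
  then have "s = cart u Y \<star> vert A (fib s)"
    using Over_eq_cart_vert[OF p] by (simp only: assms c)
  then show ?thesis using that[of "fib s"] p by (simp add: assms c)
qed

text \<open>
  The associators are compatible with \<open>u\<^sup>*\<close> because \<open>u\<^sup>*\<close> is strong monoidal, and natural in each fibre. In
  the total category both facts become one naturality statement.
\<close>

lemma tens_assoc_natural:
  assumes s: "arr s" "base s = u" "dm s = (A, X)" "cd s = (B, X')"
    and t: "arr t" "base t = u" "dm t = (A, Y)" "cd t = (B, Y')"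
    and r: "arr r" "base r = u" "dm r = (A, Z)" "cd r = (B, Z')"
  shows "vert B (TAs (Mon D B) X' Y' Z') \<star> ((s \<otimes>\<^sub>t t) \<otimes>\<^sub>t r)
    = (s \<otimes>\<^sub>t (t \<otimes>\<^sub>t r)) \<star> vert A (TAs (Mon D A) X Y Z)"
proof -
  have u: "small_fun S u" "Src u = A" "Tgt u = B"
    using arr_base[OF s(1)] cd_dm_base(5)[OF s(3)] cd_dm_base(6)[OF s(4)] s(2) by simp_all
  then have AB [simp]: "small_cat S A" "small_cat S B" using small_fun_cat by blast+
  obtain f where f: "f \<in> Arr (DCat D A)" "Dom (DCat D A) f = X" "Cod (DCat D A) f = reO D u X'"
    "s = cart u X' \<star> vert A f" "X' \<in> Ob (DCat D B)"
    by (rule arr_cart_vert[OF s])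
  obtain g where g: "g \<in> Arr (DCat D A)" "Dom (DCat D A) g = Y" "Cod (DCat D A) g = reO D u Y'"
    "t = cart u Y' \<star> vert A g" "Y' \<in> Ob (DCat D B)"
    by (rule arr_cart_vert[OF t])
  obtain h where h: "h \<in> Arr (DCat D A)" "Dom (DCat D A) h = Z" "Cod (DCat D A) h = reO D u Z'"
    "r = cart u Z' \<star> vert A h" "Z' \<in> Ob (DCat D B)"
    by (rule arr_cart_vert[OF r])
  define M N where MN: "M = Mon D A" "N = Mon D B"
  interpret A: monoidal_category "DCat D A" M unfolding MN by (rule mon_cat) simp
  interpret u: strong_monoidal_functor "DFun D u" N M "ResT D u" "ResU D u"
    using mon_fun[OF u(1)] unfolding MN u .
  note Du = D_res[OF u(1), unfolded u] and Tu = ResT_simps[OF u(1), unfolded u]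
  define X1 Y1 Z1 where XYZ: "X1 = reO D u X'" "Y1 = reO D u Y'" "Z1 = reO D u Z'"
  have o: "X1 \<in> Ob (DCat D A)" "Y1 \<in> Ob (DCat D A)" "Z1 \<in> Ob (DCat D A)"
    using Du f g h by (simp_all add: XYZ)
  have c: "arr (cart u W)" "dm (cart u W) = (A, reO D u W)" "cd (cart u W) = (B, W)"
    if "W \<in> Ob (DCat D B)" for W using that u by simp_all
  have tc: "cart u V \<otimes>\<^sub>t cart u W = cart u (TO N V W) \<star> vert A (ResT D u V W)"
    if "V \<in> Ob (DCat D B)" "W \<in> Ob (DCat D B)" for V W
    using tens_cart[OF u(1), of V W] that u by (simp add: MN)
  have cc: "(cart u X' \<otimes>\<^sub>t cart u Y') \<otimes>\<^sub>t cart u Z'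
    = cart u (TO N (TO N X' Y') Z') \<star> vert A (ResT D u (TO N X' Y') Z')
      \<star> vert A (TA M (ResT D u X' Y') (Idn (DCat D A) Z1))"
  proof -
    have "(cart u X' \<otimes>\<^sub>t cart u Y') \<otimes>\<^sub>t cart u Z'
      = (cart u (TO N X' Y') \<star> vert A (ResT D u X' Y')) \<otimes>\<^sub>t (cart u Z' \<star> vert A (Idn (DCat D A) Z1))"
      using f g h c o tc by (simp add: XYZ)
    also have "\<dots> = (cart u (TO N X' Y') \<otimes>\<^sub>t cart u Z')
        \<star> (vert A (ResT D u X' Y') \<otimes>\<^sub>t vert A (Idn (DCat D A) Z1))"
      using f g h c o Tu by (intro tens_comp) (simp_all add: MN, simp_all add: XYZ)
    finally show ?thesis
      using tc[of "TO N X' Y'" Z'] f g h o Tu by (simp add: MN cmp_assoc tens_vert del: vert_Idn)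
  qed
  have cc': "cart u X' \<otimes>\<^sub>t (cart u Y' \<otimes>\<^sub>t cart u Z')
    = cart u (TO N X' (TO N Y' Z')) \<star> vert A (ResT D u X' (TO N Y' Z'))
      \<star> vert A (TA M (Idn (DCat D A) X1) (ResT D u Y' Z'))"
  proof -
    have "cart u X' \<otimes>\<^sub>t (cart u Y' \<otimes>\<^sub>t cart u Z')
      = (cart u X' \<star> vert A (Idn (DCat D A) X1)) \<otimes>\<^sub>t (cart u (TO N Y' Z') \<star> vert A (ResT D u Y' Z'))"
      using f g h c o tc by (simp add: XYZ)
    also have "\<dots> = (cart u X' \<otimes>\<^sub>t cart u (TO N Y' Z'))
        \<star> (vert A (Idn (DCat D A) X1) \<otimes>\<^sub>t vert A (ResT D u Y' Z'))"
      using f g h c o Tu by (intro tens_comp) (simp_all add: MN, simp_all add: XYZ)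
    finally show ?thesis
      using tc[of X' "TO N Y' Z'"] f g h o Tu by (simp add: MN cmp_assoc tens_vert del: vert_Idn)
  qed
  have vA: "vert A (p \<cdot>\<^bsub>DCat D A\<^esub> q) = vert A p \<star> vert A q"
    if "p \<in> Arr (DCat D A)" "q \<in> Arr (DCat D A)" "Cod (DCat D A) q = Dom (DCat D A) p" for p q
    using that by (simp add: vert_comp)
  have fo: "X \<in> Ob (DCat D A)" "Y \<in> Ob (DCat D A)" "Z \<in> Ob (DCat D A)"
    using f g h D_cat(1)[OF AB(1)] by auto
  have coh: "vert A (reA D u (TAs N X' Y' Z')) \<star> vert A (ResT D u (TO N X' Y') Z')
      \<star> vert A (TA M (ResT D u X' Y') (Idn (DCat D A) Z1))
    = vert A (ResT D u X' (TO N Y' Z')) \<star> vert A (TA M (Idn (DCat D A) X1) (ResT D u Y' Z'))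
      \<star> vert A (TAs M X1 Y1 Z1)"
    using u.mult_assoc[of X' Y' Z'] f g h o Tu Du u
    by (simp add: MN XYZ vA[symmetric])
  have nat: "vert A (TAs M X1 Y1 Z1) \<star> vert A (TA M (TA M f g) h)
      = vert A (TA M f (TA M g h)) \<star> vert A (TAs M X Y Z)"
    using A.assoc_natural[of f X X1 g Y Y1 h Z Z1] f g h o fo
    by (simp add: MN XYZ hom_def vA[symmetric])
  have 1: "(s \<otimes>\<^sub>t t) \<otimes>\<^sub>t r = ((cart u X' \<otimes>\<^sub>t cart u Y') \<otimes>\<^sub>t cart u Z') \<star> vert A (TA M (TA M f g) h)"
    unfolding f(4) g(4) h(4) using f g h c
    by (subst tens_comp, simp_all add: tens_vert MN)+
  have 2: "s \<otimes>\<^sub>t (t \<otimes>\<^sub>t r) = (cart u X' \<otimes>\<^sub>t (cart u Y' \<otimes>\<^sub>t cart u Z')) \<star> vert A (TA M f (TA M g h))"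
    unfolding f(4) g(4) h(4) using f g h c
    by (subst tens_comp, simp_all add: tens_vert MN)+
  have 3: "vert B (TAs N X' Y' Z') \<star> cart u (TO N (TO N X' Y') Z')
    = cart u (TO N X' (TO N Y' Z')) \<star> vert A (reA D u (TAs N X' Y' Z'))"
    using cart_natural[OF u(1), of "TAs N X' Y' Z'"] f g h u by (simp add: MN)
  show ?thesis
    unfolding 1 2 cc cc' MN[symmetric]
    using cmp_reassoc[OF 3] cmp_reassoc[OF coh[unfolded cmp_assoc[symmetric]]] cmp_reassoc[OF coh] nat
    by (simp add: cmp_assoc)
qed

text \<open>
  The comparison \<open>1 \<cong> u\<^sup>* 1\<close>, as an arrow over \<open>u\<close>: the nullary case of \<open>tens\<close>.
\<close>

definition unit_arr :: "'a sfun \<Rightarrow> ('a, 'o, 'm) over_arr" where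
  "unit_arr u = Over u (ResU D u) (TU (Mon D (Tgt u)))"

lemma unit_arr_simps [simp]:
  assumes "small_fun S u"
  shows "arr (unit_arr u)" "base (unit_arr u) = u" "dm (unit_arr u) = (Src u, TU (Mon D (Src u)))"
    "cd (unit_arr u) = (Tgt u, TU (Mon D (Tgt u)))"
  using assms by (simp_all add: unit_arr_def)

lemma unit_arr_eq:
  "small_fun S u \<Longrightarrow> unit_arr u = cart u (TU (Mon D (Tgt u))) \<star> vert (Src u) (ResU D u)"
  by (simp add: unit_arr_def Over_eq_cart_vert)

lemma unit_arr_comp:
  assumes "small_fun S u" "small_fun S v" "Tgt u = Src v"
  shows "unit_arr v \<star> unit_arr u = unit_arr (v \<odot> u)"
proof -
  have "arr (unit_arr u) \<and> arr (unit_arr v) \<and> cd (unit_arr u) = dm (unit_arr v)" using assms by simp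
  then show ?thesis unfolding cmp_def using unit_comp[OF assms] by (simp add: unit_arr_def)
qed

lemma tens_lunit_natural:
  assumes s: "arr s" "base s = u" "dm s = (A, X)" "cd s = (B, X')"
  shows "vert B (TL (Mon D B) X') \<star> (unit_arr u \<otimes>\<^sub>t s) = s \<star> vert A (TL (Mon D A) X)"
    and "vert B (TR (Mon D B) X') \<star> (s \<otimes>\<^sub>t unit_arr u) = s \<star> vert A (TR (Mon D A) X)"
proof -
  have u: "small_fun S u" "Src u = A" "Tgt u = B"
    using arr_base[OF s(1)] cd_dm_base(5)[OF s(3)] cd_dm_base(6)[OF s(4)] s(2) by simp_all
  then have AB [simp]: "small_cat S A" "small_cat S B" using small_fun_cat by blast+
  obtain f where f: "f \<in> Arr (DCat D A)" "Dom (DCat D A) f = X" "Cod (DCat D A) f = reO D u X'"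
    "s = cart u X' \<star> vert A f" "X' \<in> Ob (DCat D B)"
    by (rule arr_cart_vert[OF s])
  define M N where MN: "M = Mon D A" "N = Mon D B"
  interpret A: monoidal_category "DCat D A" M unfolding MN by (rule mon_cat) simp
  interpret u: strong_monoidal_functor "DFun D u" N M "ResT D u" "ResU D u"
    using mon_fun[OF u(1)] unfolding MN u .
  note Du = D_res[OF u(1), unfolded u] and Tu = ResT_simps[OF u(1), unfolded u]
    and Uu = ResU_simps[OF u(1), unfolded u]
  define X1 where X1: "X1 = reO D u X'"
  have o: "X1 \<in> Ob (DCat D A)" "X \<in> Ob (DCat D A)"
    using Du f D_cat(1)[OF AB(1) f(1)] by (simp_all add: X1)
  have c: "arr (cart u W)" "dm (cart u W) = (A, reO D u W)" "cd (cart u W) = (B, W)"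
    if "W \<in> Ob (DCat D B)" for W using that u by simp_all
  have tc: "cart u V \<otimes>\<^sub>t cart u W = cart u (TO N V W) \<star> vert A (ResT D u V W)"
    if "V \<in> Ob (DCat D B)" "W \<in> Ob (DCat D B)" for V W
    using tens_cart[OF u(1), of V W] that u by (simp add: MN)
  have vA: "vert A (p \<cdot>\<^bsub>DCat D A\<^esub> q) = vert A p \<star> vert A q"
    if "p \<in> Arr (DCat D A)" "q \<in> Arr (DCat D A)" "Cod (DCat D A) q = Dom (DCat D A) p" for p q
    using that by (simp add: vert_comp)
  have U: "unit_arr u = cart u (TU N) \<star> vert A (ResU D u)" using unit_arr_eq[OF u(1)] u by (simp add: MN)
  have s': "s = cart u X' \<star> vert A (Idn (DCat D A) X1) \<star> vert A f" using f o by (simp add: X1)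
  have U': "unit_arr u = cart u (TU N) \<star> vert A (ResU D u) \<star> vert A (Idn (DCat D A) (TU M))"
    using U u Uu by (simp add: MN)
  show "vert B (TL (Mon D B) X') \<star> (unit_arr u \<otimes>\<^sub>t s) = s \<star> vert A (TL (Mon D A) X)"
  proof -
    have 1: "unit_arr u \<otimes>\<^sub>t s = cart u (TO N (TU N) X') \<star> vert A (ResT D u (TU N) X')
        \<star> vert A (TA M (ResU D u) (Idn (DCat D A) X1)) \<star> vert A (TA M (Idn (DCat D A) (TU M)) f)"
      unfolding s' U' using f c Uu o Tu
      by (subst tens_comp, simp_all add: tens_vert MN X1 tc[unfolded MN] cmp_assoc del: vert_Idn)+
    have 2: "vert B (TL N X') \<star> cart u (TO N (TU N) X') = cart u X' \<star> vert A (reA D u (TL N X'))"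
      using cart_natural[OF u(1), of "TL N X'"] f u by (simp add: MN)
    have 3: "vert A (reA D u (TL N X')) \<star> vert A (ResT D u (TU N) X')
        \<star> vert A (TA M (ResU D u) (Idn (DCat D A) X1)) = vert A (TL M X1)"
      using u.mult_lunit[of X'] f o Tu Du Uu u by (simp add: MN X1 vA[symmetric])
    have 4: "vert A (TL M X1) \<star> vert A (TA M (Idn (DCat D A) (TU M)) f) = vert A f \<star> vert A (TL M X)"
      using A.lunit_natural[of f X X1] f o by (simp add: MN X1 hom_def vA[symmetric])
    show ?thesis
      unfolding 1 MN[symmetric] using cmp_reassoc[OF 2] cmp_reassoc[OF 3] 4 f
      by (simp add: cmp_assoc)
  qed
  show "vert B (TR (Mon D B) X') \<star> (s \<otimes>\<^sub>t unit_arr u) = s \<star> vert A (TR (Mon D A) X)"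
  proof -
    have 1: "s \<otimes>\<^sub>t unit_arr u = cart u (TO N X' (TU N)) \<star> vert A (ResT D u X' (TU N))
        \<star> vert A (TA M (Idn (DCat D A) X1) (ResU D u)) \<star> vert A (TA M f (Idn (DCat D A) (TU M)))"
      unfolding s' U' using f c Uu o Tu
      by (subst tens_comp, simp_all add: tens_vert MN X1 tc[unfolded MN] cmp_assoc del: vert_Idn)+
    have 2: "vert B (TR N X') \<star> cart u (TO N X' (TU N)) = cart u X' \<star> vert A (reA D u (TR N X'))"
      using cart_natural[OF u(1), of "TR N X'"] f u by (simp add: MN)
    have 3: "vert A (reA D u (TR N X')) \<star> vert A (ResT D u X' (TU N))
        \<star> vert A (TA M (Idn (DCat D A) X1) (ResU D u)) = vert A (TR M X1)"
      using u.mult_runit[of X'] f o Tu Du Uu u by (simp add: MN X1 vA[symmetric])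
    have 4: "vert A (TR M X1) \<star> vert A (TA M f (Idn (DCat D A) (TU M))) = vert A f \<star> vert A (TR M X)"
      using A.runit_natural[of f X X1] f o by (simp add: MN X1 hom_def vA[symmetric])
    show ?thesis
      unfolding 1 MN[symmetric] using cmp_reassoc[OF 2] cmp_reassoc[OF 3] 4 f
      by (simp add: cmp_assoc)
  qed
qed

section \<open>The external product as a functor on the total category\<close>

definition square :: "'a sfun \<Rightarrow> 'a sfun \<Rightarrow> 'a sfun \<Rightarrow> 'a sfun \<Rightarrow> bool" where
  "square q q' w u \<longleftrightarrow> small_fun S q \<and> small_fun S q' \<and> small_fun S w \<and> small_fun S u
    \<and> Src q = Src w \<and> Tgt q = Src u \<and> Src q' = Tgt w \<and> Tgt q' = Tgt u \<and> q' \<odot> w = u \<odot> q"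

text \<open>
  Base change of an arrow \<open>s\<close> over \<open>u\<close> along a commutative square \<open>q' w = u q\<close>. By \<open>pull_eqI\<close> it is the unique arrow over \<open>w\<close>
  that makes the square with the cartesian arrows over \<open>q\<close> and \<open>q'\<close> commute, and its functoriality follows
  from this characterisation.
\<close>

definition pull :: "'a sfun \<Rightarrow> 'a sfun \<Rightarrow> 'a sfun \<Rightarrow> ('a, 'o, 'm) over_arr \<Rightarrow> ('a, 'o, 'm) over_arr"
  where "pull q q' w s = Over w (reA D q (fib s)) (reO D q' (tgt s))"

definition pull_ob :: "'a sfun \<Rightarrow> 'a scat \<times> 'o \<Rightarrow> 'a scat \<times> 'o" where
  "pull_ob q P = (Src q, reO D q (snd P))"

lemma pull_ob_Pair [simp]: "pull_ob q (A, X) = (Src q, reO D q X)"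
  by (simp add: pull_ob_def)

lemma square_res:
  assumes "square q q' w u" "Y \<in> Ob (DCat D (Tgt u))"
  shows "reO D w (reO D q' Y) = reO D q (reO D u Y)"
proof -
  have sq: "small_fun S q" "small_fun S q'" "small_fun S w" "small_fun S u" "Tgt w = Src q'"
    "Tgt q = Src u" "Tgt q' = Tgt u" "q' \<odot> w = u \<odot> q"
    using assms(1) by (simp_all add: square_def)
  have "reO D w (reO D q' Y) = reO D (q' \<odot> w) Y" using sq(1-7) assms(2) by simp
  also have "\<dots> = reO D (u \<odot> q) Y" by (simp only: sq(8))
  also have "\<dots> = reO D q (reO D u Y)" using sq(1-7) assms(2) by simp
  finally show ?thesis .
qed

lemma pull_simps:
  assumes "arr s" "square q q' w (base s)"
  shows "arr (pull q q' w s)" "base (pull q q' w s) = w"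
    "dm (pull q q' w s) = pull_ob q (dm s)" "cd (pull q q' w s) = pull_ob q' (cd s)"
    "cart q' (snd (cd s)) \<star> pull q q' w s = s \<star> cart q (snd (dm s))"
proof -
  note p = arr_props[OF assms(1)]
  have sq: "small_fun S q" "small_fun S q'" "small_fun S w" "Src w = Src q" "Tgt q = Src (base s)"
    "Src q' = Tgt w" "Tgt q' = Tgt (base s)" "q' \<odot> w = base s \<odot> q"
    using assms by (simp_all add: square_def)
  have r: "reA D q (fib s) \<in> Arr (DCat D (Src q))"
    "Dom (DCat D (Src q)) (reA D q (fib s)) = reO D q (Dom (DCat D (Src (base s))) (fib s))"
    "Cod (DCat D (Src q)) (reA D q (fib s)) = reO D w (reO D q' (tgt s))"
    using D_res(2-4)[OF sq(1), unfolded sq(5), OF p(3)] p square_res[OF assms(2)] by simp_all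
  have q't: "reO D q' (tgt s) \<in> Ob (DCat D (Tgt w))" using sq p D_res(1)[OF sq(2), of "tgt s"] by simp
  show a: "arr (pull q q' w s)" "base (pull q q' w s) = w"
    "dm (pull q q' w s) = pull_ob q (dm s)" "cd (pull q q' w s) = pull_ob q' (cd s)"
    using r sq p q't by (simp_all add: pull_def pull_ob_def dm_def cd_def)
  have ss: "snd (cd s) = tgt s" "snd (dm s) = Dom (DCat D (Src (base s))) (fib s)"
    by (simp_all add: cd_def dm_def)
  have i: "reA D w (Idn (DCat D (Tgt w)) (reO D q' (tgt s))) = Idn (DCat D (Src q)) (reO D w (reO D q' (tgt s)))"
    using D_res(5)[OF sq(3) q't] sq by simp
  have "snd (cd s) \<in> Ob (DCat D (Tgt q'))" "snd (dm s) \<in> Ob (DCat D (Tgt q))"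
    using p sq by (simp_all add: ss)
  then have c: "arr (cart q' (snd (cd s)))" "dm (cart q' (snd (cd s))) = pull_ob q' (cd s)"
    "arr (cart q (snd (dm s)))" "cd (cart q (snd (dm s))) = dm s"
    using sq by (simp_all add: pull_ob_def prod_eq_iff)
  have "cart q' (snd (cd s)) \<star> pull q q' w s = Over (q' \<odot> w) (reA D q (fib s)) (tgt s)"
    unfolding cmp_def using a c r sq i p by (simp add: cart_def pull_def ss)
  moreover have "s \<star> cart q (snd (dm s)) = Over (base s \<odot> q) (reA D q (fib s)) (tgt s)"
    unfolding cmp_def using assms(1) c r sq p by (simp add: cart_def ss)
  ultimately show "cart q' (snd (cd s)) \<star> pull q q' w s = s \<star> cart q (snd (dm s))"
    using sq(8) by simp
qed

lemma pull_eqI: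
  assumes "arr s" "square q q' w (base s)" "arr r" "base r = w" "cd r = pull_ob q' (cd s)"
    and "cart q' (snd (cd s)) \<star> r = s \<star> cart q (snd (dm s))"
  shows "r = pull q q' w s"
proof -
  have "small_fun S q'" "Tgt q' = Tgt (base s)" "snd (cd s) \<in> Ob (DCat D (Tgt (base s)))"
    using assms(1,2) arr_props(2)[OF assms(1)] by (simp_all add: square_def cd_def)
  then show ?thesis
    using assms pull_simps[OF assms(1,2)]
    by (intro cart_cancel[of q' "snd (cd s)" r "pull q q' w s"]) (simp_all add: pull_ob_def)
qed

lemma square_comp:
  "square q q' w u \<Longrightarrow> square q' q'' w' u' \<Longrightarrow> square q q'' (w' \<odot> w) (u' \<odot> u)"
  unfolding square_def
proof (elim conjE, intro conjI)
  assume a: "small_fun S q" "small_fun S q'" "small_fun S q''" "small_fun S w" "small_fun S w'"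
    "Src q = Src w" "Tgt q = Src u" "Src q' = Tgt w" "Tgt q' = Tgt u" "Src q' = Src w'"
    "Tgt q' = Src u'" "Src q'' = Tgt w'" and e: "q' \<odot> w = u \<odot> q" "q'' \<odot> w' = u' \<odot> q'"
  have "q'' \<odot> (w' \<odot> w) = (q'' \<odot> w') \<odot> w" using a by (simp add: small_comp_assoc)
  also have "\<dots> = u' \<odot> (q' \<odot> w)" unfolding e(2) using a by (simp add: small_comp_assoc)
  also have "\<dots> = (u' \<odot> u) \<odot> q" unfolding e(1) using a by (simp add: small_comp_assoc)
  finally show "q'' \<odot> (w' \<odot> w) = (u' \<odot> u) \<odot> q" .
qed simp_all

lemma square_paste:
  "square q q' w u \<Longrightarrow> square r r' x w \<Longrightarrow> square (q \<odot> r) (q' \<odot> r') x u"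
  unfolding square_def
proof (elim conjE, intro conjI)
  assume a: "small_fun S q" "small_fun S r" "small_fun S r'" "small_fun S x" "small_fun S w"
    "Src q = Src w" "Tgt q = Src u" "Src q' = Tgt w" "Tgt q' = Tgt u" "Src r = Src x"
    "Tgt r = Src w" "Src r' = Tgt x" "Tgt r' = Tgt w" and e: "q' \<odot> w = u \<odot> q" "r' \<odot> x = w \<odot> r"
  have "(q' \<odot> r') \<odot> x = q' \<odot> (r' \<odot> x)" using a by (simp add: small_comp_assoc)
  also have "\<dots> = (q' \<odot> w) \<odot> r" unfolding e(2) using a by (simp add: small_comp_assoc)
  also have "\<dots> = u \<odot> (q \<odot> r)" unfolding e(1) using a by (simp add: small_comp_assoc)
  finally show "(q' \<odot> r') \<odot> x = u \<odot> (q \<odot> r)" .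
qed simp_all

lemma pull_comp:
  assumes s: "arr s" "arr s'" "cd s = dm s'" and sq: "square q q' w (base s)" "square q' q'' w' (base s')"
  shows "pull q q'' (w' \<odot> w) (s' \<star> s) = pull q' q'' w' s' \<star> pull q q' w s"
proof (rule pull_eqI[symmetric])
  note 1 = pull_simps[OF s(1) sq(1)] and 2 = pull_simps[OF s(2) sq(2)]
  show "arr (s' \<star> s)" "square q q'' (w' \<odot> w) (base (s' \<star> s))"
    using s square_comp[OF sq] by simp_all
  show "arr (pull q' q'' w' s' \<star> pull q q' w s)" "base (pull q' q'' w' s' \<star> pull q q' w s) = w' \<odot> w"
    "cd (pull q' q'' w' s' \<star> pull q q' w s) = pull_ob q'' (cd (s' \<star> s))"
    using 1 2 s by simp_all
  show "cart q'' (snd (cd (s' \<star> s))) \<star> pull q' q'' w' s' \<star> pull q q' w s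
      = (s' \<star> s) \<star> cart q (snd (dm (s' \<star> s)))"
    using cmp_reassoc[OF 2(5)] 1(5) s by (simp add: cmp_assoc)
qed

lemma pull_pull:
  assumes "arr s" "square q q' w (base s)" "square r r' x w"
  shows "pull r r' x (pull q q' w s) = pull (q \<odot> r) (q' \<odot> r') x s"
proof -
  have "reA D r (reA D q (fib s)) = reA D (q \<odot> r) (fib s)"
    "reO D r' (reO D q' (tgt s)) = reO D (q' \<odot> r') (tgt s)"
    using assms(2,3) arr_props[OF assms(1)] by (simp_all add: square_def)
  then show ?thesis by (simp add: pull_def)
qed

lemma pull_cart:
  assumes "square q q' w u" "Y \<in> Ob (DCat D (Tgt u))"
  shows "pull q q' w (cart u Y) = cart w (reO D q' Y)"
proof -
  have "small_fun S q" "small_fun S u" "Tgt q = Src u" "Src q = Src w"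
    using assms by (simp_all add: square_def)
  moreover from this have "reA D q (Idn (DCat D (Src u)) (reO D u Y)) = Idn (DCat D (Src w)) (reO D q (reO D u Y))"
    using D_res(5)[of q "reO D u Y"] assms by simp
  ultimately show ?thesis
    using square_res[OF assms] by (simp add: pull_def) (simp add: cart_def)
qed

lemma pull_vert:
  assumes "small_fun S q" "f \<in> Arr (DCat D (Tgt q))"
  shows "pull q q (id_fun (Src q)) (vert (Tgt q) f) = vert (Src q) (reA D q f)"
  using assms by (simp add: pull_def vert_def)

text \<open>
  After composition with the cartesian arrow over \<open>q'\<close>, which is cancellable, both sides become
  \<open>(s \<otimes> t) (cart q X \<otimes> cart q Y)\<close>.
\<close>

lemma pull_tens:
  assumes s: "arr s" "dm s = (A, X)" "cd s = (B, X')" and t: "arr t" "dm t = (A, Y)" "cd t = (B, Y')"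
    and st: "base s = base t" and sq: "square q q' w (base t)"
  shows "pull q q' w (s \<otimes>\<^sub>t t) \<star> vert (Src q) (ResT D q X Y)
    = vert (Src q') (ResT D q' X' Y') \<star> (pull q q' w s \<otimes>\<^sub>t pull q q' w t)"
proof -
  have sq': "small_fun S q" "small_fun S q'" "small_fun S w" "Src w = Src q" "Tgt q = Src (base t)"
    "Src q' = Tgt w" "Tgt q' = Tgt (base t)" "q' \<odot> w = base t \<odot> q"
    using sq by (simp_all add: square_def)
  have AB: "Src (base t) = A" "Tgt (base t) = B" using cd_dm_base(5,6) t by blast+
  have O: "X \<in> Ob (DCat D A)" "Y \<in> Ob (DCat D A)" "X' \<in> Ob (DCat D B)" "Y' \<in> Ob (DCat D B)"
    using arr_ob[OF s(1)] arr_ob[OF t(1)] s t by simp_all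
  have c: "small_fun S q" "small_fun S q'" "Tgt q = A" "Tgt q' = B" "Src w = Src q" "Tgt w = Src q'"
    using sq' AB by simp_all
  note ps = pull_simps[OF s(1), of q q' w, unfolded st, OF sq] and pt = pull_simps[OF t(1) sq]
    and pst = pull_simps[of "s \<otimes>\<^sub>t t" q q' w]
  note tq = ResT_simps[OF c(1), unfolded c] and tq' = ResT_simps[OF c(2), unfolded c]
  have a: "arr (s \<otimes>\<^sub>t t)" "square q q' w (base (s \<otimes>\<^sub>t t))" "dm (s \<otimes>\<^sub>t t) = (A, TO (Mon D A) X Y)"
    "cd (s \<otimes>\<^sub>t t) = (B, TO (Mon D B) X' Y')"
    using s t st sq by simp_all
  have sm: "small_cat S A" "small_cat S B" "small_cat S (Src q)" "small_cat S (Src q')"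
    using c small_fun_cat by blast+
  note p3 = pull_simps[OF a(1,2), unfolded a]
  let ?l = "pull q q' w (s \<otimes>\<^sub>t t) \<star> vert (Src q) (ResT D q X Y)"
  let ?r = "vert (Src q') (ResT D q' X' Y') \<star> (pull q q' w s \<otimes>\<^sub>t pull q q' w t)"
  have pq: "arr (pull q q' w s \<otimes>\<^sub>t pull q q' w t)" "base (pull q q' w s \<otimes>\<^sub>t pull q q' w t) = w"
    "dm (pull q q' w s \<otimes>\<^sub>t pull q q' w t) = (Src q, TO (Mon D (Src q)) (reO D q X) (reO D q Y))"
    "cd (pull q q' w s \<otimes>\<^sub>t pull q q' w t) = (Src q', TO (Mon D (Src q')) (reO D q' X') (reO D q' Y'))"
    using ps pt s t by simp_all
  show ?thesis
  proof (rule cart_cancel[of q' "TO (Mon D B) X' Y'"])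
    show "small_fun S q'" by (fact c)
    show "TO (Mon D B) X' Y' \<in> Ob (DCat D (Tgt q'))" using O sm c by simp
    show "arr ?l" "cd ?l = (Src q', reO D q' (TO (Mon D B) X' Y'))" using p3 sm O c tq by simp_all
    show "arr ?r" "cd ?r = (Src q', reO D q' (TO (Mon D B) X' Y'))" using pq sm O c tq' by simp_all
    show "base ?l = base ?r" using p3 pq sm O c tq tq' sq'(3) by simp
    have "cart q' (TO (Mon D B) X' Y') \<star> ?r = (cart q' X' \<otimes>\<^sub>t cart q' Y') \<star> (pull q q' w s \<otimes>\<^sub>t pull q q' w t)"
      using tens_cart[of q' X' Y'] O c by (simp add: cmp_assoc)
    also have "\<dots> = (cart q' X' \<star> pull q q' w s) \<otimes>\<^sub>t (cart q' Y' \<star> pull q q' w t)"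
      using ps pt s t O c by (intro tens_comp[symmetric]) simp_all
    also have "\<dots> = (s \<star> cart q X) \<otimes>\<^sub>t (t \<star> cart q Y)"
      using ps(5) pt(5) s t by simp
    also have "\<dots> = (s \<otimes>\<^sub>t t) \<star> (cart q X \<otimes>\<^sub>t cart q Y)"
      using s t O c st by (intro tens_comp) simp_all
    also have "\<dots> = (s \<otimes>\<^sub>t t) \<star> cart q (TO (Mon D A) X Y) \<star> vert (Src q) (ResT D q X Y)"
      using tens_cart[of q X Y] O c by simp
    also have "\<dots> = cart q' (TO (Mon D B) X' Y') \<star> ?l"
      using p3(5) by (simp flip: cmp_assoc)
    finally show "cart q' (TO (Mon D B) X' Y') \<star> ?l = cart q' (TO (Mon D B) X' Y') \<star> ?r" by simp
  qed
qed

text \<open>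
  The external product \<open>pr1\<^sup>* s \<otimes> pr2\<^sup>* t\<close> on arrows. On vertical arrows it is \<open>extA\<close>, and on cartesian arrows it
  produces \<open>extRes\<close>; so a single functor carries the data of \<open>external D\<close>.
\<close>

definition box :: "('a, 'o, 'm) over_arr \<Rightarrow> ('a, 'o, 'm) over_arr \<Rightarrow> ('a, 'o, 'm) over_arr"
    (infixr "\<boxtimes>" 76) where
  "s \<boxtimes> t = (let w = base s \<otimes>\<^sub>f base t; A = Src (base s); A' = Tgt (base s); B = Src (base t);
      B' = Tgt (base t)
    in pull (pr1 A B) (pr1 A' B') w s \<otimes>\<^sub>t pull (pr2 A B) (pr2 A' B') w t)"

definition box_ob :: "'a scat \<times> 'o \<Rightarrow> 'a scat \<times> 'o \<Rightarrow> 'a scat \<times> 'o" where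
  "box_ob P Q = (fst P \<otimes>\<^sub>c fst Q, extO D (fst P) (fst Q) (snd P) (snd Q))"

lemma box_ob_Pair [simp]: "box_ob (A, X) (B, Y) = (A \<otimes>\<^sub>c B, extO D A B X Y)"
  by (simp add: box_ob_def)

lemma square_pr:
  assumes "small_fun S u" "small_fun S v"
  shows "square (pr1 (Src u) (Src v)) (pr1 (Tgt u) (Tgt v)) (u \<otimes>\<^sub>f v) u"
    "square (pr2 (Src u) (Src v)) (pr2 (Tgt u) (Tgt v)) (u \<otimes>\<^sub>f v) v"
  using assms by (simp_all add: square_def pr_prod_fun)

lemma tens_pull_ob:
  "tens_ob (pull_ob (pr1 A B) P) (pull_ob (pr2 A B) Q) = box_ob P Q" if "A = fst P" "B = fst Q"
  using that by (simp add: tens_ob_def pull_ob_def box_ob_def extO_def)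

lemma box_simps [simp]:
  assumes "arr s" "arr t"
  shows "arr (s \<boxtimes> t)" "base (s \<boxtimes> t) = base s \<otimes>\<^sub>f base t" "dm (s \<boxtimes> t) = box_ob (dm s) (dm t)"
    "cd (s \<boxtimes> t) = box_ob (cd s) (cd t)"
  using assms pull_simps[OF assms(1) square_pr(1)[OF arr_base arr_base], OF assms]
    pull_simps[OF assms(2) square_pr(2)[OF arr_base arr_base], OF assms]
  by (simp_all add: box_def Let_def tens_pull_ob)

lemma box_comp:
  assumes "arr s" "arr t" "arr s'" "arr t'" "cd s = dm s'" "cd t = dm t'"
  shows "(s' \<star> s) \<boxtimes> (t' \<star> t) = (s' \<boxtimes> t') \<star> (s \<boxtimes> t)"
proof -
  note sq = square_pr[OF arr_base arr_base, OF assms(1,2)] square_pr[OF arr_base arr_base, OF assms(3,4)]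
  have e: "Src (base s') = Tgt (base s)" "Src (base t') = Tgt (base t)"
    using cd_dm_base(1)[OF assms(5)] cd_dm_base(1)[OF assms(6)] by simp_all
  note sq' = sq(3,4)[unfolded e]
  note p = pull_simps[OF assms(1) sq(1)] pull_simps[OF assms(2) sq(2)]
    pull_simps[OF assms(3) sq'(1)] pull_simps[OF assms(4) sq'(2)]
  show ?thesis
    using assms e p pull_comp[OF assms(1,3,5) sq(1) sq'(1)] pull_comp[OF assms(2,4,6) sq(2) sq'(2)]
    by (simp add: box_def Let_def tens_comp)
qed

lemma box_cart:
  assumes "small_fun S u" "small_fun S v" "X \<in> Ob (DCat D (Tgt u))" "Y \<in> Ob (DCat D (Tgt v))"
  shows "cart u X \<boxtimes> cart v Y = cart (u \<otimes>\<^sub>f v) (extO D (Tgt u) (Tgt v) X Y)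
    \<star> vert (Src u \<otimes>\<^sub>c Src v) (extRes D u v X Y)"
  using assms pull_cart[OF square_pr(1)[OF assms(1,2)] assms(3)]
    pull_cart[OF square_pr(2)[OF assms(1,2)] assms(4)]
    tens_cart[of "u \<otimes>\<^sub>f v" "reO D (pr1 (Tgt u) (Tgt v)) X" "reO D (pr2 (Tgt u) (Tgt v)) Y"]
    D_res(1)[of "pr1 (Tgt u) (Tgt v)" X] D_res(1)[of "pr2 (Tgt u) (Tgt v)" Y]
  by (simp add: box_def Let_def extO_def extRes_def)

lemma box_vert:
  assumes "small_cat S A" "small_cat S B" "f \<in> Arr (DCat D A)" "g \<in> Arr (DCat D B)"
  shows "vert A f \<boxtimes> vert B g = vert (A \<otimes>\<^sub>c B) (extA D A B f g)"
proof -
  have "pull (pr1 A B) (pr1 A B) (id_fun (A \<otimes>\<^sub>c B)) (vert A f) = vert (A \<otimes>\<^sub>c B) (reA D (pr1 A B) f)"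
    "pull (pr2 A B) (pr2 A B) (id_fun (A \<otimes>\<^sub>c B)) (vert B g) = vert (A \<otimes>\<^sub>c B) (reA D (pr2 A B) g)"
    using pull_vert[of "pr1 A B" f] pull_vert[of "pr2 A B" g] assms by simp_all
  moreover have "reA D (pr1 A B) f \<in> Arr (DCat D (A \<otimes>\<^sub>c B))" "reA D (pr2 A B) g \<in> Arr (DCat D (A \<otimes>\<^sub>c B))"
    using D_res(2)[of "pr1 A B" f] D_res(2)[of "pr2 A B" g] assms by simp_all
  ultimately show ?thesis
    using assms by (simp add: box_def Let_def extA_def tens_vert)
qed

lemma extO_ob [simp]:
  assumes "small_cat S A" "small_cat S B" "X \<in> Ob (DCat D A)" "Y \<in> Ob (DCat D B)"
  shows "extO D A B X Y \<in> Ob (DCat D (A \<otimes>\<^sub>c B))"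
  using assms D_res(1)[of "pr1 A B" X] D_res(1)[of "pr2 A B" Y] by (simp add: extO_def)

lemma extA_simps [simp]:
  assumes "small_cat S A" "small_cat S B" "f \<in> Arr (DCat D A)" "g \<in> Arr (DCat D B)"
  shows "extA D A B f g \<in> Arr (DCat D (A \<otimes>\<^sub>c B))"
    "Dom (DCat D (A \<otimes>\<^sub>c B)) (extA D A B f g) = extO D A B (Dom (DCat D A) f) (Dom (DCat D B) g)"
    "Cod (DCat D (A \<otimes>\<^sub>c B)) (extA D A B f g) = extO D A B (Cod (DCat D A) f) (Cod (DCat D B) g)"
  using assms D_res(2-4)[of "pr1 A B" f] D_res(2-4)[of "pr2 A B" g]
  by (simp_all add: extA_def extO_def)

lemma box_ide [simp]:
  assumes "ob P" "ob Q"
  shows "ide P \<boxtimes> ide Q = ide (box_ob P Q)"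
proof -
  obtain A X B Y where PQ: "P = (A, X)" "Q = (B, Y)" by (cases P, cases Q) auto
  have "ide P \<boxtimes> ide Q = cart (id_fun A) X \<boxtimes> cart (id_fun B) Y" using assms PQ by simp
  also have "\<dots> = ide (box_ob P Q)"
    using assms PQ D_res(1)[of "pr1 A B" X] D_res(1)[of "pr2 A B" Y]
    by (subst box_cart) (simp_all add: extRes_def mult_id, simp add: extO_def)
  finally show ?thesis .
qed

lemma extRes_simps [simp]:
  assumes "small_fun S u" "small_fun S v" "X \<in> Ob (DCat D (Tgt u))" "Y \<in> Ob (DCat D (Tgt v))"
  shows "extRes D u v X Y \<in> Arr (DCat D (Src u \<otimes>\<^sub>c Src v))"
    "Dom (DCat D (Src u \<otimes>\<^sub>c Src v)) (extRes D u v X Y) = extO D (Src u) (Src v) (reO D u X) (reO D v Y)"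
    "Cod (DCat D (Src u \<otimes>\<^sub>c Src v)) (extRes D u v X Y) = reO D (u \<otimes>\<^sub>f v) (extO D (Tgt u) (Tgt v) X Y)"
    "extRes D u v X Y \<in> isos (DCat D (Src u \<otimes>\<^sub>c Src v)) (extO D (Src u) (Src v) (reO D u X) (reO D v Y))
      (reO D (u \<otimes>\<^sub>f v) (extO D (Tgt u) (Tgt v) X Y))"
proof -
  note o = D_res(1)[of "pr1 (Tgt u) (Tgt v)" X] D_res(1)[of "pr2 (Tgt u) (Tgt v)" Y]
  have o1: "reO D (pr1 (Tgt u) (Tgt v)) X \<in> Ob (DCat D (Tgt (u \<otimes>\<^sub>f v)))"
    "reO D (pr2 (Tgt u) (Tgt v)) Y \<in> Ob (DCat D (Tgt (u \<otimes>\<^sub>f v)))"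
    using assms o by simp_all
  show 1: "extRes D u v X Y \<in> isos (DCat D (Src u \<otimes>\<^sub>c Src v)) (extO D (Src u) (Src v) (reO D u X) (reO D v Y))
      (reO D (u \<otimes>\<^sub>f v) (extO D (Tgt u) (Tgt v) X Y))"
    using ResT_iso[OF _ o1, of ] assms square_res[OF square_pr(1)[OF assms(1,2)] assms(3)]
      square_res[OF square_pr(2)[OF assms(1,2)] assms(4)]
    by (simp add: extRes_def extO_def)
  show "extRes D u v X Y \<in> Arr (DCat D (Src u \<otimes>\<^sub>c Src v))"
    "Dom (DCat D (Src u \<otimes>\<^sub>c Src v)) (extRes D u v X Y) = extO D (Src u) (Src v) (reO D u X) (reO D v Y)"
    "Cod (DCat D (Src u \<otimes>\<^sub>c Src v)) (extRes D u v X Y) = reO D (u \<otimes>\<^sub>f v) (extO D (Tgt u) (Tgt v) X Y)"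
    using 1 by (simp_all add: isos_def hom_def)
qed

lemma inverse_in_iso:
  assumes "f \<in> isos (DCat D A) X Y" "small_cat S A"
  shows "inverse_in (DCat D A) f \<in> Arr (DCat D A)" "Dom (DCat D A) (inverse_in (DCat D A) f) = Y"
    "Cod (DCat D A) (inverse_in (DCat D A) f) = X"
    "inverse_in (DCat D A) f \<cdot>\<^bsub>DCat D A\<^esub> f = Idn (DCat D A) X"
    "f \<cdot>\<^bsub>DCat D A\<^esub> inverse_in (DCat D A) f = Idn (DCat D A) Y"
    "inverse_in (DCat D A) f \<in> isos (DCat D A) Y X"
proof -
  obtain g where g: "f \<in> Arr (DCat D A)" "Dom (DCat D A) f = X" "Cod (DCat D A) f = Y"
    "g \<in> Arr (DCat D A)" "Dom (DCat D A) g = Y" "Cod (DCat D A) g = X"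
    "g \<cdot>\<^bsub>DCat D A\<^esub> f = Idn (DCat D A) X" "f \<cdot>\<^bsub>DCat D A\<^esub> g = Idn (DCat D A) Y"
    by (rule isosE[OF assms])
  have "inverse_in (DCat D A) f = g"
    unfolding inverse_in_def g(2,3)
  proof (rule the_equality)
    show "g \<in> hom (DCat D A) Y X \<and> g \<cdot>\<^bsub>DCat D A\<^esub> f = Idn (DCat D A) X \<and> f \<cdot>\<^bsub>DCat D A\<^esub> g = Idn (DCat D A) Y"
      using g by (simp add: hom_def)
    fix h assume h: "h \<in> hom (DCat D A) Y X \<and> h \<cdot>\<^bsub>DCat D A\<^esub> f = Idn (DCat D A) X \<and> f \<cdot>\<^bsub>DCat D A\<^esub> h = Idn (DCat D A) Y"
    have "h = h \<cdot>\<^bsub>DCat D A\<^esub> (f \<cdot>\<^bsub>DCat D A\<^esub> g)" using h g assms(2) by (simp add: hom_def)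
    also have "\<dots> = (h \<cdot>\<^bsub>DCat D A\<^esub> f) \<cdot>\<^bsub>DCat D A\<^esub> g"
      using h g assms(2) D_assoc[of A g f h] by (simp add: hom_def)
    also have "\<dots> = g" using h g assms(2) by simp
    finally show "h = g" .
  qed
  then show "inverse_in (DCat D A) f \<in> Arr (DCat D A)" "Dom (DCat D A) (inverse_in (DCat D A) f) = Y"
    "Cod (DCat D A) (inverse_in (DCat D A) f) = X"
    "inverse_in (DCat D A) f \<cdot>\<^bsub>DCat D A\<^esub> f = Idn (DCat D A) X"
    "f \<cdot>\<^bsub>DCat D A\<^esub> inverse_in (DCat D A) f = Idn (DCat D A) Y"
    "inverse_in (DCat D A) f \<in> isos (DCat D A) Y X"
    using g by (auto simp: isos_def hom_def)
qed

lemma tens_invertible: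
  assumes "invertible s" "invertible t" "base s = id_fun A" "base t = id_fun A"
  shows "invertible (s \<otimes>\<^sub>t t)"
proof -
  obtain s' where s': "arr s'" "dm s' = cd s" "cd s' = dm s" "s' \<star> s = ide (dm s)" "s \<star> s' = ide (cd s)"
    "base s' \<odot> base s = id_fun (Src (base s))" "base s \<odot> base s' = id_fun (Tgt (base s))"
    by (rule invertibleE[OF assms(1)])
  obtain t' where t': "arr t'" "dm t' = cd t" "cd t' = dm t" "t' \<star> t = ide (dm t)" "t \<star> t' = ide (cd t)"
    "base t' \<odot> base t = id_fun (Src (base t))" "base t \<odot> base t' = id_fun (Tgt (base t))"
    by (rule invertibleE[OF assms(2)])
  have a: "arr s" "arr t" using assms by simp_all
  have b: "base s' = id_fun A" "base t' = id_fun A"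
    using s'(1,7) t'(1,7) assms cd_dm_base(3)[of s' s] cd_dm_base(4)[of s' s] cd_dm_base(1)[OF s'(3)]
      cd_dm_base(1)[OF t'(3)] by simp_all
  obtain X Y X' Y' where o: "dm s = (A, X)" "dm t = (A, Y)" "cd s = (A, X')" "cd t = (A, Y')"
    using assms fst_dm_cd(1)[of s] fst_dm_cd(1)[of t] fst_dm_cd(2)[of s] fst_dm_cd(2)[of t]
    by (metis id_fun_simps(1,2) prod.collapse)
  note O = arr_ob[OF a(1)] arr_ob[OF a(2)]
  have "(s' \<otimes>\<^sub>t t') \<star> (s \<otimes>\<^sub>t t) = ide (dm (s \<otimes>\<^sub>t t))"
    using a s' t' b assms o O by (subst tens_comp[symmetric]) simp_all
  moreover have "(s \<otimes>\<^sub>t t) \<star> (s' \<otimes>\<^sub>t t') = ide (cd (s \<otimes>\<^sub>t t))"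
    using a s' t' b assms o O by (subst tens_comp[symmetric]) simp_all
  ultimately show ?thesis
    unfolding invertible_def using a s' t' b assms by (intro conjI exI[of _ "s' \<otimes>\<^sub>t t'"]) simp_all
qed

lemma box_invertible:
  assumes "invertible s" "invertible t"
  shows "invertible (s \<boxtimes> t)"
proof -
  obtain s' where s': "arr s'" "dm s' = cd s" "cd s' = dm s" "s' \<star> s = ide (dm s)" "s \<star> s' = ide (cd s)"
    by (rule invertibleE[OF assms(1)])
  obtain t' where t': "arr t'" "dm t' = cd t" "cd t' = dm t" "t' \<star> t = ide (dm t)" "t \<star> t' = ide (cd t)"
    by (rule invertibleE[OF assms(2)])
  have a: "arr s" "arr t" using assms by simp_all
  have "(s' \<boxtimes> t') \<star> (s \<boxtimes> t) = ide (dm (s \<boxtimes> t))"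
    using a s' t' by (subst box_comp[symmetric]) simp_all
  moreover have "(s \<boxtimes> t) \<star> (s' \<boxtimes> t') = ide (cd (s \<boxtimes> t))"
    using a s' t' by (subst box_comp[symmetric]) simp_all
  ultimately show ?thesis
    unfolding invertible_def using a s' t' by (intro conjI exI[of _ "s' \<boxtimes> t'"]) simp_all
qed

section \<open>Associativity and unit constraints of the external product\<close>

definition asc :: "'a scat \<Rightarrow> 'a scat \<Rightarrow> 'a scat \<Rightarrow> 'o \<Rightarrow> 'o \<Rightarrow> 'o \<Rightarrow> ('a, 'o, 'm) over_arr" where
  "asc A B C X Y Z =
    Over (assoc_fun A B C) (extAs D A B C X Y Z) (extO D A (B \<otimes>\<^sub>c C) X (extO D B C Y Z))"

text \<open>
  The associator of \<open>\<boxtimes>\<close> is, by definition, composed from the associator over \<open>(A \<times> B) \<times> C\<close>, two comparisons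
  \<open>ResT\<close> and the inverse of a third. Precomposition with this third one removes the inverse and leaves an
  expression in arrows whose naturality is known. Being invertible, it can be cancelled afterwards.
\<close>

lemma asc_expand:
  fixes A B C X Y Z
  defines "P \<equiv> (A \<otimes>\<^sub>c B) \<otimes>\<^sub>c C"
    and "a \<equiv> assoc_fun A B C" and "p \<equiv> pr1 (A \<otimes>\<^sub>c B) C" and "q \<equiv> pr2 A (B \<otimes>\<^sub>c C)"
    and "X1 \<equiv> reO D (pr1 A B) X" and "Y1 \<equiv> reO D (pr2 A B) Y"
    and "Y2 \<equiv> reO D (pr1 B C) Y" and "Z2 \<equiv> reO D (pr2 B C) Z" and "Z' \<equiv> reO D (pr2 (A \<otimes>\<^sub>c B) C) Z"
  assumes small: "small_cat S A" "small_cat S B" "small_cat S C"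
    and obj: "X \<in> Ob (DCat D A)" "Y \<in> Ob (DCat D B)" "Z \<in> Ob (DCat D C)"
  shows "arr (asc A B C X Y Z)"
    "dm (asc A B C X Y Z) = (P, extO D (A \<otimes>\<^sub>c B) C (extO D A B X Y) Z)"
    "cd (asc A B C X Y Z) = (A \<otimes>\<^sub>c (B \<otimes>\<^sub>c C), extO D A (B \<otimes>\<^sub>c C) X (extO D B C Y Z))"
    "base (asc A B C X Y Z) = a"
    "asc A B C X Y Z \<star> (vert P (ResT D p X1 Y1) \<otimes>\<^sub>t ide (P, Z'))
      = (cart a (reO D (pr1 A (B \<otimes>\<^sub>c C)) X)
          \<otimes>\<^sub>t (cart a (reO D q (extO D B C Y Z)) \<star> vert P (ResT D (q \<odot> a) Y2 Z2)))
        \<star> vert P (TAs (Mon D P) (reO D p X1) (reO D p Y1) Z')"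
    "vert P (ResT D p X1 Y1) \<otimes>\<^sub>t ide (P, Z') = vert P (TA (Mon D P) (ResT D p X1 Y1) (Idn (DCat D P) Z'))"
    "invertible (vert P (ResT D p X1 Y1) \<otimes>\<^sub>t ide (P, Z'))"
proof -
  define K M where KM: "K = DCat D P" "M = Mon D P"
  have sP [simp]: "small_cat S P" and sa: "small_fun S a" "Src a = P" "Tgt a = A \<otimes>\<^sub>c (B \<otimes>\<^sub>c C)"
    and sp: "small_fun S p" "Src p = P" "Tgt p = A \<otimes>\<^sub>c B"
    and sq: "small_fun S q" "Src q = A \<otimes>\<^sub>c (B \<otimes>\<^sub>c C)" "Tgt q = B \<otimes>\<^sub>c C"
    and sr: "small_fun S (q \<odot> a)" "Src (q \<odot> a) = P" "Tgt (q \<odot> a) = B \<otimes>\<^sub>c C"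
    using small by (simp_all add: P_def a_def p_def q_def)
  have o1: "X1 \<in> Ob (DCat D (A \<otimes>\<^sub>c B))" "Y1 \<in> Ob (DCat D (A \<otimes>\<^sub>c B))"
    "Y2 \<in> Ob (DCat D (B \<otimes>\<^sub>c C))" "Z2 \<in> Ob (DCat D (B \<otimes>\<^sub>c C))" "Z' \<in> Ob K"
    "reO D (pr1 A (B \<otimes>\<^sub>c C)) X \<in> Ob (DCat D (A \<otimes>\<^sub>c (B \<otimes>\<^sub>c C)))"
    "extO D B C Y Z \<in> Ob (DCat D (B \<otimes>\<^sub>c C))"
    using small obj D_res(1)[of "pr1 A B" X] D_res(1)[of "pr2 A B" Y] D_res(1)[of "pr1 B C" Y]
      D_res(1)[of "pr2 B C" Z] D_res(1)[of "pr2 (A \<otimes>\<^sub>c B) C" Z] D_res(1)[of "pr1 A (B \<otimes>\<^sub>c C)" X]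
    by (simp_all add: X1_def Y1_def Y2_def Z2_def Z'_def P_def KM)
  have o2: "reO D p X1 \<in> Ob K" "reO D p Y1 \<in> Ob K"
    "reO D q (extO D B C Y Z) \<in> Ob (DCat D (A \<otimes>\<^sub>c (B \<otimes>\<^sub>c C)))"
    using o1 D_res(1)[OF sp(1)] D_res(1)[OF sq(1)] by (simp_all add: sp sq KM)
  have r: "reO D a (reO D (pr1 A (B \<otimes>\<^sub>c C)) X) = reO D p X1"
    "reO D (q \<odot> a) Y2 = reO D p Y1" "reO D (q \<odot> a) Z2 = Z'"
    "reO D a (reO D q (extO D B C Y Z)) = reO D (q \<odot> a) (extO D B C Y Z)"
  proof -
    have "reO D a (reO D (pr1 A (B \<otimes>\<^sub>c C)) X) = reO D (pr1 A (B \<otimes>\<^sub>c C) \<odot> a) X"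
      using small obj by (simp add: a_def)
    also have "\<dots> = reO D p X1"
      unfolding a_def pr_assoc_fun(1)[OF small] using small obj by (simp add: p_def X1_def)
    finally show "reO D a (reO D (pr1 A (B \<otimes>\<^sub>c C)) X) = reO D p X1" .
    have "reO D (q \<odot> a) Y2 = reO D (pr1 B C \<odot> (q \<odot> a)) Y"
      using small obj sr D_res_comp(1)[OF sr(1), of "pr1 B C" Y] by (simp add: Y2_def)
    also have "\<dots> = reO D p Y1"
      unfolding a_def q_def pr_assoc_fun(2)[OF small] using small obj by (simp add: p_def Y1_def)
    finally show "reO D (q \<odot> a) Y2 = reO D p Y1" .
    have "reO D (q \<odot> a) Z2 = reO D (pr2 B C \<odot> (q \<odot> a)) Z"
      using small obj sr D_res_comp(1)[OF sr(1), of "pr2 B C" Z] by (simp add: Z2_def)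
    also have "\<dots> = Z'"
      unfolding a_def q_def pr_assoc_fun(3)[OF small] by (simp add: Z'_def)
    finally show "reO D (q \<odot> a) Z2 = Z'" .
    show "reO D a (reO D q (extO D B C Y Z)) = reO D (q \<odot> a) (extO D B C Y Z)"
      using o1 sa sq by simp
  qed
  have eXY: "TO (Mon D (A \<otimes>\<^sub>c B)) X1 Y1 = extO D A B X Y" "TO (Mon D (B \<otimes>\<^sub>c C)) Y2 Z2 = extO D B C Y Z"
    by (simp_all add: extO_def X1_def Y1_def Y2_def Z2_def)
  define \<rho> where "\<rho> = ResT D p X1 Y1"
  define \<sigma> where "\<sigma> = ResT D (q \<odot> a) Y2 Z2"
  define \<tau> where "\<tau> = TAs M (reO D p X1) (reO D p Y1) Z'"
  define \<alpha> where "\<alpha> = ResT D a (reO D (pr1 A (B \<otimes>\<^sub>c C)) X) (reO D q (extO D B C Y Z))"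
  define \<iota> where "\<iota> = inverse_in K \<rho>"
  have \<rho>i: "\<rho> \<in> isos K (TO M (reO D p X1) (reO D p Y1)) (reO D p (extO D A B X Y))"
    using ResT_iso[OF sp(1), of X1 Y1] o1 by (simp add: \<rho>_def sp eXY KM)
  then have \<rho>: "\<rho> \<in> Arr K" "Dom K \<rho> = TO M (reO D p X1) (reO D p Y1)" "Cod K \<rho> = reO D p (extO D A B X Y)"
    by (auto simp: isos_def hom_def)
  have \<sigma>: "\<sigma> \<in> Arr K" "Dom K \<sigma> = TO M (reO D p Y1) Z'" "Cod K \<sigma> = reO D (q \<odot> a) (extO D B C Y Z)"
    using ResT_simps[OF sr(1), of Y2 Z2] o1 r unfolding sr(2,3) by (simp_all add: \<sigma>_def eXY KM)
  have \<tau>: "\<tau> \<in> Arr K" "Dom K \<tau> = TO M (TO M (reO D p X1) (reO D p Y1)) Z'"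
    "Cod K \<tau> = TO M (reO D p X1) (TO M (reO D p Y1) Z')"
    using o1 o2 by (simp_all add: \<tau>_def KM)
  have \<alpha>: "\<alpha> \<in> Arr K" "Dom K \<alpha> = TO M (reO D p X1) (reO D (q \<odot> a) (extO D B C Y Z))"
    "Cod K \<alpha> = reO D a (extO D A (B \<otimes>\<^sub>c C) X (extO D B C Y Z))"
    using ResT_simps[OF sa(1), of "reO D (pr1 A (B \<otimes>\<^sub>c C)) X" "reO D q (extO D B C Y Z)"] o1 o2 r
    unfolding sa(2,3) by (simp_all add: \<alpha>_def KM extO_def[of D A] q_def)
  have \<iota>: "\<iota> \<in> Arr K" "Dom K \<iota> = reO D p (extO D A B X Y)" "Cod K \<iota> = TO M (reO D p X1) (reO D p Y1)"
    "\<iota> \<cdot>\<^bsub>K\<^esub> \<rho> = Idn K (TO M (reO D p X1) (reO D p Y1))"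
    using inverse_in_iso[of \<rho> P] \<rho>i by (simp_all add: \<iota>_def KM)
  have tK: "f \<in> Arr K \<Longrightarrow> g \<in> Arr K \<Longrightarrow> TA M f g \<in> Arr K"
    "f \<in> Arr K \<Longrightarrow> g \<in> Arr K \<Longrightarrow> Dom K (TA M f g) = TO M (Dom K f) (Dom K g)"
    "f \<in> Arr K \<Longrightarrow> g \<in> Arr K \<Longrightarrow> Cod K (TA M f g) = TO M (Cod K f) (Cod K g)"
    "X \<in> Ob K \<Longrightarrow> Y \<in> Ob K \<Longrightarrow> TA M (Idn K X) (Idn K Y) = Idn K (TO M X Y)"
    "X \<in> Ob K \<Longrightarrow> Y \<in> Ob K \<Longrightarrow> TO M X Y \<in> Ob K" for f g X Y
    by (simp_all add: KM)
  note Ks = D_cat[OF sP, folded KM] D_comp[OF sP, folded KM] tK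
  have ex: "extAs D A B C X Y Z = \<alpha> \<cdot>\<^bsub>K\<^esub> (TA M (Idn K (reO D p X1)) \<sigma> \<cdot>\<^bsub>K\<^esub> (\<tau> \<cdot>\<^bsub>K\<^esub> TA M \<iota> (Idn K Z')))"
    by (simp add: extAs_def Let_def \<alpha>_def \<sigma>_def \<tau>_def \<iota>_def \<rho>_def KM P_def a_def p_def q_def X1_def
        Y1_def Y2_def Z2_def Z'_def)
  have Z'p: "reO D (pr2 (A \<otimes>\<^sub>c B) C) Z = Z'" by (simp add: Z'_def)
  have ea: "extAs D A B C X Y Z \<in> Arr K"
    "Dom K (extAs D A B C X Y Z) = extO D (A \<otimes>\<^sub>c B) C (extO D A B X Y) Z"
    "Cod K (extAs D A B C X Y Z) = reO D a (extO D A (B \<otimes>\<^sub>c C) X (extO D B C Y Z))"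
    unfolding ex using \<alpha> \<sigma> \<tau> \<iota> Ks o1 o2
    by (simp_all add: extO_def[of D "A \<otimes>\<^sub>c B" C] flip: p_def KM P_def, simp add: Z'p KM P_def)
  show 1: "arr (asc A B C X Y Z)"
    "dm (asc A B C X Y Z) = (P, extO D (A \<otimes>\<^sub>c B) C (extO D A B X Y) Z)"
    "cd (asc A B C X Y Z) = (A \<otimes>\<^sub>c (B \<otimes>\<^sub>c C), extO D A (B \<otimes>\<^sub>c C) X (extO D B C Y Z))"
    "base (asc A B C X Y Z) = a"
    using ea sa small obj by (simp_all add: asc_def KM flip: a_def)
  have J: "vert P \<rho> \<otimes>\<^sub>t ide (P, Z') = vert P (TA M \<rho> (Idn K Z'))"
    using tens_vert[OF sP, of \<rho> "Idn K Z'"] \<rho> o1 Ks by (simp add: KM)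
  then show "vert P (ResT D p X1 Y1) \<otimes>\<^sub>t ide (P, Z') = vert P (TA (Mon D P) (ResT D p X1 Y1) (Idn (DCat D P) Z'))"
    by (simp add: KM \<rho>_def)
  show "invertible (vert P (ResT D p X1 Y1) \<otimes>\<^sub>t ide (P, Z'))"
  proof (rule tens_invertible)
    show "invertible (vert P (ResT D p X1 Y1))"
      using \<rho>i invertible_vert[of \<rho> P] by (simp add: KM \<rho>_def)
    show "invertible (ide (P, Z'))" using o1 by (simp add: KM)
  qed simp_all
  have "asc A B C X Y Z \<star> vert P (TA M \<rho> (Idn K Z'))
      = Over a (extAs D A B C X Y Z \<cdot>\<^bsub>K\<^esub> TA M \<rho> (Idn K Z')) (extO D A (B \<otimes>\<^sub>c C) X (extO D B C Y Z))"
    unfolding asc_def a_def[symmetric] using ea sa \<rho> o1 Ks small obj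
    by (subst Over_comp_vert[symmetric, of a, unfolded sa])
      (simp_all add: KM, simp add: extO_def[of D "A \<otimes>\<^sub>c B" C] flip: p_def Z'_def P_def)
  also have "extAs D A B C X Y Z \<cdot>\<^bsub>K\<^esub> TA M \<rho> (Idn K Z')
      = \<alpha> \<cdot>\<^bsub>K\<^esub> (TA M (Idn K (reO D p X1)) \<sigma> \<cdot>\<^bsub>K\<^esub> (\<tau> \<cdot>\<^bsub>K\<^esub> (TA M \<iota> (Idn K Z') \<cdot>\<^bsub>K\<^esub> TA M \<rho> (Idn K Z'))))"
    unfolding ex using \<alpha> \<sigma> \<tau> \<iota> \<rho> Ks o1 o2 by (simp add: D_assoc[OF sP, folded KM])
  also have "TA M \<iota> (Idn K Z') \<cdot>\<^bsub>K\<^esub> TA M \<rho> (Idn K Z') = Idn K (Dom K \<tau>)"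
    using tensor_comp'[OF sP, of \<rho> \<iota> "Idn K Z'" "Idn K Z'"] \<rho> \<iota> \<tau> o1 o2 Ks by (simp add: KM)
  also have "Over a (\<alpha> \<cdot>\<^bsub>K\<^esub> (TA M (Idn K (reO D p X1)) \<sigma> \<cdot>\<^bsub>K\<^esub> (\<tau> \<cdot>\<^bsub>K\<^esub> Idn K (Dom K \<tau>))))
      (extO D A (B \<otimes>\<^sub>c C) X (extO D B C Y Z))
    = cart a (extO D A (B \<otimes>\<^sub>c C) X (extO D B C Y Z)) \<star> vert P \<alpha> \<star> vert P (TA M (Idn K (reO D p X1)) \<sigma>) \<star> vert P \<tau>"
    using \<alpha> \<sigma> \<tau> \<iota> \<rho> Ks o1 o2 sa small obj
    by (subst Over_eq_cart_vert) (simp_all add: KM vert_comp)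
  also have "cart a (extO D A (B \<otimes>\<^sub>c C) X (extO D B C Y Z)) \<star> vert P \<alpha> \<star> vert P (TA M (Idn K (reO D p X1)) \<sigma>) \<star> vert P \<tau>
    = ((cart a (reO D (pr1 A (B \<otimes>\<^sub>c C)) X) \<otimes>\<^sub>t cart a (reO D q (extO D B C Y Z)))
      \<star> (vert P (Idn K (reO D p X1)) \<otimes>\<^sub>t vert P \<sigma>)) \<star> vert P \<tau>"
  proof -
    have "cart a (reO D (pr1 A (B \<otimes>\<^sub>c C)) X) \<otimes>\<^sub>t cart a (reO D q (extO D B C Y Z))
      = cart a (extO D A (B \<otimes>\<^sub>c C) X (extO D B C Y Z)) \<star> vert P \<alpha>"
      using tens_cart[OF sa(1), of "reO D (pr1 A (B \<otimes>\<^sub>c C)) X" "reO D q (extO D B C Y Z)"] o1 o2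
      unfolding sa(2,3) by (simp add: \<alpha>_def extO_def[of D A] q_def)
    moreover have "vert P (Idn K (reO D p X1)) \<otimes>\<^sub>t vert P \<sigma> = vert P (TA M (Idn K (reO D p X1)) \<sigma>)"
      using tens_vert[OF sP, of "Idn K (reO D p X1)" \<sigma>] o2 \<sigma> Ks(3)[of "reO D p X1"] by (simp add: KM del: vert_Idn)
    ultimately show ?thesis by (simp add: cmp_assoc)
  qed
  also have "(cart a (reO D (pr1 A (B \<otimes>\<^sub>c C)) X) \<otimes>\<^sub>t cart a (reO D q (extO D B C Y Z)))
      \<star> (vert P (Idn K (reO D p X1)) \<otimes>\<^sub>t vert P \<sigma>)
    = (cart a (reO D (pr1 A (B \<otimes>\<^sub>c C)) X) \<star> vert P (Idn K (reO D p X1)))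
      \<otimes>\<^sub>t (cart a (reO D q (extO D B C Y Z)) \<star> vert P \<sigma>)"
    using sa o1 o2 r \<sigma> by (intro tens_comp[symmetric]) (simp_all add: KM)
  also have "cart a (reO D (pr1 A (B \<otimes>\<^sub>c C)) X) \<star> vert P (Idn K (reO D p X1))
      = cart a (reO D (pr1 A (B \<otimes>\<^sub>c C)) X)"
    using sa o1 o2 r by (simp add: KM)
  finally show "asc A B C X Y Z \<star> (vert P (ResT D p X1 Y1) \<otimes>\<^sub>t ide (P, Z'))
      = (cart a (reO D (pr1 A (B \<otimes>\<^sub>c C)) X)
          \<otimes>\<^sub>t (cart a (reO D q (extO D B C Y Z)) \<star> vert P (ResT D (q \<odot> a) Y2 Z2)))
        \<star> vert P (TAs (Mon D P) (reO D p X1) (reO D p Y1) Z')"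
    using J by (simp add: \<rho>_def \<sigma>_def \<tau>_def KM)
qed

text \<open>
  All three arrows may lie over arbitrary functors. For vertical arrows this is naturality of the associator,
  for cartesian ones its compatibility with restriction.
\<close>

lemma asc_natural:
  assumes s: "arr s" "dm s = (A, X)" "cd s = (A', X')"
    and t: "arr t" "dm t = (B, Y)" "cd t = (B', Y')"
    and z: "arr z" "dm z = (C, Z)" "cd z = (C', Z')"
  shows "asc A' B' C' X' Y' Z' \<star> ((s \<boxtimes> t) \<boxtimes> z) = (s \<boxtimes> (t \<boxtimes> z)) \<star> asc A B C X Y Z"
proof -
  define u v w where uvw: "u = base s" "v = base t" "w = base z"
  have ends: "Src u = A" "Tgt u = A'" "Src v = B" "Tgt v = B'" "Src w = C" "Tgt w = C'"
    using cd_dm_base(5,6)[of s] cd_dm_base(5,6)[of t] cd_dm_base(5,6)[of z] s t z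
    by (simp_all add: uvw)
  have sm [simp]: "small_fun S u" "small_fun S v" "small_fun S w" using s t z by (simp_all add: uvw)
  have sc [simp]: "small_cat S A" "small_cat S B" "small_cat S C"
    "small_cat S A'" "small_cat S B'" "small_cat S C'"
    using arr_ob[OF s(1)] arr_ob[OF t(1)] arr_ob[OF z(1)] s t z by simp_all
  have O: "X \<in> Ob (DCat D A)" "Y \<in> Ob (DCat D B)" "Z \<in> Ob (DCat D C)"
    "X' \<in> Ob (DCat D A')" "Y' \<in> Ob (DCat D B')" "Z' \<in> Ob (DCat D C')"
    using arr_ob[OF s(1)] arr_ob[OF t(1)] arr_ob[OF z(1)] s t z by simp_all
  define P P' a a' p p' q q' W V where defs: "P = (A \<otimes>\<^sub>c B) \<otimes>\<^sub>c C" "P' = (A' \<otimes>\<^sub>c B') \<otimes>\<^sub>c C'"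
    "a = assoc_fun A B C" "a' = assoc_fun A' B' C'" "p = pr1 (A \<otimes>\<^sub>c B) C" "p' = pr1 (A' \<otimes>\<^sub>c B') C'"
    "q = pr2 A (B \<otimes>\<^sub>c C)" "q' = pr2 A' (B' \<otimes>\<^sub>c C')" "W = (u \<otimes>\<^sub>f v) \<otimes>\<^sub>f w" "V = u \<otimes>\<^sub>f (v \<otimes>\<^sub>f w)"
  have sq1: "square (pr1 A B) (pr1 A' B') (u \<otimes>\<^sub>f v) u" "square (pr2 A B) (pr2 A' B') (u \<otimes>\<^sub>f v) v"
    using square_pr[OF sm(1,2)] by (simp_all add: ends)
  have sq2: "square (pr1 B C) (pr1 B' C') (v \<otimes>\<^sub>f w) v" "square (pr2 B C) (pr2 B' C') (v \<otimes>\<^sub>f w) w"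
    using square_pr[OF sm(2,3)] by (simp_all add: ends)
  have sq3: "square p p' W (u \<otimes>\<^sub>f v)" "square (pr2 (A \<otimes>\<^sub>c B) C) (pr2 (A' \<otimes>\<^sub>c B') C') W w"
    using square_pr[of "u \<otimes>\<^sub>f v" w] by (simp_all add: ends defs)
  have sq4: "square (pr1 A (B \<otimes>\<^sub>c C)) (pr1 A' (B' \<otimes>\<^sub>c C')) V u" "square q q' V (v \<otimes>\<^sub>f w)"
    using square_pr[of u "v \<otimes>\<^sub>f w"] by (simp_all add: ends defs)
  have sqa: "square a a' W V"
    using assoc_fun_natural[of u v w] by (simp add: square_def defs ends)
  have sqr: "square (q \<odot> a) (q' \<odot> a') W (v \<otimes>\<^sub>f w)" using square_paste[OF sq4(2) sqa] .
  define s1 t1 t2 z2 s3 t3 z3 s4 bz where ps: "s1 = pull (pr1 A B) (pr1 A' B') (u \<otimes>\<^sub>f v) s"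
    "t1 = pull (pr2 A B) (pr2 A' B') (u \<otimes>\<^sub>f v) t" "t2 = pull (pr1 B C) (pr1 B' C') (v \<otimes>\<^sub>f w) t"
    "z2 = pull (pr2 B C) (pr2 B' C') (v \<otimes>\<^sub>f w) z" "s3 = pull p p' W s1" "t3 = pull p p' W t1"
    "z3 = pull (pr2 (A \<otimes>\<^sub>c B) C) (pr2 (A' \<otimes>\<^sub>c B') C') W z"
    "s4 = pull (pr1 A (B \<otimes>\<^sub>c C)) (pr1 A' (B' \<otimes>\<^sub>c C')) V s" "bz = pull q q' V (t2 \<otimes>\<^sub>t z2)"
  note b = uvw[symmetric]
  have b1: "s \<boxtimes> t = s1 \<otimes>\<^sub>t t1" "t \<boxtimes> z = t2 \<otimes>\<^sub>t z2" by (simp_all add: box_def Let_def b ends ps)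
  note s1 = pull_simps[OF s(1), unfolded b, OF sq1(1), folded ps, unfolded s]
  note t1 = pull_simps[OF t(1), unfolded b, OF sq1(2), folded ps, unfolded t]
  note t2 = pull_simps[OF t(1), unfolded b, OF sq2(1), folded ps, unfolded t]
  note z2 = pull_simps[OF z(1), unfolded b, OF sq2(2), folded ps, unfolded z]
  note z3 = pull_simps[OF z(1), unfolded b, OF sq3(2), folded ps, unfolded z]
  note s4 = pull_simps[OF s(1), unfolded b, OF sq4(1), folded ps, unfolded s]
  have b2: "(s \<boxtimes> t) \<boxtimes> z = pull p p' W (s1 \<otimes>\<^sub>t t1) \<otimes>\<^sub>t z3" "s \<boxtimes> (t \<boxtimes> z) = s4 \<otimes>\<^sub>t bz"
    unfolding b1 unfolding box_def Let_def using s1 t1 t2 z2 by (simp_all add: b ends ps(7-9) defs)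
  have sq3': "square p p' W (base s1)" "square p p' W (base t1)" using sq3(1) s1(2) t1(2) by simp_all
  note s3 = pull_simps[OF s1(1) sq3'(1), folded ps, unfolded s1]
  note t3 = pull_simps[OF t1(1) sq3'(2), folded ps, unfolded t1]
  have tz2: "arr (t2 \<otimes>\<^sub>t z2)" "base (t2 \<otimes>\<^sub>t z2) = v \<otimes>\<^sub>f w"
    "dm (t2 \<otimes>\<^sub>t z2) = (B \<otimes>\<^sub>c C, extO D B C Y Z)" "cd (t2 \<otimes>\<^sub>t z2) = (B' \<otimes>\<^sub>c C', extO D B' C' Y' Z')"
    using t2 z2 by (simp_all add: extO_def)
  have sq4': "square q q' V (base (t2 \<otimes>\<^sub>t z2))" using sq4(2) tz2(2) by simp
  note bz = pull_simps[OF tz2(1) sq4', folded ps, unfolded tz2]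
  \<comment> \<open>All pullbacks to the triple products are pullbacks along composite projections, and the composites on
    the two sides of the associator agree.\<close>
  have e1: "t3 = pull (q \<odot> a) (q' \<odot> a') W t2" "z3 = pull (q \<odot> a) (q' \<odot> a') W z2" "s3 = pull a a' W s4"
    unfolding ps using pull_pull[OF t(1), unfolded b, OF sq1(2) sq3(1)]
      pull_pull[OF t(1), unfolded b, OF sq2(1) sqr] pull_pull[OF z(1), unfolded b, OF sq2(2) sqr]
      pull_pull[OF s(1), unfolded b, OF sq1(1) sq3(1)] pull_pull[OF s(1), unfolded b, OF sq4(1) sqa]
      pr_assoc_fun[of A B C] pr_assoc_fun[of A' B' C'] by (simp_all add: defs)
  have e2: "pull (q \<odot> a) (q' \<odot> a') W (t2 \<otimes>\<^sub>t z2) = pull a a' W bz"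
    unfolding ps(9) by (rule pull_pull[symmetric, OF tz2(1) sq4' sqa])
  define X1 Y1 Y2 Z2 Z0 where o: "X1 = reO D (pr1 A B) X" "Y1 = reO D (pr2 A B) Y"
    "Y2 = reO D (pr1 B C) Y" "Z2 = reO D (pr2 B C) Z" "Z0 = reO D (pr2 (A \<otimes>\<^sub>c B) C) Z"
  define X1' Y1' Y2' Z2' Z0' where o': "X1' = reO D (pr1 A' B') X'" "Y1' = reO D (pr2 A' B') Y'"
    "Y2' = reO D (pr1 B' C') Y'" "Z2' = reO D (pr2 B' C') Z'" "Z0' = reO D (pr2 (A' \<otimes>\<^sub>c B') C') Z'"
  note as = asc_expand[OF sc(1-3) O(1-3), folded defs o]
  note as' = asc_expand[OF sc(4-6) O(4-6), folded defs o']
  have sm2 [simp]: "small_fun S p" "small_fun S p'" "small_fun S a" "small_fun S a'"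
    "small_fun S q" "small_fun S q'" "small_cat S P" "small_cat S P'"
    "Src p = P" "Src p' = P'" "Tgt p = A \<otimes>\<^sub>c B" "Tgt p' = A' \<otimes>\<^sub>c B'" "Src a = P" "Src a' = P'"
    "Tgt a = A \<otimes>\<^sub>c (B \<otimes>\<^sub>c C)" "Tgt a' = A' \<otimes>\<^sub>c (B' \<otimes>\<^sub>c C')" "Src q = A \<otimes>\<^sub>c (B \<otimes>\<^sub>c C)"
    "Src q' = A' \<otimes>\<^sub>c (B' \<otimes>\<^sub>c C')" "Tgt q = B \<otimes>\<^sub>c C" "Tgt q' = B' \<otimes>\<^sub>c C'"
    by (simp_all add: defs)
  have ob1 [simp]: "X1 \<in> Ob (DCat D (A \<otimes>\<^sub>c B))" "Y1 \<in> Ob (DCat D (A \<otimes>\<^sub>c B))"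
    "Y2 \<in> Ob (DCat D (B \<otimes>\<^sub>c C))" "Z2 \<in> Ob (DCat D (B \<otimes>\<^sub>c C))" "Z0 \<in> Ob (DCat D P)"
    "reO D (pr1 A (B \<otimes>\<^sub>c C)) X \<in> Ob (DCat D (A \<otimes>\<^sub>c (B \<otimes>\<^sub>c C)))"
    using arr_ob(1)[OF s1(1)] arr_ob(1)[OF t1(1)] arr_ob(1)[OF t2(1)] arr_ob(1)[OF z2(1)]
      arr_ob(1)[OF z3(1)] arr_ob(1)[OF s4(1)]
    unfolding s1 t1 t2 z2 z3 s4 by (simp_all add: o defs(1))
  have ob2 [simp]: "X1' \<in> Ob (DCat D (A' \<otimes>\<^sub>c B'))" "Y1' \<in> Ob (DCat D (A' \<otimes>\<^sub>c B'))"
    "Y2' \<in> Ob (DCat D (B' \<otimes>\<^sub>c C'))" "Z2' \<in> Ob (DCat D (B' \<otimes>\<^sub>c C'))" "Z0' \<in> Ob (DCat D P')"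
    "reO D (pr1 A' (B' \<otimes>\<^sub>c C')) X' \<in> Ob (DCat D (A' \<otimes>\<^sub>c (B' \<otimes>\<^sub>c C')))"
    using arr_ob(2)[OF s1(1)] arr_ob(2)[OF t1(1)] arr_ob(2)[OF t2(1)] arr_ob(2)[OF z2(1)]
      arr_ob(2)[OF z3(1)] arr_ob(2)[OF s4(1)]
    unfolding s1 t1 t2 z2 z3 s4 by (simp_all add: o' defs(2))
  have d: "dm s3 = (P, reO D p X1)" "cd s3 = (P', reO D p' X1')" "dm t3 = (P, reO D p Y1)"
    "cd t3 = (P', reO D p' Y1')" "dm z3 = (P, Z0)" "cd z3 = (P', Z0')" "base s3 = W" "base t3 = W"
    "base z3 = W"
    using s3 t3 z3 by (simp_all add: o o' defs(1,2))
  have r1: "vert P' (ResT D p' X1' Y1') \<star> (s3 \<otimes>\<^sub>t t3) = pull p p' W (s1 \<otimes>\<^sub>t t1) \<star> vert P (ResT D p X1 Y1)"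
    using pull_tens[OF s1(1) _ _ t1(1), of "A \<otimes>\<^sub>c B" X1 "A' \<otimes>\<^sub>c B'" X1' Y1 Y1' p p' W] s1 t1 sq3(1)
    by (simp add: o o' ps(5,6))
  have r2: "vert P' (ResT D (q' \<odot> a') Y2' Z2') \<star> (t3 \<otimes>\<^sub>t z3)
      = pull a a' W bz \<star> vert P (ResT D (q \<odot> a) Y2 Z2)"
    using pull_tens[OF t2(1) _ _ z2(1), of "B \<otimes>\<^sub>c C" Y2 "B' \<otimes>\<^sub>c C'" Y2' Z2 Z2' "q \<odot> a" "q' \<odot> a'" W] t2 z2 sqr
    by (simp add: o o' e1 e2)
  have sqa': "square a a' W (base s4)" "square a a' W (base bz)" using sqa s4(2) bz(2) by simp_all
  note pa = pull_simps[OF s4(1) sqa'(1)] pull_simps[OF bz(1) sqa'(2)]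
  have c1: "cart a' (reO D (pr1 A' (B' \<otimes>\<^sub>c C')) X') \<star> s3 = s4 \<star> cart a (reO D (pr1 A (B \<otimes>\<^sub>c C)) X)"
    using pa(5) s4 by (simp add: e1)
  have c2: "cart a' (reO D q' (extO D B' C' Y' Z')) \<star> pull a a' W bz = bz \<star> cart a (reO D q (extO D B C Y Z))"
    using pa(10) bz by simp
  have Rp: "ResT D p X1 Y1 \<in> Arr (DCat D P)" "Dom (DCat D P) (ResT D p X1 Y1) = TO (Mon D P) (reO D p X1) (reO D p Y1)"
    "Cod (DCat D P) (ResT D p X1 Y1) = reO D p (TO (Mon D (A \<otimes>\<^sub>c B)) X1 Y1)"
    "ResT D p' X1' Y1' \<in> Arr (DCat D P')"
    "Dom (DCat D P') (ResT D p' X1' Y1') = TO (Mon D P') (reO D p' X1') (reO D p' Y1')"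
    "Cod (DCat D P') (ResT D p' X1' Y1') = reO D p' (TO (Mon D (A' \<otimes>\<^sub>c B')) X1' Y1')"
    using ResT_simps[of p X1 Y1] ResT_simps[of p' X1' Y1'] by simp_all
  have J: "(vert P' (ResT D p' X1' Y1') \<otimes>\<^sub>t ide (P', Z0')) \<star> ((s3 \<otimes>\<^sub>t t3) \<otimes>\<^sub>t z3)
    = ((s \<boxtimes> t) \<boxtimes> z) \<star> (vert P (ResT D p X1 Y1) \<otimes>\<^sub>t ide (P, Z0))"
  proof -
    have "(vert P' (ResT D p' X1' Y1') \<otimes>\<^sub>t ide (P', Z0')) \<star> ((s3 \<otimes>\<^sub>t t3) \<otimes>\<^sub>t z3)
      = (pull p p' W (s1 \<otimes>\<^sub>t t1) \<star> vert P (ResT D p X1 Y1)) \<otimes>\<^sub>t (z3 \<star> ide (P, Z0))"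
      using s3(1) t3(1) z3(1) d by (subst tens_comp[symmetric]) (simp_all add: r1 Rp)
    also have "\<dots> = ((s \<boxtimes> t) \<boxtimes> z) \<star> (vert P (ResT D p X1 Y1) \<otimes>\<^sub>t ide (P, Z0))"
    proof -
      have "square p p' W (base (s1 \<otimes>\<^sub>t t1))" "arr (s1 \<otimes>\<^sub>t t1)" using s1 t1 sq3(1) by simp_all
      note pp = pull_simps[OF this(2,1)]
      have "dm (pull p p' W (s1 \<otimes>\<^sub>t t1)) = (P, reO D p (TO (Mon D (A \<otimes>\<^sub>c B)) X1 Y1))"
        using pp(3) s1 t1 by (simp add: o)
      then show ?thesis
        unfolding b2 using pp z3(1) d Rp by (intro tens_comp) simp_all
    qed
    finally show ?thesis .
  qed
  define ca cb ca' cb' where c: "ca = cart a (reO D (pr1 A (B \<otimes>\<^sub>c C)) X)"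
    "cb = cart a (reO D q (extO D B C Y Z)) \<star> vert P (ResT D (q \<odot> a) Y2 Z2)"
    "ca' = cart a' (reO D (pr1 A' (B' \<otimes>\<^sub>c C')) X')"
    "cb' = cart a' (reO D q' (extO D B' C' Y' Z')) \<star> vert P' (ResT D (q' \<odot> a') Y2' Z2')"
  have qe: "reO D q (extO D B C Y Z) \<in> Ob (DCat D (A \<otimes>\<^sub>c (B \<otimes>\<^sub>c C)))"
    "reO D q' (extO D B' C' Y' Z') \<in> Ob (DCat D (A' \<otimes>\<^sub>c (B' \<otimes>\<^sub>c C')))"
    using arr_ob[OF bz(1)] unfolding bz by simp_all
  have eXY: "TO (Mon D (B \<otimes>\<^sub>c C)) Y2 Z2 = extO D B C Y Z" "TO (Mon D (B' \<otimes>\<^sub>c C')) Y2' Z2' = extO D B' C' Y' Z'"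
    by (simp_all add: extO_def o o')
  have rr: "reO D (q \<odot> a) Y2 = reO D p Y1" "reO D (q \<odot> a) Z2 = Z0" "reO D (q' \<odot> a') Y2' = reO D p' Y1'"
    "reO D (q' \<odot> a') Z2' = Z0'" "reO D a (reO D (pr1 A (B \<otimes>\<^sub>c C)) X) = reO D p X1"
    "reO D a' (reO D (pr1 A' (B' \<otimes>\<^sub>c C')) X') = reO D p' X1'"
  proof -
    have sqr': "square (q \<odot> a) (q' \<odot> a') W (base t2)" "square (q \<odot> a) (q' \<odot> a') W (base z2)"
      using sqr t2 z2 by simp_all
    note x = pull_simps[OF t2(1) sqr'(1), folded e1] pull_simps[OF z2(1) sqr'(2), folded e1]
    show "reO D (q \<odot> a) Y2 = reO D p Y1" "reO D (q' \<odot> a') Y2' = reO D p' Y1'"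
      using x(3,4) d(3,4) t2(3,4) by (simp_all add: o o' pull_ob_def)
    show "reO D (q \<odot> a) Z2 = Z0" "reO D (q' \<odot> a') Z2' = Z0'"
      using x(8,9) d(5,6) z2(3,4) by (simp_all add: o o' pull_ob_def)
    show "reO D a (reO D (pr1 A (B \<otimes>\<^sub>c C)) X) = reO D p X1"
      "reO D a' (reO D (pr1 A' (B' \<otimes>\<^sub>c C')) X') = reO D p' X1'"
      using pa(3,4) d(1,2) s4(3,4) by (simp_all add: e1 pull_ob_def)
  qed
  have qr: "small_fun S (q \<odot> a)" "small_fun S (q' \<odot> a')" "Src (q \<odot> a) = P" "Src (q' \<odot> a') = P'"
    "Tgt (q \<odot> a) = B \<otimes>\<^sub>c C" "Tgt (q' \<odot> a') = B' \<otimes>\<^sub>c C'"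
    by simp_all
  have Tr: "ResT D (q \<odot> a) Y2 Z2 \<in> Arr (DCat D P)" "Dom (DCat D P) (ResT D (q \<odot> a) Y2 Z2) = TO (Mon D P) (reO D p Y1) Z0"
    "Cod (DCat D P) (ResT D (q \<odot> a) Y2 Z2) = reO D a (reO D q (extO D B C Y Z))"
    using ResT_simps[OF qr(1), of Y2 Z2, unfolded qr rr eXY] O by simp_all
  have Tr': "ResT D (q' \<odot> a') Y2' Z2' \<in> Arr (DCat D P')"
    "Dom (DCat D P') (ResT D (q' \<odot> a') Y2' Z2') = TO (Mon D P') (reO D p' Y1') Z0'"
    "Cod (DCat D P') (ResT D (q' \<odot> a') Y2' Z2') = reO D a' (reO D q' (extO D B' C' Y' Z'))"
    using ResT_simps[OF qr(2), of Y2' Z2', unfolded qr rr eXY] O by simp_all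
  have ca: "arr ca" "base ca = a" "dm ca = (P, reO D p X1)" "cd ca = dm s4"
    "arr ca'" "base ca' = a'" "dm ca' = (P', reO D p' X1')"
    using s4 by (simp_all add: c rr)
  have cb: "arr cb" "base cb = a" "dm cb = (P, TO (Mon D P) (reO D p Y1) Z0)" "cd cb = dm bz"
    "arr cb'" "base cb' = a'" "dm cb' = (P', TO (Mon D P') (reO D p' Y1') Z0')"
    using bz Tr Tr' qe by (simp_all add: c)
  \<comment> \<open>The two sides agree after precomposition with the invertible arrow of \<open>asc_expand\<close>, by naturality of
    the fibrewise associator.\<close>
  have main: "(asc A' B' C' X' Y' Z' \<star> ((s \<boxtimes> t) \<boxtimes> z)) \<star> (vert P (ResT D p X1 Y1) \<otimes>\<^sub>t ide (P, Z0))
    = ((s \<boxtimes> (t \<boxtimes> z)) \<star> asc A B C X Y Z) \<star> (vert P (ResT D p X1 Y1) \<otimes>\<^sub>t ide (P, Z0))"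
  proof -
    have "(asc A' B' C' X' Y' Z' \<star> ((s \<boxtimes> t) \<boxtimes> z)) \<star> (vert P (ResT D p X1 Y1) \<otimes>\<^sub>t ide (P, Z0))
      = (asc A' B' C' X' Y' Z' \<star> (vert P' (ResT D p' X1' Y1') \<otimes>\<^sub>t ide (P', Z0'))) \<star> ((s3 \<otimes>\<^sub>t t3) \<otimes>\<^sub>t z3)"
      by (simp only: cmp_assoc J)
    also have "\<dots> = (ca' \<otimes>\<^sub>t cb') \<star> vert P' (TAs (Mon D P') (reO D p' X1') (reO D p' Y1') Z0')
        \<star> ((s3 \<otimes>\<^sub>t t3) \<otimes>\<^sub>t z3)"
      unfolding as'(5) by (simp only: cmp_assoc c)
    also have "\<dots> = ((ca' \<otimes>\<^sub>t cb') \<star> (s3 \<otimes>\<^sub>t (t3 \<otimes>\<^sub>t z3))) \<star> vert P (TAs (Mon D P) (reO D p X1) (reO D p Y1) Z0)"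
      using tens_assoc_natural[OF s3(1) _ d(1,2) t3(1) _ d(3,4) z3(1) _ d(5,6), of W] d by (simp add: cmp_assoc)
    also have "(ca' \<otimes>\<^sub>t cb') \<star> (s3 \<otimes>\<^sub>t (t3 \<otimes>\<^sub>t z3)) = (ca' \<star> s3) \<otimes>\<^sub>t (cb' \<star> (t3 \<otimes>\<^sub>t z3))"
      using s3(1) t3(1) z3(1) d ca cb by (intro tens_comp[symmetric]) simp_all
    also have "\<dots> = (s4 \<star> ca) \<otimes>\<^sub>t (bz \<star> cb)"
      using c1 cmp_reassoc[OF c2] r2 by (simp add: c cmp_assoc)
    also have "\<dots> = (s4 \<otimes>\<^sub>t bz) \<star> (ca \<otimes>\<^sub>t cb)"
      using s4(1,2) bz(1,2) ca cb by (intro tens_comp) simp_all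
    finally show ?thesis
      unfolding b2(2) using as(5) by (simp add: cmp_assoc c)
  qed
  show ?thesis
  proof (rule cocart_cancel[OF invertible_cocart[OF as(7)] _ _ _ _ _ main])
    have D1: "cd (vert P (ResT D p X1 Y1) \<otimes>\<^sub>t ide (P, Z0)) = (P, extO D (A \<otimes>\<^sub>c B) C (extO D A B X Y) Z)"
      using Rp by (simp add: extO_def[of D "A \<otimes>\<^sub>c B" C] extO_def[of D A B] flip: o defs)
    have stz: "arr ((s \<boxtimes> t) \<boxtimes> z)" "dm ((s \<boxtimes> t) \<boxtimes> z) = (P, extO D (A \<otimes>\<^sub>c B) C (extO D A B X Y) Z)"
      "cd ((s \<boxtimes> t) \<boxtimes> z) = (P', extO D (A' \<otimes>\<^sub>c B') C' (extO D A' B' X' Y') Z')" "base ((s \<boxtimes> t) \<boxtimes> z) = W"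
      "arr (s \<boxtimes> (t \<boxtimes> z))" "dm (s \<boxtimes> (t \<boxtimes> z)) = (A \<otimes>\<^sub>c (B \<otimes>\<^sub>c C), extO D A (B \<otimes>\<^sub>c C) X (extO D B C Y Z))"
      "base (s \<boxtimes> (t \<boxtimes> z)) = V"
      using s t z by (simp_all add: defs b)
    show "arr (asc A' B' C' X' Y' Z' \<star> ((s \<boxtimes> t) \<boxtimes> z))" "arr ((s \<boxtimes> (t \<boxtimes> z)) \<star> asc A B C X Y Z)"
      "dm (asc A' B' C' X' Y' Z' \<star> ((s \<boxtimes> t) \<boxtimes> z)) = cd (vert P (ResT D p X1 Y1) \<otimes>\<^sub>t ide (P, Z0))"
      "dm ((s \<boxtimes> (t \<boxtimes> z)) \<star> asc A B C X Y Z) = cd (vert P (ResT D p X1 Y1) \<otimes>\<^sub>t ide (P, Z0))"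
      using stz as as' D1 by simp_all
    show "base (asc A' B' C' X' Y' Z' \<star> ((s \<boxtimes> t) \<boxtimes> z)) = base ((s \<boxtimes> (t \<boxtimes> z)) \<star> asc A B C X Y Z)"
      using stz as as' sqa by (simp add: square_def)
  qed
qed

definition lun :: "'a scat \<Rightarrow> 'o \<Rightarrow> ('a, 'o, 'm) over_arr" where
  "lun A X = Over (pr2 \<^bold>e A) (extL D A X) X"

definition run :: "'a scat \<Rightarrow> 'o \<Rightarrow> ('a, 'o, 'm) over_arr" where
  "run A X = Over (pr1 A \<^bold>e) (extR D A X) X"

abbreviation unit0 :: "'o" where "unit0 \<equiv> TU (Mon D \<^bold>e)"

lemma TLR_iso:
  assumes "small_cat S A" "X \<in> Ob (DCat D A)"
  shows "TL (Mon D A) X \<in> isos (DCat D A) (TO (Mon D A) (TU (Mon D A)) X) X"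
    "TR (Mon D A) X \<in> isos (DCat D A) (TO (Mon D A) X (TU (Mon D A))) X"
  using monoidal_category.lunit_iso[OF mon_cat, OF assms] monoidal_category.runit_iso[OF mon_cat, OF assms]
  by simp_all

text \<open>
  As for the associator, precomposition with the invertible comparison \<open>1 \<cong> pr1\<^sup>* 1\<close> removes the inverse that occurs
  in the definition of the unit constraint.
\<close>

lemma ext_unit_expand:
  fixes A X
  defines "P \<equiv> \<^bold>e \<otimes>\<^sub>c A" and "X' \<equiv> reO D (pr2 \<^bold>e A) X"
  assumes A: "small_cat S A" and X: "X \<in> Ob (DCat D A)"
  shows "extL D A X \<in> isos (DCat D P) (extO D \<^bold>e A unit0 X) X'"
    "vert P (extL D A X) \<star> (vert P (ResU D (pr1 \<^bold>e A)) \<otimes>\<^sub>t ide (P, X')) = vert P (TL (Mon D P) X')"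
    "invertible (vert P (ResU D (pr1 \<^bold>e A)) \<otimes>\<^sub>t ide (P, X'))"
proof -
  have P [simp]: "small_cat S P" using A by (simp add: P_def)
  have X' [simp]: "X' \<in> Ob (DCat D P)" using D_res(1)[of "pr2 \<^bold>e A" X] A X by (simp add: X'_def P_def)
  have r: "ResU D (pr1 \<^bold>e A) \<in> isos (DCat D P) (TU (Mon D P)) (reO D (pr1 \<^bold>e A) unit0)"
    using ResU_simps(4)[of "pr1 \<^bold>e A"] A by (simp add: P_def)
  note i = inverse_in_iso[OF r P]
  let ?i = "inverse_in (DCat D P) (ResU D (pr1 \<^bold>e A))"
  have r': "ResU D (pr1 \<^bold>e A) \<in> Arr (DCat D P)" "Dom (DCat D P) (ResU D (pr1 \<^bold>e A)) = TU (Mon D P)"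
    "Cod (DCat D P) (ResU D (pr1 \<^bold>e A)) = reO D (pr1 \<^bold>e A) unit0"
    using r by (simp_all add: isos_def hom_def)
  have inv: "invertible (vert P ?i)" "invertible (vert P (ResU D (pr1 \<^bold>e A)))" "invertible (ide (P, X'))"
    "invertible (vert P (TL (Mon D P) X'))"
    using invertible_vert[OF i(6)] invertible_vert[OF r] invertible_vert[OF TLR_iso(1), of P X'] by simp_all
  show "invertible (vert P (ResU D (pr1 \<^bold>e A)) \<otimes>\<^sub>t ide (P, X'))"
    by (rule tens_invertible) (use inv in simp_all)
  have eL: "extL D A X = TL (Mon D P) X' \<cdot>\<^bsub>DCat D P\<^esub> TA (Mon D P) ?i (Idn (DCat D P) X')"
    by (simp add: extL_def Let_def X'_def P_def)
  have vL: "vert P (extL D A X) = vert P (TL (Mon D P) X') \<star> (vert P ?i \<otimes>\<^sub>t ide (P, X'))"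
    unfolding eL using i tens_vert[OF P, of ?i "Idn (DCat D P) X'"] by (simp add: vert_comp)
  have "invertible (vert P (extL D A X))"
    unfolding vL using inv tens_invertible[OF inv(1,3), of P] i
    by (intro invertible_comp) simp_all
  moreover have "dm (vert P (extL D A X)) = (P, extO D \<^bold>e A unit0 X)" "cd (vert P (extL D A X)) = (P, X')"
    unfolding eL using i by (simp_all add: extO_def) (simp_all add: P_def X'_def)
  ultimately show "extL D A X \<in> isos (DCat D P) (extO D \<^bold>e A unit0 X) X'"
    using vert_invertible_isos(1)[of "vert P (extL D A X)" P] by (simp add: vert_def)
  have "(vert P ?i \<otimes>\<^sub>t ide (P, X')) \<star> (vert P (ResU D (pr1 \<^bold>e A)) \<otimes>\<^sub>t ide (P, X'))
      = (vert P ?i \<star> vert P (ResU D (pr1 \<^bold>e A))) \<otimes>\<^sub>t (ide (P, X') \<star> ide (P, X'))"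
    using i r' by (intro tens_comp[symmetric]) simp_all
  also have "vert P ?i \<star> vert P (ResU D (pr1 \<^bold>e A)) = ide (P, TU (Mon D P))"
    using vert_comp[OF P r'(1) i(1)] i r' by simp
  finally show "vert P (extL D A X) \<star> (vert P (ResU D (pr1 \<^bold>e A)) \<otimes>\<^sub>t ide (P, X')) = vert P (TL (Mon D P) X')"
    unfolding vL by (simp add: cmp_assoc)
qed

lemma ext_runit_expand:
  fixes A X
  defines "P \<equiv> A \<otimes>\<^sub>c \<^bold>e" and "X' \<equiv> reO D (pr1 A \<^bold>e) X"
  assumes A: "small_cat S A" and X: "X \<in> Ob (DCat D A)"
  shows "extR D A X \<in> isos (DCat D P) (extO D A \<^bold>e X unit0) X'"
    "vert P (extR D A X) \<star> (ide (P, X') \<otimes>\<^sub>t vert P (ResU D (pr2 A \<^bold>e))) = vert P (TR (Mon D P) X')"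
    "invertible (ide (P, X') \<otimes>\<^sub>t vert P (ResU D (pr2 A \<^bold>e)))"
proof -
  have P [simp]: "small_cat S P" using A by (simp add: P_def)
  have X' [simp]: "X' \<in> Ob (DCat D P)" using D_res(1)[of "pr1 A \<^bold>e" X] A X by (simp add: X'_def P_def)
  have r: "ResU D (pr2 A \<^bold>e) \<in> isos (DCat D P) (TU (Mon D P)) (reO D (pr2 A \<^bold>e) unit0)"
    using ResU_simps(4)[of "pr2 A \<^bold>e"] A by (simp add: P_def)
  note i = inverse_in_iso[OF r P]
  let ?i = "inverse_in (DCat D P) (ResU D (pr2 A \<^bold>e))"
  have r': "ResU D (pr2 A \<^bold>e) \<in> Arr (DCat D P)" "Dom (DCat D P) (ResU D (pr2 A \<^bold>e)) = TU (Mon D P)"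
    "Cod (DCat D P) (ResU D (pr2 A \<^bold>e)) = reO D (pr2 A \<^bold>e) unit0"
    using r by (simp_all add: isos_def hom_def)
  have inv: "invertible (vert P ?i)" "invertible (vert P (ResU D (pr2 A \<^bold>e)))" "invertible (ide (P, X'))"
    "invertible (vert P (TR (Mon D P) X'))"
    using invertible_vert[OF i(6)] invertible_vert[OF r] invertible_vert[OF TLR_iso(2), of P X'] by simp_all
  show "invertible (ide (P, X') \<otimes>\<^sub>t vert P (ResU D (pr2 A \<^bold>e)))"
    by (rule tens_invertible) (use inv in simp_all)
  have eR: "extR D A X = TR (Mon D P) X' \<cdot>\<^bsub>DCat D P\<^esub> TA (Mon D P) (Idn (DCat D P) X') ?i"
    by (simp add: extR_def Let_def X'_def P_def)
  have vR: "vert P (extR D A X) = vert P (TR (Mon D P) X') \<star> (ide (P, X') \<otimes>\<^sub>t vert P ?i)"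
    unfolding eR using i tens_vert[OF P, of "Idn (DCat D P) X'" ?i] by (simp add: vert_comp)
  have "invertible (vert P (extR D A X))"
    unfolding vR using inv tens_invertible[OF inv(3,1), of P] i
    by (intro invertible_comp) simp_all
  moreover have "dm (vert P (extR D A X)) = (P, extO D A \<^bold>e X unit0)" "cd (vert P (extR D A X)) = (P, X')"
    unfolding eR using i by (simp_all add: extO_def) (simp_all add: P_def X'_def)
  ultimately show "extR D A X \<in> isos (DCat D P) (extO D A \<^bold>e X unit0) X'"
    using vert_invertible_isos(1)[of "vert P (extR D A X)" P] by (simp add: vert_def)
  have "(ide (P, X') \<otimes>\<^sub>t vert P ?i) \<star> (ide (P, X') \<otimes>\<^sub>t vert P (ResU D (pr2 A \<^bold>e)))
      = (ide (P, X') \<star> ide (P, X')) \<otimes>\<^sub>t (vert P ?i \<star> vert P (ResU D (pr2 A \<^bold>e)))"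
    using i r' by (intro tens_comp[symmetric]) simp_all
  also have "vert P ?i \<star> vert P (ResU D (pr2 A \<^bold>e)) = ide (P, TU (Mon D P))"
    using vert_comp[OF P r'(1) i(1)] i r' by simp
  finally show "vert P (extR D A X) \<star> (ide (P, X') \<otimes>\<^sub>t vert P (ResU D (pr2 A \<^bold>e))) = vert P (TR (Mon D P) X')"
    unfolding vR by (simp add: cmp_assoc)
qed

lemma unit_simps [simp]:
  assumes "small_cat S A" "X \<in> Ob (DCat D A)"
  shows "arr (lun A X)" "base (lun A X) = pr2 \<^bold>e A" "dm (lun A X) = (\<^bold>e \<otimes>\<^sub>c A, extO D \<^bold>e A unit0 X)"
    "cd (lun A X) = (A, X)"
    "arr (run A X)" "base (run A X) = pr1 A \<^bold>e" "dm (run A X) = (A \<otimes>\<^sub>c \<^bold>e, extO D A \<^bold>e X unit0)"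
    "cd (run A X) = (A, X)"
  using ext_unit_expand(1)[OF assms] ext_runit_expand(1)[OF assms] assms
  by (simp_all add: lun_def run_def isos_def hom_def)

lemma unit_eq_cart_vert:
  assumes "small_cat S A" "X \<in> Ob (DCat D A)"
  shows "lun A X = cart (pr2 \<^bold>e A) X \<star> vert (\<^bold>e \<otimes>\<^sub>c A) (extL D A X)"
    "run A X = cart (pr1 A \<^bold>e) X \<star> vert (A \<otimes>\<^sub>c \<^bold>e) (extR D A X)"
  using ext_unit_expand(1)[OF assms] ext_runit_expand(1)[OF assms] assms
    Over_eq_cart_vert[of "pr2 \<^bold>e A" X "extL D A X"] Over_eq_cart_vert[of "pr1 A \<^bold>e" X "extR D A X"]
  by (simp_all add: lun_def run_def isos_def hom_def)

lemma lun_invertible: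
  assumes "small_cat S A" "X \<in> Ob (DCat D A)"
  shows "invertible (lun A X)"
  unfolding unit_eq_cart_vert[OF assms]
proof (rule invertible_comp)
  show "invertible (vert (\<^bold>e \<otimes>\<^sub>c A) (extL D A X))"
    using invertible_vert[OF ext_unit_expand(1)[OF assms]] assms by simp
  show "invertible (cart (pr2 \<^bold>e A) X)"
    using assms pt_sec_inverse[of A] by (intro invertible_cart[of _ "pt_sec A"]) simp_all
  show "cd (vert (\<^bold>e \<otimes>\<^sub>c A) (extL D A X)) = dm (cart (pr2 \<^bold>e A) X)"
    using ext_unit_expand(1)[OF assms] assms by (simp add: isos_def hom_def)
qed

text \<open>
  The arrow \<open>s\<close> may lie over any functor. The case of a cartesian \<open>s\<close> is what makes \<open>i\<^sub>! 1 \<boxtimes> X \<cong> i\<^sub>! X\<close> compatible with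
  restriction in \<open>X\<close>.
\<close>

lemma lun_natural:
  assumes s: "arr s" "dm s = (A, X)" "cd s = (A', X')"
  shows "lun A' X' \<star> (ide (\<^bold>e, unit0) \<boxtimes> s) = s \<star> lun A X"
proof -
  define u where u: "u = base s"
  have ends: "Src u = A" "Tgt u = A'" using cd_dm_base(5,6)[of s] s by (simp_all add: u)
  have sm [simp]: "small_fun S u" "small_cat S A" "small_cat S A'" and O: "X \<in> Ob (DCat D A)" "X' \<in> Ob (DCat D A')"
    using arr_base[OF s(1)] arr_ob[OF s(1)] s by (simp_all add: u)
  define P P' p p' W where d: "P = \<^bold>e \<otimes>\<^sub>c A" "P' = \<^bold>e \<otimes>\<^sub>c A'" "p = pr1 \<^bold>e A" "p' = pr1 \<^bold>e A'"
    "W = id_fun \<^bold>e \<otimes>\<^sub>f u"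
  have P [simp]: "small_cat S P" "small_cat S P'" "small_fun S p" "small_fun S p'" "small_fun S W"
    "Src p = P" "Src p' = P'" "Tgt p = \<^bold>e" "Tgt p' = \<^bold>e" "Src W = P" "Tgt W = P'"
    by (simp_all add: d ends)
  have sq: "square (pr2 \<^bold>e A) (pr2 \<^bold>e A') W u" "square p p' W (id_fun \<^bold>e)"
    using square_pr[of "id_fun \<^bold>e" u] by (simp_all add: d ends)
  define s1 where s1_def: "s1 = pull (pr2 \<^bold>e A) (pr2 \<^bold>e A') W s"
  note s1 = pull_simps[OF s(1), unfolded u[symmetric], OF sq(1), folded s1_def, unfolded s]
  define X1 X1' where o: "X1 = reO D (pr2 \<^bold>e A) X" "X1' = reO D (pr2 \<^bold>e A') X'"
  have s1': "arr s1" "base s1 = W" "dm s1 = (P, X1)" "cd s1 = (P', X1')"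
    using s1 by (simp_all add: o d)
  have O1: "X1 \<in> Ob (DCat D P)" "X1' \<in> Ob (DCat D P')" using arr_ob[OF s1'(1)] s1' by simp_all
  have U1: "reO D p unit0 \<in> Ob (DCat D P)" "reO D p' unit0 \<in> Ob (DCat D P')"
    using D_res(1)[OF P(3)] D_res(1)[OF P(4)] by simp_all
  have sqe: "pr2 \<^bold>e A' \<odot> W = u \<odot> pr2 \<^bold>e A" using sq(1) unfolding square_def by blast
  have pW: "p' \<odot> W = p" using sq(2) by (simp add: square_def)
  have b: "ide (\<^bold>e, unit0) \<boxtimes> s = cart W (reO D p' unit0) \<otimes>\<^sub>t s1"
    using pull_cart[OF sq(2), of unit0] by (simp add: box_def Let_def s1_def d ends flip: u)
  note L = ext_unit_expand[OF sm(2) O(1), folded d o] and L' = ext_unit_expand[OF sm(3) O(2), folded d o]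
  have WU: "arr (cart W (reO D p' unit0))" "cd (cart W (reO D p' unit0)) = (P', reO D p' unit0)"
    "dm (cart W (reO D p' unit0)) = (P, reO D p unit0)"
    using U1 D_res_comp(1)[of W p' unit0] pW by simp_all
  have rU: "ResU D p \<in> Arr (DCat D P)" "Dom (DCat D P) (ResU D p) = TU (Mon D P)"
    "Cod (DCat D P) (ResU D p) = reO D p unit0"
    "ResU D p' \<in> Arr (DCat D P')" "Dom (DCat D P') (ResU D p') = TU (Mon D P')"
    "Cod (DCat D P') (ResU D p') = reO D p' unit0"
    using ResU_simps[OF P(3)] ResU_simps[OF P(4)] by simp_all
  \<comment> \<open>Both unit comparisons are restrictions of the unit over \<open>\<^bold>e\<close>, and \<open>p' \<odot> W = p\<close>.\<close>
  have un: "cart W (reO D p' unit0) \<star> vert P (ResU D p) = vert P' (ResU D p') \<star> unit_arr W"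
  proof (rule cart_cancel[of p' unit0])
    have "cart p' unit0 \<star> cart W (reO D p' unit0) \<star> vert P (ResU D p) = unit_arr p"
      using cart_comp[of W p' unit0] pW unit_arr_eq[of p] by (simp flip: cmp_assoc)
    also have "\<dots> = unit_arr p' \<star> unit_arr W" using unit_arr_comp[of W p'] pW by simp
    also have "\<dots> = cart p' unit0 \<star> vert P' (ResU D p') \<star> unit_arr W"
      using unit_arr_eq[of p'] by (simp add: cmp_assoc)
    finally show "cart p' unit0 \<star> cart W (reO D p' unit0) \<star> vert P (ResU D p)
      = cart p' unit0 \<star> vert P' (ResU D p') \<star> unit_arr W" .
  qed (use WU rU in simp_all)
  have main: "(lun A' X' \<star> (ide (\<^bold>e, unit0) \<boxtimes> s)) \<star> (vert P (ResU D p) \<otimes>\<^sub>t ide (P, X1))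
    = (s \<star> lun A X) \<star> (vert P (ResU D p) \<otimes>\<^sub>t ide (P, X1))"
  proof -
    have "(ide (\<^bold>e, unit0) \<boxtimes> s) \<star> (vert P (ResU D p) \<otimes>\<^sub>t ide (P, X1))
      = (cart W (reO D p' unit0) \<star> vert P (ResU D p)) \<otimes>\<^sub>t (s1 \<star> ide (P, X1))"
      unfolding b using WU rU s1' O1 by (intro tens_comp[symmetric]) simp_all
    also have "\<dots> = (vert P' (ResU D p') \<star> unit_arr W) \<otimes>\<^sub>t (ide (P', X1') \<star> s1)"
      using un s1' by simp
    also have "\<dots> = (vert P' (ResU D p') \<otimes>\<^sub>t ide (P', X1')) \<star> (unit_arr W \<otimes>\<^sub>t s1)"
      using rU s1' O1 by (intro tens_comp) simp_all
    finally have "vert P' (extL D A' X') \<star> (ide (\<^bold>e, unit0) \<boxtimes> s) \<star> (vert P (ResU D p) \<otimes>\<^sub>t ide (P, X1))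
      = s1 \<star> vert P (TL (Mon D P) X1)"
      using L'(2) tens_lunit_natural(1)[OF s1'] by (simp flip: cmp_assoc)
    then have "lun A' X' \<star> (ide (\<^bold>e, unit0) \<boxtimes> s) \<star> (vert P (ResU D p) \<otimes>\<^sub>t ide (P, X1))
      = cart (pr2 \<^bold>e A') X' \<star> s1 \<star> vert P (TL (Mon D P) X1)"
      using unit_eq_cart_vert(1)[OF sm(3) O(2)] by (simp add: cmp_assoc d)
    also have "\<dots> = s \<star> cart (pr2 \<^bold>e A) X \<star> vert P (TL (Mon D P) X1)"
      using s1(5) by (simp flip: cmp_assoc)
    also have "\<dots> = s \<star> lun A X \<star> (vert P (ResU D p) \<otimes>\<^sub>t ide (P, X1))"
      using L(2) unit_eq_cart_vert(1)[OF sm(2) O(1)] by (simp add: cmp_assoc d)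
    finally show ?thesis by (simp add: cmp_assoc)
  qed
  show ?thesis
  proof (rule cocart_cancel[OF invertible_cocart[OF L(3)] _ _ _ _ _ main])
    have c: "cd (vert P (ResU D p) \<otimes>\<^sub>t ide (P, X1)) = (P, extO D \<^bold>e A unit0 X)"
      using rU O1 by (simp add: extO_def flip: o d)
    show "arr (lun A' X' \<star> (ide (\<^bold>e, unit0) \<boxtimes> s))" "arr (s \<star> lun A X)"
      "dm (lun A' X' \<star> (ide (\<^bold>e, unit0) \<boxtimes> s)) = cd (vert P (ResU D p) \<otimes>\<^sub>t ide (P, X1))"
      "dm (s \<star> lun A X) = cd (vert P (ResU D p) \<otimes>\<^sub>t ide (P, X1))"
      using s O c by (simp_all add: d)
    show "base (lun A' X' \<star> (ide (\<^bold>e, unit0) \<boxtimes> s)) = base (s \<star> lun A X)"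
      using s O sqe by (simp flip: u d(5))
  qed
qed

lemma run_natural:
  assumes s: "arr s" "dm s = (A, X)" "cd s = (A', X')"
  shows "run A' X' \<star> (s \<boxtimes> ide (\<^bold>e, unit0)) = s \<star> run A X"
proof -
  define u where u: "u = base s"
  have ends: "Src u = A" "Tgt u = A'" using cd_dm_base(5,6)[of s] s by (simp_all add: u)
  have sm [simp]: "small_fun S u" "small_cat S A" "small_cat S A'" and O: "X \<in> Ob (DCat D A)" "X' \<in> Ob (DCat D A')"
    using arr_base[OF s(1)] arr_ob[OF s(1)] s by (simp_all add: u)
  define P P' p p' W where d: "P = A \<otimes>\<^sub>c \<^bold>e" "P' = A' \<otimes>\<^sub>c \<^bold>e" "p = pr2 A \<^bold>e" "p' = pr2 A' \<^bold>e"
    "W = u \<otimes>\<^sub>f id_fun \<^bold>e"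
  have P [simp]: "small_cat S P" "small_cat S P'" "small_fun S p" "small_fun S p'" "small_fun S W"
    "Src p = P" "Src p' = P'" "Tgt p = \<^bold>e" "Tgt p' = \<^bold>e" "Src W = P" "Tgt W = P'"
    by (simp_all add: d ends)
  have sq: "square (pr1 A \<^bold>e) (pr1 A' \<^bold>e) W u" "square p p' W (id_fun \<^bold>e)"
    using square_pr[of u "id_fun \<^bold>e"] by (simp_all add: d ends)
  define s1 where s1_def: "s1 = pull (pr1 A \<^bold>e) (pr1 A' \<^bold>e) W s"
  note s1 = pull_simps[OF s(1), unfolded u[symmetric], OF sq(1), folded s1_def, unfolded s]
  define X1 X1' where o: "X1 = reO D (pr1 A \<^bold>e) X" "X1' = reO D (pr1 A' \<^bold>e) X'"
  have s1': "arr s1" "base s1 = W" "dm s1 = (P, X1)" "cd s1 = (P', X1')"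
    using s1 by (simp_all add: o d)
  have O1: "X1 \<in> Ob (DCat D P)" "X1' \<in> Ob (DCat D P')" using arr_ob[OF s1'(1)] s1' by simp_all
  have U1: "reO D p unit0 \<in> Ob (DCat D P)" "reO D p' unit0 \<in> Ob (DCat D P')"
    using D_res(1)[OF P(3)] D_res(1)[OF P(4)] by simp_all
  have sqe: "pr1 A' \<^bold>e \<odot> W = u \<odot> pr1 A \<^bold>e" using sq(1) unfolding square_def by blast
  have pW: "p' \<odot> W = p" using sq(2) by (simp add: square_def)
  have b: "s \<boxtimes> ide (\<^bold>e, unit0) = s1 \<otimes>\<^sub>t cart W (reO D p' unit0)"
    using pull_cart[OF sq(2), of unit0] by (simp add: box_def Let_def s1_def d ends flip: u)
  note L = ext_runit_expand[OF sm(2) O(1), folded d o] and L' = ext_runit_expand[OF sm(3) O(2), folded d o]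
  have WU: "arr (cart W (reO D p' unit0))" "cd (cart W (reO D p' unit0)) = (P', reO D p' unit0)"
    "dm (cart W (reO D p' unit0)) = (P, reO D p unit0)"
    using U1 D_res_comp(1)[of W p' unit0] pW by simp_all
  have rU: "ResU D p \<in> Arr (DCat D P)" "Dom (DCat D P) (ResU D p) = TU (Mon D P)"
    "Cod (DCat D P) (ResU D p) = reO D p unit0"
    "ResU D p' \<in> Arr (DCat D P')" "Dom (DCat D P') (ResU D p') = TU (Mon D P')"
    "Cod (DCat D P') (ResU D p') = reO D p' unit0"
    using ResU_simps[OF P(3)] ResU_simps[OF P(4)] by simp_all
  have un: "cart W (reO D p' unit0) \<star> vert P (ResU D p) = vert P' (ResU D p') \<star> unit_arr W"
  proof (rule cart_cancel[of p' unit0])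
    have "cart p' unit0 \<star> cart W (reO D p' unit0) \<star> vert P (ResU D p) = unit_arr p"
      using cart_comp[of W p' unit0] pW unit_arr_eq[of p] by (simp flip: cmp_assoc)
    also have "\<dots> = unit_arr p' \<star> unit_arr W" using unit_arr_comp[of W p'] pW by simp
    also have "\<dots> = cart p' unit0 \<star> vert P' (ResU D p') \<star> unit_arr W"
      using unit_arr_eq[of p'] by (simp add: cmp_assoc)
    finally show "cart p' unit0 \<star> cart W (reO D p' unit0) \<star> vert P (ResU D p)
      = cart p' unit0 \<star> vert P' (ResU D p') \<star> unit_arr W" .
  qed (use WU rU in simp_all)
  have main: "(run A' X' \<star> (s \<boxtimes> ide (\<^bold>e, unit0))) \<star> (ide (P, X1) \<otimes>\<^sub>t vert P (ResU D p))
    = (s \<star> run A X) \<star> (ide (P, X1) \<otimes>\<^sub>t vert P (ResU D p))"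
  proof -
    have "(s \<boxtimes> ide (\<^bold>e, unit0)) \<star> (ide (P, X1) \<otimes>\<^sub>t vert P (ResU D p))
      = (s1 \<star> ide (P, X1)) \<otimes>\<^sub>t (cart W (reO D p' unit0) \<star> vert P (ResU D p))"
      unfolding b using WU rU s1' O1 by (intro tens_comp[symmetric]) simp_all
    also have "\<dots> = (ide (P', X1') \<star> s1) \<otimes>\<^sub>t (vert P' (ResU D p') \<star> unit_arr W)"
      using un s1' by simp
    also have "\<dots> = (ide (P', X1') \<otimes>\<^sub>t vert P' (ResU D p')) \<star> (s1 \<otimes>\<^sub>t unit_arr W)"
      using rU s1' O1 by (intro tens_comp) simp_all
    finally have "vert P' (extR D A' X') \<star> (s \<boxtimes> ide (\<^bold>e, unit0)) \<star> (ide (P, X1) \<otimes>\<^sub>t vert P (ResU D p))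
      = s1 \<star> vert P (TR (Mon D P) X1)"
      using L'(2) tens_lunit_natural(2)[OF s1'] by (simp flip: cmp_assoc)
    then have "run A' X' \<star> (s \<boxtimes> ide (\<^bold>e, unit0)) \<star> (ide (P, X1) \<otimes>\<^sub>t vert P (ResU D p))
      = cart (pr1 A' \<^bold>e) X' \<star> s1 \<star> vert P (TR (Mon D P) X1)"
      using unit_eq_cart_vert(2)[OF sm(3) O(2)] by (simp add: cmp_assoc d)
    also have "\<dots> = s \<star> cart (pr1 A \<^bold>e) X \<star> vert P (TR (Mon D P) X1)"
      using s1(5) by (simp flip: cmp_assoc)
    also have "\<dots> = s \<star> run A X \<star> (ide (P, X1) \<otimes>\<^sub>t vert P (ResU D p))"
      using L(2) unit_eq_cart_vert(2)[OF sm(2) O(1)] by (simp add: cmp_assoc d)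
    finally show ?thesis by (simp add: cmp_assoc)
  qed
  show ?thesis
  proof (rule cocart_cancel[OF invertible_cocart[OF L(3)] _ _ _ _ _ main])
    have c: "cd (ide (P, X1) \<otimes>\<^sub>t vert P (ResU D p)) = (P, extO D A \<^bold>e X unit0)"
      using rU O1 by (simp add: extO_def flip: o d)
    show "arr (run A' X' \<star> (s \<boxtimes> ide (\<^bold>e, unit0)))" "arr (s \<star> run A X)"
      "dm (run A' X' \<star> (s \<boxtimes> ide (\<^bold>e, unit0))) = cd (ide (P, X1) \<otimes>\<^sub>t vert P (ResU D p))"
      "dm (s \<star> run A X) = cd (ide (P, X1) \<otimes>\<^sub>t vert P (ResU D p))"
      using s O c by (simp_all add: d)
    show "base (run A' X' \<star> (s \<boxtimes> ide (\<^bold>e, unit0))) = base (s \<star> run A X)"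
      using s O sqe by (simp flip: u d(5))
  qed
qed

section \<open>External products of cocartesian arrows\<close>

lemma Over_cart:
  assumes "small_fun S m" "small_fun S w" "Tgt m = Src w" "f \<in> Arr (DCat D (Src w))"
    "Y \<in> Ob (DCat D (Tgt w))" "Cod (DCat D (Src w)) f = reO D w Y" "Dom (DCat D (Src w)) f = X"
  shows "Over w f Y \<star> cart m X = Over (w \<odot> m) (reA D m f) Y"
proof -
  have X: "X \<in> Ob (DCat D (Tgt m))" using assms D_cat(1)[of "Src w" f] by simp
  have "reA D m f \<in> Arr (DCat D (Src m))" "Dom (DCat D (Src m)) (reA D m f) = reO D m X"
    using D_res(2,3)[OF assms(1), of f] assms by simp_all
  then show ?thesis unfolding cmp_def using assms X by simp (simp add: cart_def)
qed

lemma box_Over: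
  assumes "arr (Over u f X)" "arr (Over v g Y)"
  shows "Over u f X \<boxtimes> Over v g Y = Over (u \<otimes>\<^sub>f v)
    (extRes D u v X Y \<cdot>\<^bsub>DCat D (Src u \<otimes>\<^sub>c Src v)\<^esub> extA D (Src u) (Src v) f g) (extO D (Tgt u) (Tgt v) X Y)"
proof -
  have a: "small_fun S u" "X \<in> Ob (DCat D (Tgt u))" "f \<in> Arr (DCat D (Src u))"
    "Cod (DCat D (Src u)) f = reO D u X" "small_fun S v" "Y \<in> Ob (DCat D (Tgt v))"
    "g \<in> Arr (DCat D (Src v))" "Cod (DCat D (Src v)) g = reO D v Y"
    using assms by simp_all
  have "Over u f X \<boxtimes> Over v g Y = (cart u X \<boxtimes> cart v Y) \<star> (vert (Src u) f \<boxtimes> vert (Src v) g)"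
    unfolding Over_eq_cart_vert[OF a(1-4)] Over_eq_cart_vert[OF a(5-8)]
    using a by (intro box_comp) simp_all
  also have "\<dots> = cart (u \<otimes>\<^sub>f v) (extO D (Tgt u) (Tgt v) X Y)
     \<star> vert (Src u \<otimes>\<^sub>c Src v) (extRes D u v X Y \<cdot>\<^bsub>DCat D (Src u \<otimes>\<^sub>c Src v)\<^esub> extA D (Src u) (Src v) f g)"
    using a by (simp add: box_cart box_vert vert_comp cmp_assoc)
  finally show ?thesis using a by (subst Over_eq_cart_vert) simp_all
qed

text \<open>
  This is cocontinuity of the product. Its axioms say that the canonical maps
  \<open>(u \<times> 1)\<^sub>! (X \<boxtimes> Y) \<rightarrow> u\<^sub>! X \<boxtimes> Y\<close> and \<open>(1 \<times> u)\<^sub>! (Y \<boxtimes> X) \<rightarrow> Y \<boxtimes> u\<^sub>! X\<close> are invertible, and these maps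
  are the transposes of the arrows shown here to be cocartesian.
\<close>

lemma lan_arr_box_cocart:
  assumes "small_fun S u" "small_cat S B" "X \<in> Ob (DCat D (Src u))" "Y \<in> Ob (DCat D B)"
  shows "cocart (lan_arr u X \<boxtimes> ide (B, Y))" "cocart (ide (B, Y) \<boxtimes> lan_arr u X)"
proof -
  define X' where X': "X' = FO (lkan D u) X"
  have o: "X' \<in> Ob (DCat D (Tgt u))" using assms by (simp add: X')
  have l: "lan_unit D u X \<in> Arr (DCat D (Src u))" "Dom (DCat D (Src u)) (lan_unit D u X) = X"
    "Cod (DCat D (Src u)) (lan_unit D u X) = reO D u X'"
    using lan_unit_simps[OF assms(1,3)] by (simp_all add: X')
  note er = extRes_simps[of u "id_fun B" X' Y] extRes_simps[of "id_fun B" u Y X']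
  let ?f = "extRes D u (id_fun B) X' Y \<cdot>\<^bsub>DCat D (Src u \<otimes>\<^sub>c B)\<^esub> extA D (Src u) B (lan_unit D u X) (Idn (DCat D B) Y)"
  have 1: "lan_arr u X \<boxtimes> ide (B, Y) = Over (u \<otimes>\<^sub>f id_fun B) ?f (extO D (Tgt u) B X' Y)"
    unfolding lan_arr_def ide_def using assms l o box_Over[of u "lan_unit D u X" X' "id_fun B" "Idn (DCat D B) Y" Y]
    by (simp flip: X')
  have iso: "is_iso (DCat D (Tgt u \<otimes>\<^sub>c B)) (transpose (u \<otimes>\<^sub>f id_fun B) ?f (extO D (Tgt u) B X' Y))"
    using cocontinuous1[OF assms(1,2,3,4)] by (simp add: cocont1_def Let_def transpose_def X')
  show "cocart (lan_arr u X \<boxtimes> ide (B, Y))"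
    unfolding 1 using assms l o iso er by (intro cocart_of_transpose) simp_all
  let ?g = "extRes D (id_fun B) u Y X' \<cdot>\<^bsub>DCat D (B \<otimes>\<^sub>c Src u)\<^esub> extA D B (Src u) (Idn (DCat D B) Y) (lan_unit D u X)"
  have 2: "ide (B, Y) \<boxtimes> lan_arr u X = Over (id_fun B \<otimes>\<^sub>f u) ?g (extO D B (Tgt u) Y X')"
    unfolding lan_arr_def ide_def using assms l o box_Over[of "id_fun B" "Idn (DCat D B) Y" Y u "lan_unit D u X" X']
    by (simp flip: X')
  have iso2: "is_iso (DCat D (B \<otimes>\<^sub>c Tgt u)) (transpose (id_fun B \<otimes>\<^sub>f u) ?g (extO D B (Tgt u) Y X'))"
    using cocontinuous2[OF assms(2,1,4,3)] by (simp add: cocont2_def Let_def transpose_def X')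
  show "cocart (ide (B, Y) \<boxtimes> lan_arr u X)"
    unfolding 2 using assms l o iso2 er by (intro cocart_of_transpose) simp_all
qed

lemma invertible_ide_ob: "ob P \<Longrightarrow> invertible (ide P)"
  by (cases P) simp

lemma cocart_eq_lan_arr:
  assumes "cocart k"
  obtains m where "invertible m" "dm m = cd (lan_arr (base k) (snd (dm k)))" "cd m = cd k"
    "k = m \<star> lan_arr (base k) (snd (dm k))"
proof -
  have k: "arr k" using assms by simp
  have o: "snd (dm k) \<in> Ob (DCat D (Src (base k)))"
    using arr_ob(1)[OF k] by (simp only: ob_def fst_dm_cd)
  have l: "cocart (lan_arr (base k) (snd (dm k)))" using o k by (intro cocart_lan_arr) simp_all
  have d: "dm (lan_arr (base k) (snd (dm k))) = dm k" using o k by (simp add: prod_eq_iff)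
  obtain m where m: "invertible m" "base m = id_fun (Tgt (base (lan_arr (base k) (snd (dm k)))))"
    "dm m = cd (lan_arr (base k) (snd (dm k)))" "cd m = cd k" "m \<star> lan_arr (base k) (snd (dm k)) = k"
    by (rule cocart_unique[OF l assms d lan_arr_simps(1)])
  show ?thesis by (rule that[OF m(1,3,4) m(5)[symmetric]])
qed

lemma cocart_box_ide:
  assumes k: "cocart k" and P: "ob P"
  shows "cocart (k \<boxtimes> ide P)" "cocart (ide P \<boxtimes> k)"
proof -
  obtain m where m: "invertible m" "dm m = cd (lan_arr (base k) (snd (dm k)))" "cd m = cd k"
    "k = m \<star> lan_arr (base k) (snd (dm k))"
    by (rule cocart_eq_lan_arr[OF k])
  define l where "l = lan_arr (base k) (snd (dm k))"
  have ka: "arr k" using k by simp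
  have o: "small_fun S (base k)" "snd (dm k) \<in> Ob (DCat D (Src (base k)))"
    using arr_base[OF ka] arr_ob(1)[OF ka] by (simp_all only: ob_def fst_dm_cd)
  have l: "arr l" "cd l = dm m" using o m(1-3) by (simp_all add: l_def)
  have kl: "k = m \<star> l" unfolding l_def by (fact m(4))
  have lc: "cocart (l \<boxtimes> ide P)" "cocart (ide P \<boxtimes> l)"
    using lan_arr_box_cocart[OF o(1) _ o(2), of "fst P" "snd P"] P by (simp_all add: l_def ob_def)
  have "k \<boxtimes> ide P = (m \<boxtimes> ide P) \<star> (l \<boxtimes> ide P)"
    using box_comp[of l "ide P" m "ide P"] l m(1) P unfolding kl by simp
  moreover have "cocart ((m \<boxtimes> ide P) \<star> (l \<boxtimes> ide P))"
    using l m(1) P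
    by (intro cocart_comp[OF lc(1) invertible_cocart[OF box_invertible[OF m(1) invertible_ide_ob[OF P]]]])
      simp_all
  ultimately show "cocart (k \<boxtimes> ide P)" by simp
  have "ide P \<boxtimes> k = (ide P \<boxtimes> m) \<star> (ide P \<boxtimes> l)"
    using box_comp[of "ide P" l "ide P" m] l m(1) P unfolding kl by simp
  moreover have "cocart ((ide P \<boxtimes> m) \<star> (ide P \<boxtimes> l))"
    using l m(1) P
    by (intro cocart_comp[OF lc(2) invertible_cocart[OF box_invertible[OF invertible_ide_ob[OF P] m(1)]]])
      simp_all
  ultimately show "cocart (ide P \<boxtimes> k)" by simp
qed

text \<open>
  As \<open>k \<boxtimes> l = (1 \<boxtimes> l) (k \<boxtimes> 1)\<close>, cocontinuity in each variable separately is enough.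
\<close>

lemma cocart_box:
  assumes "cocart k" "cocart l"
  shows "cocart (k \<boxtimes> l)"
proof -
  have a: "arr k" "arr l" using assms by simp_all
  have "k \<boxtimes> l = (ide (cd k) \<boxtimes> l) \<star> (k \<boxtimes> ide (dm l))"
    using box_comp[of k "ide (dm l)" "ide (cd k)" l] a by simp
  moreover have "cocart ((ide (cd k) \<boxtimes> l) \<star> (k \<boxtimes> ide (dm l)))"
    using a cocart_box_ide[OF assms(1), of "dm l"] cocart_box_ide[OF assms(2), of "cd k"]
    by (intro cocart_comp) simp_all
  ultimately show ?thesis by simp
qed

section \<open>Universal arrows of the affine line\<close>

text \<open>
  The universal arrow \<open>X \<boxtimes> Y \<rightarrow> X \<boxtimes>\<^sub>A\<^sub>1 Y\<close> over addition.
\<close>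

definition lam :: "'a scat \<Rightarrow> 'a scat \<Rightarrow> 'o \<Rightarrow> 'o \<Rightarrow> ('a, 'o, 'm) over_arr" where
  "lam I J X Y = Over (line_plus I J) (line_univ D I J X Y) (lineO D I J X Y)"

text \<open>
  Object and arrow parts of \<open>i\<^sub>!: D(I) \<rightarrow> D(\<^bold>N \<times> I)\<close>.
\<close>

definition iO :: "'a scat \<Rightarrow> 'o \<Rightarrow> 'o" where
  "iO I X = FO (MF (structure_morphism D) I) X"

definition iA :: "'a scat \<Rightarrow> 'm \<Rightarrow> 'm" where
  "iA I f = FA (MF (structure_morphism D) I) f"

text \<open>
  The universal arrow \<open>X \<rightarrow> i\<^sub>! X\<close>. As \<open>i\<^sub>!\<close> is formed over \<open>\<^bold>e \<times> I\<close>, the unit of the Kan extension is preceded by the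
  invertible cartesian arrow that removes the factor \<open>\<^bold>e\<close>.
\<close>

definition kap :: "'a scat \<Rightarrow> 'o \<Rightarrow> ('a, 'o, 'm) over_arr" where
  "kap I X = lan_arr (N_pt \<otimes>\<^sub>f id_fun I) (reO D (pr2 \<^bold>e I) X) \<star> cart (pt_sec I) (reO D (pr2 \<^bold>e I) X)"

lemma N_plus_fun [simp]:
  assumes "small_cat S I" "small_cat S J"
  shows "small_fun S (N_plus \<otimes>\<^sub>f id_fun (I \<otimes>\<^sub>c J))" "small_fun S (line_swap I J)"
    "Src (line_swap I J) = (\<^bold>N \<otimes>\<^sub>c \<^bold>N) \<otimes>\<^sub>c (I \<otimes>\<^sub>c J)" "Tgt (line_swap I J) = (\<^bold>N \<otimes>\<^sub>c I) \<otimes>\<^sub>c (\<^bold>N \<otimes>\<^sub>c J)"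
  using assms by (simp_all add: line_swap_def)

text \<open>
  The Kan extension \<open>+\<^sub>!\<close> acts on an object over \<open>(\<^bold>N \<times> \<^bold>N) \<times> (I \<times> J)\<close>. The interchange of factors that moves the external
  product there is an isomorphism of categories, so its cartesian lift is invertible.
\<close>

lemma lam_eq:
  fixes I J X Y
  defines "m \<equiv> mid_swap \<^bold>N I \<^bold>N J" and "Z \<equiv> reO D (line_swap I J) (extO D (\<^bold>N \<otimes>\<^sub>c I) (\<^bold>N \<otimes>\<^sub>c J) X Y)"
  assumes IJ: "small_cat S I" "small_cat S J" and X: "X \<in> Ob (DCat D (\<^bold>N \<otimes>\<^sub>c I))"
    and Y: "Y \<in> Ob (DCat D (\<^bold>N \<otimes>\<^sub>c J))"
  shows "lam I J X Y = lan_arr (N_plus \<otimes>\<^sub>f id_fun (I \<otimes>\<^sub>c J)) Z \<star> cart m Z"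
    "Z \<in> Ob (DCat D ((\<^bold>N \<otimes>\<^sub>c \<^bold>N) \<otimes>\<^sub>c (I \<otimes>\<^sub>c J)))"
    "reO D m Z = extO D (\<^bold>N \<otimes>\<^sub>c I) (\<^bold>N \<otimes>\<^sub>c J) X Y" "invertible (cart m Z)"
proof -
  have E: "extO D (\<^bold>N \<otimes>\<^sub>c I) (\<^bold>N \<otimes>\<^sub>c J) X Y \<in> Ob (DCat D ((\<^bold>N \<otimes>\<^sub>c I) \<otimes>\<^sub>c (\<^bold>N \<otimes>\<^sub>c J)))"
    using assms by simp
  show Z: "Z \<in> Ob (DCat D ((\<^bold>N \<otimes>\<^sub>c \<^bold>N) \<otimes>\<^sub>c (I \<otimes>\<^sub>c J)))"
    using D_res(1)[of "line_swap I J"] IJ E by (simp add: Z_def)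
  have sm: "small_fun S m" "Src m = (\<^bold>N \<otimes>\<^sub>c I) \<otimes>\<^sub>c (\<^bold>N \<otimes>\<^sub>c J)" "Tgt m = (\<^bold>N \<otimes>\<^sub>c \<^bold>N) \<otimes>\<^sub>c (I \<otimes>\<^sub>c J)"
    using IJ by (simp_all add: m_def)
  have ms: "line_swap I J \<odot> m = id_fun ((\<^bold>N \<otimes>\<^sub>c I) \<otimes>\<^sub>c (\<^bold>N \<otimes>\<^sub>c J))"
    "m \<odot> line_swap I J = id_fun ((\<^bold>N \<otimes>\<^sub>c \<^bold>N) \<otimes>\<^sub>c (I \<otimes>\<^sub>c J))"
    using IJ by (simp_all add: m_def line_swap_def mid_swap_mid_swap)
  show "reO D m Z = extO D (\<^bold>N \<otimes>\<^sub>c I) (\<^bold>N \<otimes>\<^sub>c J) X Y"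
    using D_res_comp(1)[OF sm(1), of "line_swap I J" "extO D (\<^bold>N \<otimes>\<^sub>c I) (\<^bold>N \<otimes>\<^sub>c J) X Y"] ms IJ E sm
    by (simp add: Z_def)
  show "invertible (cart m Z)"
    using IJ sm ms Z by (intro invertible_cart[of _ "line_swap I J"]) simp_all
  show "lam I J X Y = lan_arr (N_plus \<otimes>\<^sub>f id_fun (I \<otimes>\<^sub>c J)) Z \<star> cart m Z"
    unfolding lan_arr_def using IJ Z sm lan_unit_simps[of "N_plus \<otimes>\<^sub>f id_fun (I \<otimes>\<^sub>c J)" Z]
      lkan_simps(1)[of "N_plus \<otimes>\<^sub>f id_fun (I \<otimes>\<^sub>c J)" Z]
    by (subst Over_cart) (simp_all add: lam_def line_plus_def line_univ_def lineO_def m_def Z_def lan_mor_def)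
qed

lemma lam_simps [simp]:
  assumes "small_cat S I" "small_cat S J" "X \<in> Ob (DCat D (\<^bold>N \<otimes>\<^sub>c I))" "Y \<in> Ob (DCat D (\<^bold>N \<otimes>\<^sub>c J))"
  shows "cocart (lam I J X Y)" "base (lam I J X Y) = line_plus I J"
    "dm (lam I J X Y) = ((\<^bold>N \<otimes>\<^sub>c I) \<otimes>\<^sub>c (\<^bold>N \<otimes>\<^sub>c J), extO D (\<^bold>N \<otimes>\<^sub>c I) (\<^bold>N \<otimes>\<^sub>c J) X Y)"
    "cd (lam I J X Y) = (\<^bold>N \<otimes>\<^sub>c (I \<otimes>\<^sub>c J), lineO D I J X Y)"
proof -
  note l = lam_eq[OF assms]
  show "cocart (lam I J X Y)"
    unfolding l(1) using l assms by (intro cocart_comp cocart_lan_arr invertible_cocart) simp_all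
  show "dm (lam I J X Y) = ((\<^bold>N \<otimes>\<^sub>c I) \<otimes>\<^sub>c (\<^bold>N \<otimes>\<^sub>c J), extO D (\<^bold>N \<otimes>\<^sub>c I) (\<^bold>N \<otimes>\<^sub>c J) X Y)"
    unfolding l(1) using l assms by simp
qed (simp_all add: lam_def)

lemma lineO_ob [simp]:
  assumes "small_cat S I" "small_cat S J" "X \<in> Ob (DCat D (\<^bold>N \<otimes>\<^sub>c I))" "Y \<in> Ob (DCat D (\<^bold>N \<otimes>\<^sub>c J))"
  shows "lineO D I J X Y \<in> Ob (DCat D (\<^bold>N \<otimes>\<^sub>c (I \<otimes>\<^sub>c J)))"
  using arr_ob(2)[OF cocart_arr[OF lam_simps(1)[OF assms]]] assms by simp

text \<open>
  The first fact determines \<open>lineA\<close>, since \<open>lam\<close> is cocartesian; it replaces the definition from here on.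
\<close>

lemma
  assumes IJ: "small_cat S I" "small_cat S J" and f: "f \<in> Arr (DCat D (\<^bold>N \<otimes>\<^sub>c I))"
    and g: "g \<in> Arr (DCat D (\<^bold>N \<otimes>\<^sub>c J))"
  defines "X \<equiv> Dom (DCat D (\<^bold>N \<otimes>\<^sub>c I)) f" and "X' \<equiv> Cod (DCat D (\<^bold>N \<otimes>\<^sub>c I)) f"
    and "Y \<equiv> Dom (DCat D (\<^bold>N \<otimes>\<^sub>c J)) g" and "Y' \<equiv> Cod (DCat D (\<^bold>N \<otimes>\<^sub>c J)) g"
  shows lineA_lam: "vert (\<^bold>N \<otimes>\<^sub>c (I \<otimes>\<^sub>c J)) (lineA D I J f g) \<star> lam I J X Y
    = lam I J X' Y' \<star> (vert (\<^bold>N \<otimes>\<^sub>c I) f \<boxtimes> vert (\<^bold>N \<otimes>\<^sub>c J) g)"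
    and lineA_simps [simp]: "lineA D I J f g \<in> Arr (DCat D (\<^bold>N \<otimes>\<^sub>c (I \<otimes>\<^sub>c J)))"
    "Dom (DCat D (\<^bold>N \<otimes>\<^sub>c (I \<otimes>\<^sub>c J))) (lineA D I J f g) = lineO D I J X Y"
    "Cod (DCat D (\<^bold>N \<otimes>\<^sub>c (I \<otimes>\<^sub>c J))) (lineA D I J f g) = lineO D I J X' Y'"
proof -
  define m w where mw: "m = mid_swap \<^bold>N I \<^bold>N J" "w = N_plus \<otimes>\<^sub>f id_fun (I \<otimes>\<^sub>c J)"
  define L where "L = (\<^bold>N \<otimes>\<^sub>c I) \<otimes>\<^sub>c (\<^bold>N \<otimes>\<^sub>c J)"
  define L' where "L' = (\<^bold>N \<otimes>\<^sub>c \<^bold>N) \<otimes>\<^sub>c (I \<otimes>\<^sub>c J)"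
  define h where "h = extA D (\<^bold>N \<otimes>\<^sub>c I) (\<^bold>N \<otimes>\<^sub>c J) f g"
  have o: "X \<in> Ob (DCat D (\<^bold>N \<otimes>\<^sub>c I))" "X' \<in> Ob (DCat D (\<^bold>N \<otimes>\<^sub>c I))"
    "Y \<in> Ob (DCat D (\<^bold>N \<otimes>\<^sub>c J))" "Y' \<in> Ob (DCat D (\<^bold>N \<otimes>\<^sub>c J))"
    using assms by simp_all
  have h: "h \<in> Arr (DCat D L)" "Dom (DCat D L) h = extO D (\<^bold>N \<otimes>\<^sub>c I) (\<^bold>N \<otimes>\<^sub>c J) X Y"
    "Cod (DCat D L) h = extO D (\<^bold>N \<otimes>\<^sub>c I) (\<^bold>N \<otimes>\<^sub>c J) X' Y'"
    using assms by (simp_all add: h_def L_def)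
  define Z Z' k where Z: "Z = reO D (line_swap I J) (extO D (\<^bold>N \<otimes>\<^sub>c I) (\<^bold>N \<otimes>\<^sub>c J) X Y)"
    "Z' = reO D (line_swap I J) (extO D (\<^bold>N \<otimes>\<^sub>c I) (\<^bold>N \<otimes>\<^sub>c J) X' Y')"
    and k_def: "k = reA D (line_swap I J) h"
  note l = lam_eq[OF IJ o(1,3), folded mw Z] and l' = lam_eq[OF IJ o(2,4), folded mw Z]
  have sm: "small_fun S m" "Src m = L" "Tgt m = L'" "small_fun S w" "Src w = L'" "Tgt w = \<^bold>N \<otimes>\<^sub>c (I \<otimes>\<^sub>c J)"
    "small_fun S (line_swap I J)" "Src (line_swap I J) = L'" "Tgt (line_swap I J) = L"
    using IJ by (simp_all add: mw L_def L'_def)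
  have k: "k \<in> Arr (DCat D L')" "Dom (DCat D L') k = Z" "Cod (DCat D L') k = Z'"
    using D_res(2-4)[OF sm(7), of h] h by (simp_all add: sm k_def Z)
  have ms: "line_swap I J \<odot> m = id_fun L"
    using IJ by (simp add: mw line_swap_def mid_swap_mid_swap L_def)
  have mk: "reA D m k = h"
    using D_res_comp(2)[OF sm(1) sm(7)] ms h sm IJ by (simp add: k_def L_def)
  have A: "lineA D I J f g = FA (lkan D w) k"
    by (simp add: lineA_def lan_mor_def mw k_def h_def)
  have O: "lineO D I J X Y = FO (lkan D w) Z" "lineO D I J X' Y' = FO (lkan D w) Z'"
    by (simp_all add: lineO_def lan_mor_def mw Z)
  show "lineA D I J f g \<in> Arr (DCat D (\<^bold>N \<otimes>\<^sub>c (I \<otimes>\<^sub>c J)))"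
    "Dom (DCat D (\<^bold>N \<otimes>\<^sub>c (I \<otimes>\<^sub>c J))) (lineA D I J f g) = lineO D I J X Y"
    "Cod (DCat D (\<^bold>N \<otimes>\<^sub>c (I \<otimes>\<^sub>c J))) (lineA D I J f g) = lineO D I J X' Y'"
    unfolding A O using lkan_simps(2-4)[OF sm(4), of k] k by (simp_all add: sm)
  have "vert (\<^bold>N \<otimes>\<^sub>c (I \<otimes>\<^sub>c J)) (FA (lkan D w) k) \<star> lan_arr w Z = lan_arr w Z' \<star> vert L' k"
    using lkan_lan_arr[OF sm(4), of k] k by (simp add: sm)
  moreover have "vert L' k \<star> cart m Z = cart m Z' \<star> vert L h"
    using cart_natural[OF sm(1), of k] k mk by (simp add: sm)
  moreover have "vert L h = vert (\<^bold>N \<otimes>\<^sub>c I) f \<boxtimes> vert (\<^bold>N \<otimes>\<^sub>c J) g"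
    using box_vert[of "\<^bold>N \<otimes>\<^sub>c I" "\<^bold>N \<otimes>\<^sub>c J" f g] f g IJ by (simp add: h_def L_def)
  ultimately show "vert (\<^bold>N \<otimes>\<^sub>c (I \<otimes>\<^sub>c J)) (lineA D I J f g) \<star> lam I J X Y
    = lam I J X' Y' \<star> (vert (\<^bold>N \<otimes>\<^sub>c I) f \<boxtimes> vert (\<^bold>N \<otimes>\<^sub>c J) g)"
    unfolding A l(1) l'(1) by (metis cmp_assoc)
qed

lemma structure_functor:
  assumes "small_cat S I"
  shows "is_functor (MF (structure_morphism D) I)" "Src (MF (structure_morphism D) I) = DCat D I"
    "Tgt (MF (structure_morphism D) I) = DCat D (\<^bold>N \<otimes>\<^sub>c I)"
    "X \<in> Ob (DCat D I) \<Longrightarrow> iO I X = FO (lkan D (N_pt \<otimes>\<^sub>f id_fun I)) (reO D (pr2 \<^bold>e I) X)"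
    "f \<in> Arr (DCat D I) \<Longrightarrow> iA I f = FA (lkan D (N_pt \<otimes>\<^sub>f id_fun I)) (reA D (pr2 \<^bold>e I) f)"
proof -
  have s: "small_fun S (N_pt \<otimes>\<^sub>f id_fun I)" "small_fun S (pr2 \<^bold>e I)" using assms by simp_all
  note l = lkan_functor[OF s(1)] and p = "fun"[OF s(2)]
  show "is_functor (MF (structure_morphism D) I)" "Src (MF (structure_morphism D) I) = DCat D I"
    "Tgt (MF (structure_morphism D) I) = DCat D (\<^bold>N \<otimes>\<^sub>c I)"
    "X \<in> Ob (DCat D I) \<Longrightarrow> iO I X = FO (lkan D (N_pt \<otimes>\<^sub>f id_fun I)) (reO D (pr2 \<^bold>e I) X)"
    "f \<in> Arr (DCat D I) \<Longrightarrow> iA I f = FA (lkan D (N_pt \<otimes>\<^sub>f id_fun I)) (reA D (pr2 \<^bold>e I) f)"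
    using l p by (simp_all add: structure_morphism_def lan_mor_def is_functor_comp_fun iO_def iA_def)
qed

lemma iO_ob [simp]: "small_cat S I \<Longrightarrow> X \<in> Ob (DCat D I) \<Longrightarrow> iO I X \<in> Ob (DCat D (\<^bold>N \<otimes>\<^sub>c I))"
  using is_functor.obj_in[OF structure_functor(1), of I X] structure_functor(2,3)[of I] by (simp add: iO_def)

lemma iA_simps [simp]:
  assumes "small_cat S I" "f \<in> Arr (DCat D I)"
  shows "iA I f \<in> Arr (DCat D (\<^bold>N \<otimes>\<^sub>c I))" "Dom (DCat D (\<^bold>N \<otimes>\<^sub>c I)) (iA I f) = iO I (Dom (DCat D I) f)"
    "Cod (DCat D (\<^bold>N \<otimes>\<^sub>c I)) (iA I f) = iO I (Cod (DCat D I) f)"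
  using is_functor.FA_simps[OF structure_functor(1)[OF assms(1)], of f] structure_functor(2,3)[OF assms(1)] assms
  by (simp_all add: iO_def iA_def)

lemma pr2_ob [simp]: "small_cat S I \<Longrightarrow> X \<in> Ob (DCat D I) \<Longrightarrow> reO D (pr2 \<^bold>e I) X \<in> Ob (DCat D (\<^bold>e \<otimes>\<^sub>c I))"
  using D_res(1)[of "pr2 \<^bold>e I" X] by simp

lemma pt_sec_res:
  assumes "small_cat S I"
  shows "X \<in> Ob (DCat D I) \<Longrightarrow> reO D (pt_sec I) (reO D (pr2 \<^bold>e I) X) = X"
    "f \<in> Arr (DCat D I) \<Longrightarrow> reA D (pt_sec I) (reA D (pr2 \<^bold>e I) f) = f"
  using D_res_comp[of "pt_sec I" "pr2 \<^bold>e I"] assms pt_sec_inverse(2)[OF assms] by simp_all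

lemma kap_simps [simp]:
  assumes "small_cat S I" "X \<in> Ob (DCat D I)"
  shows "cocart (kap I X)" "base (kap I X) = line_pt I" "dm (kap I X) = (I, X)"
    "cd (kap I X) = (\<^bold>N \<otimes>\<^sub>c I, iO I X)"
proof -
  have s: "dm (cart (pt_sec I) (reO D (pr2 \<^bold>e I) X)) = (I, X)"
    "invertible (cart (pt_sec I) (reO D (pr2 \<^bold>e I) X))"
    using assms pt_sec_res(1)[OF assms] pt_sec_inverse[OF assms(1)]
    by (simp, intro invertible_cart[of _ "pr2 \<^bold>e I"], simp_all)
  show "cocart (kap I X)" unfolding kap_def
    using assms s by (intro cocart_comp cocart_lan_arr invertible_cocart) simp_all
  show "base (kap I X) = line_pt I" "dm (kap I X) = (I, X)" "cd (kap I X) = (\<^bold>N \<otimes>\<^sub>c I, iO I X)"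
    using assms s structure_functor(4)[OF assms] by (simp_all add: kap_def line_pt_def)
qed

lemma kap_pr2:
  assumes "small_cat S I" "X \<in> Ob (DCat D I)"
  shows "kap I X \<star> cart (pr2 \<^bold>e I) X = lan_arr (N_pt \<otimes>\<^sub>f id_fun I) (reO D (pr2 \<^bold>e I) X)"
proof -
  have "cart (pt_sec I) (reO D (pr2 \<^bold>e I) X) \<star> cart (pr2 \<^bold>e I) X
      = cart (pt_sec I \<odot> pr2 \<^bold>e I) (reO D (pr2 \<^bold>e I) X)"
    using cart_comp[of "pr2 \<^bold>e I" "pt_sec I" "reO D (pr2 \<^bold>e I) X"] assms pt_sec_res(1)[OF assms] by simp
  then show ?thesis
    unfolding kap_def using assms pt_sec_inverse(1)[OF assms(1)] by (simp add: cmp_assoc)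
qed

lemma kap_natural:
  assumes "small_cat S I" "f \<in> Arr (DCat D I)"
  shows "vert (\<^bold>N \<otimes>\<^sub>c I) (iA I f) \<star> kap I (Dom (DCat D I) f) = kap I (Cod (DCat D I) f) \<star> vert I f"
proof -
  let ?p = "pr2 \<^bold>e I" and ?i = "N_pt \<otimes>\<^sub>f id_fun I" and ?s = "pt_sec I"
  have f': "reA D ?p f \<in> Arr (DCat D (\<^bold>e \<otimes>\<^sub>c I))"
    "Dom (DCat D (\<^bold>e \<otimes>\<^sub>c I)) (reA D ?p f) = reO D ?p (Dom (DCat D I) f)"
    "Cod (DCat D (\<^bold>e \<otimes>\<^sub>c I)) (reA D ?p f) = reO D ?p (Cod (DCat D I) f)"
    using D_res(2-4)[of ?p f] assms by simp_all
  have 1: "vert (\<^bold>N \<otimes>\<^sub>c I) (iA I f) \<star> lan_arr ?i (reO D ?p (Dom (DCat D I) f))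
    = lan_arr ?i (reO D ?p (Cod (DCat D I) f)) \<star> vert (\<^bold>e \<otimes>\<^sub>c I) (reA D ?p f)"
    using lkan_lan_arr[of ?i "reA D ?p f"] f' assms structure_functor(5)[OF assms] by simp
  have 2: "vert (\<^bold>e \<otimes>\<^sub>c I) (reA D ?p f) \<star> cart ?s (reO D ?p (Dom (DCat D I) f))
    = cart ?s (reO D ?p (Cod (DCat D I) f)) \<star> vert I f"
    using cart_natural[of ?s "reA D ?p f"] f' assms pt_sec_res(2)[OF assms] by simp
  show ?thesis unfolding kap_def using cmp_reassoc[OF 1] 2 by (simp add: cmp_assoc)
qed

section \<open>Base change for the structure morphism\<close>

text \<open>
  The constraint \<open>i\<^sub>! w\<^sup>* X \<rightarrow> (1 \<times> w)\<^sup>* i\<^sub>! X\<close> of the structure morphism, and the same morphism as an arrow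
  \<open>i\<^sub>! w\<^sup>* X \<rightarrow> i\<^sub>! X\<close> over \<open>1 \<times> w\<close>.
\<close>

definition con :: "'a sfun \<Rightarrow> 'o \<Rightarrow> 'm" where
  "con w X = MC (structure_morphism D) w X"

definition con_arr :: "'a sfun \<Rightarrow> 'o \<Rightarrow> ('a, 'o, 'm) over_arr" where
  "con_arr w X = Over (id_fun \<^bold>N \<otimes>\<^sub>f w) (con w X) (iO (Tgt w) X)"

text \<open>
  The constraint is the mate of an identity transformation; unwinding the mate gives the last equation, which characterises
  it because \<open>kap\<close> is cocartesian.
\<close>

lemma con_arr_kap:
  assumes w: "small_fun S w" and X: "X \<in> Ob (DCat D (Tgt w))"
  shows "con w X \<in> Arr (DCat D (\<^bold>N \<otimes>\<^sub>c Src w))"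
    "Dom (DCat D (\<^bold>N \<otimes>\<^sub>c Src w)) (con w X) = iO (Src w) (reO D w X)"
    "Cod (DCat D (\<^bold>N \<otimes>\<^sub>c Src w)) (con w X) = reO D (id_fun \<^bold>N \<otimes>\<^sub>f w) (iO (Tgt w) X)"
    "con_arr w X \<star> kap (Src w) (reO D w X) = kap (Tgt w) X \<star> cart w X"
proof -
  define I J where IJ: "I = Src w" "J = Tgt w"
  have IJs [simp]: "small_cat S I" "small_cat S J" "Src w = I" "Tgt w = J" using w by (simp_all add: IJ)
  define p q u v where pquv: "p = id_fun \<^bold>e \<otimes>\<^sub>f w" "q = N_pt \<otimes>\<^sub>f id_fun I" "u = N_pt \<otimes>\<^sub>f id_fun J"
    "v = id_fun \<^bold>N \<otimes>\<^sub>f w"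
  have s [simp]: "small_fun S p" "small_fun S q" "small_fun S u" "small_fun S v"
    "Src p = \<^bold>e \<otimes>\<^sub>c I" "Tgt p = \<^bold>e \<otimes>\<^sub>c J" "Src q = \<^bold>e \<otimes>\<^sub>c I" "Tgt q = \<^bold>N \<otimes>\<^sub>c I"
    "Src u = \<^bold>e \<otimes>\<^sub>c J" "Tgt u = \<^bold>N \<otimes>\<^sub>c J" "Src v = \<^bold>N \<otimes>\<^sub>c I" "Tgt v = \<^bold>N \<otimes>\<^sub>c J"
    using w by (simp_all add: pquv)
  have up: "u \<odot> p = N_pt \<otimes>\<^sub>f w" "v \<odot> q = N_pt \<otimes>\<^sub>f w" using w by (simp_all add: pquv)
  define X1 where "X1 = reO D (pr2 \<^bold>e J) X"
  have XJ: "X \<in> Ob (DCat D J)" using X by simp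
  have X1: "X1 \<in> Ob (DCat D (\<^bold>e \<otimes>\<^sub>c J))" using XJ by (simp add: X1_def)
  define Y where "Y = iO J X"
  have Y: "Y \<in> Ob (DCat D (\<^bold>N \<otimes>\<^sub>c J))" "FO (lkan D u) X1 = Y"
    using XJ structure_functor(4)[of J X, symmetric] by (simp_all add: Y_def X1_def pquv)
  have wX: "reO D w X \<in> Ob (DCat D I)" using D_res(1)[OF w X] by simp
  have pX: "reO D p X1 = reO D (pr2 \<^bold>e I) (reO D w X)"
  proof -
    have "square (pr2 \<^bold>e I) (pr2 \<^bold>e J) p w"
      using square_pr(2)[of "id_fun \<^bold>e" w] w by (simp add: pquv)
    then show ?thesis using square_res[OF _ X] by (simp add: X1_def)
  qed
  have lu: "lan_unit D u X1 \<in> Arr (DCat D (\<^bold>e \<otimes>\<^sub>c J))" "Dom (DCat D (\<^bold>e \<otimes>\<^sub>c J)) (lan_unit D u X1) = X1"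
    "Cod (DCat D (\<^bold>e \<otimes>\<^sub>c J)) (lan_unit D u X1) = reO D u Y"
    using lan_unit_simps[OF s(3), of X1] X1 Y by simp_all
  have plu: "reA D p (lan_unit D u X1) \<in> Arr (DCat D (\<^bold>e \<otimes>\<^sub>c I))"
    "Dom (DCat D (\<^bold>e \<otimes>\<^sub>c I)) (reA D p (lan_unit D u X1)) = reO D p X1"
    "Cod (DCat D (\<^bold>e \<otimes>\<^sub>c I)) (reA D p (lan_unit D u X1)) = reO D p (reO D u Y)"
    using D_res(2-4)[OF s(1), of "lan_unit D u X1"] lu by simp_all
  have puY: "reO D p (reO D u Y) = reO D q (reO D v Y)" "reO D (N_pt \<otimes>\<^sub>f w) Y = reO D p (reO D u Y)"
  proof -
    have "reO D p (reO D u Y) = reO D (u \<odot> p) Y" "reO D q (reO D v Y) = reO D (v \<odot> q) Y"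
      using Y by simp_all
    then show "reO D p (reO D u Y) = reO D q (reO D v Y)" "reO D (N_pt \<otimes>\<^sub>f w) Y = reO D p (reO D u Y)"
      by (simp_all only: up)
  qed
  have At: "At (DNat D (id_nat (N_pt \<otimes>\<^sub>f w))) Y = Idn (DCat D (\<^bold>e \<otimes>\<^sub>c I)) (reO D p (reO D u Y))"
    using nat_id[of "N_pt \<otimes>\<^sub>f w"] w Y puY(2) by (simp add: id_nat_def mk_nat_def)
  have vY: "reO D v Y \<in> Ob (DCat D (\<^bold>N \<otimes>\<^sub>c I))" using D_res(1)[OF s(4)] Y by simp
  have con: "con w X = transpose q (reA D p (lan_unit D u X1)) (reO D v Y)"
    using plu At Y
    by (simp add: con_def structure_morphism_def lan_mor_def lan_mate_def transpose_def X1_def flip: pquv)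
  have cY: "Cod (DCat D (Src q)) (reA D p (lan_unit D u X1)) = reO D q (reO D v Y)"
    using plu puY by simp
  have tr: "con w X \<in> Arr (DCat D (\<^bold>N \<otimes>\<^sub>c I))" "Dom (DCat D (\<^bold>N \<otimes>\<^sub>c I)) (con w X) = FO (lkan D q) (reO D p X1)"
    "Cod (DCat D (\<^bold>N \<otimes>\<^sub>c I)) (con w X) = reO D v Y"
    using transpose_simps[OF s(2) _ _ cY] plu vY by (simp_all add: con)
  show "con w X \<in> Arr (DCat D (\<^bold>N \<otimes>\<^sub>c Src w))"
    "Dom (DCat D (\<^bold>N \<otimes>\<^sub>c Src w)) (con w X) = iO (Src w) (reO D w X)"
    "Cod (DCat D (\<^bold>N \<otimes>\<^sub>c Src w)) (con w X) = reO D (id_fun \<^bold>N \<otimes>\<^sub>f w) (iO (Tgt w) X)"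
    using tr structure_functor(4)[of I "reO D w X"] wX pX by (simp_all add: pquv Y_def)
  have "vert (\<^bold>N \<otimes>\<^sub>c I) (con w X) \<star> lan_arr q (reO D p X1) = Over q (reA D p (lan_unit D u X1)) (reO D v Y)"
    using transpose_lan_arr[OF s(2) _ _ cY] plu vY by (simp add: con)
  then have "con_arr w X \<star> lan_arr q (reO D p X1) = cart v Y \<star> Over q (reA D p (lan_unit D u X1)) (reO D v Y)"
    unfolding con_arr_def using Over_eq_cart_vert[of v Y "con w X"] tr Y
    by (simp add: cmp_assoc flip: pquv Y_def)
  also have "\<dots> = (cart v Y \<star> cart q (reO D v Y)) \<star> vert (\<^bold>e \<otimes>\<^sub>c I) (reA D p (lan_unit D u X1))"
    using Over_eq_cart_vert[OF s(2) _ _ cY] plu vY by (simp add: cmp_assoc)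
  also have "cart v Y \<star> cart q (reO D v Y) = cart u Y \<star> cart p (reO D u Y)"
    using cart_comp[of q v Y] cart_comp[of p u Y] Y up by simp
  also have "(cart u Y \<star> cart p (reO D u Y)) \<star> vert (\<^bold>e \<otimes>\<^sub>c I) (reA D p (lan_unit D u X1))
    = cart u Y \<star> vert (\<^bold>e \<otimes>\<^sub>c J) (lan_unit D u X1) \<star> cart p X1"
    using cart_natural[OF s(1), of "lan_unit D u X1"] lu by (simp add: cmp_assoc)
  also have "\<dots> = lan_arr u X1 \<star> cart p X1"
    unfolding lan_arr_def Y(2) using Over_eq_cart_vert[of u Y "lan_unit D u X1"] lu Y by (simp add: cmp_assoc)
  finally have key: "con_arr w X \<star> lan_arr q (reO D p X1) = lan_arr u X1 \<star> cart p X1" .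
  have "con_arr w X \<star> kap I (reO D w X) = lan_arr u X1 \<star> cart p X1 \<star> cart (pt_sec I) (reO D p X1)"
    unfolding kap_def using cmp_reassoc[OF key] by (simp add: pX cmp_assoc flip: pquv)
  also have "cart p X1 \<star> cart (pt_sec I) (reO D p X1) = cart (p \<odot> pt_sec I) X1"
    using cart_comp[of "pt_sec I" p X1] X1 by simp
  also have "p \<odot> pt_sec I = pt_sec J \<odot> w"
    using w small_fun_simps(1,2)[OF w] by (intro small_fun_eqI) (auto simp: pquv)
  also have "cart (pt_sec J \<odot> w) X1 = cart (pt_sec J) X1 \<star> cart w X"
    using cart_comp[of w "pt_sec J" X1] X1 w pt_sec_res(1)[OF IJs(2) XJ] by (simp add: X1_def)
  finally show "con_arr w X \<star> kap (Src w) (reO D w X) = kap (Tgt w) X \<star> cart w X"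
    unfolding kap_def by (simp add: X1_def cmp_assoc pquv)
qed

lemma con_arr_simps [simp]:
  assumes w: "small_fun S w" and X: "X \<in> Ob (DCat D (Tgt w))"
  shows "arr (con_arr w X)" "base (con_arr w X) = id_fun \<^bold>N \<otimes>\<^sub>f w"
    "dm (con_arr w X) = (\<^bold>N \<otimes>\<^sub>c Src w, iO (Src w) (reO D w X))"
    "cd (con_arr w X) = (\<^bold>N \<otimes>\<^sub>c Tgt w, iO (Tgt w) X)"
  using assms con_arr_kap(1-3)[OF assms] by (simp_all add: con_arr_def)

lemma res_iso:
  assumes "small_fun S u" "f \<in> isos (DCat D (Tgt u)) X Y"
  shows "reA D u f \<in> isos (DCat D (Src u)) (reO D u X) (reO D u Y)"
proof -
  obtain g where g: "f \<in> Arr (DCat D (Tgt u))" "Dom (DCat D (Tgt u)) f = X" "Cod (DCat D (Tgt u)) f = Y"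
    "g \<in> Arr (DCat D (Tgt u))" "Dom (DCat D (Tgt u)) g = Y" "Cod (DCat D (Tgt u)) g = X"
    "g \<cdot>\<^bsub>DCat D (Tgt u)\<^esub> f = Idn (DCat D (Tgt u)) X" "f \<cdot>\<^bsub>DCat D (Tgt u)\<^esub> g = Idn (DCat D (Tgt u)) Y"
    by (rule isosE[OF assms(2)]) (use assms in simp)
  have o: "X \<in> Ob (DCat D (Tgt u))" "Y \<in> Ob (DCat D (Tgt u))"
    using D_cat(1,2)[of "Tgt u" f] g assms by simp_all
  have "reA D u g \<cdot>\<^bsub>DCat D (Src u)\<^esub> reA D u f = Idn (DCat D (Src u)) (reO D u X)"
    "reA D u f \<cdot>\<^bsub>DCat D (Src u)\<^esub> reA D u g = Idn (DCat D (Src u)) (reO D u Y)"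
    using D_res(6)[OF assms(1), of f g] D_res(6)[OF assms(1), of g f] g o assms(1) by simp_all
  moreover have "reA D u f \<in> hom (DCat D (Src u)) (reO D u X) (reO D u Y)"
    "reA D u g \<in> hom (DCat D (Src u)) (reO D u Y) (reO D u X)"
    using g assms(1) by (simp_all add: hom_def)
  ultimately show ?thesis unfolding isos_def by blast
qed

text \<open>
  Both sides of the equation exhibit Kan extensions of \<open>1 \<boxtimes> X\<close> along \<open>i \<times> 1\<close>: the left one by cocontinuity, the right one
  because the unit constraint is invertible. Hence \<open>i\<^sub>! 1 \<boxtimes> X \<cong> i\<^sub>! X\<close>.
\<close>

lemma unit_kap_compare:
  assumes I: "small_cat S I" and X: "X \<in> Ob (DCat D I)"
  obtains m where "invertible m" "base m = id_fun (\<^bold>N \<otimes>\<^sub>c I)"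
    "dm m = (\<^bold>N \<otimes>\<^sub>c I, extO D \<^bold>N I (FO (lkan D N_pt) unit0) X)" "cd m = (\<^bold>N \<otimes>\<^sub>c I, iO I X)"
    "m \<star> (lan_arr N_pt unit0 \<boxtimes> ide (I, X)) = kap I X \<star> lun I X"
proof -
  let ?k = "lan_arr N_pt unit0 \<boxtimes> ide (I, X)" and ?l = "kap I X \<star> lun I X"
  have k: "cocart ?k" using I X by (intro lan_arr_box_cocart) simp_all
  have l: "cocart ?l" using I X
    by (intro cocart_comp[OF invertible_cocart[OF lun_invertible[OF I X]]]) simp_all
  have dk: "dm ?k = dm ?l" and bk: "base ?k = base ?l"
    using I X line_pt_pr2[OF I] by simp_all
  obtain m where m: "invertible m" "base m = id_fun (Tgt (base ?k))" "dm m = cd ?k" "cd m = cd ?l" "m \<star> ?k = ?l"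
    by (rule cocart_unique[OF k l dk bk])
  show ?thesis by (rule that[OF m(1) _ _ _ m(5)]) (use m I X in simp_all)
qed

text \<open>
  Under \<open>i\<^sub>! 1 \<boxtimes> X \<cong> i\<^sub>! X\<close> the constraint becomes the comparison
  \<open>i\<^sub>! 1 \<boxtimes> w\<^sup>* X \<rightarrow> (1 \<times> w)\<^sup>* (i\<^sub>! 1 \<boxtimes> X)\<close> of the external product with restriction, which is invertible
  because restriction functors are strong monoidal.
\<close>

lemma con_iso:
  assumes w: "small_fun S w" and X: "X \<in> Ob (DCat D (Tgt w))"
  shows "con w X \<in> isos (DCat D (\<^bold>N \<otimes>\<^sub>c Src w)) (iO (Src w) (reO D w X)) (reO D (id_fun \<^bold>N \<otimes>\<^sub>f w) (iO (Tgt w) X))"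
proof -
  define I J where IJ: "I = Src w" "J = Tgt w"
  have IJs [simp]: "small_cat S I" "small_cat S J" "Src w = I" "Tgt w = J" using w by (simp_all add: IJ)
  have XJ: "X \<in> Ob (DCat D J)" using X by simp
  have wX: "reO D w X \<in> Ob (DCat D I)" using D_res(1)[OF w X] by simp
  define G k v where Gkv: "G = FO (lkan D N_pt) unit0" "k = lan_arr N_pt unit0" "v = id_fun \<^bold>N \<otimes>\<^sub>f w"
  have G: "G \<in> Ob (DCat D \<^bold>N)" using lkan_simps(1)[of N_pt unit0] by (simp add: Gkv)
  have k: "arr k" "base k = N_pt" "dm k = (\<^bold>e, unit0)" "cd k = (\<^bold>N, G)" by (simp_all add: Gkv)
  obtain m where m: "invertible m" "base m = id_fun (\<^bold>N \<otimes>\<^sub>c I)"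
    "dm m = (\<^bold>N \<otimes>\<^sub>c I, extO D \<^bold>N I G (reO D w X))" "cd m = (\<^bold>N \<otimes>\<^sub>c I, iO I (reO D w X))"
    "m \<star> (k \<boxtimes> ide (I, reO D w X)) = kap I (reO D w X) \<star> lun I (reO D w X)"
    using unit_kap_compare[OF IJs(1) wX] unfolding Gkv by blast
  obtain n where n: "invertible n" "base n = id_fun (\<^bold>N \<otimes>\<^sub>c J)"
    "dm n = (\<^bold>N \<otimes>\<^sub>c J, extO D \<^bold>N J G X)" "cd n = (\<^bold>N \<otimes>\<^sub>c J, iO J X)"
    "n \<star> (k \<boxtimes> ide (J, X)) = kap J X \<star> lun J X"
    using unit_kap_compare[OF IJs(2) XJ] unfolding Gkv by blast
  have cw: "arr (cart w X)" "base (cart w X) = w" "dm (cart w X) = (I, reO D w X)" "cd (cart w X) = (J, X)"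
    using w X by simp_all
  have ca: "arr (con_arr w X)" "base (con_arr w X) = v" "dm (con_arr w X) = (\<^bold>N \<otimes>\<^sub>c I, iO I (reO D w X))"
    "cd (con_arr w X) = (\<^bold>N \<otimes>\<^sub>c J, iO J X)"
    using con_arr_simps[OF w X] by (simp_all add: Gkv)
  \<comment> \<open>The isomorphisms \<open>m\<close> and \<open>n\<close> intertwine the constraint with the external product by \<open>cart w X\<close>.\<close>
  have eq: "con_arr w X \<star> m = n \<star> (ide (\<^bold>N, G) \<boxtimes> cart w X)"
  proof (rule cocart_cancel)
    show "cocart (k \<boxtimes> ide (I, reO D w X))"
      unfolding Gkv using wX by (intro lan_arr_box_cocart) simp_all
    have "(con_arr w X \<star> m) \<star> (k \<boxtimes> ide (I, reO D w X)) = con_arr w X \<star> kap I (reO D w X) \<star> lun I (reO D w X)"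
      by (simp add: cmp_assoc m(5))
    also have "\<dots> = kap J X \<star> cart w X \<star> lun I (reO D w X)"
      using cmp_reassoc[OF con_arr_kap(4)[OF w X]] by (simp add: cmp_assoc)
    also have "\<dots> = (kap J X \<star> lun J X) \<star> (ide (\<^bold>e, unit0) \<boxtimes> cart w X)"
      using lun_natural[OF cw(1,3,4)] by (simp add: cmp_assoc)
    also have "\<dots> = n \<star> ((k \<boxtimes> ide (J, X)) \<star> (ide (\<^bold>e, unit0) \<boxtimes> cart w X))"
      by (simp add: cmp_assoc flip: n(5))
    also have "(k \<boxtimes> ide (J, X)) \<star> (ide (\<^bold>e, unit0) \<boxtimes> cart w X) = k \<boxtimes> cart w X"
      using k cw XJ by (subst box_comp[symmetric]) simp_all
    also have "\<dots> = (ide (\<^bold>N, G) \<boxtimes> cart w X) \<star> (k \<boxtimes> ide (I, reO D w X))"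
      using k cw G wX by (subst box_comp[symmetric]) simp_all
    finally show "(con_arr w X \<star> m) \<star> (k \<boxtimes> ide (I, reO D w X))
      = (n \<star> (ide (\<^bold>N, G) \<boxtimes> cart w X)) \<star> (k \<boxtimes> ide (I, reO D w X))" by (simp add: cmp_assoc)
  qed (use ca m n k cw G wX XJ w in \<open>simp_all add: Gkv\<close>)
  have v: "small_fun S v" "Src v = \<^bold>N \<otimes>\<^sub>c I" "Tgt v = \<^bold>N \<otimes>\<^sub>c J" using w by (simp_all add: Gkv)
  define f where "f = fib n"
  have f: "n = vert (\<^bold>N \<otimes>\<^sub>c J) f" "f \<in> isos (DCat D (\<^bold>N \<otimes>\<^sub>c J)) (extO D \<^bold>N J G X) (iO J X)"
    using vert_invertible_isos[OF n(1-4)] by (simp_all add: f_def)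
  have f': "f \<in> Arr (DCat D (\<^bold>N \<otimes>\<^sub>c J))" "Dom (DCat D (\<^bold>N \<otimes>\<^sub>c J)) f = extO D \<^bold>N J G X"
    "Cod (DCat D (\<^bold>N \<otimes>\<^sub>c J)) f = iO J X"
    using f(2) by (simp_all add: isos_def hom_def)
  define g where "g = extRes D (id_fun \<^bold>N) w G X"
  have g: "g \<in> isos (DCat D (\<^bold>N \<otimes>\<^sub>c I)) (extO D \<^bold>N I G (reO D w X)) (reO D v (extO D \<^bold>N J G X))"
    using extRes_simps(4)[of "id_fun \<^bold>N" w G X] w X G by (simp add: g_def Gkv)
  have g': "g \<in> Arr (DCat D (\<^bold>N \<otimes>\<^sub>c I))" "Dom (DCat D (\<^bold>N \<otimes>\<^sub>c I)) g = extO D \<^bold>N I G (reO D w X)"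
    "Cod (DCat D (\<^bold>N \<otimes>\<^sub>c I)) g = reO D v (extO D \<^bold>N J G X)"
    using g by (simp_all add: isos_def hom_def)
  have vf: "reA D v f \<in> isos (DCat D (\<^bold>N \<otimes>\<^sub>c I)) (reO D v (extO D \<^bold>N J G X)) (reO D v (iO J X))"
    using res_iso[OF v(1)] f(2) by (simp add: v)
  have vf': "reA D v f \<in> Arr (DCat D (\<^bold>N \<otimes>\<^sub>c I))" "Dom (DCat D (\<^bold>N \<otimes>\<^sub>c I)) (reA D v f) = reO D v (extO D \<^bold>N J G X)"
    "Cod (DCat D (\<^bold>N \<otimes>\<^sub>c I)) (reA D v f) = reO D v (iO J X)"
    using vf by (simp_all add: isos_def hom_def)
  note cn = con_arr_kap(1-3)[OF w X, unfolded IJ[symmetric], folded Gkv]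
  have "ide (\<^bold>N, G) \<boxtimes> cart w X = cart v (extO D \<^bold>N J G X) \<star> vert (\<^bold>N \<otimes>\<^sub>c I) g"
    using box_cart[of "id_fun \<^bold>N" w G X] w X G by (simp add: g_def Gkv)
  then have "con_arr w X \<star> m = vert (\<^bold>N \<otimes>\<^sub>c J) f \<star> cart v (extO D \<^bold>N J G X) \<star> vert (\<^bold>N \<otimes>\<^sub>c I) g"
    using eq f(1) by simp
  also have "\<dots> = (vert (\<^bold>N \<otimes>\<^sub>c J) f \<star> cart v (extO D \<^bold>N J G X)) \<star> vert (\<^bold>N \<otimes>\<^sub>c I) g"
    by (simp only: cmp_assoc)
  also have "vert (\<^bold>N \<otimes>\<^sub>c J) f \<star> cart v (extO D \<^bold>N J G X) = cart v (iO J X) \<star> vert (\<^bold>N \<otimes>\<^sub>c I) (reA D v f)"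
    using cart_natural[OF v(1), of f] f' by (simp add: v)
  finally have e1: "cart v (iO J X) \<star> vert (\<^bold>N \<otimes>\<^sub>c I) (con w X) \<star> m
    = cart v (iO J X) \<star> vert (\<^bold>N \<otimes>\<^sub>c I) (reA D v f) \<star> vert (\<^bold>N \<otimes>\<^sub>c I) g"
    using Over_eq_cart_vert[OF v(1), of "iO J X" "con w X"] cn XJ
    by (simp add: v con_arr_def cmp_assoc Gkv(3)[symmetric])
  have e2: "vert (\<^bold>N \<otimes>\<^sub>c I) (con w X) \<star> m = vert (\<^bold>N \<otimes>\<^sub>c I) (reA D v f) \<star> vert (\<^bold>N \<otimes>\<^sub>c I) g"
    by (rule cart_cancel[OF v(1) _ _ _ _ _ _ e1]) (use v cn XJ m g' vf' in simp_all)
  obtain m' where m': "arr m'" "dm m' = cd m" "cd m' = dm m" "m' \<star> m = ide (dm m)" "m \<star> m' = ide (cd m)"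
    "base m' \<odot> base m = id_fun (Src (base m))" "base m \<odot> base m' = id_fun (Tgt (base m))" "invertible m'"
    by (rule invertibleE[OF m(1)])
  have "vert (\<^bold>N \<otimes>\<^sub>c I) (con w X) = vert (\<^bold>N \<otimes>\<^sub>c I) (con w X) \<star> m \<star> m'"
    using m' m cn XJ by simp
  also have "\<dots> = (vert (\<^bold>N \<otimes>\<^sub>c I) (reA D v f) \<star> vert (\<^bold>N \<otimes>\<^sub>c I) g) \<star> m'"
    by (rule cmp_reassoc[OF e2])
  finally have e3: "vert (\<^bold>N \<otimes>\<^sub>c I) (con w X) = (vert (\<^bold>N \<otimes>\<^sub>c I) (reA D v f) \<star> vert (\<^bold>N \<otimes>\<^sub>c I) g) \<star> m'" .
  have "invertible (vert (\<^bold>N \<otimes>\<^sub>c I) g)" "invertible (vert (\<^bold>N \<otimes>\<^sub>c I) (reA D v f))"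
    using invertible_vert[OF g] invertible_vert[OF vf] by simp_all
  then have "invertible (vert (\<^bold>N \<otimes>\<^sub>c I) (con w X))"
    unfolding e3 using m' m g' vf' by (intro invertible_comp) simp_all
  from vert_invertible_isos(1)[OF this, of "\<^bold>N \<otimes>\<^sub>c I" "iO I (reO D w X)" "reO D v (iO J X)"]
  show ?thesis using cn by (simp add: vert_def Gkv)
qed

section \<open>The constraints of the affine line\<close>

lemma Over_eq_by_cocart:
  assumes k: "cocart k" "cd k = (Src w, Y)" and w: "small_fun S w"
    and f: "f \<in> hom (DCat D (Src w)) Y (reO D w Z)" and g: "g \<in> hom (DCat D (Src w)) Y (reO D w Z)"
    and Z: "Z \<in> Ob (DCat D (Tgt w))" and eq: "Over w f Z \<star> k = Over w g Z \<star> k"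
  shows "f = g"
proof -
  have "Over w f Z = Over w g Z"
    by (rule cocart_cancel[OF k(1) _ _ _ _ _ eq]) (use assms in \<open>simp_all add: hom_def\<close>)
  then show ?thesis by simp
qed

lemma Over_cmp:
  assumes "arr (Over u f X)" "arr (Over v g Y)" "Tgt u = Src v" "Dom (DCat D (Src v)) g = X"
  shows "Over v g Y \<star> Over u f X = Over (v \<odot> u) (reA D u g \<cdot>\<^bsub>DCat D (Src u)\<^esub> f) Y"
  using assms unfolding cmp_def by simp

lemma fib_simps [simp]:
  "fib (cart u Y) = Idn (DCat D (Src u)) (reO D u Y)" "fib (vert A f) = f"
  "fib (ide P) = Idn (DCat D (fst P)) (snd P)" "fib (lam I J X Y) = line_univ D I J X Y"
  "fib (lun A Z) = extL D A Z" "fib (run A Z) = extR D A Z" "fib (asc A B C X Y Z) = extAs D A B C X Y Z"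
  "fib (con_arr w Z) = con w Z"
  by (simp_all add: con_arr_def cart_def vert_def ide_def lam_def lun_def run_def asc_def)

lemma fib_cmp:
  "arr s \<Longrightarrow> arr t \<Longrightarrow> cd s = dm t \<Longrightarrow>
    fib (t \<star> s) = reA D (base s) (fib t) \<cdot>\<^bsub>DCat D (Src (base s))\<^esub> fib s"
  by (simp add: cmp_def)

lemma fib_cmp_vert:
  "arr t \<Longrightarrow> arr (vert A f) \<Longrightarrow> small_cat S A \<Longrightarrow> dm t = (A, Cod (DCat D A) f) \<Longrightarrow>
    fib (t \<star> vert A f) = fib t \<cdot>\<^bsub>DCat D A\<^esub> f"
  using cd_dm_base(5)[of t A] arr_props(3)[of t] by (simp add: fib_cmp)

lemma fib_vert_cmp:
  "arr t \<Longrightarrow> arr (vert A f) \<Longrightarrow> cd t = (A, Dom (DCat D A) f) \<Longrightarrow>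
    fib (vert A f \<star> t) = reA D (base t) f \<cdot>\<^bsub>DCat D (Src (base t))\<^esub> fib t"
  by (simp add: fib_cmp)

lemma fib_box:
  assumes "arr s" "arr t" "cd s = (A, X)" "cd t = (B, Y)"
  shows "fib (s \<boxtimes> t) = extRes D (base s) (base t) X Y
    \<cdot>\<^bsub>DCat D (Src (base s) \<otimes>\<^sub>c Src (base t))\<^esub> extA D (Src (base s)) (Src (base t)) (fib s) (fib t)"
proof -
  have "s = Over (base s) (fib s) X" "t = Over (base t) (fib t) Y"
    using assms by (auto elim!: arrE)
  then show ?thesis using box_Over[of "base s" "fib s" X "base t" "fib t" Y] assms(1,2)
    by (metis over_arr.sel(2))
qed

lemma fib_box_cart:
  assumes "small_fun S u" "small_fun S v" "X \<in> Ob (DCat D (Tgt u))" "Y \<in> Ob (DCat D (Tgt v))"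
  shows "fib (cart u X \<boxtimes> cart v Y) = extRes D u v X Y"
  using assms extRes_simps[OF assms]
    Over_eq_cart_vert[of "u \<otimes>\<^sub>f v" "extO D (Tgt u) (Tgt v) X Y" "extRes D u v X Y"]
  by (simp add: box_cart) (metis over_arr.sel(2))

text \<open>
  The constraints of the affine line are defined as the unique morphisms of a fibre that satisfy an equation. Here
  \<open>fib\<close> of a composite is written out, so that the equation reads \<open>Over v r Z \<star> k = h\<close> and the universal property
  of \<open>k\<close> provides existence and uniqueness.
\<close>

lemma the_cocart_factor:
  assumes k: "cocart k" "cd k = (B, Y)" and h: "arr h" "dm h = dm k" "cd h = (C, Z)"
    and v: "small_fun S v" "Src v = B" "Tgt v = C" "base h = v \<odot> base k"
  defines "r \<equiv> THE r. r \<in> hom (DCat D B) Y (reO D v Z)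
    \<and> reA D (base k) r \<cdot>\<^bsub>DCat D (Src (base k))\<^esub> fib k = fib h"
  shows "arr (Over v r Z)" "dm (Over v r Z) = (B, Y)" "Over v r Z \<star> k = h"
proof -
  have Bk: "Tgt (base k) = B" using k(2) by (rule cd_dm_base)
  have Z: "Z \<in> Ob (DCat D (Tgt v))" using arr_ob(2)[OF h(1)] h v by simp
  have he: "h = Over (v \<odot> base k) (fib h) Z" using h v(4) by (auto elim!: arrE)
  have P: "reA D (base k) r \<cdot>\<^bsub>DCat D (Src (base k))\<^esub> fib k = fib h \<longleftrightarrow> Over v r Z \<star> k = h"
    if "r \<in> hom (DCat D B) Y (reO D v Z)" for r
  proof -
    have "Over v r Z \<star> k = Over (v \<odot> base k) (reA D (base k) r \<cdot>\<^bsub>DCat D (Src (base k))\<^esub> fib k) Z"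
      using that k v Z by (simp add: cmp_def hom_def)
    then show ?thesis using he by (metis over_arr.sel(2))
  qed
  obtain g where g: "arr g" "base g = v" "dm g = cd k" "cd g = cd h" "g \<star> k = h"
    by (rule cocartE[OF k(1) h(1,2) v(1) _ v(4)]) (use v Bk in simp)
  then obtain f where f: "g = Over v f Z" "f \<in> hom (DCat D B) Y (reO D v Z)"
    using k h v by (auto elim!: arrE simp: hom_def)
  have "\<exists>!r. r \<in> hom (DCat D B) Y (reO D v Z)
    \<and> reA D (base k) r \<cdot>\<^bsub>DCat D (Src (base k))\<^esub> fib k = fib h"
  proof (rule ex1I[of _ f])
    show "f \<in> hom (DCat D B) Y (reO D v Z) \<and> reA D (base k) f \<cdot>\<^bsub>DCat D (Src (base k))\<^esub> fib k = fib h"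
      using f g P[OF f(2)] by simp
    fix x assume x: "x \<in> hom (DCat D B) Y (reO D v Z)
      \<and> reA D (base k) x \<cdot>\<^bsub>DCat D (Src (base k))\<^esub> fib k = fib h"
    then have "Over v x Z \<star> k = Over v f Z \<star> k" using P[of x] f g by simp
    then show "x = f" using Over_eq_by_cocart[OF k(1) _ v(1), of Y x Z f] x f(2) k(2) v Z by simp
  qed
  from theI'[OF this, folded r_def] P[of r]
  show "arr (Over v r Z)" "dm (Over v r Z) = (B, Y)" "Over v r Z \<star> k = h"
    using v Z by (simp_all add: hom_def)
qed

text \<open>
  The constraints \<open>lineRes\<close> and \<open>lineAs\<close> as arrows of the total category.
\<close>

definition res_arr :: "'a sfun \<Rightarrow> 'a sfun \<Rightarrow> 'o \<Rightarrow> 'o \<Rightarrow> ('a, 'o, 'm) over_arr" where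
  "res_arr u v X Y = Over (id_fun \<^bold>N \<otimes>\<^sub>f (u \<otimes>\<^sub>f v)) (lineRes D u v X Y) (lineO D (Tgt u) (Tgt v) X Y)"

definition as_arr :: "'a scat \<Rightarrow> 'a scat \<Rightarrow> 'a scat \<Rightarrow> 'o \<Rightarrow> 'o \<Rightarrow> 'o \<Rightarrow> ('a, 'o, 'm) over_arr" where
  "as_arr A B C X Y Z = Over (id_fun \<^bold>N \<otimes>\<^sub>f assoc_fun A B C) (lineAs D A B C X Y Z)
    (lineO D A (B \<otimes>\<^sub>c C) X (lineO D B C Y Z))"

text \<open>
  The defining equations of the constraints, with every inverse and every comparison absorbed into the arrows
  of the total category. Only these equations are used later.
\<close>

lemma
  assumes u: "small_fun S u" and v: "small_fun S v"
    and X: "X \<in> Ob (DCat D (\<^bold>N \<otimes>\<^sub>c Tgt u))" and Y: "Y \<in> Ob (DCat D (\<^bold>N \<otimes>\<^sub>c Tgt v))"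
  defines "u' \<equiv> id_fun \<^bold>N \<otimes>\<^sub>f u" and "v' \<equiv> id_fun \<^bold>N \<otimes>\<^sub>f v" and "w \<equiv> id_fun \<^bold>N \<otimes>\<^sub>f (u \<otimes>\<^sub>f v)"
  shows res_arr_simps [simp]: "arr (res_arr u v X Y)" "base (res_arr u v X Y) = w"
    "cd (res_arr u v X Y) = (\<^bold>N \<otimes>\<^sub>c (Tgt u \<otimes>\<^sub>c Tgt v), lineO D (Tgt u) (Tgt v) X Y)"
    "dm (res_arr u v X Y) = (\<^bold>N \<otimes>\<^sub>c (Src u \<otimes>\<^sub>c Src v), lineO D (Src u) (Src v) (reO D u' X) (reO D v' Y))"
    and res_arr_lam: "res_arr u v X Y \<star> lam (Src u) (Src v) (reO D u' X) (reO D v' Y)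
      = lam (Tgt u) (Tgt v) X Y \<star> (cart u' X \<boxtimes> cart v' Y)"
proof -
  have s [simp]: "small_fun S u'" "small_fun S v'" "small_fun S w" "Src u' = \<^bold>N \<otimes>\<^sub>c Src u"
    "Tgt u' = \<^bold>N \<otimes>\<^sub>c Tgt u" "Src v' = \<^bold>N \<otimes>\<^sub>c Src v" "Tgt v' = \<^bold>N \<otimes>\<^sub>c Tgt v"
    "Src w = \<^bold>N \<otimes>\<^sub>c (Src u \<otimes>\<^sub>c Src v)" "Tgt w = \<^bold>N \<otimes>\<^sub>c (Tgt u \<otimes>\<^sub>c Tgt v)"
    using u v by (simp_all add: u'_def v'_def w_def)
  have r: "reO D u' X \<in> Ob (DCat D (\<^bold>N \<otimes>\<^sub>c Src u))" "reO D v' Y \<in> Ob (DCat D (\<^bold>N \<otimes>\<^sub>c Src v))"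
    using D_res(1)[of u' X] D_res(1)[of v' Y] X Y by simp_all
  let ?k = "lam (Src u) (Src v) (reO D u' X) (reO D v' Y)"
  let ?h = "lam (Tgt u) (Tgt v) X Y \<star> (cart u' X \<boxtimes> cart v' Y)"
  have k: "cocart ?k" "cd ?k = (\<^bold>N \<otimes>\<^sub>c (Src u \<otimes>\<^sub>c Src v), lineO D (Src u) (Src v) (reO D u' X) (reO D v' Y))"
    using u v r by simp_all
  have h: "arr ?h" "dm ?h = dm ?k" "cd ?h = (\<^bold>N \<otimes>\<^sub>c (Tgt u \<otimes>\<^sub>c Tgt v), lineO D (Tgt u) (Tgt v) X Y)"
    "base ?h = w \<odot> base ?k"
    using u v X Y r line_plus_natural[OF u v] by (simp_all add: u'_def v'_def w_def)
  have "fib ?h = reA D (u' \<otimes>\<^sub>f v') (line_univ D (Tgt u) (Tgt v) X Y)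
      \<cdot>\<^bsub>DCat D ((\<^bold>N \<otimes>\<^sub>c Src u) \<otimes>\<^sub>c (\<^bold>N \<otimes>\<^sub>c Src v))\<^esub> extRes D u' v' X Y"
    using u v X Y by (simp add: fib_cmp fib_box_cart)
  then have "lineRes D u v X Y = (THE r. r \<in> hom (DCat D (\<^bold>N \<otimes>\<^sub>c (Src u \<otimes>\<^sub>c Src v)))
      (lineO D (Src u) (Src v) (reO D u' X) (reO D v' Y)) (reO D w (lineO D (Tgt u) (Tgt v) X Y))
      \<and> reA D (base ?k) r \<cdot>\<^bsub>DCat D (Src (base ?k))\<^esub> fib ?k = fib ?h)"
    using u v r by (simp add: lineRes_def Let_def flip: u'_def v'_def w_def)
  note f = the_cocart_factor[OF k h(1-3) s(3,8,9) h(4), folded this]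
  have e: "res_arr u v X Y = Over w (lineRes D u v X Y) (lineO D (Tgt u) (Tgt v) X Y)"
    by (simp add: res_arr_def w_def)
  show "arr (res_arr u v X Y)" "base (res_arr u v X Y) = w"
    "cd (res_arr u v X Y) = (\<^bold>N \<otimes>\<^sub>c (Tgt u \<otimes>\<^sub>c Tgt v), lineO D (Tgt u) (Tgt v) X Y)"
    "dm (res_arr u v X Y) = (\<^bold>N \<otimes>\<^sub>c (Src u \<otimes>\<^sub>c Src v), lineO D (Src u) (Src v) (reO D u' X) (reO D v' Y))"
    "res_arr u v X Y \<star> ?k = ?h"
    unfolding e using f by simp_all
qed

lemma
  assumes s: "small_cat S A" "small_cat S B" "small_cat S C"
    and XYZ: "X \<in> Ob (DCat D (\<^bold>N \<otimes>\<^sub>c A))" "Y \<in> Ob (DCat D (\<^bold>N \<otimes>\<^sub>c B))" "Z \<in> Ob (DCat D (\<^bold>N \<otimes>\<^sub>c C))"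
  defines "T \<equiv> lineO D A (B \<otimes>\<^sub>c C) X (lineO D B C Y Z)" and "v \<equiv> id_fun \<^bold>N \<otimes>\<^sub>f assoc_fun A B C"
  shows as_arr_simps [simp]: "arr (as_arr A B C X Y Z)" "base (as_arr A B C X Y Z) = v"
    "cd (as_arr A B C X Y Z) = (\<^bold>N \<otimes>\<^sub>c (A \<otimes>\<^sub>c (B \<otimes>\<^sub>c C)), T)"
    "dm (as_arr A B C X Y Z) = (\<^bold>N \<otimes>\<^sub>c ((A \<otimes>\<^sub>c B) \<otimes>\<^sub>c C), lineO D (A \<otimes>\<^sub>c B) C (lineO D A B X Y) Z)"
    and as_arr_lam: "as_arr A B C X Y Z \<star> lam (A \<otimes>\<^sub>c B) C (lineO D A B X Y) Z \<star> (lam A B X Y \<boxtimes> ide (\<^bold>N \<otimes>\<^sub>c C, Z))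
      = lam A (B \<otimes>\<^sub>c C) X (lineO D B C Y Z) \<star> (ide (\<^bold>N \<otimes>\<^sub>c A, X) \<boxtimes> lam B C Y Z)
        \<star> asc (\<^bold>N \<otimes>\<^sub>c A) (\<^bold>N \<otimes>\<^sub>c B) (\<^bold>N \<otimes>\<^sub>c C) X Y Z"
proof -
  let ?l = "lam (A \<otimes>\<^sub>c B) C (lineO D A B X Y) Z" and ?k1 = "lam A B X Y \<boxtimes> ide (\<^bold>N \<otimes>\<^sub>c C, Z)"
    and ?l' = "lam A (B \<otimes>\<^sub>c C) X (lineO D B C Y Z)" and ?k2 = "ide (\<^bold>N \<otimes>\<^sub>c A, X) \<boxtimes> lam B C Y Z"
    and ?a = "asc (\<^bold>N \<otimes>\<^sub>c A) (\<^bold>N \<otimes>\<^sub>c B) (\<^bold>N \<otimes>\<^sub>c C) X Y Z"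
  let ?k = "?l \<star> ?k1" and ?h = "(?l' \<star> ?k2) \<star> ?a"
  have v: "small_fun S v" "Src v = \<^bold>N \<otimes>\<^sub>c ((A \<otimes>\<^sub>c B) \<otimes>\<^sub>c C)" "Tgt v = \<^bold>N \<otimes>\<^sub>c (A \<otimes>\<^sub>c (B \<otimes>\<^sub>c C))"
    using s by (simp_all add: v_def)
  note as = asc_expand(1-4)[OF _ _ _ XYZ]
  have k1: "cocart ?k1" "cd ?k1 = dm ?l" using s XYZ by (simp_all add: cocart_box_ide)
  have k: "cocart ?k" "cd ?k = (\<^bold>N \<otimes>\<^sub>c ((A \<otimes>\<^sub>c B) \<otimes>\<^sub>c C), lineO D (A \<otimes>\<^sub>c B) C (lineO D A B X Y) Z)"
    using k1 s XYZ by (simp_all add: cocart_comp)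
  have k2: "arr (?l' \<star> ?k2)" "dm (?l' \<star> ?k2) = cd ?a" "cd (?l' \<star> ?k2) = (\<^bold>N \<otimes>\<^sub>c (A \<otimes>\<^sub>c (B \<otimes>\<^sub>c C)), T)"
    using s XYZ as by (simp_all add: T_def)
  have h: "arr ?h" "dm ?h = dm ?k" "cd ?h = (\<^bold>N \<otimes>\<^sub>c (A \<otimes>\<^sub>c (B \<otimes>\<^sub>c C)), T)" "base ?h = v \<odot> base ?k"
    using k1 k2 s XYZ as line_plus_assoc[OF s] by (simp_all add: small_comp_assoc v_def)
  have "lineAs D A B C X Y Z = (THE r. r \<in> hom (DCat D (\<^bold>N \<otimes>\<^sub>c ((A \<otimes>\<^sub>c B) \<otimes>\<^sub>c C)))
      (lineO D (A \<otimes>\<^sub>c B) C (lineO D A B X Y) Z) (reO D v T)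
      \<and> reA D (base ?k) r \<cdot>\<^bsub>DCat D (Src (base ?k))\<^esub> fib ?k = fib ?h)"
    using k1 k2 s XYZ as by (simp add: lineAs_def Let_def fib_cmp fib_box T_def v_def)
  note f = the_cocart_factor[OF k h(1-3) v h(4), folded this]
  have e: "as_arr A B C X Y Z = Over v (lineAs D A B C X Y Z) T" by (simp add: as_arr_def v_def T_def)
  show "arr (as_arr A B C X Y Z)" "base (as_arr A B C X Y Z) = v"
    "cd (as_arr A B C X Y Z) = (\<^bold>N \<otimes>\<^sub>c (A \<otimes>\<^sub>c (B \<otimes>\<^sub>c C)), T)"
    "dm (as_arr A B C X Y Z) = (\<^bold>N \<otimes>\<^sub>c ((A \<otimes>\<^sub>c B) \<otimes>\<^sub>c C), lineO D (A \<otimes>\<^sub>c B) C (lineO D A B X Y) Z)"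
    "as_arr A B C X Y Z \<star> ?k = ?l' \<star> ?k2 \<star> ?a"
    unfolding e using f v by (simp_all add: cmp_assoc)
qed

lemma lineU_eq: "lineU D = iO \<^bold>e unit0"
  by (simp add: lineU_def iO_def)

lemma lineU_ob [simp]: "lineU D \<in> Ob (DCat D (\<^bold>N \<otimes>\<^sub>c \<^bold>e))"
  by (simp add: lineU_eq)

text \<open>
  The universal arrow of the unit \<open>i\<^sub>! 1\<close> that enters the unit constraints starts at \<open>pr2\<^sup>* 1\<close> over \<open>\<^bold>e \<times> \<^bold>e\<close>; it differs from
  \<open>kap \<^bold>e unit0\<close> by an invertible cartesian arrow.
\<close>

lemma pt_univ_arr:
  "lan_arr (N_pt \<otimes>\<^sub>f id_fun \<^bold>e) (reO D (pr2 \<^bold>e \<^bold>e) unit0) = Over (N_pt \<otimes>\<^sub>f id_fun \<^bold>e) (pt_univ D \<^bold>e unit0) (lineU D)"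
  "arr (Over (N_pt \<otimes>\<^sub>f id_fun \<^bold>e) (pt_univ D \<^bold>e unit0) (lineU D))"
  "kap \<^bold>e unit0 \<star> cart (pr2 \<^bold>e \<^bold>e) unit0 = Over (N_pt \<otimes>\<^sub>f id_fun \<^bold>e) (pt_univ D \<^bold>e unit0) (lineU D)"
proof -
  show 1: "lan_arr (N_pt \<otimes>\<^sub>f id_fun \<^bold>e) (reO D (pr2 \<^bold>e \<^bold>e) unit0) = Over (N_pt \<otimes>\<^sub>f id_fun \<^bold>e) (pt_univ D \<^bold>e unit0) (lineU D)"
    using structure_functor(4)[of "\<^bold>e" unit0] by (simp add: lan_arr_def pt_univ_def lineU_eq)
  show "arr (Over (N_pt \<otimes>\<^sub>f id_fun \<^bold>e) (pt_univ D \<^bold>e unit0) (lineU D))"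
    unfolding 1[symmetric] by (intro lan_arr_simps) simp_all
  show "kap \<^bold>e unit0 \<star> cart (pr2 \<^bold>e \<^bold>e) unit0 = Over (N_pt \<otimes>\<^sub>f id_fun \<^bold>e) (pt_univ D \<^bold>e unit0) (lineU D)"
    unfolding 1[symmetric] by (rule kap_pr2) simp_all
qed

lemma pr2_ee_invertible: "invertible (cart (pr2 \<^bold>e \<^bold>e) unit0)"
  using pt_sec_inverse[of "\<^bold>e"] by (intro invertible_cart[of _ "pt_sec \<^bold>e"]) simp_all

definition lunit_arr :: "'a scat \<Rightarrow> 'o \<Rightarrow> ('a, 'o, 'm) over_arr" where
  "lunit_arr A X = Over (id_fun \<^bold>N \<otimes>\<^sub>f pr2 \<^bold>e A) (lineL D A X) X"

lemma
  assumes A: "small_cat S A" and X: "X \<in> Ob (DCat D (\<^bold>N \<otimes>\<^sub>c A))"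
  defines "v \<equiv> id_fun \<^bold>N \<otimes>\<^sub>f pr2 \<^bold>e A"
  shows lunit_arr_simps [simp]: "arr (lunit_arr A X)" "base (lunit_arr A X) = v" "cd (lunit_arr A X) = (\<^bold>N \<otimes>\<^sub>c A, X)"
    "dm (lunit_arr A X) = (\<^bold>N \<otimes>\<^sub>c (\<^bold>e \<otimes>\<^sub>c A), lineO D \<^bold>e A (lineU D) X)"
    and lunit_arr_lam: "lunit_arr A X \<star> lam \<^bold>e A (lineU D) X \<star> (kap \<^bold>e unit0 \<boxtimes> ide (\<^bold>N \<otimes>\<^sub>c A, X)) = lun (\<^bold>N \<otimes>\<^sub>c A) X"
proof -
  let ?NA = "\<^bold>N \<otimes>\<^sub>c A"
  define p where "p = kap \<^bold>e unit0 \<star> cart (pr2 \<^bold>e \<^bold>e) unit0"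
  let ?c = "cart (pr2 \<^bold>e \<^bold>e) unit0 \<boxtimes> ide (?NA, X)" and ?l = "lam \<^bold>e A (lineU D) X"
  let ?k = "?l \<star> (p \<boxtimes> ide (?NA, X))" and ?h = "lun ?NA X \<star> ?c"
  have v: "small_fun S v" "Src v = \<^bold>N \<otimes>\<^sub>c (\<^bold>e \<otimes>\<^sub>c A)" "Tgt v = ?NA" using A by (simp_all add: v_def)
  have p: "cocart p" "base p = N_pt \<otimes>\<^sub>f id_fun \<^bold>e" "dm p = (\<^bold>e \<otimes>\<^sub>c \<^bold>e, reO D (pr2 \<^bold>e \<^bold>e) unit0)"
    "cd p = (\<^bold>N \<otimes>\<^sub>c \<^bold>e, lineU D)"
    using pr2_ee_invertible
    by (simp_all add: p_def cocart_comp invertible_cocart line_pt_pr2 lineU_eq)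
  have fp: "fib p = pt_univ D \<^bold>e unit0" unfolding p_def pt_univ_arr(3) by simp
  have ci: "invertible ?c" using pr2_ee_invertible A X by (intro box_invertible) simp_all
  have pc: "p \<boxtimes> ide (?NA, X) = (kap \<^bold>e unit0 \<boxtimes> ide (?NA, X)) \<star> ?c"
    unfolding p_def using A X by (subst box_comp[symmetric]) simp_all
  have k: "cocart ?k" "cd ?k = (\<^bold>N \<otimes>\<^sub>c (\<^bold>e \<otimes>\<^sub>c A), lineO D \<^bold>e A (lineU D) X)"
    using p A X by (simp_all add: cocart_comp cocart_box_ide)
  have h: "arr ?h" "dm ?h = dm ?k" "cd ?h = (?NA, X)" "base ?h = v \<odot> base ?k"
    using p A X line_plus_unit(1)[OF A] by (simp_all add: v_def)
  have "fib ?c = extRes D (pr2 \<^bold>e \<^bold>e) (id_fun ?NA) unit0 X"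
    using fib_box_cart[of "pr2 \<^bold>e \<^bold>e" "id_fun ?NA" unit0 X] A X by simp
  then have "lineL D A X = (THE r. r \<in> hom (DCat D (\<^bold>N \<otimes>\<^sub>c (\<^bold>e \<otimes>\<^sub>c A))) (lineO D \<^bold>e A (lineU D) X) (reO D v X)
      \<and> reA D (base ?k) r \<cdot>\<^bsub>DCat D (Src (base ?k))\<^esub> fib ?k = fib ?h)"
    using p fp A X by (simp add: lineL_def Let_def fib_cmp fib_box v_def)
  note f = the_cocart_factor[OF k h(1-3) v h(4), folded this]
  have o: "lunit_arr A X = Over v (lineL D A X) X" by (simp add: lunit_arr_def v_def)
  show t: "arr (lunit_arr A X)" "base (lunit_arr A X) = v" "cd (lunit_arr A X) = (\<^bold>N \<otimes>\<^sub>c A, X)"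
    "dm (lunit_arr A X) = (\<^bold>N \<otimes>\<^sub>c (\<^bold>e \<otimes>\<^sub>c A), lineO D \<^bold>e A (lineU D) X)"
    unfolding o using f v by simp_all
  have e: "(lunit_arr A X \<star> ?l \<star> (kap \<^bold>e unit0 \<boxtimes> ide (?NA, X))) \<star> ?c = lun ?NA X \<star> ?c"
    unfolding o using f(3) by (simp add: pc cmp_assoc)
  have "v \<odot> (line_plus \<^bold>e A \<odot> (line_pt \<^bold>e \<otimes>\<^sub>f id_fun ?NA)) = pr2 \<^bold>e ?NA"
    unfolding v_def using A by (intro small_fun_eqI) (auto simp: prod_cat_simps)
  then show "lunit_arr A X \<star> ?l \<star> (kap \<^bold>e unit0 \<boxtimes> ide (?NA, X)) = lun ?NA X"
    using t A X lineU_eq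
    by (intro cocart_cancel[OF invertible_cocart[OF ci] _ _ _ _ _ e]) simp_all
qed

definition runit_arr :: "'a scat \<Rightarrow> 'o \<Rightarrow> ('a, 'o, 'm) over_arr" where
  "runit_arr A X = Over (id_fun \<^bold>N \<otimes>\<^sub>f pr1 A \<^bold>e) (lineR D A X) X"

lemma
  assumes A: "small_cat S A" and X: "X \<in> Ob (DCat D (\<^bold>N \<otimes>\<^sub>c A))"
  defines "v \<equiv> id_fun \<^bold>N \<otimes>\<^sub>f pr1 A \<^bold>e"
  shows runit_arr_simps [simp]: "arr (runit_arr A X)" "base (runit_arr A X) = v" "cd (runit_arr A X) = (\<^bold>N \<otimes>\<^sub>c A, X)"
    "dm (runit_arr A X) = (\<^bold>N \<otimes>\<^sub>c (A \<otimes>\<^sub>c \<^bold>e), lineO D A \<^bold>e X (lineU D))"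
    and runit_arr_lam: "runit_arr A X \<star> lam A \<^bold>e X (lineU D) \<star> (ide (\<^bold>N \<otimes>\<^sub>c A, X) \<boxtimes> kap \<^bold>e unit0) = run (\<^bold>N \<otimes>\<^sub>c A) X"
proof -
  let ?NA = "\<^bold>N \<otimes>\<^sub>c A"
  define p where "p = kap \<^bold>e unit0 \<star> cart (pr2 \<^bold>e \<^bold>e) unit0"
  let ?c = "ide (?NA, X) \<boxtimes> cart (pr2 \<^bold>e \<^bold>e) unit0" and ?l = "lam A \<^bold>e X (lineU D)"
  let ?k = "?l \<star> (ide (?NA, X) \<boxtimes> p)" and ?h = "run ?NA X \<star> ?c"
  have v: "small_fun S v" "Src v = \<^bold>N \<otimes>\<^sub>c (A \<otimes>\<^sub>c \<^bold>e)" "Tgt v = ?NA" using A by (simp_all add: v_def)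
  have p: "cocart p" "base p = N_pt \<otimes>\<^sub>f id_fun \<^bold>e" "dm p = (\<^bold>e \<otimes>\<^sub>c \<^bold>e, reO D (pr2 \<^bold>e \<^bold>e) unit0)"
    "cd p = (\<^bold>N \<otimes>\<^sub>c \<^bold>e, lineU D)"
    using pr2_ee_invertible
    by (simp_all add: p_def cocart_comp invertible_cocart line_pt_pr2 lineU_eq)
  have fp: "fib p = pt_univ D \<^bold>e unit0" unfolding p_def pt_univ_arr(3) by simp
  have ci: "invertible ?c" using pr2_ee_invertible A X by (intro box_invertible) simp_all
  have pc: "ide (?NA, X) \<boxtimes> p = (ide (?NA, X) \<boxtimes> kap \<^bold>e unit0) \<star> ?c"
    unfolding p_def using A X by (subst box_comp[symmetric]) simp_all
  have k: "cocart ?k" "cd ?k = (\<^bold>N \<otimes>\<^sub>c (A \<otimes>\<^sub>c \<^bold>e), lineO D A \<^bold>e X (lineU D))"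
    using p A X by (simp_all add: cocart_comp cocart_box_ide)
  have h: "arr ?h" "dm ?h = dm ?k" "cd ?h = (?NA, X)" "base ?h = v \<odot> base ?k"
    using p A X line_plus_unit(2)[OF A] by (simp_all add: v_def)
  have "fib ?c = extRes D (id_fun ?NA) (pr2 \<^bold>e \<^bold>e) X unit0"
    using fib_box_cart[of "id_fun ?NA" "pr2 \<^bold>e \<^bold>e" X unit0] A X by simp
  then have "lineR D A X = (THE r. r \<in> hom (DCat D (\<^bold>N \<otimes>\<^sub>c (A \<otimes>\<^sub>c \<^bold>e))) (lineO D A \<^bold>e X (lineU D)) (reO D v X)
      \<and> reA D (base ?k) r \<cdot>\<^bsub>DCat D (Src (base ?k))\<^esub> fib ?k = fib ?h)"
    using p fp A X by (simp add: lineR_def Let_def fib_cmp fib_box v_def)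
  note f = the_cocart_factor[OF k h(1-3) v h(4), folded this]
  have o: "runit_arr A X = Over v (lineR D A X) X" by (simp add: runit_arr_def v_def)
  show t: "arr (runit_arr A X)" "base (runit_arr A X) = v" "cd (runit_arr A X) = (\<^bold>N \<otimes>\<^sub>c A, X)"
    "dm (runit_arr A X) = (\<^bold>N \<otimes>\<^sub>c (A \<otimes>\<^sub>c \<^bold>e), lineO D A \<^bold>e X (lineU D))"
    unfolding o using f v by simp_all
  have e: "(runit_arr A X \<star> ?l \<star> (ide (?NA, X) \<boxtimes> kap \<^bold>e unit0)) \<star> ?c = run ?NA X \<star> ?c"
    unfolding o using f(3) by (simp add: pc cmp_assoc)
  have "v \<odot> (line_plus A \<^bold>e \<odot> (id_fun ?NA \<otimes>\<^sub>f line_pt \<^bold>e)) = pr1 ?NA \<^bold>e"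
    unfolding v_def using A by (intro small_fun_eqI) (auto simp: prod_cat_simps)
  then show "runit_arr A X \<star> ?l \<star> (ide (?NA, X) \<boxtimes> kap \<^bold>e unit0) = run ?NA X"
    using t A X lineU_eq
    by (intro cocart_cancel[OF invertible_cocart[OF ci] _ _ _ _ _ e]) simp_all
qed

section \<open>The structure morphism as a morphism of derivators\<close>

lemma ext_simps [simp]:
  "DCat (external D) = DCat D" "DFun (external D) = DFun D" "DNat (external D) = DNat D"
  "XO (external D) = extO D" "XA (external D) = extA D" "XU (external D) = unit0"
  "XRes (external D) = extRes D" "XAs (external D) = extAs D" "XL (external D) = extL D" "XR (external D) = extR D"
  by (simp_all add: external_def)

lemma line_simps [simp]:
  "DCat (affine_line D) A = DCat D (\<^bold>N \<otimes>\<^sub>c A)" "DFun (affine_line D) u = DFun D (id_fun \<^bold>N \<otimes>\<^sub>f u)"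
  "DNat (affine_line D) \<alpha> = DNat D (lprod_nat \<^bold>N \<alpha>)"
  "XO (affine_line D) = lineO D" "XA (affine_line D) = lineA D" "XU (affine_line D) = lineU D"
  "XRes (affine_line D) = lineRes D" "XAs (affine_line D) = lineAs D" "XL (affine_line D) = lineL D"
  "XR (affine_line D) = lineR D"
  by (simp_all add: affine_line_def shift_def)

lemma mk_nat_simps [simp]:
  "NSrc (mk_nat F G t) = F" "NTgt (mk_nat F G t) = G" "a \<in> Ob (Src F) \<Longrightarrow> At (mk_nat F G t) a = t a"
  by (simp_all add: mk_nat_def)

lemma mk_nat_cong:
  "F = F' \<Longrightarrow> G = G' \<Longrightarrow> (\<And>a. a \<in> Ob (Src F) \<Longrightarrow> s a = t a) \<Longrightarrow> mk_nat F G s = mk_nat F' G' t"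
  by (auto simp: mk_nat_def restrict_def)

lemma is_nat_id_nat:
  assumes "small_fun S u"
  shows "small_nat S (id_nat u)"
proof -
  interpret u: is_functor u using assms by (rule small_fun_functor)
  interpret B: category "Tgt u" by (rule u.tgt_cat)
  show ?thesis
    unfolding small_nat_def
    using assms u.obj_in u.FA_simps u.is_functor_axioms
    by (auto simp: id_nat_def mk_nat_def hom_def intro!: is_nat.intro)
qed

lemma small_lprod_nat:
  assumes \<alpha>: "small_nat S \<alpha>"
  shows "small_nat S (lprod_nat \<^bold>N \<alpha>)"
proof -
  interpret \<alpha>: is_nat \<alpha> using \<alpha> by (simp add: small_nat_def)
  define u v where uv: "u = NSrc \<alpha>" "v = NTgt \<alpha>"
  have s [simp]: "small_fun S u" "small_fun S v" "Src v = Src u" "Tgt v = Tgt u"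
    using \<alpha> \<alpha>.same_src \<alpha>.same_tgt by (simp_all add: small_nat_def uv)
  have at: "a \<in> Ob (Src u) \<Longrightarrow> At \<alpha> a \<in> Arr (Tgt u) \<and> Dom (Tgt u) (At \<alpha> a) = FO u a \<and> Cod (Tgt u) (At \<alpha> a) = FO v a" for a
    using \<alpha>.at_in[of a] by (simp add: uv hom_def)
  have nat: "f \<in> Arr (Src u) \<Longrightarrow> At \<alpha> (Cod (Src u) f) \<cdot>\<^bsub>Tgt u\<^esub> FA u f = FA v f \<cdot>\<^bsub>Tgt u\<^esub> At \<alpha> (Dom (Src u) f)" for f
    using \<alpha>.natural[of f "Dom (Src u) f" "Cod (Src u) f"] by (simp add: uv hom_def)
  have vs: "f \<in> Arr (Src u) \<Longrightarrow> FA v f \<in> Arr (Tgt u) \<and> Dom (Tgt u) (FA v f) = FO v (Dom (Src u) f)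
      \<and> Cod (Tgt u) (FA v f) = FO v (Cod (Src u) f)" for f
    using small_fun_simps[of v f] s by simp
  have "is_nat (lprod_nat \<^bold>N \<alpha>)"
  proof (rule is_nat.intro)
    fix a assume "a \<in> Ob (Src (NSrc (lprod_nat \<^bold>N \<alpha>)))"
    then show "At (lprod_nat \<^bold>N \<alpha>) a \<in> hom (Tgt (NSrc (lprod_nat \<^bold>N \<alpha>))) (FO (NSrc (lprod_nat \<^bold>N \<alpha>)) a) (FO (NTgt (lprod_nat \<^bold>N \<alpha>)) a)"
      using at by (auto simp: lprod_nat_def mk_nat_def hom_def prod_cat_simps simp flip: uv)
  next
    fix f a b assume f: "f \<in> hom (Src (NSrc (lprod_nat \<^bold>N \<alpha>))) a b"
    then obtain m g where "f = Pair_el (Nat_el m) g" "g \<in> Arr (Src u)" "a = Pair_el (Nat_el 0) (Dom (Src u) g)"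
      "b = Pair_el (Nat_el 0) (Cod (Src u) g)"
      by (auto simp: lprod_nat_def mk_nat_def hom_def prod_cat_simps(2) simp flip: uv)
    then show "At (lprod_nat \<^bold>N \<alpha>) b \<cdot>\<^bsub>Tgt (NSrc (lprod_nat \<^bold>N \<alpha>))\<^esub> FA (NSrc (lprod_nat \<^bold>N \<alpha>)) f
      = FA (NTgt (lprod_nat \<^bold>N \<alpha>)) f \<cdot>\<^bsub>Tgt (NSrc (lprod_nat \<^bold>N \<alpha>))\<^esub> At (lprod_nat \<^bold>N \<alpha>) a"
      using at vs nat by (simp add: lprod_nat_def mk_nat_def flip: uv)
  qed (simp_all add: lprod_nat_def mk_nat_def small_fun_functor flip: uv)
  then show ?thesis by (simp add: small_nat_def lprod_nat_def mk_nat_def flip: uv)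
qed

text \<open>
  A transformation \<open>1 \<times> \<alpha>\<close> restricted along the base point is \<open>\<alpha>\<close> again: both whiskerings have the same components, and a
  prederivator preserves horizontal composition strictly.
\<close>

lemma line_pt_whisker:
  assumes \<alpha>: "small_nat S \<alpha>" "NSrc \<alpha> = u" "NTgt \<alpha> = v" and Y: "Y \<in> Ob (DCat D (\<^bold>N \<otimes>\<^sub>c Tgt u))"
  shows "reA D (line_pt (Src u)) (At (DNat D (lprod_nat \<^bold>N \<alpha>)) Y) = At (DNat D \<alpha>) (reO D (line_pt (Tgt u)) Y)"
proof -
  interpret \<alpha>: is_nat \<alpha> using \<alpha> by (simp add: small_nat_def)
  define I J where IJ: "I = Src u" "J = Tgt u"
  have s [simp]: "small_fun S u" "small_fun S v" "Src v = I" "Tgt v = J" "Src u = I" "Tgt u = J"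
    using \<alpha> \<alpha>.same_src \<alpha>.same_tgt by (simp_all add: small_nat_def IJ)
  have IJs [simp]: "small_cat S I" "small_cat S J" using small_fun_cat[OF s(1)] by simp_all
  have at: "a \<in> Ob I \<Longrightarrow> At \<alpha> a \<in> Arr J \<and> Dom J (At \<alpha> a) = FO u a \<and> Cod J (At \<alpha> a) = FO v a" for a
    using \<alpha>.at_in[of a] \<alpha>(2,3) by (simp add: hom_def)
  let ?l = "lprod_nat \<^bold>N \<alpha>"
  have l: "small_nat S ?l" "NSrc ?l = id_fun \<^bold>N \<otimes>\<^sub>f u" "NTgt ?l = id_fun \<^bold>N \<otimes>\<^sub>f v"
    using small_lprod_nat[OF \<alpha>(1)] \<alpha> by (simp_all add: lprod_nat_def mk_nat_def)
  have i: "small_nat S (id_nat (line_pt I))" "small_nat S (id_nat (line_pt J))"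
    by (simp_all add: is_nat_id_nat)
  have obj: "FO u a \<in> Ob J" "FO v a \<in> Ob J" if "a \<in> Ob I" for a
    using small_fun_simps(1)[OF s(1)] small_fun_simps(1)[OF s(2)] that by simp_all
  have "hcomp ?l (id_nat (line_pt I)) = hcomp (id_nat (line_pt J)) \<alpha>"
  proof -
    have 1: "(id_fun \<^bold>N \<otimes>\<^sub>f u) \<odot> line_pt I = line_pt J \<odot> u" "(id_fun \<^bold>N \<otimes>\<^sub>f v) \<odot> line_pt I = line_pt J \<odot> v"
      using line_pt_natural[of u] line_pt_natural[of v] by simp_all
    show ?thesis
      unfolding hcomp_def
    proof (rule mk_nat_cong)
      fix a assume "a \<in> Ob (Src (NSrc ?l \<odot> NSrc (id_nat (line_pt I))))"
      then have "a \<in> Ob I" by (simp add: id_nat_def)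
      then show "At ?l (FO (NTgt (id_nat (line_pt I))) a) \<cdot>\<^bsub>Tgt (NSrc ?l)\<^esub> FA (NSrc ?l) (At (id_nat (line_pt I)) a)
        = At (id_nat (line_pt J)) (FO (NTgt \<alpha>) a) \<cdot>\<^bsub>Tgt (NSrc (id_nat (line_pt J)))\<^esub> FA (NSrc (id_nat (line_pt J))) (At \<alpha> a)"
        using at[of a] obj[of a] small_fun_simps(5)[OF s(1), of a] \<alpha>(2,3)
        by (simp add: lprod_nat_def id_nat_def)
    qed (use 1 l \<alpha>(2,3) in \<open>simp_all add: id_nat_def\<close>)
  qed
  then have "DNat D (hcomp ?l (id_nat (line_pt I))) = DNat D (hcomp (id_nat (line_pt J)) \<alpha>)" by simp
  moreover have "DNat D (hcomp ?l (id_nat (line_pt I))) = hcomp (id_nat (DFun D (line_pt I))) (DNat D ?l)"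
    using nat_hcomp[OF i(1) l(1)] l nat_id[of "line_pt I"] by (simp add: id_nat_def mk_nat_def)
  moreover have "DNat D (hcomp (id_nat (line_pt J)) \<alpha>) = hcomp (DNat D \<alpha>) (id_nat (DFun D (line_pt J)))"
    using nat_hcomp[OF \<alpha>(1) i(2)] \<alpha>(2) nat_id[of "line_pt J"] by (simp add: id_nat_def mk_nat_def)
  ultimately have e: "At (hcomp (id_nat (DFun D (line_pt I))) (DNat D ?l)) Y
    = At (hcomp (DNat D \<alpha>) (id_nat (DFun D (line_pt J)))) Y" by simp
  have YJ: "Y \<in> Ob (DCat D (\<^bold>N \<otimes>\<^sub>c J))" using Y by simp
  note nl = nat[OF l(1)] and na = nat[OF \<alpha>(1)]
  have sJ: "Src (id_fun \<^bold>N \<otimes>\<^sub>f v) = \<^bold>N \<otimes>\<^sub>c I" "Tgt (id_fun \<^bold>N \<otimes>\<^sub>f v) = \<^bold>N \<otimes>\<^sub>c J" by simp_all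
  have vY: "reO D (id_fun \<^bold>N \<otimes>\<^sub>f v) Y \<in> Ob (DCat D (\<^bold>N \<otimes>\<^sub>c I))"
    using D_res(1)[of "id_fun \<^bold>N \<otimes>\<^sub>f v" Y] YJ by simp
  interpret nl: is_nat "DNat D ?l" using nl by simp
  interpret na: is_nat "DNat D \<alpha>" using na by simp
  have A1: "At (DNat D ?l) Y \<in> Arr (DCat D (\<^bold>N \<otimes>\<^sub>c I))" "Cod (DCat D (\<^bold>N \<otimes>\<^sub>c I)) (At (DNat D ?l) Y) = reO D (id_fun \<^bold>N \<otimes>\<^sub>f v) Y"
    using nl.at_in[of Y] nl l YJ by (simp_all add: hom_def)
  have jY: "reO D (line_pt J) Y \<in> Ob (DCat D J)" using D_res(1)[of "line_pt J" Y] YJ by simp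
  have A2: "At (DNat D \<alpha>) (reO D (line_pt J) Y) \<in> Arr (DCat D I)"
    "Dom (DCat D I) (At (DNat D \<alpha>) (reO D (line_pt J) Y)) = reO D u (reO D (line_pt J) Y)"
    using na.at_in[of "reO D (line_pt J) Y"] na \<alpha>(2,3) jY by (simp_all add: hom_def)
  have "At (hcomp (id_nat (DFun D (line_pt I))) (DNat D ?l)) Y
    = Idn (DCat D I) (reO D (line_pt I) (reO D (id_fun \<^bold>N \<otimes>\<^sub>f v) Y)) \<cdot>\<^bsub>DCat D I\<^esub> reA D (line_pt I) (At (DNat D ?l) Y)"
    using nl l YJ vY by (simp add: hcomp_def mk_nat_def id_nat_def)
  also have "\<dots> = reA D (line_pt I) (At (DNat D ?l) Y)"
    using A1 D_res(2,4)[of "line_pt I" "At (DNat D ?l) Y"] by simp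
  finally have e1: "At (hcomp (id_nat (DFun D (line_pt I))) (DNat D ?l)) Y = reA D (line_pt I) (At (DNat D ?l) Y)" .
  have "At (hcomp (DNat D \<alpha>) (id_nat (DFun D (line_pt J)))) Y
    = At (DNat D \<alpha>) (reO D (line_pt J) Y) \<cdot>\<^bsub>DCat D I\<^esub> reA D u (Idn (DCat D J) (reO D (line_pt J) Y))"
    using na \<alpha>(2,3) YJ by (simp add: hcomp_def mk_nat_def id_nat_def)
  also have "\<dots> = At (DNat D \<alpha>) (reO D (line_pt J) Y)"
    using A2 D_res(5)[OF s(1), of "reO D (line_pt J) Y"] jY by simp
  finally show ?thesis using e e1 by simp
qed

text \<open>
  Arrows out of \<open>i\<^sub>! X\<close> are tested on \<open>X\<close>. The compatibility of \<open>i\<^sub>!\<close> with arrows, identities and composites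
  reduces in this way to the corresponding property of cartesian arrows, and that with transformations to \<open>line_pt_whisker\<close>.
\<close>

lemma kap_cancel:
  assumes "small_cat S I" "X \<in> Ob (DCat D I)" "arr s" "arr t" "dm s = (\<^bold>N \<otimes>\<^sub>c I, iO I X)" "dm t = (\<^bold>N \<otimes>\<^sub>c I, iO I X)"
    "base s = base t" "s \<star> kap I X = t \<star> kap I X"
  shows "s = t"
  by (rule cocart_cancel[OF kap_simps(1)[OF assms(1,2)]]) (use assms in simp_all)

lemma con_arr_natural:
  assumes u: "small_fun S u" and f: "f \<in> Arr (DCat D (Tgt u))"
  shows "con_arr u (Cod (DCat D (Tgt u)) f) \<star> vert (\<^bold>N \<otimes>\<^sub>c Src u) (iA (Src u) (reA D u f))
    = vert (\<^bold>N \<otimes>\<^sub>c Tgt u) (iA (Tgt u) f) \<star> con_arr u (Dom (DCat D (Tgt u)) f)"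
proof (rule kap_cancel[of "Src u" "reO D u (Dom (DCat D (Tgt u)) f)"])
  note cX = con_arr_kap(4)[OF u, of "Dom (DCat D (Tgt u)) f"] and cY = con_arr_kap(4)[OF u, of "Cod (DCat D (Tgt u)) f"]
  show "(con_arr u (Cod (DCat D (Tgt u)) f) \<star> vert (\<^bold>N \<otimes>\<^sub>c Src u) (iA (Src u) (reA D u f)))
      \<star> kap (Src u) (reO D u (Dom (DCat D (Tgt u)) f))
    = (vert (\<^bold>N \<otimes>\<^sub>c Tgt u) (iA (Tgt u) f) \<star> con_arr u (Dom (DCat D (Tgt u)) f))
      \<star> kap (Src u) (reO D u (Dom (DCat D (Tgt u)) f))"
    using u f kap_natural[of "Src u" "reA D u f"] cmp_reassoc[OF kap_natural[of "Tgt u" f]]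
      cX cmp_reassoc[OF cY] cart_natural[OF u f]
    by (simp add: cmp_assoc)
qed (use u f in simp_all)

lemma con_arr_id: "small_cat S A \<Longrightarrow> X \<in> Ob (DCat D A) \<Longrightarrow> con_arr (id_fun A) X = ide (\<^bold>N \<otimes>\<^sub>c A, iO A X)"
  using con_arr_kap(4)[of "id_fun A" X] by (rule_tac kap_cancel[of A X]) simp_all

lemma con_arr_comp:
  assumes u: "small_fun S u" and v: "small_fun S v" and uv: "Tgt u = Src v" and X: "X \<in> Ob (DCat D (Tgt v))"
  shows "con_arr (v \<odot> u) X = con_arr v X \<star> con_arr u (reO D v X)"
proof (rule kap_cancel[of "Src u" "reO D u (reO D v X)"])
  have vX: "reO D v X \<in> Ob (DCat D (Tgt u))" using v X uv by simp
  have "con_arr (v \<odot> u) X \<star> kap (Src u) (reO D u (reO D v X)) = kap (Tgt v) X \<star> cart (v \<odot> u) X"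
    using con_arr_kap(4)[of "v \<odot> u" X] u v uv X by simp
  also have "\<dots> = (con_arr v X \<star> kap (Src v) (reO D v X)) \<star> cart u (reO D v X)"
    using cart_comp[OF u v uv X] by (simp add: con_arr_kap(4)[OF v X] cmp_assoc)
  also have "\<dots> = (con_arr v X \<star> con_arr u (reO D v X)) \<star> kap (Src u) (reO D u (reO D v X))"
    using con_arr_kap(4)[OF u vX] uv by (simp add: cmp_assoc)
  finally show "con_arr (v \<odot> u) X \<star> kap (Src u) (reO D u (reO D v X))
    = (con_arr v X \<star> con_arr u (reO D v X)) \<star> kap (Src u) (reO D u (reO D v X))" .
qed (use assms D_res(1)[OF v X] in \<open>simp_all add: D_res(1)[OF u]\<close>)

lemma con_2cell:
  assumes \<alpha>: "small_nat S \<alpha>" "NSrc \<alpha> = u" "NTgt \<alpha> = v" and X: "X \<in> Ob (DCat D (Tgt u))"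
  shows "At (DNat D (lprod_nat \<^bold>N \<alpha>)) (iO (Tgt u) X) \<cdot>\<^bsub>DCat D (\<^bold>N \<otimes>\<^sub>c Src u)\<^esub> con u X
    = con v X \<cdot>\<^bsub>DCat D (\<^bold>N \<otimes>\<^sub>c Src u)\<^esub> iA (Src u) (At (DNat D \<alpha>) X)"
proof -
  interpret \<alpha>: is_nat \<alpha> using \<alpha> by (simp add: small_nat_def)
  define I J where IJ: "I = Src u" "J = Tgt u"
  have s [simp]: "small_fun S u" "small_fun S v" "Src v = I" "Tgt v = J" "Src u = I" "Tgt u = J"
    using \<alpha> \<alpha>.same_src \<alpha>.same_tgt by (simp_all add: small_nat_def IJ)
  have IJs [simp]: "small_cat S I" "small_cat S J" using small_fun_cat[OF s(1)] by simp_all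
  have XJ: "X \<in> Ob (DCat D J)" using X by simp
  define p q where pq: "p = id_fun \<^bold>N \<otimes>\<^sub>f u" "q = id_fun \<^bold>N \<otimes>\<^sub>f v"
  have p: "small_fun S p" "Src p = \<^bold>N \<otimes>\<^sub>c I" "Tgt p = \<^bold>N \<otimes>\<^sub>c J" "small_fun S q" "Src q = \<^bold>N \<otimes>\<^sub>c I" "Tgt q = \<^bold>N \<otimes>\<^sub>c J"
    by (simp_all add: pq)
  let ?l = "lprod_nat \<^bold>N \<alpha>"
  have l: "small_nat S ?l" "NSrc ?l = p" "NTgt ?l = q"
    using small_lprod_nat[OF \<alpha>(1)] \<alpha> by (simp_all add: lprod_nat_def mk_nat_def pq)
  interpret nl: is_nat "DNat D ?l" using nat[OF l(1)] by simp
  interpret na: is_nat "DNat D \<alpha>" using nat[OF \<alpha>(1)] by simp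
  define Y where "Y = iO J X"
  have Y: "Y \<in> Ob (DCat D (\<^bold>N \<otimes>\<^sub>c J))" using XJ by (simp add: Y_def)
  define a where "a = At (DNat D \<alpha>) X"
  define b where "b = At (DNat D ?l) Y"
  have a: "a \<in> Arr (DCat D I)" "Dom (DCat D I) a = reO D u X" "Cod (DCat D I) a = reO D v X"
    using na.at_in[of X] nat[OF \<alpha>(1)] \<alpha> XJ by (simp_all add: hom_def a_def)
  have b: "b \<in> Arr (DCat D (\<^bold>N \<otimes>\<^sub>c I))" "Dom (DCat D (\<^bold>N \<otimes>\<^sub>c I)) b = reO D p Y" "Cod (DCat D (\<^bold>N \<otimes>\<^sub>c I)) b = reO D q Y"
    using nl.at_in[of Y] nat[OF l(1)] l p Y by (simp_all add: hom_def b_def)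
  have uX: "reO D u X \<in> Ob (DCat D I)" "reO D v X \<in> Ob (DCat D I)"
    using D_res(1)[OF s(1)] D_res(1)[OF s(2)] XJ by simp_all
  note cu = con_arr_kap[OF s(1), unfolded s, OF XJ, folded pq Y_def] and cv = con_arr_kap[OF s(2), unfolded s, OF XJ, folded pq Y_def]
  have Fa: "iA I a \<in> Arr (DCat D (\<^bold>N \<otimes>\<^sub>c I))" "Dom (DCat D (\<^bold>N \<otimes>\<^sub>c I)) (iA I a) = iO I (reO D u X)"
    "Cod (DCat D (\<^bold>N \<otimes>\<^sub>c I)) (iA I a) = iO I (reO D v X)"
    using iA_simps[of I a] a by simp_all
  \<comment> \<open>Transformations act on the fibres only, so the universal arrows are unpacked into their fibre components.\<close>
  obtain k where k: "kap J X = Over (line_pt J) k Y" "k \<in> Arr (DCat D J)" "Dom (DCat D J) k = X"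
    "Cod (DCat D J) k = reO D (line_pt J) Y"
    using cocart_arr[OF kap_simps(1)[OF IJs(2) XJ]] kap_simps(2-4)[OF IJs(2) XJ] by (auto elim!: arrE simp: Y_def)
  obtain h where h: "kap I (reO D u X) = Over (line_pt I) h (iO I (reO D u X))" "h \<in> Arr (DCat D I)"
    "Dom (DCat D I) h = reO D u X" "Cod (DCat D I) h = reO D (line_pt I) (iO I (reO D u X))"
    using cocart_arr[OF kap_simps(1)[OF IJs(1) uX(1)]] kap_simps(2-4)[OF IJs(1) uX(1)] by (auto elim!: arrE)
  have rc: "reA D (line_pt I) (con u X) \<in> Arr (DCat D I)" "Dom (DCat D I) (reA D (line_pt I) (con u X)) = reO D (line_pt I) (iO I (reO D u X))"
    "Cod (DCat D I) (reA D (line_pt I) (con u X)) = reO D (line_pt I) (reO D p Y)"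
    using D_res(2-4)[of "line_pt I" "con u X"] cu by simp_all
  have rb: "reA D (line_pt I) b \<in> Arr (DCat D I)" "Dom (DCat D I) (reA D (line_pt I) b) = reO D (line_pt I) (reO D p Y)"
    "Cod (DCat D I) (reA D (line_pt I) b) = reO D (line_pt I) (reO D q Y)"
    using D_res(2-4)[of "line_pt I" b] b by simp_all
  have ruk: "reA D u k \<in> Arr (DCat D I)" "Dom (DCat D I) (reA D u k) = reO D u X" "Cod (DCat D I) (reA D u k) = reO D u (reO D (line_pt J) Y)"
    using D_res(2-4)[OF s(1), of k] k by simp_all
  have rvk: "reA D v k \<in> Arr (DCat D I)" "Dom (DCat D I) (reA D v k) = reO D v X" "Cod (DCat D I) (reA D v k) = reO D v (reO D (line_pt J) Y)"
    using D_res(2-4)[OF s(2), of k] k by simp_all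
  have fu: "reA D (line_pt I) (con u X) \<cdot>\<^bsub>DCat D I\<^esub> h = reA D u k"
  proof -
    have "con_arr u X \<star> kap I (reO D u X) = Over (p \<odot> line_pt I) (reA D (line_pt I) (con u X) \<cdot>\<^bsub>DCat D I\<^esub> h) Y"
      unfolding h(1) con_arr_def s(6) Y_def[symmetric] pq[symmetric]
      using h cu p Y uX by (subst Over_cmp) simp_all
    moreover have "kap J X \<star> cart u X = Over (line_pt J \<odot> u) (reA D u k) Y"
      unfolding k(1) using k Y by (intro Over_cart) simp_all
    ultimately show ?thesis using cu(4) by simp
  qed
  have natk: "At (DNat D \<alpha>) (reO D (line_pt J) Y) \<cdot>\<^bsub>DCat D I\<^esub> reA D u k = reA D v k \<cdot>\<^bsub>DCat D I\<^esub> a"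
    using na.natural[of k X "reO D (line_pt J) Y"] nat[OF \<alpha>(1)] \<alpha> k by (simp add: hom_def a_def)
  have wh: "reA D (line_pt I) b = At (DNat D \<alpha>) (reO D (line_pt J) Y)"
    using line_pt_whisker[OF \<alpha>] Y by (simp add: b_def)
  have lq: "q \<odot> line_pt I = line_pt J \<odot> v" using line_pt_natural[of v] by (simp add: pq)
  have "b \<cdot>\<^bsub>DCat D (\<^bold>N \<otimes>\<^sub>c I)\<^esub> con u X = con v X \<cdot>\<^bsub>DCat D (\<^bold>N \<otimes>\<^sub>c I)\<^esub> iA I a"
  proof (rule Over_eq_by_cocart[OF kap_simps(1)[OF IJs(1) uX(1)] _ p(4), unfolded p])
    show "cd (kap I (reO D u X)) = (\<^bold>N \<otimes>\<^sub>c I, iO I (reO D u X))" using uX by simp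
    show "b \<cdot>\<^bsub>DCat D (\<^bold>N \<otimes>\<^sub>c I)\<^esub> con u X \<in> hom (DCat D (\<^bold>N \<otimes>\<^sub>c I)) (iO I (reO D u X)) (reO D q Y)"
      "con v X \<cdot>\<^bsub>DCat D (\<^bold>N \<otimes>\<^sub>c I)\<^esub> iA I a \<in> hom (DCat D (\<^bold>N \<otimes>\<^sub>c I)) (iO I (reO D u X)) (reO D q Y)"
      using b cu cv Fa by (simp_all add: hom_def)
    show "Y \<in> Ob (DCat D (\<^bold>N \<otimes>\<^sub>c J))" by (fact Y)
    have "Over q (con v X \<cdot>\<^bsub>DCat D (\<^bold>N \<otimes>\<^sub>c I)\<^esub> iA I a) Y = con_arr v X \<star> vert (\<^bold>N \<otimes>\<^sub>c I) (iA I a)"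
      using Over_comp_vert[OF p(4), of Y "con v X" "iA I a"] p cv Fa Y unfolding con_arr_def s(4) Y_def[symmetric] pq(2)[symmetric]
      by simp
    then have "Over q (con v X \<cdot>\<^bsub>DCat D (\<^bold>N \<otimes>\<^sub>c I)\<^esub> iA I a) Y \<star> kap I (reO D u X)
      = con_arr v X \<star> (vert (\<^bold>N \<otimes>\<^sub>c I) (iA I a) \<star> kap I (reO D u X))"
      by (simp add: cmp_assoc)
    also have "vert (\<^bold>N \<otimes>\<^sub>c I) (iA I a) \<star> kap I (reO D u X) = kap I (reO D v X) \<star> vert I a"
      using kap_natural[of I a] a by simp
    also have "con_arr v X \<star> kap I (reO D v X) \<star> vert I a = (kap J X \<star> cart v X) \<star> vert I a"
      by (simp add: cmp_reassoc[OF cv(4)])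
    also have "kap J X \<star> cart v X = Over (line_pt J \<odot> v) (reA D v k) Y"
      unfolding k(1) using k Y by (intro Over_cart) simp_all
    also have "\<dots> \<star> vert I a = Over (line_pt J \<odot> v) (reA D v k \<cdot>\<^bsub>DCat D I\<^esub> a) Y"
      using Over_comp_vert[of "line_pt J \<odot> v" Y "reA D v k" a] rvk a Y by simp
    finally have 1: "Over q (con v X \<cdot>\<^bsub>DCat D (\<^bold>N \<otimes>\<^sub>c I)\<^esub> iA I a) Y \<star> kap I (reO D u X)
      = Over (line_pt J \<odot> v) (reA D v k \<cdot>\<^bsub>DCat D I\<^esub> a) Y" .
    have "Over q (b \<cdot>\<^bsub>DCat D (\<^bold>N \<otimes>\<^sub>c I)\<^esub> con u X) Y \<star> kap I (reO D u X)
      = Over (q \<odot> line_pt I) (reA D (line_pt I) (b \<cdot>\<^bsub>DCat D (\<^bold>N \<otimes>\<^sub>c I)\<^esub> con u X) \<cdot>\<^bsub>DCat D I\<^esub> h) Y"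
      unfolding h(1) using h b cu p Y uX by (subst Over_cmp) simp_all
    also have "reA D (line_pt I) (b \<cdot>\<^bsub>DCat D (\<^bold>N \<otimes>\<^sub>c I)\<^esub> con u X) \<cdot>\<^bsub>DCat D I\<^esub> h
      = reA D (line_pt I) b \<cdot>\<^bsub>DCat D I\<^esub> (reA D (line_pt I) (con u X) \<cdot>\<^bsub>DCat D I\<^esub> h)"
      using D_res(6)[of "line_pt I" "con u X" b] b cu h rc rb D_assoc[of I h "reA D (line_pt I) (con u X)" "reA D (line_pt I) b"]
      by simp
    also have "\<dots> = reA D v k \<cdot>\<^bsub>DCat D I\<^esub> a" unfolding fu wh by (rule natk)
    finally show "Over q (b \<cdot>\<^bsub>DCat D (\<^bold>N \<otimes>\<^sub>c I)\<^esub> con u X) Y \<star> kap I (reO D u X)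
      = Over q (con v X \<cdot>\<^bsub>DCat D (\<^bold>N \<otimes>\<^sub>c I)\<^esub> iA I a) Y \<star> kap I (reO D u X)"
      unfolding 1 lq .
  qed
  then show ?thesis by (simp add: a_def b_def Y_def)
qed

lemma structure_derivator_morphism:
  "derivator_morphism S (external D) (affine_line D) (structure_morphism D)"
proof (rule derivator_morphism.intro, goal_cases)
  case (1 A)
  then show ?case using structure_functor(1-3)[of A] by simp
next
  case (2 u X)
  then show ?case using con_iso[of u X] by (simp add: con_def iO_def)
next
  case (3 u f X Y)
  then have u: "small_fun S u" and f: "f \<in> Arr (DCat D (Tgt u))" "Dom (DCat D (Tgt u)) f = X" "Cod (DCat D (Tgt u)) f = Y"
    by (simp_all add: hom_def)
  then have "X \<in> Ob (DCat D (Tgt u))" "Y \<in> Ob (DCat D (Tgt u))" by auto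
  then show ?case
    using arg_cong[OF con_arr_natural[OF u f(1)], of fib] u f by (simp add: fib_cmp_vert fib_vert_cmp flip: con_def iO_def iA_def)
next
  case (4 A X)
  then show ?case using arg_cong[OF con_arr_id, of A X fib] by (simp flip: con_def iO_def)
next
  case (5 u v X)
  then show ?case using arg_cong[OF con_arr_comp, of u v X fib] by (simp add: fib_cmp flip: con_def)
next
  case (6 \<alpha> u v X)
  then show ?case using con_2cell[of \<alpha> u v X] by (simp flip: con_def iO_def iA_def)
qed

section \<open>The structure morphism is strong monoidal\<close>

lemma Idn_isos:
  "small_cat S A \<Longrightarrow> X \<in> Ob (DCat D A) \<Longrightarrow> Idn (DCat D A) X \<in> isos (DCat D A) X X"
  unfolding isos_def by (intro CollectI conjI bexI[of _ "Idn (DCat D A) X"]) (simp_all add: hom_def)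

text \<open>
  The composite \<open>X \<boxtimes> Y \<rightarrow> i\<^sub>! X \<boxtimes> i\<^sub>! Y \<rightarrow> i\<^sub>! X \<boxtimes>\<^sub>A\<^sub>1 i\<^sub>! Y\<close> of universal arrows. It is cocartesian over the base point,
  and so is \<open>kap\<close> at \<open>X \<boxtimes> Y\<close>; \<open>mu\<close> is the resulting vertical isomorphism.
\<close>

definition kap2 :: "'a scat \<Rightarrow> 'a scat \<Rightarrow> 'o \<Rightarrow> 'o \<Rightarrow> ('a, 'o, 'm) over_arr" where
  "kap2 A B X Y = lam A B (iO A X) (iO B Y) \<star> (kap A X \<boxtimes> kap B Y)"

definition mu :: "'a scat \<Rightarrow> 'a scat \<Rightarrow> 'o \<Rightarrow> 'o \<Rightarrow> 'm" where
  "mu A B X Y = fib (SOME m. invertible m \<and> base m = id_fun (\<^bold>N \<otimes>\<^sub>c (A \<otimes>\<^sub>c B)) \<and> dm m = cd (kap2 A B X Y)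
     \<and> cd m = cd (kap (A \<otimes>\<^sub>c B) (extO D A B X Y)) \<and> m \<star> kap2 A B X Y = kap (A \<otimes>\<^sub>c B) (extO D A B X Y))"

lemma kap2_simps [simp]:
  assumes "small_cat S A" "small_cat S B" "X \<in> Ob (DCat D A)" "Y \<in> Ob (DCat D B)"
  shows "cocart (kap2 A B X Y)" "base (kap2 A B X Y) = line_pt (A \<otimes>\<^sub>c B)"
    "dm (kap2 A B X Y) = (A \<otimes>\<^sub>c B, extO D A B X Y)"
    "cd (kap2 A B X Y) = (\<^bold>N \<otimes>\<^sub>c (A \<otimes>\<^sub>c B), lineO D A B (iO A X) (iO B Y))"
proof -
  have c: "cocart (kap A X \<boxtimes> kap B Y)" using assms by (intro cocart_box) simp_all
  show "cocart (kap2 A B X Y)" unfolding kap2_def using c assms by (intro cocart_comp) simp_all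
  show "base (kap2 A B X Y) = line_pt (A \<otimes>\<^sub>c B)" "dm (kap2 A B X Y) = (A \<otimes>\<^sub>c B, extO D A B X Y)"
    "cd (kap2 A B X Y) = (\<^bold>N \<otimes>\<^sub>c (A \<otimes>\<^sub>c B), lineO D A B (iO A X) (iO B Y))"
    unfolding kap2_def using assms line_plus_line_pt[of A B] by simp_all
qed

lemma mu_iso_kap2:
  assumes "small_cat S A" "small_cat S B" "X \<in> Ob (DCat D A)" "Y \<in> Ob (DCat D B)"
  shows "mu A B X Y \<in> isos (DCat D (\<^bold>N \<otimes>\<^sub>c (A \<otimes>\<^sub>c B))) (lineO D A B (iO A X) (iO B Y)) (iO (A \<otimes>\<^sub>c B) (extO D A B X Y))"
    "vert (\<^bold>N \<otimes>\<^sub>c (A \<otimes>\<^sub>c B)) (mu A B X Y) \<star> kap2 A B X Y = kap (A \<otimes>\<^sub>c B) (extO D A B X Y)"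
proof -
  let ?l = "kap (A \<otimes>\<^sub>c B) (extO D A B X Y)"
  have l: "cocart ?l" "dm (kap2 A B X Y) = dm ?l" "base (kap2 A B X Y) = base ?l" using assms by simp_all
  obtain m where "invertible m" "base m = id_fun (Tgt (base (kap2 A B X Y)))" "dm m = cd (kap2 A B X Y)" "cd m = cd ?l"
    "m \<star> kap2 A B X Y = ?l"
    by (rule cocart_unique[OF kap2_simps(1)[OF assms] l])
  then have "\<exists>m. invertible m \<and> base m = id_fun (\<^bold>N \<otimes>\<^sub>c (A \<otimes>\<^sub>c B)) \<and> dm m = cd (kap2 A B X Y) \<and> cd m = cd ?l
      \<and> m \<star> kap2 A B X Y = ?l"
    using assms by (intro exI[of _ m]) simp
  from someI_ex[OF this] obtain m where m: "invertible m" "base m = id_fun (\<^bold>N \<otimes>\<^sub>c (A \<otimes>\<^sub>c B))"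
    "dm m = cd (kap2 A B X Y)" "cd m = cd ?l" "m \<star> kap2 A B X Y = ?l" "mu A B X Y = fib m"
    unfolding mu_def by blast
  have "dm m = (\<^bold>N \<otimes>\<^sub>c (A \<otimes>\<^sub>c B), lineO D A B (iO A X) (iO B Y))"
    "cd m = (\<^bold>N \<otimes>\<^sub>c (A \<otimes>\<^sub>c B), iO (A \<otimes>\<^sub>c B) (extO D A B X Y))"
    using m assms by simp_all
  from vert_invertible_isos[OF m(1,2) this]
  show "mu A B X Y \<in> isos (DCat D (\<^bold>N \<otimes>\<^sub>c (A \<otimes>\<^sub>c B))) (lineO D A B (iO A X) (iO B Y)) (iO (A \<otimes>\<^sub>c B) (extO D A B X Y))"
    "vert (\<^bold>N \<otimes>\<^sub>c (A \<otimes>\<^sub>c B)) (mu A B X Y) \<star> kap2 A B X Y = kap (A \<otimes>\<^sub>c B) (extO D A B X Y)"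
    using m(5,6) by simp_all
qed

lemma mu_simps [simp]:
  assumes "small_cat S A" "small_cat S B" "X \<in> Ob (DCat D A)" "Y \<in> Ob (DCat D B)"
  shows "mu A B X Y \<in> Arr (DCat D (\<^bold>N \<otimes>\<^sub>c (A \<otimes>\<^sub>c B)))"
    "Dom (DCat D (\<^bold>N \<otimes>\<^sub>c (A \<otimes>\<^sub>c B))) (mu A B X Y) = lineO D A B (iO A X) (iO B Y)"
    "Cod (DCat D (\<^bold>N \<otimes>\<^sub>c (A \<otimes>\<^sub>c B))) (mu A B X Y) = iO (A \<otimes>\<^sub>c B) (extO D A B X Y)"
  using mu_iso_kap2(1)[OF assms] by (simp_all add: isos_def hom_def)

abbreviation mu_arr :: "'a scat \<Rightarrow> 'a scat \<Rightarrow> 'o \<Rightarrow> 'o \<Rightarrow> ('a, 'o, 'm) over_arr" where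
  "mu_arr A B X Y \<equiv> vert (\<^bold>N \<otimes>\<^sub>c (A \<otimes>\<^sub>c B)) (mu A B X Y)"

abbreviation lineA_arr :: "'a scat \<Rightarrow> 'a scat \<Rightarrow> 'm \<Rightarrow> 'm \<Rightarrow> ('a, 'o, 'm) over_arr" where
  "lineA_arr A B f g \<equiv> vert (\<^bold>N \<otimes>\<^sub>c (A \<otimes>\<^sub>c B)) (lineA D A B f g)"

abbreviation iA_arr :: "'a scat \<Rightarrow> 'm \<Rightarrow> ('a, 'o, 'm) over_arr" where
  "iA_arr A f \<equiv> vert (\<^bold>N \<otimes>\<^sub>c A) (iA A f)"

text \<open>
  The coherence conditions below concern arrows out of \<open>i\<^sub>! X \<boxtimes>\<^sub>A\<^sub>1 i\<^sub>! Y\<close>, and are tested on \<open>X \<boxtimes> Y\<close>.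
\<close>

lemma kap2_cancel:
  assumes "small_cat S A" "small_cat S B" "X \<in> Ob (DCat D A)" "Y \<in> Ob (DCat D B)" "arr s" "arr t"
    "dm s = (\<^bold>N \<otimes>\<^sub>c (A \<otimes>\<^sub>c B), lineO D A B (iO A X) (iO B Y))"
    "dm t = (\<^bold>N \<otimes>\<^sub>c (A \<otimes>\<^sub>c B), lineO D A B (iO A X) (iO B Y))"
    "base s = base t" "s \<star> kap2 A B X Y = t \<star> kap2 A B X Y"
  shows "s = t"
  by (rule cocart_cancel[OF kap2_simps(1)[OF assms(1-4)]]) (use assms in simp_all)

lemma lineA_box:
  assumes s: "small_cat S A" "small_cat S B" and f: "f \<in> Arr (DCat D (\<^bold>N \<otimes>\<^sub>c A))" "g \<in> Arr (DCat D (\<^bold>N \<otimes>\<^sub>c B))"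
    and t: "arr s" "arr t" "cd s = (\<^bold>N \<otimes>\<^sub>c A, Dom (DCat D (\<^bold>N \<otimes>\<^sub>c A)) f)" "cd t = (\<^bold>N \<otimes>\<^sub>c B, Dom (DCat D (\<^bold>N \<otimes>\<^sub>c B)) g)"
  shows "lineA_arr A B f g \<star> lam A B (Dom (DCat D (\<^bold>N \<otimes>\<^sub>c A)) f) (Dom (DCat D (\<^bold>N \<otimes>\<^sub>c B)) g) \<star> (s \<boxtimes> t)
    = lam A B (Cod (DCat D (\<^bold>N \<otimes>\<^sub>c A)) f) (Cod (DCat D (\<^bold>N \<otimes>\<^sub>c B)) g)
      \<star> ((vert (\<^bold>N \<otimes>\<^sub>c A) f \<star> s) \<boxtimes> (vert (\<^bold>N \<otimes>\<^sub>c B) g \<star> t))"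
proof -
  have "(vert (\<^bold>N \<otimes>\<^sub>c A) f \<star> s) \<boxtimes> (vert (\<^bold>N \<otimes>\<^sub>c B) g \<star> t)
      = (vert (\<^bold>N \<otimes>\<^sub>c A) f \<boxtimes> vert (\<^bold>N \<otimes>\<^sub>c B) g) \<star> (s \<boxtimes> t)"
    using s f t by (intro box_comp) simp_all
  then show ?thesis using cmp_reassoc[OF lineA_lam[OF s f]] by (simp add: cmp_assoc)
qed

lemma mu_natural:
  assumes s: "small_cat S A" "small_cat S B" and f: "f \<in> hom (DCat D A) X X'" and g: "g \<in> hom (DCat D B) Y Y'"
  defines "K \<equiv> DCat D (\<^bold>N \<otimes>\<^sub>c (A \<otimes>\<^sub>c B))"
  shows "mu A B X' Y' \<cdot>\<^bsub>K\<^esub> lineA D A B (iA A f) (iA B g) = iA (A \<otimes>\<^sub>c B) (extA D A B f g) \<cdot>\<^bsub>K\<^esub> mu A B X Y"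
proof -
  have f': "f \<in> Arr (DCat D A)" "Dom (DCat D A) f = X" "Cod (DCat D A) f = X'"
    "g \<in> Arr (DCat D B)" "Dom (DCat D B) g = Y" "Cod (DCat D B) g = Y'"
    using f g by (simp_all add: hom_def)
  have o: "X \<in> Ob (DCat D A)" "X' \<in> Ob (DCat D A)" "Y \<in> Ob (DCat D B)" "Y' \<in> Ob (DCat D B)"
    using D_cat(1,2)[OF s(1) f'(1)] D_cat(1,2)[OF s(2) f'(4)] f' by simp_all
  have "mu_arr A B X' Y' \<star> lineA_arr A B (iA A f) (iA B g) = iA_arr (A \<otimes>\<^sub>c B) (extA D A B f g) \<star> mu_arr A B X Y"
  proof (rule kap2_cancel[OF s o(1,3)])
    have "lineA_arr A B (iA A f) (iA B g) \<star> kap2 A B X Y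
        = lam A B (iO A X') (iO B Y') \<star> ((kap A X' \<star> vert A f) \<boxtimes> (kap B Y' \<star> vert B g))"
      using lineA_box[OF s, of "iA A f" "iA B g" "kap A X" "kap B Y"] s f' o
        kap_natural[OF s(1) f'(1)] kap_natural[OF s(2) f'(4)] by (simp add: kap2_def)
    also have "\<dots> = kap2 A B X' Y' \<star> vert (A \<otimes>\<^sub>c B) (extA D A B f g)"
      using s f' o box_vert[OF s f'(1,4)] by (simp add: kap2_def cmp_assoc box_comp)
    finally show "(mu_arr A B X' Y' \<star> lineA_arr A B (iA A f) (iA B g)) \<star> kap2 A B X Y
      = (iA_arr (A \<otimes>\<^sub>c B) (extA D A B f g) \<star> mu_arr A B X Y) \<star> kap2 A B X Y"
      using cmp_reassoc[OF mu_iso_kap2(2)[OF s o(2,4)]] mu_iso_kap2(2)[OF s o(1,3)]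
        kap_natural[of "A \<otimes>\<^sub>c B" "extA D A B f g"] s f' by (simp add: cmp_assoc)
  qed (use s f' o in simp_all)
  from arg_cong[OF this, of fib] show ?thesis
    unfolding K_def using s f' o by (simp add: fib_cmp_vert)
qed

lemma con_arr_vert:
  assumes "small_fun S u" "X \<in> Ob (DCat D (Tgt u))"
  shows "con_arr u X = cart (id_fun \<^bold>N \<otimes>\<^sub>f u) (iO (Tgt u) X) \<star> vert (\<^bold>N \<otimes>\<^sub>c Src u) (con u X)"
  using con_arr_kap(1-3)[OF assms] Over_eq_cart_vert[of "id_fun \<^bold>N \<otimes>\<^sub>f u" "iO (Tgt u) X" "con u X"] assms
  by (simp add: con_arr_def)

text \<open>
  The side of each coherence condition that ends with a constraint of the structure morphism is evaluated here once and for all: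
  precomposed with \<open>kap2\<close> it is a constraint of \<open>\<boxtimes>\<close> followed by the universal arrow of \<open>i\<^sub>!\<close>.
\<close>

lemma con_arr_kap2:
  assumes s: "small_cat S A" "small_cat S B" and X: "X \<in> Ob (DCat D A)" and Y: "Y \<in> Ob (DCat D B)"
    and w: "small_fun S w" "Src w = A \<otimes>\<^sub>c B" "Z \<in> Ob (DCat D (Tgt w))"
    and f: "f \<in> Arr (DCat D (A \<otimes>\<^sub>c B))" "Dom (DCat D (A \<otimes>\<^sub>c B)) f = extO D A B X Y" "Cod (DCat D (A \<otimes>\<^sub>c B)) f = reO D w Z"
  shows "con_arr w Z \<star> iA_arr (A \<otimes>\<^sub>c B) f \<star> mu_arr A B X Y \<star> kap2 A B X Y
    = kap (Tgt w) Z \<star> Over w f Z"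
proof -
  have "iA_arr (A \<otimes>\<^sub>c B) f \<star> mu_arr A B X Y \<star> kap2 A B X Y = kap (A \<otimes>\<^sub>c B) (reO D w Z) \<star> vert (A \<otimes>\<^sub>c B) f"
    using mu_iso_kap2(2)[OF s X Y] kap_natural[of "A \<otimes>\<^sub>c B" f] s f by simp
  then show ?thesis
    using cmp_reassoc[OF con_arr_kap(4)[OF w(1,3)]] Over_eq_cart_vert[of w Z f] w f by (simp add: cmp_assoc)
qed

text \<open>
  Precomposed with \<open>kap2\<close>, both sides become \<open>kap (cart u X \<boxtimes> cart v Y)\<close>; the left one because
  \<open>con_arr \<star> kap = kap \<star> cart\<close> in each factor.
\<close>

lemma mu_res:
  assumes u: "small_fun S u" and v: "small_fun S v" and X: "X \<in> Ob (DCat D (Tgt u))" and Y: "Y \<in> Ob (DCat D (Tgt v))"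
  defines "w \<equiv> id_fun \<^bold>N \<otimes>\<^sub>f (u \<otimes>\<^sub>f v)" and "K \<equiv> DCat D (\<^bold>N \<otimes>\<^sub>c (Src u \<otimes>\<^sub>c Src v))"
  shows "reA D w (mu (Tgt u) (Tgt v) X Y) \<cdot>\<^bsub>K\<^esub> lineRes D u v (iO (Tgt u) X) (iO (Tgt v) Y)
      \<cdot>\<^bsub>K\<^esub> lineA D (Src u) (Src v) (con u X) (con v Y)
    = con (u \<otimes>\<^sub>f v) (extO D (Tgt u) (Tgt v) X Y) \<cdot>\<^bsub>K\<^esub> iA (Src u \<otimes>\<^sub>c Src v) (extRes D u v X Y)
      \<cdot>\<^bsub>K\<^esub> mu (Src u) (Src v) (reO D u X) (reO D v Y)"
proof -
  define I I' J J' where IJ: "I = Src u" "I' = Tgt u" "J = Src v" "J' = Tgt v"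
  have s [simp]: "small_cat S I" "small_cat S I'" "small_cat S J" "small_cat S J'" "Src u = I" "Tgt u = I'"
    "Src v = J" "Tgt v = J'" using u v by (simp_all add: IJ)
  define X' Y' E \<epsilon> where XY': "X' = reO D u X" "Y' = reO D v Y" "E = extO D I' J' X Y" "\<epsilon> = extRes D u v X Y"
  have XY: "X \<in> Ob (DCat D I')" "Y \<in> Ob (DCat D J')" "X' \<in> Ob (DCat D I)" "Y' \<in> Ob (DCat D J)"
    "E \<in> Ob (DCat D (I' \<otimes>\<^sub>c J'))"
    using X Y D_res(1)[OF u X] D_res(1)[OF v Y] by (simp_all add: XY')
  have \<epsilon>: "\<epsilon> \<in> Arr (DCat D (I \<otimes>\<^sub>c J))" "Dom (DCat D (I \<otimes>\<^sub>c J)) \<epsilon> = extO D I J X' Y'"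
    "Cod (DCat D (I \<otimes>\<^sub>c J)) \<epsilon> = reO D (u \<otimes>\<^sub>f v) E"
    using extRes_simps[OF u v X Y] by (simp_all add: XY')
  define F G where FG: "F = iO I' X" "G = iO J' Y"
  have FGo: "F \<in> Ob (DCat D (\<^bold>N \<otimes>\<^sub>c I'))" "G \<in> Ob (DCat D (\<^bold>N \<otimes>\<^sub>c J'))" using XY by (simp_all add: FG)
  define u' v' where uv': "u' = id_fun \<^bold>N \<otimes>\<^sub>f u" "v' = id_fun \<^bold>N \<otimes>\<^sub>f v"
  have s' [simp]: "small_fun S u'" "small_fun S v'" "small_fun S w" "Src u' = \<^bold>N \<otimes>\<^sub>c I" "Tgt u' = \<^bold>N \<otimes>\<^sub>c I'"
    "Src v' = \<^bold>N \<otimes>\<^sub>c J" "Tgt v' = \<^bold>N \<otimes>\<^sub>c J'" "Src w = \<^bold>N \<otimes>\<^sub>c (I \<otimes>\<^sub>c J)" "Tgt w = \<^bold>N \<otimes>\<^sub>c (I' \<otimes>\<^sub>c J')"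
    using u v by (simp_all add: uv' w_def)
  note cu = con_arr_kap[OF u X, unfolded s, folded FG uv' XY'] and cv = con_arr_kap[OF v Y, unfolded s, folded FG uv' XY']
  note R = res_arr_simps[OF u v, of F G, unfolded s, folded uv' w_def, OF FGo]
  let ?R = "res_arr u v F G" and ?L = "lineA_arr I J (con u X) (con v Y)"
  have c: "arr (con_arr (u \<otimes>\<^sub>f v) E)" "dm (con_arr (u \<otimes>\<^sub>f v) E) = (\<^bold>N \<otimes>\<^sub>c (I \<otimes>\<^sub>c J), iO (I \<otimes>\<^sub>c J) (reO D (u \<otimes>\<^sub>f v) E))"
    "base (con_arr (u \<otimes>\<^sub>f v) E) = w" using u v XY by (simp_all add: w_def)
  have "mu_arr I' J' X Y \<star> ?R \<star> ?L = con_arr (u \<otimes>\<^sub>f v) E \<star> iA_arr (I \<otimes>\<^sub>c J) \<epsilon> \<star> mu_arr I J X' Y'"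
  proof (rule kap2_cancel[OF s(1,3) XY(3,4)])
    have "?L \<star> kap2 I J X' Y' = lam I J (reO D u' F) (reO D v' G)
        \<star> ((vert (\<^bold>N \<otimes>\<^sub>c I) (con u X) \<star> kap I X') \<boxtimes> (vert (\<^bold>N \<otimes>\<^sub>c J) (con v Y) \<star> kap J Y'))"
      using lineA_box[OF s(1,3) cu(1) cv(1), of "kap I X'" "kap J Y'"] cu cv XY by (simp add: kap2_def)
    then have "?R \<star> ?L \<star> kap2 I J X' Y' = lam I' J' F G
        \<star> (cart u' F \<boxtimes> cart v' G) \<star> ((vert (\<^bold>N \<otimes>\<^sub>c I) (con u X) \<star> kap I X') \<boxtimes> (vert (\<^bold>N \<otimes>\<^sub>c J) (con v Y) \<star> kap J Y'))"
      using cmp_reassoc[OF res_arr_lam[OF u v, of F G, unfolded s, folded uv', OF FGo]] by (simp add: cmp_assoc)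
    also have "(cart u' F \<boxtimes> cart v' G) \<star> ((vert (\<^bold>N \<otimes>\<^sub>c I) (con u X) \<star> kap I X') \<boxtimes> (vert (\<^bold>N \<otimes>\<^sub>c J) (con v Y) \<star> kap J Y'))
      = (con_arr u X \<star> kap I X') \<boxtimes> (con_arr v Y \<star> kap J Y')"
      using con_arr_vert[OF u X, unfolded s, folded FG uv'] con_arr_vert[OF v Y, unfolded s, folded FG uv'] cu cv FGo XY
      by (simp add: cmp_assoc) (subst box_comp[symmetric], simp_all)
    also have "\<dots> = (kap I' X \<boxtimes> kap J' Y) \<star> (cart u X \<boxtimes> cart v Y)"
      unfolding cu(4) cv(4) using u v X Y XY by (intro box_comp) simp_all
    finally have "?R \<star> ?L \<star> kap2 I J X' Y' = kap2 I' J' X Y \<star> (cart u X \<boxtimes> cart v Y)" by (simp add: kap2_def FG cmp_assoc)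
    then have "mu_arr I' J' X Y \<star> ?R \<star> ?L \<star> kap2 I J X' Y' = kap (I' \<otimes>\<^sub>c J') E \<star> (cart u X \<boxtimes> cart v Y)"
      using cmp_reassoc[OF mu_iso_kap2(2)[of I' J' X Y]] XY by (simp add: XY')
    also have "cart u X \<boxtimes> cart v Y = Over (u \<otimes>\<^sub>f v) \<epsilon> E"
      using box_cart[OF u v X Y] Over_eq_cart_vert[of "u \<otimes>\<^sub>f v" E \<epsilon>] u v \<epsilon> XY by (simp add: XY')
    also have "kap (I' \<otimes>\<^sub>c J') E \<star> \<dots> = con_arr (u \<otimes>\<^sub>f v) E \<star> iA_arr (I \<otimes>\<^sub>c J) \<epsilon> \<star> mu_arr I J X' Y' \<star> kap2 I J X' Y'"
      using con_arr_kap2[OF s(1,3) XY(3,4), of "u \<otimes>\<^sub>f v" E \<epsilon>] u v \<epsilon> XY by simp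
    finally show "(mu_arr I' J' X Y \<star> ?R \<star> ?L) \<star> kap2 I J X' Y'
      = (con_arr (u \<otimes>\<^sub>f v) E \<star> iA_arr (I \<otimes>\<^sub>c J) \<epsilon> \<star> mu_arr I J X' Y') \<star> kap2 I J X' Y'"
      by (simp only: cmp_assoc)
  qed (use cu cv \<epsilon> XY R c FG in simp_all)
  from arg_cong[OF this, of fib] show ?thesis
    using cu cv \<epsilon> XY R c FG
    by (simp add: fib_cmp_vert fib_vert_cmp K_def vert_comp[symmetric] flip: XY') (simp add: res_arr_def)
qed

text \<open>
  The left side starts at \<open>(i\<^sub>! X \<boxtimes>\<^sub>A\<^sub>1 i\<^sub>! Y) \<boxtimes>\<^sub>A\<^sub>1 i\<^sub>! Z\<close>, which is a Kan extension of \<open>(X \<boxtimes> Y) \<boxtimes> Z\<close> since \<open>\<boxtimes>\<close> preserves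
  cocartesian arrows. On \<open>(X \<boxtimes> Y) \<boxtimes> Z\<close> the condition is naturality of the associator of \<open>\<boxtimes>\<close> with respect to the
  universal arrows of \<open>X\<close>, \<open>Y\<close> and \<open>Z\<close>.
\<close>

lemma mu_assoc:
  assumes s: "small_cat S A" "small_cat S B" "small_cat S C"
    and o: "X \<in> Ob (DCat D A)" "Y \<in> Ob (DCat D B)" "Z \<in> Ob (DCat D C)"
  defines "P \<equiv> (A \<otimes>\<^sub>c B) \<otimes>\<^sub>c C" and "a \<equiv> assoc_fun A B C"
  defines "K \<equiv> DCat D (\<^bold>N \<otimes>\<^sub>c P)" and "w \<equiv> id_fun \<^bold>N \<otimes>\<^sub>f a"
  shows "con a (extO D A (B \<otimes>\<^sub>c C) X (extO D B C Y Z)) \<cdot>\<^bsub>K\<^esub> iA P (extAs D A B C X Y Z)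
      \<cdot>\<^bsub>K\<^esub> mu (A \<otimes>\<^sub>c B) C (extO D A B X Y) Z
      \<cdot>\<^bsub>K\<^esub> lineA D (A \<otimes>\<^sub>c B) C (mu A B X Y) (Idn (DCat D (\<^bold>N \<otimes>\<^sub>c C)) (iO C Z))
    = reA D w (mu A (B \<otimes>\<^sub>c C) X (extO D B C Y Z))
      \<cdot>\<^bsub>K\<^esub> reA D w (lineA D A (B \<otimes>\<^sub>c C) (Idn (DCat D (\<^bold>N \<otimes>\<^sub>c A)) (iO A X)) (mu B C Y Z))
      \<cdot>\<^bsub>K\<^esub> lineAs D A B C (iO A X) (iO B Y) (iO C Z)"
proof -
  let ?BC = "B \<otimes>\<^sub>c C" and ?AB = "A \<otimes>\<^sub>c B"
  define XY YZ T where xyz: "XY = extO D A B X Y" "YZ = extO D B C Y Z" "T = extO D A ?BC X YZ"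
  have sP [simp]: "small_cat S P" "small_fun S a" "Src a = P" "Tgt a = A \<otimes>\<^sub>c ?BC" "?AB \<otimes>\<^sub>c C = P"
    "small_fun S w" "Src w = \<^bold>N \<otimes>\<^sub>c P" "Tgt w = \<^bold>N \<otimes>\<^sub>c (A \<otimes>\<^sub>c ?BC)"
    using s by (simp_all add: P_def a_def w_def)
  have ob: "XY \<in> Ob (DCat D ?AB)" "YZ \<in> Ob (DCat D ?BC)" "T \<in> Ob (DCat D (A \<otimes>\<^sub>c ?BC))"
    using s o by (simp_all add: xyz)
  define F G H where FGH: "F = iO A X" "G = iO B Y" "H = iO C Z"
  have Fo: "F \<in> Ob (DCat D (\<^bold>N \<otimes>\<^sub>c A))" "G \<in> Ob (DCat D (\<^bold>N \<otimes>\<^sub>c B))" "H \<in> Ob (DCat D (\<^bold>N \<otimes>\<^sub>c C))"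
    using s o by (simp_all add: FGH)
  let ?idF = "Idn (DCat D (\<^bold>N \<otimes>\<^sub>c A)) F" and ?idH = "Idn (DCat D (\<^bold>N \<otimes>\<^sub>c C)) H"
  let ?l1 = "lineA_arr ?AB C (mu A B X Y) ?idH" and ?l2 = "lineA_arr A ?BC ?idF (mu B C Y Z)"
  let ?R = "as_arr A B C F G H"
  note R = as_arr_simps[OF s Fo, folded P_def a_def, folded w_def]
  have m: "mu A B X Y \<in> Arr (DCat D (\<^bold>N \<otimes>\<^sub>c ?AB))" "Dom (DCat D (\<^bold>N \<otimes>\<^sub>c ?AB)) (mu A B X Y) = lineO D A B F G"
    "Cod (DCat D (\<^bold>N \<otimes>\<^sub>c ?AB)) (mu A B X Y) = iO ?AB XY"
    "mu B C Y Z \<in> Arr (DCat D (\<^bold>N \<otimes>\<^sub>c ?BC))" "Dom (DCat D (\<^bold>N \<otimes>\<^sub>c ?BC)) (mu B C Y Z) = lineO D B C G H"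
    "Cod (DCat D (\<^bold>N \<otimes>\<^sub>c ?BC)) (mu B C Y Z) = iO ?BC YZ"
    using s o by (simp_all add: FGH xyz)
  have mm: "mu ?AB C XY Z \<in> Arr (DCat D (\<^bold>N \<otimes>\<^sub>c P))" "Dom (DCat D (\<^bold>N \<otimes>\<^sub>c P)) (mu ?AB C XY Z) = lineO D ?AB C (iO ?AB XY) H"
    "Cod (DCat D (\<^bold>N \<otimes>\<^sub>c P)) (mu ?AB C XY Z) = iO P (extO D ?AB C XY Z)"
    "mu A ?BC X YZ \<in> Arr (DCat D (\<^bold>N \<otimes>\<^sub>c (A \<otimes>\<^sub>c ?BC)))"
    "Dom (DCat D (\<^bold>N \<otimes>\<^sub>c (A \<otimes>\<^sub>c ?BC))) (mu A ?BC X YZ) = lineO D A ?BC F (iO ?BC YZ)"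
    "Cod (DCat D (\<^bold>N \<otimes>\<^sub>c (A \<otimes>\<^sub>c ?BC))) (mu A ?BC X YZ) = iO (A \<otimes>\<^sub>c ?BC) T"
    using mu_simps[of ?AB C XY Z] mu_simps[of A ?BC X YZ] s o ob by (simp_all add: FGH xyz(3))
  have l: "lineA D ?AB C (mu A B X Y) ?idH \<in> Arr (DCat D (\<^bold>N \<otimes>\<^sub>c P))"
    "Dom (DCat D (\<^bold>N \<otimes>\<^sub>c P)) (lineA D ?AB C (mu A B X Y) ?idH) = lineO D ?AB C (lineO D A B F G) H"
    "Cod (DCat D (\<^bold>N \<otimes>\<^sub>c P)) (lineA D ?AB C (mu A B X Y) ?idH) = lineO D ?AB C (iO ?AB XY) H"
    "lineA D A ?BC ?idF (mu B C Y Z) \<in> Arr (DCat D (\<^bold>N \<otimes>\<^sub>c (A \<otimes>\<^sub>c ?BC)))"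
    "Dom (DCat D (\<^bold>N \<otimes>\<^sub>c (A \<otimes>\<^sub>c ?BC))) (lineA D A ?BC ?idF (mu B C Y Z)) = lineO D A ?BC F (lineO D B C G H)"
    "Cod (DCat D (\<^bold>N \<otimes>\<^sub>c (A \<otimes>\<^sub>c ?BC))) (lineA D A ?BC ?idF (mu B C Y Z)) = lineO D A ?BC F (iO ?BC YZ)"
    using lineA_simps[of ?AB C "mu A B X Y" ?idH] lineA_simps[of A ?BC ?idF "mu B C Y Z"] s m Fo by simp_all
  define x where "x = extAs D A B C X Y Z"
  have asc_eq: "asc A B C X Y Z = Over a x T" by (simp add: asc_def x_def xyz a_def)
  have x: "x \<in> Arr (DCat D P)" "Dom (DCat D P) x = extO D ?AB C XY Z" "Cod (DCat D P) x = reO D a T"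
    using asc_expand(1,2)[OF s o, folded P_def a_def xyz] unfolding asc_eq by simp_all
  have Fx: "iA P x \<in> Arr (DCat D (\<^bold>N \<otimes>\<^sub>c P))" "Dom (DCat D (\<^bold>N \<otimes>\<^sub>c P)) (iA P x) = iO P (extO D ?AB C XY Z)"
    "Cod (DCat D (\<^bold>N \<otimes>\<^sub>c P)) (iA P x) = iO P (reO D a T)"
    using iA_simps[OF sP(1) x(1)] x by simp_all
  have c: "arr (con_arr a T)" "dm (con_arr a T) = (\<^bold>N \<otimes>\<^sub>c P, iO P (reO D a T))" "base (con_arr a T) = w"
    using ob by (simp_all add: w_def)
  define k where "k = lam ?AB C (lineO D A B F G) H \<star> (kap2 A B X Y \<boxtimes> kap C Z)"
  have k: "cocart k" "cd k = (\<^bold>N \<otimes>\<^sub>c P, lineO D ?AB C (lineO D A B F G) H)"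
  proof -
    have "cocart (kap2 A B X Y \<boxtimes> kap C Z)" using s o by (intro cocart_box) simp_all
    then show "cocart k" "cd k = (\<^bold>N \<otimes>\<^sub>c P, lineO D ?AB C (lineO D A B F G) H)"
      unfolding k_def using s o Fo by (simp_all add: cocart_comp FGH)
  qed
  have "con_arr a T \<star> iA_arr P x \<star> mu_arr ?AB C XY Z \<star> ?l1 = mu_arr A ?BC X YZ \<star> ?l2 \<star> ?R"
  proof (rule cocart_cancel[OF k(1)])
    have "?l1 \<star> k = kap2 ?AB C XY Z"
      using lineA_box[of ?AB C "mu A B X Y" ?idH "kap2 A B X Y" "kap C Z"] s o m Fo mu_iso_kap2(2)[OF s(1,2) o(1,2)]
      by (simp add: k_def kap2_def FGH flip: xyz)
    then have 1: "(con_arr a T \<star> iA_arr P x \<star> mu_arr ?AB C XY Z \<star> ?l1) \<star> k = kap (A \<otimes>\<^sub>c ?BC) T \<star> asc A B C X Y Z"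
      using con_arr_kap2[of ?AB C XY Z a T x] s o ob x by (simp add: cmp_assoc asc_eq)
    have "k = lam ?AB C (lineO D A B F G) H \<star> (lam A B F G \<boxtimes> ide (\<^bold>N \<otimes>\<^sub>c C, H)) \<star> ((kap A X \<boxtimes> kap B Y) \<boxtimes> kap C Z)"
      using s o Fo unfolding k_def kap2_def FGH by (subst box_comp[symmetric]) simp_all
    then have "?R \<star> k = (lam A ?BC F (lineO D B C G H) \<star> (ide (\<^bold>N \<otimes>\<^sub>c A, F) \<boxtimes> lam B C G H)
        \<star> asc (\<^bold>N \<otimes>\<^sub>c A) (\<^bold>N \<otimes>\<^sub>c B) (\<^bold>N \<otimes>\<^sub>c C) F G H) \<star> ((kap A X \<boxtimes> kap B Y) \<boxtimes> kap C Z)"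
      unfolding as_arr_lam[OF s Fo, symmetric] by (simp only: cmp_assoc)
    also have "\<dots> = lam A ?BC F (lineO D B C G H) \<star> (ide (\<^bold>N \<otimes>\<^sub>c A, F) \<boxtimes> lam B C G H)
        \<star> (kap A X \<boxtimes> (kap B Y \<boxtimes> kap C Z)) \<star> asc A B C X Y Z"
      using asc_natural[of "kap A X" A X _ _ "kap B Y" B Y _ _ "kap C Z" C Z] s o by (simp add: cmp_assoc FGH)
    also have "\<dots> = (lam A ?BC F (lineO D B C G H) \<star> (kap A X \<boxtimes> kap2 B C Y Z)) \<star> asc A B C X Y Z"
    proof -
      have "kap A X \<boxtimes> kap2 B C Y Z = (ide (\<^bold>N \<otimes>\<^sub>c A, F) \<boxtimes> lam B C G H) \<star> (kap A X \<boxtimes> (kap B Y \<boxtimes> kap C Z))"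
        using s o Fo unfolding kap2_def FGH by (subst box_comp[symmetric]) simp_all
      then show ?thesis by (simp add: cmp_assoc)
    qed
    finally have "?l2 \<star> ?R \<star> k = (?l2 \<star> lam A ?BC F (lineO D B C G H) \<star> (kap A X \<boxtimes> kap2 B C Y Z)) \<star> asc A B C X Y Z"
      by (simp add: cmp_assoc)
    also have "?l2 \<star> lam A ?BC F (lineO D B C G H) \<star> (kap A X \<boxtimes> kap2 B C Y Z) = kap2 A ?BC X YZ"
      using lineA_box[of A ?BC ?idF "mu B C Y Z" "kap A X" "kap2 B C Y Z"] s o m Fo mu_iso_kap2(2)[OF s(2,3) o(2,3)]
      by (simp add: kap2_def FGH flip: xyz)
    finally show "(con_arr a T \<star> iA_arr P x \<star> mu_arr ?AB C XY Z \<star> ?l1) \<star> k = (mu_arr A ?BC X YZ \<star> ?l2 \<star> ?R) \<star> k"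
      using cmp_reassoc[OF mu_iso_kap2(2)[of A ?BC X YZ]] s o ob unfolding 1 by (simp add: cmp_assoc xyz(3))
  qed (use s k m mm l R c Fx ob in simp_all)
  from arg_cong[OF this, of fib] show ?thesis
    using s m mm l R c Fx ob
    by (simp add: fib_cmp_vert fib_vert_cmp K_def vert_comp[symmetric] flip: FGH) (simp add: as_arr_def x_def xyz)
qed

text \<open>
  The universal arrow \<open>1 \<rightarrow> i\<^sub>! 1\<close> is part of both \<open>kap2\<close> and the unit constraint of the affine line. What remains is
  naturality of the unit constraint of \<open>\<boxtimes>\<close> with respect to \<open>kap\<close>; the right-hand version is the same.
\<close>

lemma mu_lunit:
  assumes s: "small_cat S A" and X: "X \<in> Ob (DCat D A)"
  defines "K \<equiv> DCat D (\<^bold>N \<otimes>\<^sub>c (\<^bold>e \<otimes>\<^sub>c A))"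
  shows "lineL D A (iO A X) = con (pr2 \<^bold>e A) X \<cdot>\<^bsub>K\<^esub> iA (\<^bold>e \<otimes>\<^sub>c A) (extL D A X) \<cdot>\<^bsub>K\<^esub> mu \<^bold>e A unit0 X
    \<cdot>\<^bsub>K\<^esub> lineA D \<^bold>e A (Idn (DCat D (\<^bold>N \<otimes>\<^sub>c \<^bold>e)) (lineU D)) (Idn (DCat D (\<^bold>N \<otimes>\<^sub>c A)) (iO A X))"
proof -
  let ?P = "\<^bold>e \<otimes>\<^sub>c A" and ?p = "pr2 \<^bold>e A" and ?U = "Idn (DCat D (\<^bold>N \<otimes>\<^sub>c \<^bold>e)) (lineU D)" and ?F = "Idn (DCat D (\<^bold>N \<otimes>\<^sub>c A)) (iO A X)"
  have x: "extL D A X \<in> Arr (DCat D ?P)" "Dom (DCat D ?P) (extL D A X) = extO D \<^bold>e A unit0 X"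
    "Cod (DCat D ?P) (extL D A X) = reO D ?p X"
    using ext_unit_expand(1)[OF s X] by (simp_all add: isos_def hom_def)
  have "lunit_arr A (iO A X) = con_arr ?p X \<star> iA_arr ?P (extL D A X) \<star> mu_arr \<^bold>e A unit0 X \<star> lineA_arr \<^bold>e A ?U ?F"
  proof (rule kap2_cancel[of "\<^bold>e" A unit0 X])
    have l: "lineA_arr \<^bold>e A ?U ?F \<star> kap2 \<^bold>e A unit0 X = kap2 \<^bold>e A unit0 X"
      using lineA_box[of "\<^bold>e" A ?U ?F "kap \<^bold>e unit0" "kap A X"] s X by (simp add: kap2_def lineU_eq)
    have "kap2 \<^bold>e A unit0 X = lam \<^bold>e A (lineU D) (iO A X) \<star> (kap \<^bold>e unit0 \<boxtimes> ide (\<^bold>N \<otimes>\<^sub>c A, iO A X)) \<star> (ide (\<^bold>e, unit0) \<boxtimes> kap A X)"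
      unfolding kap2_def using s X by (subst box_comp[symmetric]) (simp_all add: lineU_eq)
    then have "lunit_arr A (iO A X) \<star> kap2 \<^bold>e A unit0 X = (lunit_arr A (iO A X) \<star> lam \<^bold>e A (lineU D) (iO A X)
        \<star> (kap \<^bold>e unit0 \<boxtimes> ide (\<^bold>N \<otimes>\<^sub>c A, iO A X))) \<star> (ide (\<^bold>e, unit0) \<boxtimes> kap A X)"
      by (simp only: cmp_assoc)
    also have "\<dots> = kap A X \<star> lun A X"
      using lunit_arr_lam[OF s, of "iO A X"] lun_natural[of "kap A X" A X] s X by simp
    also have "lun A X = Over ?p (extL D A X) X" by (simp add: lun_def)
    finally show "lunit_arr A (iO A X) \<star> kap2 \<^bold>e A unit0 X
        = (con_arr ?p X \<star> iA_arr ?P (extL D A X) \<star> mu_arr \<^bold>e A unit0 X \<star> lineA_arr \<^bold>e A ?U ?F) \<star> kap2 \<^bold>e A unit0 X"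
      using con_arr_kap2[of "\<^bold>e" A unit0 X ?p X "extL D A X"] s X x by (simp add: cmp_assoc l)
  qed (use s X x lineU_eq in simp_all)
  from arg_cong[OF this, of fib] show ?thesis
    using s X x by (simp add: fib_cmp_vert K_def lineU_eq vert_comp[symmetric]) (simp add: lunit_arr_def)
qed

lemma mu_runit:
  assumes s: "small_cat S A" and X: "X \<in> Ob (DCat D A)"
  defines "K \<equiv> DCat D (\<^bold>N \<otimes>\<^sub>c (A \<otimes>\<^sub>c \<^bold>e))"
  shows "lineR D A (iO A X) = con (pr1 A \<^bold>e) X \<cdot>\<^bsub>K\<^esub> iA (A \<otimes>\<^sub>c \<^bold>e) (extR D A X) \<cdot>\<^bsub>K\<^esub> mu A \<^bold>e X unit0
    \<cdot>\<^bsub>K\<^esub> lineA D A \<^bold>e (Idn (DCat D (\<^bold>N \<otimes>\<^sub>c A)) (iO A X)) (Idn (DCat D (\<^bold>N \<otimes>\<^sub>c \<^bold>e)) (lineU D))"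
proof -
  let ?P = "A \<otimes>\<^sub>c \<^bold>e" and ?p = "pr1 A \<^bold>e" and ?U = "Idn (DCat D (\<^bold>N \<otimes>\<^sub>c \<^bold>e)) (lineU D)" and ?F = "Idn (DCat D (\<^bold>N \<otimes>\<^sub>c A)) (iO A X)"
  have x: "extR D A X \<in> Arr (DCat D ?P)" "Dom (DCat D ?P) (extR D A X) = extO D A \<^bold>e X unit0"
    "Cod (DCat D ?P) (extR D A X) = reO D ?p X"
    using ext_runit_expand(1)[OF s X] by (simp_all add: isos_def hom_def)
  have "runit_arr A (iO A X) = con_arr ?p X \<star> iA_arr ?P (extR D A X) \<star> mu_arr A \<^bold>e X unit0 \<star> lineA_arr A \<^bold>e ?F ?U"
  proof (rule kap2_cancel[of A "\<^bold>e" X unit0])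
    have l: "lineA_arr A \<^bold>e ?F ?U \<star> kap2 A \<^bold>e X unit0 = kap2 A \<^bold>e X unit0"
      using lineA_box[of A "\<^bold>e" ?F ?U "kap A X" "kap \<^bold>e unit0"] s X by (simp add: kap2_def lineU_eq)
    have "kap2 A \<^bold>e X unit0 = lam A \<^bold>e (iO A X) (lineU D) \<star> (ide (\<^bold>N \<otimes>\<^sub>c A, iO A X) \<boxtimes> kap \<^bold>e unit0) \<star> (kap A X \<boxtimes> ide (\<^bold>e, unit0))"
      unfolding kap2_def using s X by (subst box_comp[symmetric]) (simp_all add: lineU_eq)
    then have "runit_arr A (iO A X) \<star> kap2 A \<^bold>e X unit0 = (runit_arr A (iO A X) \<star> lam A \<^bold>e (iO A X) (lineU D)
        \<star> (ide (\<^bold>N \<otimes>\<^sub>c A, iO A X) \<boxtimes> kap \<^bold>e unit0)) \<star> (kap A X \<boxtimes> ide (\<^bold>e, unit0))"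
      by (simp only: cmp_assoc)
    also have "\<dots> = kap A X \<star> run A X"
      using runit_arr_lam[OF s, of "iO A X"] run_natural[of "kap A X" A X] s X by simp
    also have "run A X = Over ?p (extR D A X) X" by (simp add: run_def)
    finally show "runit_arr A (iO A X) \<star> kap2 A \<^bold>e X unit0
        = (con_arr ?p X \<star> iA_arr ?P (extR D A X) \<star> mu_arr A \<^bold>e X unit0 \<star> lineA_arr A \<^bold>e ?F ?U) \<star> kap2 A \<^bold>e X unit0"
      using con_arr_kap2[of A "\<^bold>e" X unit0 ?p X "extR D A X"] s X x by (simp add: cmp_assoc l)
  qed (use s X x lineU_eq in simp_all)
  from arg_cong[OF this, of fib] show ?thesis
    using s X x by (simp add: fib_cmp_vert K_def lineU_eq vert_comp[symmetric]) (simp add: runit_arr_def)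
qed

end

theorem proposition5p1:
  fixes S :: "'a elem set set" and D :: "('a, 'o, 'm) mon_drv_data"
  assumes "size_class S"
    and "monoidal_derivator S D"
  shows "strong_monoidal S (external D) (affine_line D) (structure_morphism D)"
proof -
  interpret small_monoidal_derivator S D
    using assms by (simp add: small_monoidal_derivator_def size_universe_def)
  \<comment> \<open>The unit of the affine line is \<open>i\<^sub>! 1\<close> itself, so the unit comparison is an identity.\<close>
  let ?\<epsilon> = "Idn (DCat D (\<^bold>N \<otimes>\<^sub>c \<^bold>e)) (lineU D)"
  have "strong_monoidal_structure S (external D) (affine_line D) (structure_morphism D) mu ?\<epsilon>"
  proof (rule strong_monoidal_structure.intro[OF structure_derivator_morphism strong_monoidal_structure_axioms.intro],
      goal_cases)
    case (1 A B X Y)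
    then show ?case using mu_iso_kap2(1) by (simp flip: iO_def)
  next
    case 2
    show ?case using Idn_isos[of "\<^bold>N \<otimes>\<^sub>c \<^bold>e" "lineU D"] by (simp add: lineU_eq flip: iO_def)
  next
    case (3 A B f X X' g Y Y')
    then show ?case using mu_natural by (simp flip: iO_def iA_def)
  next
    case (4 u v X Y K)
    then show ?case using mu_res[of u v X Y] by (simp flip: iO_def iA_def con_def)
  next
    case (5 A B C X Y Z P K a)
    then show ?case using mu_assoc[of A B C X Y Z] by (simp flip: iO_def iA_def con_def)
  next
    case (6 A X K)
    then show ?case using mu_lunit[of A X] by (simp flip: iO_def iA_def con_def)
  next
    case (7 A X K)
    then show ?case using mu_runit[of A X] by (simp flip: iO_def iA_def con_def)
  qed
  then show ?thesis unfolding strong_monoidal_def by blast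
qed

end
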